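(* Let $Q$ be a finite tree quiver, $A=\Bbbk Q$ its path algebra, and let $\mathscr{D}_A'$, the bimodule $N\otimes_\Bbbk N'$ and the set $\mathcal{T}$ of subbimodules of $N\otimes_\Bbbk N'$ be as defined in the context. Let $\mathcal{Q}^{(2)}$ be the quiver whose vertices are the elements of $\mathcal{T}$ up to isomorphism, with exactly one arrow from $M$ to $K$ if $M$ covers $K$ in the poset $\mathcal{T}$ (ordered by inclusion inside $N\otimes_\Bbbk N'$), and no arrows from $M$ to $K$ otherwise. Then $\mathcal{Q}^{(2)}$ is the quiver of the underlying algebra of the principal $2$-representation $\mathbf{P}_{\mathtt{i}}$ of $\mathscr{D}_A'$, and the relations are exactly all commutativity relations: the underlying algebra is the quotient of the path algebra $\Bbbk\mathcal{Q}^{(2)}$ by the ideal generated by all differences $p-q$, where $p$ and $q$ are paths in $\mathcal{Q}^{(2)}$ with the same source and the same target.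
   Context: $\Bbbk$ is an algebraically closed field; all categories and functors are $\Bbbk$-linear; modules are finitely generated left modules. A finite tree quiver $Q=(Q_0,Q_1,s,t)$ is a finite quiver whose underlying graph is a tree. Paths are composed right to left; $\varepsilon_v$ is the trivial path at $v$. "Ideal" means two-sided ideal; ideals of $A$ are identified with subbimodules of ${}_AA_A$, and an ideal is indecomposable if it is (nonzero and) indecomposable as an $A$-$A$-bimodule; $\mathcal{I}(A)^{\mathrm{ind}}$ is the set of indecomposable ideals. In a poset, $M$ covers $K$ if $K<M$ and there is no element strictly between them. For an ideal $I$, $\mathrm{Dp}_I$ is the functor $I\otimes_A{}_-:A\text{-mod}\to A\text{-mod}$. The $2$-category $\mathscr{D}_A'$ has one object $\mathtt{i}$ (identified with a small category equivalent to $A$-mod); its $1$-morphisms are the functors given, up to equivalence with $A$-mod, by functors in the additive closure of ${}_AA\otimes_\Bbbk A_A\otimes_A{}_-$ and all $\mathrm{Dp}_I$; its $2$-morphisms are all natural transformations. $N$ is the left $A$-module assigning $\Bbbk$ to each vertex of $Q$ and the identity map to each arrow of $Q$; $N'$ is the right $A$-module assigning $\Bbbk$ to each vertex of $Q$ and the identity map to each arrow of $Q^{\mathrm{op}}$. For $i,j\in Q_0$ set $X_{ij}=A\varepsilon_i\otimes_\Bbbk\varepsilon_jA$. There is a unique up to scalar non-zero bimodule homomorphism $\varphi_{ij}:X_{ij}\to N\otimes_\Bbbk N'$; it is injective, and $X_{ij}$ is identified with its image. The bimodule ${}_AA_A$ is identified with the subbimodule $\sum_{i\in Q_0}\mathrm{Im}(\varphi_{ii})$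 of $N\otimes_\Bbbk N'$ (to which it is isomorphic), so ideals of $A$ also become subbimodules of $N\otimes_\Bbbk N'$. Then $\mathcal{T}:=\{X_{ij}\mid i,j\in Q_0\}\cup\mathcal{I}(A)^{\mathrm{ind}}$. The principal $2$-representation is $\mathbf{P}_{\mathtt{i}}=\mathscr{D}_A'(\mathtt{i},{}_-)$. Its underlying algebra is the basic finite dimensional algebra $R$ such that $\overline{\mathbf{P}}_{\mathtt{i}}(\mathtt{i})\simeq R\text{-mod}$, where $\overline{\mathbf{P}}_{\mathtt{i}}(\mathtt{i})$ is the abelian category whose objects are diagrams $X\overset{\alpha}{\to}Y$ in $\mathscr{D}_A'(\mathtt{i},\mathtt{i})$ and whose morphisms from $X\overset{\alpha}{\to}Y$ to $X'\overset{\alpha'}{\to}Y'$ are pairs $(f:X\to X',g:Y\to Y')$ with $g\alpha=\alpha'f$, modulo those pairs for which $g=\alpha'h$ for some $h:Y\to X'$. The vertex given by $M\in\mathcal{T}$ corresponds to the indecomposable projective object $0\to(M\otimes_A{}_-)$; arrows in the quiver go in the direction opposite to that of homomorphisms between the corresponding projective objects. *)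

theory Defs
  imports
    "HOL-Library.Function_Algebras"
    "HOL-Library.FuncSet"
    "HOL-Algebra.QuotRing"
    "HOL-Algebra.Ideal_Product"
    "Jordan_Normal_Form.VS_Connect"
    "Graph_Theory.Digraph_Component"
begin

section \<open>Quivers and path algebras\<close>

text \<open>Every arrow of the quiver may be traversed in both directions; the flag records
  whether it is traversed backwards.\<close>

definition double_quiver :: "('v, 'e) pre_digraph \<Rightarrow> ('v, 'e \<times> bool) pre_digraph" where
  "double_quiver Q = \<lparr>verts = verts Q, arcs = arcs Q \<times> UNIV,
     tail = (\<lambda>(e, b). if b then head Q e else tail Q e),
     head = (\<lambda>(e, b). if b then tail Q e else head Q e)\<rparr>"

text \<open>The underlying undirected multigraph is connected and has no cycle. Loops and pairs of
  parallel or antiparallel arrows are cycles, while going along an arrow and straight back is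
  not: hence the distinctness of the underlying arrows. The predicate \<open>tree\<close> of the library
  only excludes directed cycles.\<close>

definition tree_quiver :: "('v, 'e) pre_digraph \<Rightarrow> bool" where
  "tree_quiver Q \<longleftrightarrow> fin_digraph Q \<and> Digraph_Component.connected Q \<and>
     \<not> (\<exists>p. pre_digraph.cycle (double_quiver Q) p \<and> distinct (map fst p))"

text \<open>A path is its source together with its list of arrows in the order of traversal.\<close>

type_synonym ('v, 'e) qpath = "'v \<times> 'e list"

definition psrc :: "('v, 'e) qpath \<Rightarrow> 'v" where
  "psrc p = fst p"

definition ptgt :: "('v, 'e) pre_digraph \<Rightarrow> ('v, 'e) qpath \<Rightarrow> 'v" where
  "ptgt Q p = pre_digraph.awlast Q (fst p) (snd p)"

definition qpaths :: "('v, 'e) pre_digraph \<Rightarrow> ('v, 'e) qpath set" where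
  "qpaths Q = {p. pre_digraph.awalk Q (psrc p) (snd p) (ptgt Q p)}"

text \<open>Composition from right to left: first \<open>q\<close>, then \<open>p\<close>.\<close>

definition pcomp :: "('v, 'e) qpath \<Rightarrow> ('v, 'e) qpath \<Rightarrow> ('v, 'e) qpath" where
  "pcomp p q = (psrc q, snd q @ snd p)"

definition pvec :: "('v, 'e) qpath \<Rightarrow> ('v, 'e) qpath \<Rightarrow> 'k::field" where
  "pvec p = (\<lambda>r. if r = p then 1 else 0)"

abbreviation fscale :: "'k::field \<Rightarrow> ('x \<Rightarrow> 'k) \<Rightarrow> 'x \<Rightarrow> 'k" where
  "fscale c f \<equiv> (\<lambda>x. c * f x)"

text \<open>The \<open>module\<close> record of HOL-Algebra carries all operations of a \<open>\<k>\<close>-algebra. The base field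
  is a type.\<close>

definition path_algebra :: "('v, 'e) pre_digraph \<Rightarrow> ('k::field, ('v, 'e) qpath \<Rightarrow> 'k) module" where
  "path_algebra Q = \<lparr>
     carrier = {f. finite {p. f p \<noteq> 0} \<and> {p. f p \<noteq> 0} \<subseteq> qpaths Q},
     monoid.mult = (\<lambda>f g r. \<Sum>(p, q) \<in> {(p, q). p \<in> qpaths Q \<and> q \<in> qpaths Q \<and>
               ptgt Q q = psrc p \<and> pcomp p q = r}. f p * g q),
     one = (\<Sum>v\<in>verts Q. pvec (v, [])),
     zero = 0,
     add = (+),
     smult = fscale\<rparr>"

section \<open>Finite dimensional algebras\<close>

definition fd_algebra :: "('k::field, 'a) module \<Rightarrow> bool" where
  "fd_algebra R \<longleftrightarrow> ring R \<and> vectorspace class_ring R \<and>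
     (\<forall>c. \<forall>x\<in>carrier R. \<forall>y\<in>carrier R.
        (c \<odot>\<^bsub>R\<^esub> x) \<otimes>\<^bsub>R\<^esub> y = c \<odot>\<^bsub>R\<^esub> (x \<otimes>\<^bsub>R\<^esub> y) \<and>
        x \<otimes>\<^bsub>R\<^esub> (c \<odot>\<^bsub>R\<^esub> y) = c \<odot>\<^bsub>R\<^esub> (x \<otimes>\<^bsub>R\<^esub> y)) \<and>
     vectorspace.fin_dim class_ring R"

text \<open>A two-sided ideal of the ring underlying a unital algebra is stable under scalars.\<close>

definition quotient_algebra :: "('k::field, 'a) module \<Rightarrow> 'a set \<Rightarrow> ('k, 'a set) module" where
  "quotient_algebra R I = \<lparr>
     carrier = carrier (R Quot I), monoid.mult = monoid.mult (R Quot I), one = one (R Quot I),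
     zero = zero (R Quot I), add = add (R Quot I),
     smult = (\<lambda>c X. \<Union>x\<in>X. I +>\<^bsub>R\<^esub> (c \<odot>\<^bsub>R\<^esub> x))\<rparr>"

definition left_ideal :: "('k, 'a) module \<Rightarrow> 'a set \<Rightarrow> bool" where
  "left_ideal R L \<longleftrightarrow> additive_subgroup L R \<and> (\<forall>a\<in>carrier R. \<forall>x\<in>L. a \<otimes>\<^bsub>R\<^esub> x \<in> L)"

definition maximal_left_ideal :: "('k, 'a) module \<Rightarrow> 'a set \<Rightarrow> bool" where
  "maximal_left_ideal R L \<longleftrightarrow> left_ideal R L \<and> L \<noteq> carrier R \<and>
     (\<forall>L'. left_ideal R L' \<and> L \<subseteq> L' \<longrightarrow> L' = L \<or> L' = carrier R)"

definition jacobson_radical :: "('k, 'a) module \<Rightarrow> 'a set" where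
  "jacobson_radical R = carrier R \<inter> \<Inter> {L. maximal_left_ideal R L}"

definition idempotent :: "('k, 'a) module \<Rightarrow> 'a \<Rightarrow> bool" where
  "idempotent R e \<longleftrightarrow> e \<in> carrier R \<and> e \<otimes>\<^bsub>R\<^esub> e = e"

definition primitive_idempotent :: "('k, 'a) module \<Rightarrow> 'a \<Rightarrow> bool" where
  "primitive_idempotent R e \<longleftrightarrow> idempotent R e \<and> e \<noteq> \<zero>\<^bsub>R\<^esub> \<and>
     \<not> (\<exists>f g. idempotent R f \<and> idempotent R g \<and> f \<noteq> \<zero>\<^bsub>R\<^esub> \<and> g \<noteq> \<zero>\<^bsub>R\<^esub> \<and>
          f \<otimes>\<^bsub>R\<^esub> g = \<zero>\<^bsub>R\<^esub> \<and> g \<otimes>\<^bsub>R\<^esub> f = \<zero>\<^bsub>R\<^esub> \<and> e = f \<oplus>\<^bsub>R\<^esub> g)"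

definition principal_left :: "('k, 'a) module \<Rightarrow> 'a \<Rightarrow> 'a set" where
  "principal_left R e = {a \<otimes>\<^bsub>R\<^esub> e | a. a \<in> carrier R}"

definition principal_right :: "('k, 'a) module \<Rightarrow> 'a \<Rightarrow> 'a set" where
  "principal_right R e = {e \<otimes>\<^bsub>R\<^esub> a | a. a \<in> carrier R}"

definition principal_left_iso :: "('k, 'a) module \<Rightarrow> 'a \<Rightarrow> 'a \<Rightarrow> bool" where
  "principal_left_iso R e f \<longleftrightarrow> (\<exists>\<theta>. bij_betw \<theta> (principal_left R e) (principal_left R f) \<and>
     (\<forall>x\<in>principal_left R e. \<forall>y\<in>principal_left R e. \<theta> (x \<oplus>\<^bsub>R\<^esub> y) = \<theta> x \<oplus>\<^bsub>R\<^esub> \<theta> y) \<and>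
     (\<forall>a\<in>carrier R. \<forall>x\<in>principal_left R e. \<theta> (a \<otimes>\<^bsub>R\<^esub> x) = a \<otimes>\<^bsub>R\<^esub> \<theta> x))"

text \<open>A complete set of primitive orthogonal idempotents with pairwise non-isomorphic
  indecomposable projective modules.\<close>

definition basic_idempotents :: "('k, 'a) module \<Rightarrow> 'i set \<Rightarrow> ('i \<Rightarrow> 'a) \<Rightarrow> bool" where
  "basic_idempotents R V e \<longleftrightarrow> finite V \<and>
     (\<forall>v\<in>V. primitive_idempotent R (e v)) \<and>
     (\<forall>v\<in>V. \<forall>w\<in>V. v \<noteq> w \<longrightarrow> e v \<otimes>\<^bsub>R\<^esub> e w = \<zero>\<^bsub>R\<^esub>) \<and>
     finsum R e V = \<one>\<^bsub>R\<^esub> \<and>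
     (\<forall>v\<in>V. \<forall>w\<in>V. v \<noteq> w \<longrightarrow> \<not> principal_left_iso R (e v) (e w))"

definition basic_fd_algebra :: "('k::field, 'a) module \<Rightarrow> bool" where
  "basic_fd_algebra R \<longleftrightarrow> fd_algebra R \<and> (\<exists>(n::nat) e. basic_idempotents R {..<n} e)"

definition residue_basis ::
  "('k::field, 'a) module \<Rightarrow> 'a set \<Rightarrow> 'a set \<Rightarrow> 'i set \<Rightarrow> ('i \<Rightarrow> 'a) \<Rightarrow> bool" where
  "residue_basis R U W S b \<longleftrightarrow> b ` S \<subseteq> U \<and>
     (\<forall>u\<in>U. \<exists>!c. c \<in> S \<rightarrow>\<^sub>E UNIV \<and> u \<ominus>\<^bsub>R\<^esub> finsum R (\<lambda>s. c s \<odot>\<^bsub>R\<^esub> b s) S \<in> W)"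

text \<open>The (ordinary, Gabriel) quiver of a basic algebra: the vertex \<open>v\<close> is the idempotent \<open>e v\<close>,
  and the arrows from \<open>v\<close> to \<open>w\<close> are in bijection with a basis of
  \<open>e\<^sub>w (rad R / rad\<^sup>2 R) e\<^sub>v\<close>. Elements of \<open>e\<^sub>w R e\<^sub>v\<close> are the homomorphisms from \<open>R e\<^sub>w\<close> to
  \<open>R e\<^sub>v\<close>, so arrows are opposite to homomorphisms between projectives.\<close>

definition quiver_of_algebra ::
  "('k::field, 'a) module \<Rightarrow> ('v, 'e) pre_digraph \<Rightarrow> ('v \<Rightarrow> 'a) \<Rightarrow> bool" where
  "quiver_of_algebra R G e \<longleftrightarrow> fin_digraph G \<and> basic_idempotents R (verts G) e \<and>
     (let J = jacobson_radical R; J2 = ideal_prod R J J in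
      \<forall>v\<in>verts G. \<forall>w\<in>verts G. \<exists>b. residue_basis R
        {e w \<otimes>\<^bsub>R\<^esub> x \<otimes>\<^bsub>R\<^esub> e v | x. x \<in> J} {e w \<otimes>\<^bsub>R\<^esub> x \<otimes>\<^bsub>R\<^esub> e v | x. x \<in> J2}
        {a \<in> arcs G. tail G a = v \<and> head G a = w} b)"

section \<open>Linear categories\<close>

text \<open>In \<open>Comp C X Y Z g f\<close> the morphism \<open>f\<close> goes from \<open>X\<close> to \<open>Y\<close> and \<open>g\<close> from \<open>Y\<close> to \<open>Z\<close>.\<close>

record ('o, 'm, 'k) lincat =
  Ob :: "'o set"
  Hom :: "'o \<Rightarrow> 'o \<Rightarrow> 'm set"
  Comp :: "'o \<Rightarrow> 'o \<Rightarrow> 'o \<Rightarrow> 'm \<Rightarrow> 'm \<Rightarrow> 'm"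
  Ident :: "'o \<Rightarrow> 'm"
  Hzero :: "'o \<Rightarrow> 'o \<Rightarrow> 'm"
  Hadd :: "'o \<Rightarrow> 'o \<Rightarrow> 'm \<Rightarrow> 'm \<Rightarrow> 'm"
  Hscale :: "'o \<Rightarrow> 'o \<Rightarrow> 'k \<Rightarrow> 'm \<Rightarrow> 'm"

record ('o, 'm, 'p, 'n) lfunctor =
  omap :: "'o \<Rightarrow> 'p"
  mmap :: "'o \<Rightarrow> 'o \<Rightarrow> 'm \<Rightarrow> 'n"

definition iso_objects :: "('o, 'm, 'k) lincat \<Rightarrow> 'o \<Rightarrow> 'o \<Rightarrow> bool" where
  "iso_objects C X Y \<longleftrightarrow> (\<exists>f\<in>Hom C X Y. \<exists>g\<in>Hom C Y X.
     Comp C X Y X g f = Ident C X \<and> Comp C Y X Y f g = Ident C Y)"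

definition zero_object :: "('o, 'm, 'k) lincat \<Rightarrow> 'o \<Rightarrow> bool" where
  "zero_object C Z \<longleftrightarrow> Z \<in> Ob C \<and> Ident C Z = Hzero C Z Z"

definition biproduct :: "('o, 'm, 'k) lincat \<Rightarrow> 'o list \<Rightarrow> 'o \<Rightarrow> bool" where
  "biproduct C Xs Z \<longleftrightarrow> set Xs \<subseteq> Ob C \<and> Z \<in> Ob C \<and> (\<exists>\<iota> \<pi>.
     (\<forall>k<length Xs. \<iota> k \<in> Hom C (Xs ! k) Z \<and> \<pi> k \<in> Hom C Z (Xs ! k)) \<and>
     (\<forall>k<length Xs. \<forall>l<length Xs. Comp C (Xs ! k) Z (Xs ! l) (\<pi> l) (\<iota> k) =
        (if k = l then Ident C (Xs ! k) else Hzero C (Xs ! k) (Xs ! l))) \<and>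
     foldr (Hadd C Z Z) (map (\<lambda>k. Comp C Z (Xs ! k) Z (\<iota> k) (\<pi> k)) [0..<length Xs])
       (Hzero C Z Z) = Ident C Z)"

text \<open>Direct summands of finite direct sums of objects from \<open>S\<close>.\<close>

definition additive_closure :: "('o, 'm, 'k) lincat \<Rightarrow> 'o set \<Rightarrow> 'o set" where
  "additive_closure C S = {X \<in> Ob C. \<exists>Y Z Xs.
     set Xs \<subseteq> S \<and> biproduct C Xs Z \<and> biproduct C [X, Y] Z}"

definition linear_functor ::
  "('o, 'm, 'k) lincat \<Rightarrow> ('p, 'n, 'k) lincat \<Rightarrow> ('o, 'm, 'p, 'n) lfunctor \<Rightarrow> bool" where
  "linear_functor C D F \<longleftrightarrow>
     (\<forall>X\<in>Ob C. omap F X \<in> Ob D \<and> mmap F X X (Ident C X) = Ident D (omap F X)) \<and>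
     (\<forall>X\<in>Ob C. \<forall>Y\<in>Ob C. \<forall>f\<in>Hom C X Y.
        mmap F X Y f \<in> Hom D (omap F X) (omap F Y) \<and>
        (\<forall>g\<in>Hom C X Y. mmap F X Y (Hadd C X Y f g) =
           Hadd D (omap F X) (omap F Y) (mmap F X Y f) (mmap F X Y g)) \<and>
        (\<forall>c. mmap F X Y (Hscale C X Y c f) =
           Hscale D (omap F X) (omap F Y) c (mmap F X Y f)) \<and>
        (\<forall>Z\<in>Ob C. \<forall>g\<in>Hom C Y Z. mmap F X Z (Comp C X Y Z g f) =
           Comp D (omap F X) (omap F Y) (omap F Z) (mmap F Y Z g) (mmap F X Y f)))"

definition equivalence_of_categories ::
  "('o, 'm, 'k) lincat \<Rightarrow> ('p, 'n, 'k) lincat \<Rightarrow> ('o, 'm, 'p, 'n) lfunctor \<Rightarrow> bool" where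
  "equivalence_of_categories C D F \<longleftrightarrow> linear_functor C D F \<and>
     (\<forall>X\<in>Ob C. \<forall>Y\<in>Ob C. bij_betw (mmap F X Y) (Hom C X Y) (Hom D (omap F X) (omap F Y))) \<and>
     (\<forall>Y\<in>Ob D. \<exists>X\<in>Ob C. iso_objects D (omap F X) Y)"

text \<open>Natural transformations are extensional families, so that they are equal in HOL
  as soon as their components are.\<close>

definition nat_trans ::
  "('o, 'm, 'k) lincat \<Rightarrow> ('p, 'n, 'k) lincat \<Rightarrow> ('o, 'm, 'p, 'n) lfunctor \<Rightarrow>
    ('o, 'm, 'p, 'n) lfunctor \<Rightarrow> ('o \<Rightarrow> 'n) set" where
  "nat_trans C D F G = {\<eta> \<in> (\<Pi>\<^sub>E X\<in>Ob C. Hom D (omap F X) (omap G X)).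
     \<forall>X\<in>Ob C. \<forall>Y\<in>Ob C. \<forall>f\<in>Hom C X Y.
       Comp D (omap F X) (omap F Y) (omap G Y) (\<eta> Y) (mmap F X Y f) =
       Comp D (omap F X) (omap G X) (omap G Y) (mmap G X Y f) (\<eta> X)}"

definition functor_category ::
  "('o, 'm, 'k) lincat \<Rightarrow> ('p, 'n, 'k) lincat \<Rightarrow>
    (('o, 'm, 'p, 'n) lfunctor, 'o \<Rightarrow> 'n, 'k) lincat" where
  "functor_category C D = \<lparr>
     Ob = {F. linear_functor C D F},
     Hom = nat_trans C D,
     Comp = (\<lambda>F G H \<eta> \<theta>. \<lambda>X\<in>Ob C. Comp D (omap F X) (omap G X) (omap H X) (\<eta> X) (\<theta> X)),
     Ident = (\<lambda>F. \<lambda>X\<in>Ob C. Ident D (omap F X)),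
     Hzero = (\<lambda>F G. \<lambda>X\<in>Ob C. Hzero D (omap F X) (omap G X)),
     Hadd = (\<lambda>F G \<eta> \<theta>. \<lambda>X\<in>Ob C. Hadd D (omap F X) (omap G X) (\<eta> X) (\<theta> X)),
     Hscale = (\<lambda>F G c \<eta>. \<lambda>X\<in>Ob C. Hscale D (omap F X) (omap G X) c (\<eta> X))\<rparr>"

subsection \<open>The diagrammatic abelianization\<close>

text \<open>The object \<open>\<alpha> : X \<rightarrow> Y\<close> is the triple \<open>(X, \<alpha>, Y)\<close>. A morphism is the full equivalence class
  of pairs \<open>(f, g)\<close>; operations on classes are the unions of the classes of all results.\<close>

definition ab_pairs :: "('o, 'm, 'k) lincat \<Rightarrow> 'o \<times> 'm \<times> 'o \<Rightarrow> 'o \<times> 'm \<times> 'o \<Rightarrow> ('m \<times> 'm) set" where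
  "ab_pairs C = (\<lambda>(X, \<alpha>, Y) (X', \<alpha>', Y'). {(f, g). f \<in> Hom C X X' \<and> g \<in> Hom C Y Y' \<and>
     Comp C X Y Y' g \<alpha> = Comp C X X' Y' \<alpha>' f})"

definition ab_class ::
  "('o, 'm, 'k) lincat \<Rightarrow> 'o \<times> 'm \<times> 'o \<Rightarrow> 'o \<times> 'm \<times> 'o \<Rightarrow> 'm \<times> 'm \<Rightarrow> ('m \<times> 'm) set" where
  "ab_class C = (\<lambda>(X, \<alpha>, Y) (X', \<alpha>', Y') (f, g).
     {(f', g') \<in> ab_pairs C (X, \<alpha>, Y) (X', \<alpha>', Y').
        \<exists>h\<in>Hom C Y X'. g' = Hadd C Y Y' g (Comp C Y X' Y' \<alpha>' h)})"

definition abelianization ::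
  "('o, 'm, 'k) lincat \<Rightarrow> ('o \<times> 'm \<times> 'o, ('m \<times> 'm) set, 'k) lincat" where
  "abelianization C = \<lparr>
     Ob = {(X, \<alpha>, Y). X \<in> Ob C \<and> Y \<in> Ob C \<and> \<alpha> \<in> Hom C X Y},
     Hom = (\<lambda>P P'. ab_class C P P' ` ab_pairs C P P'),
     Comp = (\<lambda>(X, \<alpha>, Y) (X', \<alpha>', Y') (X'', \<alpha>'', Y'') s t.
        \<Union>(f', g')\<in>s. \<Union>(f, g)\<in>t. ab_class C (X, \<alpha>, Y) (X'', \<alpha>'', Y'')
          (Comp C X X' X'' f' f, Comp C Y Y' Y'' g' g)),
     Ident = (\<lambda>(X, \<alpha>, Y). ab_class C (X, \<alpha>, Y) (X, \<alpha>, Y) (Ident C X, Ident C Y)),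
     Hzero = (\<lambda>(X, \<alpha>, Y) (X', \<alpha>', Y').
        ab_class C (X, \<alpha>, Y) (X', \<alpha>', Y') (Hzero C X X', Hzero C Y Y')),
     Hadd = (\<lambda>(X, \<alpha>, Y) (X', \<alpha>', Y') s t.
        \<Union>(f', g')\<in>s. \<Union>(f, g)\<in>t. ab_class C (X, \<alpha>, Y) (X', \<alpha>', Y')
          (Hadd C X X' f' f, Hadd C Y Y' g' g)),
     Hscale = (\<lambda>(X, \<alpha>, Y) (X', \<alpha>', Y') c s.
        \<Union>(f, g)\<in>s. ab_class C (X, \<alpha>, Y) (X', \<alpha>', Y')
          (Hscale C X X' c f, Hscale C Y Y' c g))\<rparr>"

section \<open>Modules, bimodules and tensor products\<close>

text \<open>A small model of the category of finitely generated left modules over a finite dimensional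
  algebra: an object \<open>(n, \<rho>)\<close> is a module structure \<open>\<rho>\<close> on the space of column vectors of
  length \<open>n\<close>. Values of \<open>\<rho>\<close> outside of the algebra are irrelevant.\<close>

type_synonym ('k, 'a) fdmod = "nat \<times> ('a \<Rightarrow> 'k mat)"

definition module_structure :: "('k::field, 'a) module \<Rightarrow> nat \<Rightarrow> ('a \<Rightarrow> 'k mat) \<Rightarrow> bool" where
  "module_structure R n \<rho> \<longleftrightarrow> \<rho> \<one>\<^bsub>R\<^esub> = 1\<^sub>m n \<and>
     (\<forall>a\<in>carrier R. \<rho> a \<in> carrier_mat n n \<and>
        (\<forall>c. \<rho> (c \<odot>\<^bsub>R\<^esub> a) = c \<cdot>\<^sub>m \<rho> a) \<and>
        (\<forall>b\<in>carrier R. \<rho> (a \<oplus>\<^bsub>R\<^esub> b) = \<rho> a + \<rho> b \<and> \<rho> (a \<otimes>\<^bsub>R\<^esub> b) = \<rho> a * \<rho> b))"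

definition module_category ::
  "('k::field, 'a) module \<Rightarrow> (('k, 'a) fdmod, 'k mat, 'k) lincat" where
  "module_category R = \<lparr>
     Ob = {(n, \<rho>). module_structure R n \<rho>},
     Hom = (\<lambda>(n, \<rho>) (m, \<sigma>). {f \<in> carrier_mat m n. \<forall>a\<in>carrier R. f * \<rho> a = \<sigma> a * f}),
     Comp = (\<lambda>_ _ _ g f. g * f),
     Ident = (\<lambda>(n, _). 1\<^sub>m n),
     Hzero = (\<lambda>(n, _) (m, _). 0\<^sub>m m n),
     Hadd = (\<lambda>_ _ f g. f + g),
     Hscale = (\<lambda>_ _ c f. c \<cdot>\<^sub>m f)\<rparr>"

definition iso_to_principal_left ::
  "('k::field, 'a) module \<Rightarrow> ('k, 'a) fdmod \<Rightarrow> 'a \<Rightarrow> bool" where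
  "iso_to_principal_left R = (\<lambda>(n, \<rho>) e. \<exists>\<theta>. bij_betw \<theta> (principal_left R e) (carrier_vec n) \<and>
     (\<forall>x\<in>principal_left R e. \<forall>y\<in>principal_left R e. \<theta> (x \<oplus>\<^bsub>R\<^esub> y) = \<theta> x + \<theta> y) \<and>
     (\<forall>a\<in>carrier R. \<forall>x\<in>principal_left R e. \<theta> (a \<otimes>\<^bsub>R\<^esub> x) = \<rho> a *\<^sub>v \<theta> x))"

text \<open>All bimodules needed here are spaces of \<open>\<k>\<close>-valued functions with the pointwise vector space
  structure.\<close>

record ('k, 'a, 'x) bimod =
  bcarrier :: "('x \<Rightarrow> 'k) set"
  lact :: "'a \<Rightarrow> ('x \<Rightarrow> 'k) \<Rightarrow> 'x \<Rightarrow> 'k"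
  ract :: "('x \<Rightarrow> 'k) \<Rightarrow> 'a \<Rightarrow> 'x \<Rightarrow> 'k"

abbreviation fspan :: "('x \<Rightarrow> 'k::field) set \<Rightarrow> ('x \<Rightarrow> 'k) set" where
  "fspan \<equiv> Modules.module.span fscale"

abbreviation fsubspace :: "('x \<Rightarrow> 'k::field) set \<Rightarrow> bool" where
  "fsubspace \<equiv> Modules.module.subspace fscale"

definition subbimodule :: "('k::field, 'a) module \<Rightarrow> ('k, 'a, 'x) bimod \<Rightarrow> ('x \<Rightarrow> 'k) set \<Rightarrow> bool" where
  "subbimodule A B U \<longleftrightarrow> fsubspace U \<and> U \<subseteq> bcarrier B \<and>
     (\<forall>a\<in>carrier A. \<forall>u\<in>U. lact B a u \<in> U \<and> ract B u a \<in> U)"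

definition indecomposable_bimodule :: "('k::field, 'a) module \<Rightarrow> ('k, 'a, 'x) bimod \<Rightarrow> bool" where
  "indecomposable_bimodule A B \<longleftrightarrow> bcarrier B \<noteq> {0} \<and>
     \<not> (\<exists>U W. subbimodule A B U \<and> subbimodule A B W \<and> U \<noteq> {0} \<and> W \<noteq> {0} \<and>
          U \<inter> W = {0} \<and> {u + w | u w. u \<in> U \<and> w \<in> W} = bcarrier B)"

definition bimodule_homs ::
  "('k::field, 'a) module \<Rightarrow> ('k, 'a, 'x) bimod \<Rightarrow> ('k, 'a, 'y) bimod \<Rightarrow>
    (('x \<Rightarrow> 'k) \<Rightarrow> ('y \<Rightarrow> 'k)) set" where
  "bimodule_homs A B B' = {\<phi>. \<forall>x\<in>bcarrier B. \<phi> x \<in> bcarrier B' \<and>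
     (\<forall>y\<in>bcarrier B. \<phi> (x + y) = \<phi> x + \<phi> y) \<and>
     (\<forall>c. \<phi> (fscale c x) = fscale c (\<phi> x)) \<and>
     (\<forall>a\<in>carrier A. \<phi> (lact B a x) = lact B' a (\<phi> x) \<and> \<phi> (ract B x a) = ract B' (\<phi> x) a)}"

definition bimodule_iso ::
  "('k::field, 'a) module \<Rightarrow> ('k, 'a, 'x) bimod \<Rightarrow> ('k, 'a, 'y) bimod \<Rightarrow> bool" where
  "bimodule_iso A B B' \<longleftrightarrow> (\<exists>\<phi>\<in>bimodule_homs A B B'. bij_betw \<phi> (bcarrier B) (bcarrier B'))"

text \<open>The tensor product over \<open>\<k>\<close> of a left module \<open>U\<close> and a right module \<open>W\<close>, as the span of the
  elementary tensors \<open>(x, y) \<mapsto> u x \<sqdot> w y\<close>. The actions are \<open>a (u \<otimes> w) b = (a u) \<otimes> (w b)\<close>.\<close>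

definition outer_tensor ::
  "('x \<Rightarrow> 'k::field) set \<Rightarrow> ('a \<Rightarrow> ('x \<Rightarrow> 'k) \<Rightarrow> 'x \<Rightarrow> 'k) \<Rightarrow>
   ('y \<Rightarrow> 'k) set \<Rightarrow> (('y \<Rightarrow> 'k) \<Rightarrow> 'a \<Rightarrow> 'y \<Rightarrow> 'k) \<Rightarrow> ('k, 'a, 'x \<times> 'y) bimod" where
  "outer_tensor U l W r = \<lparr>
     bcarrier = fspan {(\<lambda>(x, y). u x * w y) | u w. u \<in> U \<and> w \<in> W},
     lact = (\<lambda>a t (x, y). l a (\<lambda>x'. t (x', y)) x),
     ract = (\<lambda>t a (x, y). r (\<lambda>y'. t (x, y')) a y)\<rparr>"

definition ideal_bimod :: "('k::field, 'x \<Rightarrow> 'k) module \<Rightarrow> ('x \<Rightarrow> 'k) set \<Rightarrow> ('k, 'x \<Rightarrow> 'k, 'x) bimod" where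
  "ideal_bimod A I = \<lparr>bcarrier = I, lact = monoid.mult A, ract = monoid.mult A\<rparr>"

definition free_bimod :: "('k::field, 'x \<Rightarrow> 'k) module \<Rightarrow> ('k, 'x \<Rightarrow> 'k, 'x \<times> 'x) bimod" where
  "free_bimod A = outer_tensor (carrier A) (monoid.mult A) (carrier A) (monoid.mult A)"

text \<open>\<open>B \<otimes>\<^sub>A X\<close> is characterized by its universal property. Since it is finite dimensional, testing
  against the spaces of column vectors suffices.\<close>

definition balanced_map ::
  "('k::field, 'a) module \<Rightarrow> ('k, 'a, 'x) bimod \<Rightarrow> ('k, 'a) fdmod \<Rightarrow> nat \<Rightarrow>
    (('x \<Rightarrow> 'k) \<Rightarrow> 'k vec \<Rightarrow> 'k vec) \<Rightarrow> bool" where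
  "balanced_map A B = (\<lambda>(n, \<rho>) m \<gamma>. \<forall>b\<in>bcarrier B. \<forall>x\<in>carrier_vec n.
     \<gamma> b x \<in> carrier_vec m \<and>
     (\<forall>b'\<in>bcarrier B. \<gamma> (b + b') x = \<gamma> b x + \<gamma> b' x) \<and>
     (\<forall>x'\<in>carrier_vec n. \<gamma> b (x + x') = \<gamma> b x + \<gamma> b x') \<and>
     (\<forall>c. \<gamma> (fscale c b) x = c \<cdot>\<^sub>v \<gamma> b x \<and> \<gamma> b (c \<cdot>\<^sub>v x) = c \<cdot>\<^sub>v \<gamma> b x) \<and>
     (\<forall>a\<in>carrier A. \<gamma> (ract B b a) x = \<gamma> b (\<rho> a *\<^sub>v x)))"

definition is_tensor_product ::
  "('k::field, 'a) module \<Rightarrow> ('k, 'a, 'x) bimod \<Rightarrow> ('k, 'a) fdmod \<Rightarrow> ('k, 'a) fdmod \<Rightarrow>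
    (('x \<Rightarrow> 'k) \<Rightarrow> 'k vec \<Rightarrow> 'k vec) \<Rightarrow> bool" where
  "is_tensor_product A B = (\<lambda>(n, \<rho>) (m, \<sigma>) \<beta>. balanced_map A B (n, \<rho>) m \<beta> \<and>
     (\<forall>a\<in>carrier A. \<forall>b\<in>bcarrier B. \<forall>x\<in>carrier_vec n. \<beta> (lact B a b) x = \<sigma> a *\<^sub>v \<beta> b x) \<and>
     (\<forall>l \<gamma>. balanced_map A B (n, \<rho>) l \<gamma> \<longrightarrow>
        (\<exists>!h. h \<in> carrier_mat l m \<and>
           (\<forall>b\<in>bcarrier B. \<forall>x\<in>carrier_vec n. h *\<^sub>v \<beta> b x = \<gamma> b x))))"

type_synonym ('k, 'a) endofunctor = "(('k, 'a) fdmod, 'k mat, ('k, 'a) fdmod, 'k mat) lfunctor"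

text \<open>\<open>F\<close> is (isomorphic to) the functor \<open>B \<otimes>\<^sub>A _\<close>.\<close>

definition is_tensor_functor ::
  "('k::field, 'a) module \<Rightarrow> ('k, 'a, 'x) bimod \<Rightarrow> ('k, 'a) endofunctor \<Rightarrow> bool" where
  "is_tensor_functor A B F \<longleftrightarrow> linear_functor (module_category A) (module_category A) F \<and>
     (\<exists>\<beta>. (\<forall>X\<in>Ob (module_category A). is_tensor_product A B X (omap F X) (\<beta> X)) \<and>
        (\<forall>X\<in>Ob (module_category A). \<forall>Y\<in>Ob (module_category A). \<forall>f\<in>Hom (module_category A) X Y.
           \<forall>b\<in>bcarrier B. \<forall>x\<in>carrier_vec (fst X).
             mmap F X Y f *\<^sub>v \<beta> X b x = \<beta> Y b (f *\<^sub>v x)))"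

section \<open>The 2-category and the underlying algebra of its principal 2-representation\<close>

text \<open>The 2-category has a single object. This is its category of 1-morphisms and 2-morphisms,
  on which the principal 2-representation takes its value.\<close>

definition D_category ::
  "('k::field, 'x \<Rightarrow> 'k) module \<Rightarrow>
    (('k, 'x \<Rightarrow> 'k) endofunctor, ('k, 'x \<Rightarrow> 'k) fdmod \<Rightarrow> 'k mat, 'k) lincat" where
  "D_category A = (let E = functor_category (module_category A) (module_category A) in
     E\<lparr>Ob := additive_closure E
        ({F. is_tensor_functor A (free_bimod A) F} \<union>
         {F. \<exists>I. ideal I A \<and> is_tensor_functor A (ideal_bimod A I) F})\<rparr>)"

definition underlying_algebra ::
  "('o, 'm, 'k::field) lincat \<Rightarrow> ('k, 'a) module \<Rightarrow>
    ('o \<times> 'm \<times> 'o, ('m \<times> 'm) set, ('k, 'a) fdmod, 'k mat) lfunctor \<Rightarrow> bool" where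
  "underlying_algebra C R \<Phi> \<longleftrightarrow> basic_fd_algebra R \<and>
     equivalence_of_categories (abelianization C) (module_category R) \<Phi>"

section \<open>The poset of subbimodules\<close>

text \<open>\<open>N\<close> and \<open>N'\<close> have the same underlying space, with one coordinate for each vertex; a path acts
  by the identity between the coordinates of its two end points.\<close>

definition N_space :: "('v, 'e) pre_digraph \<Rightarrow> ('v \<Rightarrow> 'k::field) set" where
  "N_space Q = {f. \<forall>v. v \<notin> verts Q \<longrightarrow> f v = 0}"

definition N_lact ::
  "('v, 'e) pre_digraph \<Rightarrow> (('v, 'e) qpath \<Rightarrow> 'k::field) \<Rightarrow> ('v \<Rightarrow> 'k) \<Rightarrow> 'v \<Rightarrow> 'k" where
  "N_lact Q a f = (\<lambda>y. \<Sum>p | a p \<noteq> 0 \<and> ptgt Q p = y. a p * f (psrc p))"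

definition N'_ract ::
  "('v, 'e) pre_digraph \<Rightarrow> ('v \<Rightarrow> 'k::field) \<Rightarrow> (('v, 'e) qpath \<Rightarrow> 'k) \<Rightarrow> 'v \<Rightarrow> 'k" where
  "N'_ract Q f a = (\<lambda>x. \<Sum>p | a p \<noteq> 0 \<and> psrc p = x. f (ptgt Q p) * a p)"

definition NN :: "('v, 'e) pre_digraph \<Rightarrow> ('k::field, ('v, 'e) qpath \<Rightarrow> 'k, 'v \<times> 'v) bimod" where
  "NN Q = outer_tensor (N_space Q) (N_lact Q) (N_space Q) (N'_ract Q)"

definition X_bimod ::
  "('v, 'e) pre_digraph \<Rightarrow> 'v \<Rightarrow> 'v \<Rightarrow>
    ('k::field, ('v, 'e) qpath \<Rightarrow> 'k, ('v, 'e) qpath \<times> ('v, 'e) qpath) bimod" where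
  "X_bimod Q i j = (let A = path_algebra Q in
     outer_tensor (principal_left A (pvec (i, []))) (monoid.mult A)
       (principal_right A (pvec (j, []))) (monoid.mult A))"

text \<open>The images of all nonzero homomorphisms from \<open>X\<^sub>i\<^sub>j\<close> to \<open>N \<otimes> N'\<close>. As such a
  homomorphism is unique up to a scalar, this set has exactly one element.\<close>

definition X_images :: "('v, 'e) pre_digraph \<Rightarrow> 'v \<Rightarrow> 'v \<Rightarrow> ('v \<times> 'v \<Rightarrow> 'k::field) set set" where
  "X_images Q i j = {\<phi> ` bcarrier (X_bimod Q i j) | \<phi>.
     \<phi> \<in> bimodule_homs (path_algebra Q) (X_bimod Q i j) (NN Q) \<and>
     (\<exists>x\<in>bcarrier (X_bimod Q i j). \<phi> x \<noteq> 0)}"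

definition NN_sub ::
  "('v, 'e) pre_digraph \<Rightarrow> ('v \<times> 'v \<Rightarrow> 'k::field) set \<Rightarrow>
    ('k, ('v, 'e) qpath \<Rightarrow> 'k, 'v \<times> 'v) bimod" where
  "NN_sub Q M = (NN Q)\<lparr>bcarrier := M\<rparr>"

definition A_image :: "('v, 'e) pre_digraph \<Rightarrow> ('v \<times> 'v \<Rightarrow> 'k::field) set" where
  "A_image Q = fspan (\<Union>i\<in>verts Q. \<Union>(X_images Q i i))"

text \<open>The images of the indecomposable ideals under any isomorphism from the regular bimodule onto
  \<open>A_image Q\<close>. Such an isomorphism is unique up to a scalar when \<open>Q\<close> is a tree.\<close>

definition ideal_images :: "('v, 'e) pre_digraph \<Rightarrow> ('v \<times> 'v \<Rightarrow> 'k::field) set set" where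
  "ideal_images Q = (let A = path_algebra Q in
     {\<psi> ` I | \<psi> I. \<psi> \<in> bimodule_homs A (ideal_bimod A (carrier A)) (NN_sub Q (A_image Q)) \<and>
        bij_betw \<psi> (carrier A) (A_image Q) \<and>
        ideal I A \<and> indecomposable_bimodule A (ideal_bimod A I)})"

definition T_set :: "('v, 'e) pre_digraph \<Rightarrow> ('v \<times> 'v \<Rightarrow> 'k::field) set set" where
  "T_set Q = (\<Union>i\<in>verts Q. \<Union>j\<in>verts Q. X_images Q i j) \<union> ideal_images Q"

definition covers_in :: "'b::order set \<Rightarrow> 'b \<Rightarrow> 'b \<Rightarrow> bool" where
  "covers_in S M K \<longleftrightarrow> M \<in> S \<and> K \<in> S \<and> K < M \<and> \<not> (\<exists>L\<in>S. K < L \<and> L < M)"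

text \<open>The vertices are the isomorphism classes of elements of \<open>T_set Q\<close>.\<close>

definition T_iso :: "('v, 'e) pre_digraph \<Rightarrow> ('v \<times> 'v \<Rightarrow> 'k::field) set rel" where
  "T_iso Q = {(M, K). M \<in> T_set Q \<and> K \<in> T_set Q \<and>
     bimodule_iso (path_algebra Q) (NN_sub Q M) (NN_sub Q K)}"

type_synonym ('k, 'v) iso_class = "('v \<times> 'v \<Rightarrow> 'k) set set"

definition Q2 ::
  "('v, 'e) pre_digraph \<Rightarrow>
    (('k::field, 'v) iso_class, ('k, 'v) iso_class \<times> ('k, 'v) iso_class) pre_digraph" where
  "Q2 Q = \<lparr>verts = T_set Q // T_iso Q,
     arcs = {(c, d). c \<in> T_set Q // T_iso Q \<and> d \<in> T_set Q // T_iso Q \<and>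
               (\<exists>M\<in>c. \<exists>K\<in>d. covers_in (T_set Q) M K)},
     tail = fst, head = snd\<rparr>"

definition commutativity_ideal :: "('v, 'e) pre_digraph \<Rightarrow> (('v, 'e) qpath \<Rightarrow> 'k::field) set" where
  "commutativity_ideal G = genideal (path_algebra G)
     {pvec p - pvec q | p q. p \<in> qpaths G \<and> q \<in> qpaths G \<and> psrc p = psrc q \<and> ptgt G p = ptgt G q}"

definition commutativity_algebra ::
  "('v, 'e) pre_digraph \<Rightarrow> ('k::field, (('v, 'e) qpath \<Rightarrow> 'k) set) module" where
  "commutativity_algebra G = quotient_algebra (path_algebra G) (commutativity_ideal G)"

definition vertex_idempotent ::
  "('v, 'e) pre_digraph \<Rightarrow> 'v \<Rightarrow> (('v, 'e) qpath \<Rightarrow> 'k::field) set" where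
  "vertex_idempotent G v = commutativity_ideal G +>\<^bsub>path_algebra G\<^esub> pvec (v, [])"

end

(* The 1-morphisms of the 2-category are the tensor functors with the direct summands of sums of the
   bimodules in the poset, so by Eilenberg-Watts the category is additively generated by the tensor
   functor T of their direct sum. Between connected up-sets of pairs of vertices all bimodule
   homomorphisms are scalar multiples of inclusions; hence the endomorphism algebra of T is the
   incidence algebra of the poset, which is the path algebra of the Hasse quiver modulo
   commutativity. Taking cokernels identifies the abelianization of the category with the modules
   over this algebra. *)
theory Submission
  imports Defs
begin

text \<open>Additive closures are handled through one criterion: an object is a direct summand of a
  finite sum of objects of S exactly when its identity is a finite sum of morphisms passing through
  S. Identities of tensor functors are induced by identities of bimodules, so it is enough to write
  the identity of a bimodule as a sum of endomorphisms through other bimodules. Up-sets arise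
  because N \<otimes> N' has one coordinate for each pair (b, a) of vertices, and paths move b
  forwards and a backwards. Trivial paths on both sides isolate a coordinate, so homomorphisms are
  diagonal; longer paths compare neighbouring diagonal entries, so these are constant on a connected
  up-set. A nonzero scalar forces the source into the target, which is where the order comes from.
  Homomorphisms run against the arrows: the endomorphism ring of T is opposite to the algebra of the
  quiver. Precomposition therefore makes Hom(T, Y) a left module, and an object X \<rightarrow> Y of
  the abelianization is sent to the cokernel of Hom(T, X) \<rightarrow> Hom(T, Y).\<close>

abbreviation (input) "CV \<equiv> carrier_vec"
abbreviation (input) "CM \<equiv> carrier_mat"
abbreviation (input) "MC \<equiv> module_category"
abbreviation (input) "MS \<equiv> module_structure"
abbreviation (input) "bC \<equiv> bcarrier"
abbreviation (input) "BH \<equiv> bimodule_homs"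
abbreviation (input) "LF \<equiv> linear_functor"
abbreviation mv (infixl "*v" 70) where "A *v x \<equiv> A *\<^sub>v x"
abbreviation sv (infixl ".*v" 70) where "c .*v x \<equiv> c \<cdot>\<^sub>v x"

section \<open>Finitely generated spaces over a field\<close>

lemma mult_mat_vec_unit:
 assumes "M:CM m n" "i < m" "j < n"
 shows "(M *v unit_vec n j) $ i = (M :: 'k::field mat) $$ (i, j)"
 using assms by (auto simp: scalar_prod_def unit_vec_def if_distrib cong: if_cong)

lemma mat_eq_by_vecs:
 assumes "M:CM m n" "M':CM m n"
  and "!!x. x:CV n ==> M *v x = M' *v (x :: 'k::field vec)"
 shows "M = M'"
proof (rule eq_matI)
 fix i j assume ij: "i < dim_row M'" "j < dim_col M'"
 have "(M *v unit_vec n j) $ i = (M' *v unit_vec n j) $ i"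
  using assms(3)[of "unit_vec n j"] by simp
 then show "M $$ (i, j) = M' $$ (i, j)"
  using mult_mat_vec_unit[OF assms(1)] mult_mat_vec_unit[OF assms(2)] assms(1,2) ij by auto
qed (use assms in auto)

lemma zero_smult_vec: "v:CV n ==> (0 :: 'k::field) .*v v = 0\<^sub>v n"
 by (auto intro!: eq_vecI)

text \<open>Linear maps into column vectors from a set with its own operations, so that hom sets of
  a category, function spaces and column vectors can all serve as sources.\<close>

definition vlin ::
 "'h set=>('h=>'h=>'h)=>('k::field=>'h=>'h)=>nat=>('h=>'k vec)=>bool" where
 "vlin H pl scl n q\<longleftrightarrow>(ALL h:H. q h:CV n &
   (ALL h':H. q (pl h h') = q h + q h') & (ALL c. q (scl c h) = c .*v q h))"

lemma vlin_matrix: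
 fixes g :: "'k::field vec=>'k vec"
 assumes g: "vlin (CV n) (+) (\<cdot>\<^sub>v) m g"
 shows "EX M:CM m n. ALL x:CV n. M *v x = g x"
proof (intro bexI ballI)
 define M where "M = mat m n (%(i, j). g (unit_vec n j) $ i)"
 show M: "M:CM m n" by (simp add: M_def)
 fix x :: "'k vec" assume x: "x:CV n"
 have gc: "g y:CV m" if "y:CV n" for y
  using g that by (auto simp: vlin_def)
 have g0: "g (0\<^sub>v n) = 0\<^sub>v m"
 proof -
  have "g (0 .*v 0\<^sub>v n) = 0 .*v g (0\<^sub>v n)"
   using g zero_carrier_vec[of n] unfolding vlin_def by blast
  then show ?thesis
   using zero_smult_vec[OF gc[of "0\<^sub>v n"]] zero_smult_vec[of "0\<^sub>v n :: 'k vec" n] by simp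
 qed
 show "M *v x = g x"
 proof (rule eq_vecI)
  fix i assume i: "i < dim_vec (g x)"
  then have im: "i < m" using gc[OF x] by simp
  \<comment> \<open>\<open>t k\<close> keeps the first \<open>k\<close> entries of \<open>x\<close>.
    It grows by one multiple of a unit vector at a time, so additivity expands \<open>g x\<close> by
    induction on \<open>k\<close>.\<close>
  define t where "t k = vec n (%j. if j < k then x $ j else 0)" for k
  have tc: "t k:CV n" for k by (simp add: t_def)
  have *: "g (t k) $ i = (\<Sum>j<k. x $ j * g (unit_vec n j) $ i)" if "k\<le>n" for k
   using that
  proof (induction k)
   case 0
   have "t 0 = 0\<^sub>v n" by (auto simp: t_def)
   then show ?case using g0 im by simp
  next
   case (Suc k)
   have ts: "t (Suc k) = t k + x $ k .*v unit_vec n k"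
    using Suc.prems by (auto simp: t_def unit_vec_def less_Suc_eq)
   have "g (t k + x $ k .*v unit_vec n k) = g (t k) + g (x $ k .*v unit_vec n k)"
    using g tc[of k] smult_carrier_vec unit_vec_carrier unfolding vlin_def by blast
   moreover have "g (x $ k .*v unit_vec n k) = x $ k .*v g (unit_vec n k)"
    using g unit_vec_carrier unfolding vlin_def by blast
   ultimately show ?case using Suc ts im gc[OF tc] gc[OF unit_vec_carrier[of n k]] by simp
  qed
  have "t n = x" using x by (auto simp: t_def)
  with *[of n] have "g x $ i = (\<Sum>j<n. x $ j * g (unit_vec n j) $ i)" by simp
  also have "\<dots> = (M *v x) $ i"
   using x im by (auto simp: M_def scalar_prod_def lessThan_atLeast0 mult.commute intro!: sum.cong)
  finally show "(M *v x) $ i = g x $ i" by simp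
 qed (use gc[OF x] M in auto)
qed

text \<open>Vector spaces with explicit operations: the hom sets of a \<open>lincat\<close> carry
  their own addition, scaling and zero on a subset of a type. Additive inverses are expressed as
  \<open>scl (- 1)\<close>.\<close>

locale kspace =
 fixes H :: "'h set" and add :: "'h=>'h=>'h" and scl :: "'k::field=>'h=>'h" and zero :: 'h
 assumes add_closed: "x:H ==> y:H ==> add x y:H"
  and add_assoc: "x:H ==> y:H ==> z:H ==> add (add x y) z = add x (add y z)"
  and add_comm: "x:H ==> y:H ==> add x y = add y x"
  and zero_closed: "zero:H"
  and add_zero: "x:H ==> add x zero = x"
  and scl_closed: "x:H ==> scl c x:H"
  and scl_add: "x:H ==> y:H ==> scl c (add x y) = add (scl c x) (scl c y)"
  and add_scl: "x:H ==> scl (c + d) x = add (scl c x) (scl d x)"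
  and scl_scl: "x:H ==> scl c (scl d x) = scl (c * d) x"
  and scl_one: "x:H ==> scl 1 x = x"
  and scl_0: "x:H ==> scl 0 x = zero"
begin

lemma add_lcomm: "x:H ==> y:H ==> z:H ==> add x (add y z) = add y (add x z)"
 by (metis add_assoc add_comm)

lemmas ac = add_assoc add_comm add_lcomm
lemmas closed = add_closed zero_closed scl_closed

lemma scl_zero: "scl c zero = zero"
 by (metis scl_0 scl_scl zero_closed mult_zero_right)

lemma zero_add: "x:H ==> add zero x = x"
 by (metis add_comm add_zero zero_closed)

lemma add_neg: "x:H ==> add x (scl (- 1) x) = zero"
 by (metis add_scl scl_0 scl_one add.right_inverse)

lemma add_neg2: "x:H ==> y:H ==> add (add y x) (scl (- 1) x) = y"
 by (simp add: add_assoc closed add_neg add_zero)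

lemma add_cancel: "x:H ==> y:H ==> z:H ==> add x z = add y z ==> x = y"
 by (metis add_neg2)

lemma eq_add_neg: "x:H ==> y:H ==> z:H ==> add x z = y ==> x = add y (scl (- 1) z)"
 by (metis add_neg2)

lemma diff_zero_eq: "x:H ==> y:H ==> add x (scl (- 1) y) = zero ==> x = y"
 by (metis add_neg add_cancel scl_closed)

definition subsp :: "'h set=>bool" where
 "subsp W\<longleftrightarrow>W<=H & zero:W & (ALL x:W. ALL y:W. add x y:W) & (ALL c. ALL x:W. scl c x:W)"

lemma subsp_zero: "subsp {zero}" by (auto simp: subsp_def closed add_zero scl_zero)

lemma kspace_subsp: "subsp W ==> kspace W add scl zero"
 unfolding subsp_def
 by unfold_locales (auto simp: subset_eq ac closed add_zero scl_zero scl_add add_scl scl_scl scl_one scl_0)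

definition adjoin :: "'h set=>'h=>'h set" where
 "adjoin U ka = {add u (scl c ka) | u c. u:U}"

text \<open>A finite chain from W to U in which each step adjoins one vector, possibly one that is
  already there. With W = {zero} this is finite dimensionality; induction along the chain takes the
  place of bases.\<close>

inductive fin_over :: "'h set=>'h set=>bool" for W where
 base: "fin_over W W"
| step: "fin_over W U ==> ka:H ==> fin_over W (adjoin U ka)"

lemma subset_adjoin: "U<=H ==> ka:H ==> U<=adjoin U ka"
 unfolding adjoin_def by (force simp: scl_0 add_zero intro: exI[where x = 0])

lemma mem_adjoin: "zero:U ==> ka:H ==> ka:adjoin U ka"
 unfolding adjoin_def by (force simp: scl_one zero_add intro: exI[where x = 1])

lemma subsp_adjoin:
 assumes "subsp U" "ka:H"
 shows "subsp (adjoin U ka)"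
proof -
 have U: "!!u. u:U ==> u:H" "zero:U" "!!u v. u:U ==> v:U ==> add u v:U"
  "!!u c. u:U ==> scl c u:U"
  using assms(1) by (auto simp: subsp_def)
 have "add (add u (scl c ka)) (add v (scl d ka)) = add (add u v) (scl (c + d) ka)"
  if "u:U" "v:U" for u v c d
  using that assms(2) by (simp add: add_scl ac closed U)
 then have "ALL x:adjoin U ka. ALL y:adjoin U ka. add x y:adjoin U ka"
  unfolding adjoin_def using U(3) by blast
 moreover have "scl d (add u (scl c ka)) = add (scl d u) (scl (d * c) ka)" if "u:U" for u c d
  using that assms(2) by (simp add: scl_add scl_scl closed U)
 then have "ALL d. ALL x:adjoin U ka. scl d x:adjoin U ka"
  unfolding adjoin_def using U(4) by blast
 moreover have "adjoin U ka<=H" using U assms(2) by (auto simp: adjoin_def closed)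
 moreover have "zero:adjoin U ka" using subset_adjoin[of U ka] U assms(2) by blast
 ultimately show ?thesis by (simp add: subsp_def)
qed

lemma adjoin_subset: "subsp W ==> U<=W ==> ka:W ==> adjoin U ka<=W"
 by (auto simp: adjoin_def subsp_def)

lemma adjoin_unique:
 assumes U: "subsp U" "ka:H" "ka~:U" and "u:U" "v:U"
  and eq: "add u (scl c ka) = add v (scl d ka)"
 shows "u = v & c = d"
proof -
 have uv: "u:H" "v:H" using assms by (auto simp: subsp_def)
 have cd: "c = d"
 proof (rule ccontr)
  assume ne: "c~=d"
  have "add (add u (scl c ka)) (scl (- d) ka) = add (add v (scl d ka)) (scl (- d) ka)"
   using eq by simp
  then have "add u (scl (c - d) ka) = v"
   using uv U(2) add_scl[of ka c "- d", symmetric] add_scl[of ka d "- d", symmetric]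
   by (simp add: add_assoc closed scl_0 add_zero)
  then have "scl (c - d) ka = add v (scl (- 1) u)"
   using eq_add_neg[of "scl (c - d) ka" v u] uv U(2) by (simp add: ac closed)
  then have "scl (c - d) ka:U" using U(1) assms(4,5) by (auto simp: subsp_def)
  then have "scl (1 / (c - d)) (scl (c - d) ka):U" using U(1) by (auto simp: subsp_def)
  then show False using ne U by (simp add: scl_scl scl_one)
 qed
 then show ?thesis using add_cancel[of u v "scl c ka"] eq uv U(2) by (simp add: closed)
qed

text \<open>The quotient of U by W is identified with column vectors: every step of the chain that
  leaves the previous space adds one coordinate.\<close>

lemma quotient_coordinates:
 assumes W: "subsp W" and "fin_over W U"
 shows "subsp U & W<=U & (EX n q. vlin U add scl n q & q ` U = CV n &
   (ALL h:U. q h = 0\<^sub>v n\<longleftrightarrow>h:W))"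
 using assms(2)
proof induction
 case base
 have "vlin W add scl 0 (%h. vec 0 (%_. 0 :: 'k))" by (auto simp: vlin_def)
 moreover have "(%h. vec 0 (%_. 0 :: 'k)) ` W = CV 0"
  using W by (fastforce simp: subsp_def image_iff)
 moreover have "ALL h:W. vec 0 (%_. 0 :: 'k) = 0\<^sub>v 0\<longleftrightarrow>h:W" by auto
 ultimately show ?case using W by blast
next
 case (step U ka)
 then have U: "subsp U" "W<=U" by auto
 obtain n q where q: "vlin U add scl n q" "q ` U = CV n"
  "ALL h:U. q h = 0\<^sub>v n\<longleftrightarrow>h:W" using step by blast
 have UH: "U<=H" using U by (auto simp: subsp_def)
 note a = subsp_adjoin[OF U(1) step.hyps(2)]
 show ?case
 proof (cases "ka:U")
  case True
  then have "adjoin U ka = U"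
   using adjoin_subset[OF U(1) subset_refl] subset_adjoin[OF UH step.hyps(2)] by blast
  then show ?thesis using step.IH by simp
 next
  case False
  note uniq = adjoin_unique[OF U(1) step.hyps(2) False]
  \<comment> \<open>A vector of the larger space is u + c ka in exactly one way because
    \<open>ka\<close> is outside U, so the coefficient c can be prepended to the coordinates of
    u.\<close>
  define q' where "q' h = (THE w. EX u:U. EX c. h = add u (scl c ka) & w = vCons c (q u))" for h
  have q': "q' (add u (scl c ka)) = vCons c (q u)" if "u:U" for u c
   unfolding q'_def by (rule the_equality) (use that uniq in blast)+
  have UU: "!!u. u:U ==> u:H" "zero:U" "!!u v. u:U ==> v:U ==> add u v:U"
   "!!u c. u:U ==> scl c u:U"
   using U(1) by (auto simp: subsp_def)
  have vadd: "vCons c v + vCons d w = vCons (c + d) (v + w)" if "v:CV n" "w:CV n"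
   for c d :: 'k and v w
   using that by (auto intro!: eq_vecI simp: vec_index_vCons)
  have vscl: "d .*v vCons c v = vCons (d * c) (d .*v v)" for c d :: 'k and v
   by (auto intro!: eq_vecI simp: vec_index_vCons)
  have qU: "!!u. u:U ==> q u:CV n" "!!u v. u:U ==> v:U ==> q (add u v) = q u + q v"
   "!!u c. u:U ==> q (scl c u) = c .*v q u"
   using q(1) by (auto simp: vlin_def)
  have "vlin (adjoin U ka) add scl (Suc n) q'"
   unfolding vlin_def
  proof (intro ballI conjI allI)
   fix h assume "h:adjoin U ka"
   then obtain u c where h: "u:U" "h = add u (scl c ka)" by (auto simp: adjoin_def)
   show "q' h:CV (Suc n)" using h q' qU by simp
   fix d
   have "scl d h = add (scl d u) (scl (d * c) ka)"
    using h UU step.hyps(2) by (simp add: scl_add scl_scl closed)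
   then show "q' (scl d h) = d .*v q' h" using h q' qU vscl UU by simp
  next
   fix h h' assume "h:adjoin U ka" "h':adjoin U ka"
   then obtain u c u' c' where h: "u:U" "h = add u (scl c ka)" "u':U" "h' = add u' (scl c' ka)"
    by (auto simp: adjoin_def)
   have "add h h' = add (add u u') (scl (c + c') ka)"
    using h UU step.hyps(2) by (simp add: add_scl ac closed)
   then show "q' (add h h') = q' h + q' h'" using h q' qU vadd UU by simp
  qed
  moreover have "q' ` adjoin U ka = CV (Suc n)"
  proof (intro equalityI subsetI)
   fix w assume "w:q' ` adjoin U ka"
   then show "w:CV (Suc n)" using q' qU by (auto simp: adjoin_def)
  next
   fix w :: "'k vec" assume "w:CV (Suc n)"
   then obtain c v where w: "w = vCons c v" "v:CV n" by (cases w) auto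
   then obtain u where "u:U" "v = q u" using q(2) by blast
   then have "w = q' (add u (scl c ka))" "add u (scl c ka):adjoin U ka"
    using q' w by (auto simp: adjoin_def)
   then show "w:q' ` adjoin U ka" by blast
  qed
  moreover have "q' h = 0\<^sub>v (Suc n)\<longleftrightarrow>h:W" if hU: "h:adjoin U ka" for h
  proof -
   obtain u c where h: "u:U" "h = add u (scl c ka)" using hU by (auto simp: adjoin_def)
   have "q' h = 0\<^sub>v (Suc n)\<longleftrightarrow>c = 0 & u:W"
    using h q' q(3) by (simp add: zero_vec_Suc)
   also have "\<dots>\<longleftrightarrow>h:W"
   proof
    assume "c = 0 & u:W" then show "h:W" using h UU step.hyps(2) by (simp add: scl_0 add_zero)
   next
    assume hW: "h:W"
    then have hU': "h:U" using U(2) by blast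
    then have "add u (scl c ka) = add h (scl 0 ka)"
     using h(2) UU(1) step.hyps(2) by (simp add: scl_0 add_zero)
    then have "u = h & c = 0" by (rule uniq[OF h(1) hU'])
    then show "c = 0 & u:W" using hW by simp
   qed
   finally show ?thesis .
  qed
  moreover have "W<=adjoin U ka" using U(2) subset_adjoin[OF UH step.hyps(2)] by simp
  ultimately show ?thesis using a by (intro conjI exI[of _ "Suc n"] exI[of _ q']) auto
 qed
qed

lemma fin_over_subsp: "fin_over {zero} U ==> subsp U"
 using quotient_coordinates[OF subsp_zero] by blast

text \<open>Adjoining one vector to U enlarges the trace of W by at most one direction: a single
  \<open>w\<close> in W outside U spans W over its intersection with U.\<close>

lemma fin_over_subspace:
 assumes "fin_over {zero} U" "subsp W" "W<=U"
 shows "fin_over {zero} W"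
 using assms
proof (induction arbitrary: W)
 case base
 then have "W = {zero}" by (auto simp: subsp_def)
 then show ?case using fin_over.base by simp
next
 case (step U ka)
 have U: "subsp U" using fin_over_subsp[OF step.hyps(1)] .
 have WU: "subsp (W\<inter>U)" using step.prems(1) U by (auto simp: subsp_def)
 have fin: "fin_over {zero} (W\<inter>U)" using step.IH[OF WU] by simp
 show ?case
 proof (cases "W<=U")
  case True then show ?thesis using fin by (simp add: Int_absorb2)
 next
  case False
  then obtain w where w: "w:W" "w~:U" by blast
  then obtain u c where u: "u:U" "w = add u (scl c ka)" using step.prems by (auto simp: adjoin_def)
  have uH: "u:H" "w:H" using U u w step.prems by (auto simp: subsp_def)
  have c: "c~=0" using u w uH step.hyps(2) by (auto simp: scl_0 add_zero)
  have "W = adjoin (W\<inter>U) w"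
  proof (intro equalityI subsetI)
   fix x assume x: "x:W"
   then obtain v d where v: "v:U" "x = add v (scl d ka)" using step.prems by (auto simp: adjoin_def)
   have vH: "v:H" "x:H" using U v x step.prems by (auto simp: subsp_def)
   \<comment> \<open>\<open>w\<close> contains \<open>ka\<close> with coefficient c ~= 0 and x
     contains it with coefficient d, so subtracting d / c times \<open>w\<close> leaves an element
     of U.\<close>
   define y where "y = add x (scl (- (d / c)) w)"
   have "scl (- (d / c)) w = add (scl (- (d / c)) u) (scl (- d) ka)"
    using u uH step.hyps(2) c by (simp add: scl_add scl_scl closed)
   then have "y = add (add v (scl (- (d / c)) u)) (add (scl d ka) (scl (- d) ka))"
    using v vH uH step.hyps(2) by (simp add: y_def ac closed)
   also have "add (scl d ka) (scl (- d) ka) = zero"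
    using add_scl[of ka d "- d"] step.hyps(2) by (simp add: scl_0)
   finally have "y:U" using U u v by (auto simp: subsp_def)
   moreover have "y:W" using x w step.prems by (auto simp: y_def subsp_def)
   moreover have "x = add y (scl (d / c) w)"
    using vH uH add_scl[of w "- (d / c)" "d / c", symmetric] by (simp add: y_def add_assoc closed scl_0 add_zero)
   ultimately show "x:adjoin (W\<inter>U) w" by (auto simp: adjoin_def)
  next
   fix x assume "x:adjoin (W\<inter>U) w"
   then show "x:W" using w step.prems by (auto simp: adjoin_def subsp_def)
  qed
  then show ?thesis using fin_over.step[OF fin uH(2)] by simp
 qed
qed

lemma fin_over_sum:
 assumes "fin_over {zero} U" "subsp W"
 shows "fin_over W {add w u | w u. w:W & u:U}"
 using assms
proof induction
 case base
 have "{add w u |w u. w:W & u:{zero}} = W" using base by (force simp: subsp_def add_zero)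
 then show ?case using fin_over.base by metis
next
 case (step U ka)
 have U: "U<=H" "W<=H" using fin_over_subsp[OF step.hyps(1)] step.prems by (auto simp: subsp_def)
 have "add (add w u) (scl c ka) = add w (add u (scl c ka))" if "w:W" "u:U" for w u c
  using that U step.hyps(2) by (intro add_assoc) (auto simp: closed)
 then have "adjoin {add w u |w u. w:W & u:U} ka = {add w u |w u. w:W & u:adjoin U ka}"
  unfolding adjoin_def
  by (intro equalityI subsetI; clarsimp; metis)
 then show ?case using fin_over.step[OF step.IH[OF step.prems] step.hyps(2)] by simp
qed

text \<open>H is the sum of W and H, so \<open>fin_over_sum\<close> translates the chain from zero
  to H into one from W to H. This gives the underlying space of the cokernels taken later.\<close>

lemma coker_coordinates:
 assumes "fin_over {zero} H" "subsp W"
 shows "EX n q. vlin H add scl n q & q ` H = CV n & (ALL h:H. q h = 0\<^sub>v n\<longleftrightarrow>h:W)"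
proof -
 have "{add w u | w u. w:W & u:H} = H"
 proof (intro equalityI subsetI)
  fix x assume "x:{add w u | w u. w:W & u:H}"
  then show "x:H" using assms(2) by (auto simp: subsp_def closed)
 next
  fix x assume "x:H"
  then have "x = add zero x" "zero:W" using assms(2) by (auto simp: zero_add subsp_def)
  then show "x:{add w u | w u. w:W & u:H}" using \<open>x \<in> H\<close> by blast
 qed
 then have "fin_over W H" using fin_over_sum[OF assms] by simp
 then show ?thesis using quotient_coordinates[OF assms(2)] by blast
qed

lemma vlin_zero: "vlin H add scl n q ==> q zero = 0\<^sub>v n"
proof -
 assume q: "vlin H add scl n q"
 have "q (scl 0 zero) = 0 .*v q zero" "q zero:CV n"
  using q zero_closed by (auto simp: vlin_def)
 then show ?thesis by (simp add: scl_zero zero_smult_vec)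
qed

lemma vlin_diff:
 assumes "vlin H add scl n q" "x:H" "y:H"
 shows "q (add x (scl (- 1) y)) = 0\<^sub>v n\<longleftrightarrow>q x = q y"
proof -
 have c: "q x:CV n" "q y:CV n" using assms by (auto simp: vlin_def)
 have "q (add x (scl (- 1) y)) = q x + (- 1) .*v q y"
  using assms scl_closed by (simp add: vlin_def)
 also have "\<dots> = 0\<^sub>v n\<longleftrightarrow>q x = q y"
  using c by (auto simp: vec_eq_iff)
 finally show ?thesis .
qed

lemma coordinates:
 assumes "fin_over {zero} H"
 shows "EX n q. vlin H add scl n q & bij_betw q H (CV n)"
proof -
 obtain n q where q: "vlin H add scl n q" "q ` H = CV n" "ALL h:H. q h = 0\<^sub>v n\<longleftrightarrow>h = zero"
  using coker_coordinates[OF assms subsp_zero] by auto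
 have "inj_on q H"
 proof (rule inj_onI)
  fix x y assume xy: "x:H" "y:H" "q x = q y"
  then have "add x (scl (- 1) y) = zero"
   using vlin_diff[OF q(1) xy(1,2)] q(3) by (simp add: closed)
  then show "x = y" using diff_zero_eq xy by simp
 qed
 then show ?thesis using q by (auto simp: bij_betw_def)
qed

text \<open>A map that kills the kernel of \<open>q\<close> agrees on any two preimages of a column
  vector, so composing it with an arbitrary set-theoretic section of \<open>q\<close> is linear,
  hence given by a matrix. Matrices between cokernels are obtained this way.\<close>

lemma vlin_factor:
 assumes q: "vlin H add scl n q" "q ` H = CV n" and p: "vlin H add scl m p"
  and ker: "!!h. h:H ==> q h = 0\<^sub>v n ==> p h = 0\<^sub>v m"
 shows "EX M:CM m n. ALL h:H. M *v q h = p h"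
proof -
 define r where "r x = (SOME h. h:H & q h = x)" for x
 have r: "r x:H" "q (r x) = x" if "x:CV n" for x
 proof -
  have "x:q ` H" using that q(2) by simp
  then have "EX h. h:H & q h = x" by (auto simp: image_iff)
  from someI_ex[OF this] show "r x:H" "q (r x) = x" by (auto simp: r_def)
 qed
 have eq: "p x = p y" if "x:H" "y:H" "q x = q y" for x y
  using that vlin_diff[OF q(1) that(1,2)] vlin_diff[OF p that(1,2)]
   ker[OF add_closed[OF that(1) scl_closed[OF that(2)]]] by simp
 have "vlin (CV n) (+) (\<cdot>\<^sub>v) m (%x. p (r x))"
  unfolding vlin_def
 proof (intro ballI conjI allI)
  fix x :: "'k vec" assume x: "x:CV n"
  show "p (r x):CV m" using r[OF x] p by (auto simp: vlin_def)
  fix c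
  have cx: "c .*v x:CV n" using x by simp
  have "q (r (c .*v x)) = q (scl c (r x))" using q(1) r[OF x] r(2)[OF cx] by (simp add: vlin_def)
  then have "p (r (c .*v x)) = p (scl c (r x))"
   by (rule eq[OF r(1)[OF cx] scl_closed[OF r(1)[OF x]]])
  then show "p (r (c .*v x)) = c .*v p (r x)" using r[OF x] p by (auto simp: vlin_def)
 next
  fix x y :: "'k vec" assume x: "x:CV n" and y: "y:CV n"
  have xy: "x + y:CV n" using x y by simp
  have "q (r (x + y)) = q (add (r x) (r y))"
   using q(1) r[OF x] r[OF y] r(2)[OF xy] by (simp add: vlin_def)
  then have "p (r (x + y)) = p (add (r x) (r y))"
   by (rule eq[OF r(1)[OF xy] add_closed[OF r(1)[OF x] r(1)[OF y]]])
  then show "p (r (x + y)) = p (r x) + p (r y)" using r[OF x] r[OF y] p by (auto simp: vlin_def)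
 qed
 from vlin_matrix[OF this]
 obtain M where M: "M:CM m n" "ALL x:CV n. M *v x = p (r x)" ..
 have "M *v q h = p h" if "h:H" for h
 proof -
  have "q h:CV n" using that q by blast
  then show ?thesis using M(2) eq[OF r(1)[of "q h"] that] r(2)[of "q h"] by simp
 qed
 then show ?thesis using M(1) by blast
qed

end

lemma kspace_vec: "kspace (CV n) (+) (\<cdot>\<^sub>v) (0\<^sub>v n :: 'k::field vec)"
 by unfold_locales (auto simp: smult_add_distrib_vec add_smult_distrib_vec comm_add_vec[of _ n]
   smult_smult_assoc)

lemma fin_over_image:
 assumes "kspace H1 a1 s1 z1" "kspace H2 a2 s2 z2"
  and g: "!!x. x:H1 ==> g x:H2" "!!x y. x:H1 ==> y:H1 ==> g (a1 x y) = a2 (g x) (g y)"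
   "!!x c. x:H1 ==> g (s1 c x) = s2 c (g x)"
  and "kspace.fin_over H1 a1 s1 {z1} U"
 shows "kspace.fin_over H2 a2 s2 {z2} (g ` U)"
proof -
 interpret K1: kspace H1 a1 s1 z1 by fact
 interpret K2: kspace H2 a2 s2 z2 by fact
 from assms(6) show ?thesis
 proof induction
  case base
  have "g z1 = z2"
   using g(3)[OF K1.zero_closed, of 0] g(1)[OF K1.zero_closed] by (simp add: K1.scl_0 K1.zero_closed K2.scl_0)
  then show ?case using K2.fin_over.base by simp
 next
  case (step U ka)
  have U: "U<=H1" using K1.fin_over_subsp[OF step.hyps(1)] by (auto simp: K1.subsp_def)
  have "g (a1 u (s1 c ka)) = a2 (g u) (s2 c (g ka))" if "u:U" for u c
   using that U g step.hyps(2) K1.scl_closed by auto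
  then have "g ` K1.adjoin U ka = K2.adjoin (g ` U) (g ka)"
   unfolding K1.adjoin_def K2.adjoin_def by (auto simp: image_iff) metis+
  then show ?case using K2.fin_over.step[OF step.IH g(1)[OF step.hyps(2)]] by simp
 qed
qed

lemma fin_over_vec: "kspace.fin_over (CV n) (+) (\<cdot>\<^sub>v) {0\<^sub>v n} (CV n :: 'k::field vec set)"
proof -
 interpret kspace "CV n" "(+)" "(\<cdot>\<^sub>v)" "0\<^sub>v n :: 'k vec" by (rule kspace_vec)
 define V where "V k = {v:CV n. ALL i<n. k\<le>i-->v $ i = (0 :: 'k)}" for k
 have "fin_over {0\<^sub>v n} (V k)" if "k\<le>n" for k
  using that
 proof (induction k)
  case 0
  have "V 0 = {0\<^sub>v n}" by (auto simp: V_def)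
  then show ?case using fin_over.base by simp
 next
  case (Suc k)
  have "V (Suc k) = adjoin (V k) (unit_vec n k)"
  proof (intro equalityI subsetI)
   fix v assume v: "v:V (Suc k)"
   define u where "u = vec n (%i. if i < k then v $ i else 0)"
   have "v = u + v $ k .*v unit_vec n k" "u:V k"
    using v Suc.prems by (auto simp: V_def u_def intro!: eq_vecI)
   then show "v:adjoin (V k) (unit_vec n k)" unfolding adjoin_def by blast
  qed (use Suc.prems in "auto simp: adjoin_def V_def")
  then show ?case using fin_over.step[OF Suc.IH] Suc.prems by simp
 qed
 moreover have "V n = CV n" by (auto simp: V_def)
 ultimately show ?thesis by (metis le_refl)
qed

text \<open>\<open>S\<close> is a linear section of the projection \<open>P\<close>, assembled from
  preimages of the unit vectors. The pair serves to split idempotents and to form tensor products as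
  quotients.\<close>

lemma vec_quotient:
 assumes "kspace.subsp (CV n) (+) (\<cdot>\<^sub>v) (0\<^sub>v n) (W :: 'k::field vec set)"
 shows "EX m. EX P:CM m n. EX S:CM n m. P * S = 1\<^sub>m m &
  (ALL x:CV n. P *v x = 0\<^sub>v m\<longleftrightarrow>x:W)"
proof -
 interpret kspace "CV n" "(+)" "(\<cdot>\<^sub>v)" "0\<^sub>v n :: 'k vec" by (rule kspace_vec)
 obtain m q where q: "vlin (CV n) (+) (\<cdot>\<^sub>v) m q" "q ` CV n = CV m"
  "ALL x:CV n. q x = 0\<^sub>v m\<longleftrightarrow>x:W"
  using coker_coordinates[OF fin_over_vec assms] by blast
 obtain P where P: "P:CM m n" "ALL x:CV n. P *v x = q x" using vlin_matrix[OF q(1)] by blast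
 have "EX s. s:CV n & P *v s = unit_vec m j" for j
  using q(2) P(2) unit_vec_carrier[of m j] by (metis image_iff)
 then obtain s where s: "!!j. s j:CV n" "!!j. P *v s j = unit_vec m j" by metis
 define S where "S = mat n m (%(i, j). s j $ i)"
 have S: "S:CM n m" by (simp add: S_def)
 have "P * S = 1\<^sub>m m"
 proof (rule eq_matI)
  fix i j assume ij: "i < dim_row (1\<^sub>m m :: 'k mat)" "j < dim_col (1\<^sub>m m :: 'k mat)"
  have "col S j = s j" using ij s(1)[of j] by (auto simp: S_def)
  then have "(P * S) $$ (i, j) = (P *v s j) $ i" using ij P S by simp
  then show "(P * S) $$ (i, j) = 1\<^sub>m m $$ (i, j)" using s(2) ij by (auto simp: unit_vec_def)
 qed (use P S in auto)
 then show ?thesis using P q S by metis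
qed

section \<open>Spaces of functions with finite support\<close>

lemma fsubspace_iff:
 "fsubspace (B :: ('x=>'k::field) set) \<longleftrightarrow>
  0:B & (ALL x:B. ALL y:B. x + y:B) & (ALL c. ALL x:B. fscale c x:B)"
proof -
 interpret vector_space "fscale :: 'k=>('x=>'k)=>'x=>'k"
  by unfold_locales (auto simp: algebra_simps fun_eq_iff)
 show ?thesis by (auto simp: subspace_def)
qed

lemma kspace_fun:
 assumes "fsubspace (B :: ('x=>'k::field) set)"
 shows "kspace B (+) fscale 0"
 using assms unfolding fsubspace_iff
 by unfold_locales (simp_all add: fun_eq_iff distrib_left distrib_right)

definition spt :: "'x set=>('x=>'k::zero) set" where
 "spt S = {f. ALL x. f x~=0-->x:S}"

lemma fsub_spt: "fsubspace (spt S :: ('x=>'k::field) set)"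
 unfolding fsubspace_iff spt_def by auto (metis add.right_neutral)

lemma fin_over_fun:
 assumes B: "fsubspace (B :: ('x=>'k::field) set)" and S: "finite S" "B<=spt S"
 shows "kspace.fin_over B (+) fscale {0} B"
proof -
 interpret U: kspace "UNIV :: ('x=>'k) set" "(+)" fscale 0
  by (rule kspace_fun) (simp add: fsubspace_iff)
 interpret B: kspace B "(+)" fscale 0 by (rule kspace_fun[OF B])
 have "U.fin_over {0} (spt S)" using S(1)
 proof (induction S)
  case empty
  have "spt {} = {0 :: 'x=>'k}" by (auto simp: spt_def)
  show ?case unfolding \<open>spt {} = {0 :: 'x \<Rightarrow> 'k}\<close> by (rule U.fin_over.base)
 next
  case (insert a S)
  have "spt (insert a S) = U.adjoin (spt S) (%x. if x = a then 1 else 0)"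
  proof (intro equalityI subsetI)
   fix f :: "'x=>'k" assume f: "f:spt (insert a S)"
   have "f = (%x. if x = a then 0 else f x) + fscale (f a) (%x. if x = a then 1 else 0)"
    by auto
   moreover have "(%x. if x = a then 0 else f x):spt S" using f by (auto simp: spt_def)
   ultimately show "f:U.adjoin (spt S) (%x. if x = a then 1 else 0)"
    unfolding U.adjoin_def by blast
  qed (auto simp: U.adjoin_def spt_def split: if_splits)
  show ?case unfolding \<open>spt (insert a S) = _\<close> by (rule U.fin_over.step[OF insert.IH UNIV_I])
 qed
 moreover have "U.subsp B" using B by (auto simp: U.subsp_def fsubspace_iff)
 ultimately have fin: "U.fin_over {0} B" using U.fin_over_subspace S(2) by blast
 \<comment> \<open>The chain ending in B was built inside the space of all functions. Each of its
   members is contained in the last one, so all adjoined vectors lie in B and the chain is also one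
   inside B.\<close>
 have "U.fin_over {0} X ==> X<=B ==> B.fin_over {0} X" for X
 proof (induction rule: U.fin_over.induct)
  case base show ?case by (rule B.fin_over.base)
 next
  case (step U' ka)
  have sub: "U'<=U.adjoin U' ka" "ka:U.adjoin U' ka"
   using U.subset_adjoin[of U' ka] U.mem_adjoin[of U' ka] U.fin_over_subsp[OF step.hyps(1)]
   by (auto simp: U.subsp_def)
  then have "B.fin_over {0} (B.adjoin U' ka)" using B.fin_over.step step by blast
  moreover have "U.adjoin U' ka = B.adjoin U' ka" unfolding U.adjoin_def B.adjoin_def ..
  ultimately show ?case by (simp only:)
 qed
 then show ?thesis using fin by blast
qed

section \<open>Linear categories\<close>

text \<open>Membership of a morphism in the ideal of the category generated by the identities of the
  objects in S. In contrast to an explicit biproduct it is stable under sums and under composition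
  on both sides by a direct induction.\<close>

inductive factors :: "('o, 'm, 'k) lincat=>'o set=>'o=>'o=>'m=>bool" for C S X Y where
 zero: "factors C S X Y (Hzero C X Y)"
| step: "factors C S X Y r ==> s:S ==> f:Hom C X s ==> g:Hom C s Y ==>
  factors C S X Y (Hadd C X Y r (Comp C X s Y g f))"

definition binary_biproduct ::
 "('o, 'm, 'k) lincat=>'o=>'o=>'o=>'m=>'m=>'m=>'m=>bool" where
 "binary_biproduct C X Y Z i1 i2 p1 p2\<longleftrightarrow>X:Ob C & Y:Ob C & Z:Ob C &
   i1:Hom C X Z & i2:Hom C Y Z & p1:Hom C Z X & p2:Hom C Z Y &
   Comp C X Z X p1 i1 = Ident C X & Comp C Y Z Y p2 i2 = Ident C Y &
   Comp C X Z Y p2 i1 = Hzero C X Y & Comp C Y Z X p1 i2 = Hzero C Y X &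
   Hadd C Z Z (Comp C Z X Z i1 p1) (Comp C Z Y Z i2 p2) = Ident C Z"

definition has_biproducts :: "('o, 'm, 'k) lincat=>bool" where
 "has_biproducts C \<longleftrightarrow>
   (ALL X:Ob C. ALL Y:Ob C. EX Z i1 i2 p1 p2. binary_biproduct C X Y Z i1 i2 p1 p2)"

definition splits_idempotents :: "('o, 'm, 'k) lincat=>bool" where
 "splits_idempotents C\<longleftrightarrow>(ALL X:Ob C. ALL e:Hom C X X. Comp C X X X e e = e -->
   (EX Y:Ob C. EX p:Hom C X Y. EX s:Hom C Y X.
    Comp C Y X Y p s = Ident C Y & Comp C X Y X s p = e))"

locale linear_category =
 fixes C :: "('o, 'm, 'k::field) lincat"
 assumes hom_space: "X:Ob C ==> Y:Ob C ==>
   kspace (Hom C X Y) (Hadd C X Y) (Hscale C X Y) (Hzero C X Y)"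
  and ident_hom: "X:Ob C ==> Ident C X:Hom C X X"
  and comp_hom: "X:Ob C ==> Y:Ob C ==> Z:Ob C ==> f:Hom C X Y ==> g:Hom C Y Z ==>
   Comp C X Y Z g f:Hom C X Z"
  and ca: "W:Ob C ==> X:Ob C ==> Y:Ob C ==> Z:Ob C ==>
   f:Hom C W X ==> g:Hom C X Y ==> h:Hom C Y Z ==>
   Comp C W X Z (Comp C X Y Z h g) f = Comp C W Y Z h (Comp C W X Y g f)"
  and ident_left: "X:Ob C ==> Y:Ob C ==> f:Hom C X Y ==> Comp C X Y Y (Ident C Y) f = f"
  and ident_right: "X:Ob C ==> Y:Ob C ==> f:Hom C X Y ==> Comp C X X Y f (Ident C X) = f"
  and comp_add_left: "X:Ob C ==> Y:Ob C ==> Z:Ob C ==> f:Hom C X Y ==>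
   g:Hom C Y Z ==> g':Hom C Y Z ==>
   Comp C X Y Z (Hadd C Y Z g g') f = Hadd C X Z (Comp C X Y Z g f) (Comp C X Y Z g' f)"
  and comp_add_right: "X:Ob C ==> Y:Ob C ==> Z:Ob C ==> f:Hom C X Y ==>
   f':Hom C X Y ==> g:Hom C Y Z ==>
   Comp C X Y Z g (Hadd C X Y f f') = Hadd C X Z (Comp C X Y Z g f) (Comp C X Y Z g f')"
  and comp_scale_left: "X:Ob C ==> Y:Ob C ==> Z:Ob C ==> f:Hom C X Y ==>
   g:Hom C Y Z ==> Comp C X Y Z (Hscale C Y Z c g) f = Hscale C X Z c (Comp C X Y Z g f)"
  and comp_scale_right: "X:Ob C ==> Y:Ob C ==> Z:Ob C ==> f:Hom C X Y ==>
   g:Hom C Y Z ==> Comp C X Y Z g (Hscale C X Y c f) = Hscale C X Z c (Comp C X Y Z g f)"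
begin

lemma
 assumes "X:Ob C" "Y:Ob C"
 shows add_hom: "f:Hom C X Y ==> g:Hom C X Y ==> Hadd C X Y f g:Hom C X Y"
  and zero_hom: "Hzero C X Y:Hom C X Y"
  and scale_hom: "f:Hom C X Y ==> Hscale C X Y c f:Hom C X Y"
  and hadd_zero: "f:Hom C X Y ==> Hadd C X Y f (Hzero C X Y) = f"
  and hzero_add: "f:Hom C X Y ==> Hadd C X Y (Hzero C X Y) f = f"
  and hadd_comm: "f:Hom C X Y ==> g:Hom C X Y ==> Hadd C X Y f g = Hadd C X Y g f"
  and hadd_assoc: "f:Hom C X Y ==> g:Hom C X Y ==> h:Hom C X Y ==>
   Hadd C X Y (Hadd C X Y f g) h = Hadd C X Y f (Hadd C X Y g h)"
  and hadd_lcomm: "f:Hom C X Y ==> g:Hom C X Y ==> h:Hom C X Y ==>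
   Hadd C X Y f (Hadd C X Y g h) = Hadd C X Y g (Hadd C X Y f h)"
  and hscale_0: "f:Hom C X Y ==> Hscale C X Y 0 f = Hzero C X Y"
  and hscale_add: "f:Hom C X Y ==> g:Hom C X Y ==>
   Hscale C X Y c (Hadd C X Y f g) = Hadd C X Y (Hscale C X Y c f) (Hscale C X Y c g)"
  and hscale_zero: "Hscale C X Y c (Hzero C X Y) = Hzero C X Y"
proof -
 interpret kspace "Hom C X Y" "Hadd C X Y" "Hscale C X Y" "Hzero C X Y" by (rule hom_space[OF assms])
 show "f:Hom C X Y ==> g:Hom C X Y ==> Hadd C X Y f g:Hom C X Y" by (rule add_closed)
 show "Hzero C X Y:Hom C X Y" by (rule zero_closed)
 show "f:Hom C X Y ==> Hscale C X Y c f:Hom C X Y" by (rule scl_closed)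
 show "f:Hom C X Y ==> Hadd C X Y f (Hzero C X Y) = f" by (rule add_zero)
 show "f:Hom C X Y ==> Hadd C X Y (Hzero C X Y) f = f" by (rule zero_add)
 show "f:Hom C X Y ==> g:Hom C X Y ==> Hadd C X Y f g = Hadd C X Y g f" by (rule add_comm)
 show "f:Hom C X Y ==> g:Hom C X Y ==> h:Hom C X Y ==>
   Hadd C X Y (Hadd C X Y f g) h = Hadd C X Y f (Hadd C X Y g h)" by (rule add_assoc)
 show "f:Hom C X Y ==> g:Hom C X Y ==> h:Hom C X Y ==>
   Hadd C X Y f (Hadd C X Y g h) = Hadd C X Y g (Hadd C X Y f h)" by (rule add_lcomm)
 show "f:Hom C X Y ==> Hscale C X Y 0 f = Hzero C X Y" by (rule scl_0)
 show "f:Hom C X Y ==> g:Hom C X Y ==>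
   Hscale C X Y c (Hadd C X Y f g) = Hadd C X Y (Hscale C X Y c f) (Hscale C X Y c g)" by (rule scl_add)
 show "Hscale C X Y c (Hzero C X Y) = Hzero C X Y" by (rule scl_zero)
qed

lemma comp_zero_left:
 assumes "X:Ob C" "Y:Ob C" "Z:Ob C" "f:Hom C X Y"
 shows "Comp C X Y Z (Hzero C Y Z) f = Hzero C X Z"
 using comp_scale_left[OF assms zero_hom[OF assms(2,3)], of 0] assms
 by (simp add: hscale_zero hscale_0 comp_hom zero_hom)

lemma comp_zero_right:
 assumes "X:Ob C" "Y:Ob C" "Z:Ob C" "g:Hom C Y Z"
 shows "Comp C X Y Z g (Hzero C X Y) = Hzero C X Z"
 using comp_scale_right[OF assms(1-3) zero_hom[OF assms(1,2)] assms(4), of 0] assms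
 by (simp add: hscale_zero hscale_0 comp_hom zero_hom)

lemmas hom_closed = ident_hom comp_hom add_hom zero_hom scale_hom
lemmas hs = hom_closed ident_left ident_right comp_zero_left comp_zero_right hadd_zero hzero_add
lemmas distrib = comp_add_left comp_add_right comp_scale_left comp_scale_right

context
 fixes S assumes S: "S<=Ob C"
begin

lemma factors_hom: "factors C S X Y r ==> X:Ob C ==> Y:Ob C ==> r:Hom C X Y"
 by (induction rule: factors.induct) (use S in "auto simp: hs subset_eq")

lemma factors_single:
 assumes "X:Ob C" "Y:Ob C" "s:S" "f:Hom C X s" "g:Hom C s Y"
 shows "factors C S X Y (Comp C X s Y g f)"
 using factors.step[OF factors.zero, of s S f C X g Y] assms S by (simp add: hs subset_eq)

lemma factors_add:
 assumes "X:Ob C" "Y:Ob C" "factors C S X Y r" "factors C S X Y r'"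
 shows "factors C S X Y (Hadd C X Y r r')"
 using assms(4)
proof induction
 case zero then show ?case using assms factors_hom by (simp add: hadd_zero)
next
 case (step r' s f g)
 have "Hadd C X Y r (Hadd C X Y r' (Comp C X s Y g f)) = Hadd C X Y (Hadd C X Y r r') (Comp C X s Y g f)"
  using step.hyps assms factors_hom[OF assms(3)] factors_hom[OF step.hyps(1)] S
  by (intro hadd_assoc[symmetric]) (auto simp: hs subset_eq)
 then show ?case using factors.step[OF step.IH step.hyps(2-4)] by simp
qed

lemma factors_comp_left:
 assumes "X:Ob C" "Y:Ob C" "Z:Ob C" "factors C S X Y r" "h:Hom C Y Z"
 shows "factors C S X Z (Comp C X Y Z h r)"
 using assms(4)
proof induction
 case zero then show ?case using assms factors.zero by (simp add: hs)
next
 case (step r s f g)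
 have s: "s:Ob C" using step S by auto
 have "Comp C X Y Z h (Hadd C X Y r (Comp C X s Y g f)) =
  Hadd C X Z (Comp C X Y Z h r) (Comp C X s Z (Comp C s Y Z h g) f)"
  using step.hyps assms s factors_hom[OF step.hyps(1)] by (simp add: comp_add_right ca hs)
 then show ?case using factors.step[OF step.IH step.hyps(2,3)] comp_hom[OF s assms(2,3)] step.hyps assms
  by simp
qed

lemma factors_comp_right:
 assumes "X:Ob C" "Y:Ob C" "Z:Ob C" "factors C S Y Z r" "h:Hom C X Y"
 shows "factors C S X Z (Comp C X Y Z r h)"
 using assms(4)
proof induction
 case zero then show ?case using assms factors.zero by (simp add: hs)
next
 case (step r s f g)
 have s: "s:Ob C" using step S by auto
 have "Comp C X Y Z (Hadd C Y Z r (Comp C Y s Z g f)) h =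
  Hadd C X Z (Comp C X Y Z r h) (Comp C X s Z g (Comp C X Y s f h))"
  using step.hyps assms s factors_hom[OF step.hyps(1)] by (simp add: comp_add_left ca hs)
 then show ?case using factors.step[OF step.IH step.hyps(2) _ step.hyps(4)] comp_hom[OF assms(1,2) s] step.hyps assms
  by simp
qed

lemma factors_sandwich:
 assumes "W:Ob C" "X:Ob C" "Y:Ob C" "Z:Ob C" "factors C S X Y r" "f:Hom C W X" "g:Hom C Y Z"
 shows "factors C S W Z (Comp C W Y Z g (Comp C W X Y r f))"
 using factors_comp_left[OF assms(1,3,4) factors_comp_right[OF assms(1-3,5,6)] assms(7)] .

end

text \<open>Each summand g f through an object s is read as g 1 f, and the factorization of the
  identity of s is substituted.\<close>

lemma factors_trans:
 assumes S: "S<=Ob C" "S'<=Ob C" and r: "factors C S X Y r" and "X:Ob C" "Y:Ob C"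
  and id: "!!s. s:S ==> factors C S' s s (Ident C s)"
 shows "factors C S' X Y r"
 using r
proof induction
 case zero show ?case by (rule factors.zero)
next
 case (step r s f g)
 have s: "s:Ob C" using step S by auto
 have "factors C S' X Y (Comp C X s Y g (Comp C X s s (Ident C s) f))"
  using factors_sandwich[OF S(2) assms(4) s s assms(5) id[OF step.hyps(2)] step.hyps(3,4)] .
 then have "factors C S' X Y (Comp C X s Y g f)"
  using s assms step.hyps by (simp add: ident_left)
 then show ?case by (rule factors_add[OF S(2) assms(4,5) step.IH])
qed

text \<open>The zero endomorphism is idempotent. On the object that splits it, the identity p s = p
  s p s = p (s p) s is zero.\<close>

lemma zero_object_exists:
 assumes "splits_idempotents C" "X:Ob C"
 shows "EX Z. zero_object C Z"
proof -
 obtain Z p s where Z: "Z:Ob C" "p:Hom C X Z" "s:Hom C Z X" "Comp C Z X Z p s = Ident C Z"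
  "Comp C X Z X s p = Hzero C X X"
  using assms comp_zero_right[OF assms(2) assms(2) assms(2) zero_hom[OF assms(2) assms(2)]]
   zero_hom[OF assms(2) assms(2)]
  unfolding splits_idempotents_def by metis
 have "Ident C Z = Comp C Z X Z (Comp C X Z Z (Comp C Z X Z p s) p) s"
  using Z assms by (simp add: hs)
 also have "\<dots> = Comp C Z X Z p (Comp C Z X X (Comp C X Z X s p) s)"
  using Z(1-3) assms(2) by (simp add: hs ca)
 also have "\<dots> = Hzero C Z Z" using Z assms by (simp add: hs)
 finally show ?thesis using Z by (auto simp: zero_object_def)
qed

text \<open>The new summand takes index 0 and the old inclusions and projections are composed with
  those of Z. This builds the biproducts of lists in \<open>additive_closure\<close> from binary
  ones.\<close>

lemma biproduct_Cons:
 assumes "biproduct C Xs Z" "binary_biproduct C X Z Z' i1 i2 p1 p2"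
 shows "biproduct C (X # Xs) Z'"
proof -
 obtain io pj where Xs: "set Xs<=Ob C" and Z: "Z:Ob C"
  and h: "!!k. k < length Xs ==> io k:Hom C (Xs ! k) Z" "!!k. k < length Xs ==> pj k:Hom C Z (Xs ! k)"
  and o: "!!k l. k < length Xs ==> l < length Xs ==> Comp C (Xs ! k) Z (Xs ! l) (pj l) (io k) =
    (if k = l then Ident C (Xs ! k) else Hzero C (Xs ! k) (Xs ! l))"
  and sum: "foldr (Hadd C Z Z) (map (%k. Comp C Z (Xs ! k) Z (io k) (pj k)) [0..<length Xs])
    (Hzero C Z Z) = Ident C Z"
  using assms(1) unfolding biproduct_def by blast
 note b = assms(2)[unfolded binary_biproduct_def]
 have XO: "k < length Xs ==> Xs ! k:Ob C" for k using Xs by (auto simp: subset_eq)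
 have Z': "Z':Ob C" "X:Ob C" using b by auto
 have p: "Comp C V Z' X p1 (Comp C V X Z' i1 f) = f" "Comp C V Z' Z p2 (Comp C V X Z' i1 f) = Hzero C V Z"
  if "V:Ob C" "f:Hom C V X" for V f
  using b that ca[of V X Z' X f i1 p1] ca[of V X Z' Z f i1 p2] by (auto simp: hs)
 have p': "Comp C V Z' X p1 (Comp C V Z Z' i2 f) = Hzero C V X" "Comp C V Z' Z p2 (Comp C V Z Z' i2 f) = f"
  if "V:Ob C" "f:Hom C V Z" for V f
  using b that ca[of V Z Z' X f i2 p1] ca[of V Z Z' Z f i2 p2] by (auto simp: hs)
 define io' where "io' k = (case k of 0=>i1 | Suc k=>Comp C (Xs ! k) Z Z' i2 (io k))" for k
 define pj' where "pj' k = (case k of 0=>p1 | Suc k=>Comp C Z' Z (Xs ! k) (pj k) p2)" for k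
 have homs: "io' k:Hom C ((X # Xs) ! k) Z' & pj' k:Hom C Z' ((X # Xs) ! k)" if "k < Suc (length Xs)" for k
  using that b h XO by (cases k) (auto simp: io'_def pj'_def hs)
 have orth: "Comp C ((X # Xs) ! k) Z' ((X # Xs) ! l) (pj' l) (io' k) =
    (if k = l then Ident C ((X # Xs) ! k) else Hzero C ((X # Xs) ! k) ((X # Xs) ! l))"
  if "k < Suc (length Xs)" "l < Suc (length Xs)" for k l
  using that b h XO o by (cases k; cases l) (auto simp: io'_def pj'_def hs ca p p')
 have fold: "foldr (Hadd C Z Z) (map t ks) (Hzero C Z Z):Hom C Z Z &
   foldr (Hadd C Z' Z') (map (%k. Comp C Z' Z Z' i2 (Comp C Z' Z Z (t k) p2)) ks) (Hzero C Z' Z') =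
   Comp C Z' Z Z' i2 (Comp C Z' Z Z (foldr (Hadd C Z Z) (map t ks) (Hzero C Z Z)) p2)"
  if "!!k. k:set ks ==> t k:Hom C Z Z" for t and ks :: "nat list"
  using that b by (induction ks) (auto simp: hs distrib)
 have "foldr (Hadd C Z' Z') (map (%k. Comp C Z' ((X # Xs) ! k) Z' (io' k) (pj' k)) [0..<Suc (length Xs)])
    (Hzero C Z' Z') = Hadd C Z' Z' (Comp C Z' X Z' i1 p1)
   (foldr (Hadd C Z' Z') (map (%k. Comp C Z' (Xs ! k) Z' (io' (Suc k)) (pj' (Suc k))) [0..<length Xs])
    (Hzero C Z' Z'))"
  by (simp add: upt_conv_Cons map_Suc_upt[symmetric] comp_def io'_def pj'_def del: upt_Suc)
 also have "map (%k. Comp C Z' (Xs ! k) Z' (io' (Suc k)) (pj' (Suc k))) [0..<length Xs] =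
  map (%k. Comp C Z' Z Z' i2 (Comp C Z' Z Z (Comp C Z (Xs ! k) Z (io k) (pj k)) p2)) [0..<length Xs]"
  using b h XO by (intro map_cong) (auto simp: io'_def pj'_def hs ca)
 also have "foldr (Hadd C Z' Z') \<dots> (Hzero C Z' Z') = Comp C Z' Z Z' i2 (Comp C Z' Z Z (Ident C Z) p2)"
  using fold[of "[0..<length Xs]" "%k. Comp C Z (Xs ! k) Z (io k) (pj k)"] h XO Z sum
  by (simp add: hs)
 also have "Hadd C Z' Z' (Comp C Z' X Z' i1 p1) \<dots> = Ident C Z'"
  using b by (simp add: hs)
 finally have sum': "foldr (Hadd C Z' Z') (map (%k. Comp C Z' ((X # Xs) ! k) Z' (io' k) (pj' k))
   [0..<Suc (length Xs)]) (Hzero C Z' Z') = Ident C Z'" .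
 show ?thesis unfolding biproduct_def
  using Xs Z' homs orth sum' by (intro conjI exI[of _ io'] exI[of _ pj']) (simp_all del: upt_Suc)
qed

text \<open>A sum of composites g f is a single composite: the column of all f followed by the row
  of all g, through the biproduct of the objects met on the way.\<close>

lemma factors_through_biproduct:
 assumes S: "S<=Ob C" and C: "has_biproducts C" "zero_object C Oz" and X: "X:Ob C" "Y:Ob C"
  and r: "factors C S X Y r"
 shows "EX Xs Z. set Xs<=S & biproduct C Xs Z &
  (EX b:Hom C X Z. EX a:Hom C Z Y. Comp C X Z Y a b = r)"
 using r
proof induction
 case zero
 have Oz: "Oz:Ob C" "Ident C Oz = Hzero C Oz Oz" using C by (auto simp: zero_object_def)
 then have "biproduct C [] Oz" by (auto simp: biproduct_def)
 moreover have "Comp C X Oz Y (Hzero C Oz Y) (Hzero C X Oz) = Hzero C X Y"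
  using Oz X by (simp add: hs)
 ultimately show ?case using Oz X zero_hom by (metis empty_set empty_subsetI)
next
 case (step r s f g)
 then obtain Xs Z a b where Z: "set Xs<=S" "biproduct C Xs Z" "b:Hom C X Z" "a:Hom C Z Y"
  "Comp C X Z Y a b = r" by blast
 have Oz: "s:Ob C" "Z:Ob C" using step S Z by (auto simp: biproduct_def)
 obtain Z' i1 i2 p1 p2 where bb: "binary_biproduct C s Z Z' i1 i2 p1 p2"
  using C Oz unfolding has_biproducts_def by blast
 note b = bb[unfolded binary_biproduct_def]
 define b' where "b' = Hadd C X Z' (Comp C X s Z' i1 f) (Comp C X Z Z' i2 b)"
 define a' where "a' = Hadd C Z' Y (Comp C Z' s Y g p1) (Comp C Z' Z Y a p2)"
 have h: "a':Hom C Z' Y" "b':Hom C X Z'" using b X Z step by (auto simp: a'_def b'_def hs)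
 have p: "Comp C X Z' s p1 (Comp C X s Z' i1 f) = f" "Comp C X Z' Z p2 (Comp C X s Z' i1 f) = Hzero C X Z"
  "Comp C X Z' s p1 (Comp C X Z Z' i2 b) = Hzero C X s" "Comp C X Z' Z p2 (Comp C X Z Z' i2 b) = b"
  using b X Z step.hyps ca[of X s Z' s f i1 p1] ca[of X s Z' Z f i1 p2]
   ca[of X Z Z' s b i2 p1] ca[of X Z Z' Z b i2 p2] by (auto simp: hs)
 have "Comp C X Z' Y a' b' = Hadd C X Y r (Comp C X s Y g f)"
  unfolding a'_def b'_def
  using b X Z step.hyps factors_hom[OF S step.hyps(1) X] by (simp add: hs distrib ca p hadd_comm)
 then show ?case using biproduct_Cons[OF Z(2) bb] Z(1) step.hyps(2) h
  by (intro exI[of _ "s # Xs"] exI[of _ Z']) auto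
qed

text \<open>From left to right, the identity of a biproduct is the sum of its inclusions after its
  projections, and this is compressed to the summand X. Conversely the identity of X is a b through
  a biproduct Z, so b a is an idempotent of Z, and splitting the complementary idempotent 1 - b a
  yields the complement Y.\<close>

lemma additive_closure_iff:
 assumes S: "S<=Ob C" and C: "has_biproducts C" "splits_idempotents C"
 shows "X:additive_closure C S\<longleftrightarrow>X:Ob C & factors C S X X (Ident C X)"
proof
 assume "X:additive_closure C S"
 then obtain Y Z Xs where X: "X:Ob C" and Xs: "set Xs<=S" and bp: "biproduct C Xs Z" "biproduct C [X, Y] Z"
  by (auto simp: additive_closure_def)
 have Z: "Z:Ob C" using bp by (auto simp: biproduct_def)
 obtain io pj where h: "!!k. k < length Xs ==> io k:Hom C (Xs ! k) Z" "!!k. k < length Xs ==> pj k:Hom C Z (Xs ! k)"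
  and sum: "foldr (Hadd C Z Z) (map (%k. Comp C Z (Xs ! k) Z (io k) (pj k)) [0..<length Xs])
    (Hzero C Z Z) = Ident C Z"
  using bp(1) unfolding biproduct_def by blast
 have "factors C S Z Z (foldr (Hadd C Z Z) (map (%k. Comp C Z (Xs ! k) Z (io k) (pj k)) ks) (Hzero C Z Z))"
  if "set ks<={..<length Xs}" for ks
  using that
 proof (induction ks)
  case Nil show ?case by (simp add: factors.zero)
 next
  case (Cons k ks)
  have "Xs ! k:S" using Cons.prems Xs by auto
  then have "factors C S Z Z (Comp C Z (Xs ! k) Z (io k) (pj k))"
   using factors_single[OF S Z Z] h Cons.prems by auto
  then show ?case using factors_add[OF S Z Z] Cons by auto
 qed
 from this[of "[0..<length Xs]"] have fZ: "factors C S Z Z (Ident C Z)" using sum by (simp add: lessThan_atLeast0)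
 obtain io' pj' where "ALL k<length [X, Y]. io' k:Hom C ([X, Y] ! k) Z & pj' k:Hom C Z ([X, Y] ! k)"
   "ALL k<length [X, Y]. ALL l<length [X, Y]. Comp C ([X, Y] ! k) Z ([X, Y] ! l) (pj' l) (io' k) =
    (if k = l then Ident C ([X, Y] ! k) else Hzero C ([X, Y] ! k) ([X, Y] ! l))"
  using bp(2) unfolding biproduct_def by (elim conjE exE) (rule that)
 from this(1)[rule_format, of 0] this(2)[rule_format, of 0 0]
 have i: "io' 0:Hom C X Z" "pj' 0:Hom C Z X" "Comp C X Z X (pj' 0) (io' 0) = Ident C X" by auto
 show "X:Ob C & factors C S X X (Ident C X)"
  using factors_sandwich[OF S X Z Z X fZ i(1,2)] X i(3) ident_left[OF X Z i(1)] by simp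
next
 assume X: "X:Ob C & factors C S X X (Ident C X)"
 then obtain Oz where Oz: "zero_object C Oz" using zero_object_exists[OF C(2)] by blast
 obtain Xs Z a b where Z: "set Xs<=S" "biproduct C Xs Z" "b:Hom C X Z" "a:Hom C Z X"
  "Comp C X Z X a b = Ident C X" using factors_through_biproduct[OF S C(1) Oz] X by blast
 have ZO: "Z:Ob C" "X:Ob C" using Z(2) X by (auto simp: biproduct_def)
 interpret K: kspace "Hom C Z Z" "Hadd C Z Z" "Hscale C Z Z" "Hzero C Z Z" by (rule hom_space) fact+
 define e where "e = Comp C Z X Z b a"
 define m where "m = Hscale C Z Z (- 1) e"
 define e' where "e' = Hadd C Z Z (Ident C Z) m"
 have eh: "e:Hom C Z Z" "m:Hom C Z Z" "e':Hom C Z Z" using Z ZO by (auto simp: e_def m_def e'_def hs)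
 have ab: "Comp C V Z X a (Comp C V X Z b f) = f" if "V:Ob C" "f:Hom C V X" for V f
  using ca[of V X Z X f b a] that Z ZO by (simp add: hs)
 have ee: "Comp C Z Z Z e e = e" using Z ZO ab by (simp add: e_def ca hs)
 have em: "Comp C Z Z Z e m = m" using eh ZO ee by (simp add: m_def distrib)
 have eem: "Hadd C Z Z e m = Hzero C Z Z" unfolding m_def by (rule K.add_neg[OF eh(1)])
 have ee': "Comp C Z Z Z e e' = Hzero C Z Z" unfolding e'_def using eh ZO em eem by (simp add: distrib hs)
 have e'e: "Comp C Z Z Z e' e = Hzero C Z Z" unfolding e'_def m_def using eh ZO ee eem[unfolded m_def]
  by (simp add: distrib hs)
 have "Comp C Z Z Z m e' = Hzero C Z Z" unfolding m_def using eh ZO ee' by (simp add: distrib hscale_zero)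
 then have e'e': "Comp C Z Z Z e' e' = e'" using eh ZO e'_def by (metis comp_add_left ident_left ident_hom hadd_zero)
 obtain Y p s where Y: "Y:Ob C" "p:Hom C Z Y" "s:Hom C Y Z" "Comp C Y Z Y p s = Ident C Y"
  "Comp C Z Y Z s p = e'" using C(2) eh(3) e'e' ZO(1) unfolding splits_idempotents_def by blast
 have ba: "Comp C X Z Z e b = b" using Z ZO by (simp add: e_def ca hs)
 have ae: "Comp C Z Z X a e = a" using Z ZO ab by (simp add: e_def)
 have pe: "Comp C Z Z Y p e' = p" unfolding Y(5)[symmetric]
  using Y ZO ca[of Z Y Z Y p s p] by (simp add: hs)
 have es: "Comp C Y Z Z e' s = s" unfolding Y(5)[symmetric]
  using Y(1-4) ZO by (simp add: hs ca)
 have pb: "Comp C X Z Y p b = Hzero C X Y"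
 proof -
  have "Comp C X Z Y p b = Comp C X Z Y (Comp C Z Z Y p e') (Comp C X Z Z e b)" by (simp add: pe ba)
  also have "\<dots> = Comp C X Z Y p (Comp C X Z Z (Comp C Z Z Z e' e) b)"
   using Y Z ZO eh by (simp add: ca hs)
  also have "\<dots> = Hzero C X Y" using Y Z ZO e'e by (simp add: hs)
  finally show ?thesis .
 qed
 have as: "Comp C Y Z X a s = Hzero C Y X"
 proof -
  have "Comp C Y Z X a s = Comp C Y Z X (Comp C Z Z X a e) (Comp C Y Z Z e' s)" by (simp add: ae es)
  also have "\<dots> = Comp C Y Z X a (Comp C Y Z Z (Comp C Z Z Z e e') s)"
   using Y Z ZO eh by (simp add: ca hs)
  also have "\<dots> = Hzero C Y X" using Y Z ZO ee' by (simp add: hs)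
  finally show ?thesis .
 qed
 have "Hadd C Z Z e e' = Hadd C Z Z (Ident C Z) (Hadd C Z Z e m)"
  unfolding e'_def using eh ZO by (simp add: hadd_lcomm hs)
 then have 1: "Hadd C Z Z e e' = Ident C Z" using eem ZO by (simp add: hs)
 have "biproduct C [X, Y] Z" unfolding biproduct_def
  by (intro conjI exI[of _ "%k. if k = 0 then b else s"] exI[of _ "%k. if k = 0 then a else p"])
   (use Y Z ZO pb as 1 eh e_def in "auto simp: less_Suc_eq hs")
 then show "X:additive_closure C S" using Z X unfolding additive_closure_def by blast
qed

lemma full_subcategory:
 assumes "O'<=Ob C"
 shows "linear_category (C\<lparr>Ob := O'\<rparr>)"
 by (rule linear_category.intro)
  (use assms hom_space in "auto simp: subset_eq hs distrib ca")

end

section \<open>Categories of functors and of modules\<close>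

lemma
 assumes "LF C D F"
 shows lf_ob: "X:Ob C ==> omap F X:Ob D"
  and lf_ident: "X:Ob C ==> mmap F X X (Ident C X) = Ident D (omap F X)"
  and lf_hom: "X:Ob C ==> Y:Ob C ==> f:Hom C X Y ==>
   mmap F X Y f:Hom D (omap F X) (omap F Y)"
  and lf_add: "X:Ob C ==> Y:Ob C ==> f:Hom C X Y ==> g:Hom C X Y ==>
   mmap F X Y (Hadd C X Y f g) = Hadd D (omap F X) (omap F Y) (mmap F X Y f) (mmap F X Y g)"
  and lf_scale: "X:Ob C ==> Y:Ob C ==> f:Hom C X Y ==>
   mmap F X Y (Hscale C X Y c f) = Hscale D (omap F X) (omap F Y) c (mmap F X Y f)"
  and lf_comp: "X:Ob C ==> Y:Ob C ==> Z:Ob C ==> f:Hom C X Y ==> g:Hom C Y Z ==>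
   mmap F X Z (Comp C X Y Z g f) =
   Comp D (omap F X) (omap F Y) (omap F Z) (mmap F Y Z g) (mmap F X Y f)"
 using assms unfolding linear_functor_def by blast+

lemma
 assumes "et:nat_trans C D F G"
 shows nt_hom: "X:Ob C ==> et X:Hom D (omap F X) (omap G X)"
  and nt_nat: "X:Ob C ==> Y:Ob C ==> f:Hom C X Y ==>
   Comp D (omap F X) (omap F Y) (omap G Y) (et Y) (mmap F X Y f) =
   Comp D (omap F X) (omap G X) (omap G Y) (mmap G X Y f) (et X)"
  and nt_ext: "X~:Ob C ==> et X = undefined"
  and nt_restrict: "(\<lambda>X\<in>Ob C. et X) = et"
 using assms unfolding nat_trans_def by (auto simp: PiE_def extensional_def restrict_def)

lemma nt_restrI:
 assumes "!!X. X:Ob C ==> et X:Hom D (omap F X) (omap G X)"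
  and "!!X Y f. X:Ob C ==> Y:Ob C ==> f:Hom C X Y ==>
   Comp D (omap F X) (omap F Y) (omap G Y) (et Y) (mmap F X Y f) =
   Comp D (omap F X) (omap G X) (omap G Y) (mmap G X Y f) (et X)"
 shows "(\<lambda>X\<in>Ob C. et X):nat_trans C D F G"
 using assms unfolding nat_trans_def by auto

lemma nt_eqI:
 assumes "et:nat_trans C D F G" "th:nat_trans C D F' G'" "!!X. X:Ob C ==> et X = th X"
 shows "et = th"
 using assms(3) nt_ext[OF assms(1)] nt_ext[OF assms(2)] by (metis ext)

section \<open>Functor categories: linearity, biproducts and split idempotents, formed
  pointwise\<close>

context linear_category
begin

lemma functor_linear_category: "linear_category (functor_category B C)"
proof (rule linear_category.intro)
 let ?E = "functor_category B C"
 fix F G assume "F:Ob ?E" "G:Ob ?E"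
 then have F: "LF B C F" and G: "LF B C G" by (auto simp: functor_category_def)
 note s = lf_ob[OF F] lf_ob[OF G] lf_hom[OF F] lf_hom[OF G]
 note k = hom_space[OF lf_ob[OF F] lf_ob[OF G]]
 show "kspace (Hom ?E F G) (Hadd ?E F G) (Hscale ?E F G) (Hzero ?E F G)"
  unfolding functor_category_def lincat.simps
 proof (unfold_locales, goal_cases)
  case (1 x y)
  show ?case by (rule nt_restrI) (use nt_hom[OF 1(1)] nt_hom[OF 1(2)] nt_nat[OF 1(1)] nt_nat[OF 1(2)] in
   \<open>simp_all add: s distrib hs\<close>)
 next
  case (2 x y z)
  show ?case by (rule ext)
   (use nt_hom[OF 2(1)] nt_hom[OF 2(2)] nt_hom[OF 2(3)] s in "simp add: restrict_def hadd_assoc")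
 next
  case (3 x y)
  show ?case by (rule ext) (use nt_hom[OF 3(1)] nt_hom[OF 3(2)] s in "simp add: restrict_def hadd_comm")
 next
  case 4
  show ?case by (rule nt_restrI) (simp_all add: s hs)
 next
  case (5 x)
  show ?case by (rule ext) (use nt_hom[OF 5] nt_ext[OF 5] s in "simp add: restrict_def hs")
 next
  case (6 x c)
  show ?case by (rule nt_restrI) (use nt_hom[OF 6] nt_nat[OF 6] in "simp_all add: s distrib hs")
 next
  case (7 x y c)
  show ?case by (rule ext) (use nt_hom[OF 7(1)] nt_hom[OF 7(2)] s in "simp add: restrict_def hscale_add")
 next
  case (8 x c d)
  show ?case by (rule ext) (use nt_hom[OF 8(1)] s kspace.add_scl[OF k] in "simp add: restrict_def")
 next
  case (9 x c d)
  show ?case by (rule ext) (use nt_hom[OF 9(1)] s kspace.scl_scl[OF k] in "simp add: restrict_def")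
 next
  case (10 x)
  show ?case by (rule ext) (use nt_hom[OF 10(1)] nt_ext[OF 10(1)] s kspace.scl_one[OF k] in "simp add: restrict_def")
 next
  case (11 x)
  show ?case by (rule ext) (use nt_hom[OF 11(1)] s in "simp add: restrict_def hscale_0")
 qed
next
 let ?E = "functor_category B C"
 fix F assume "F:Ob ?E"
 then have F: "LF B C F" by (auto simp: functor_category_def)
 show "Ident ?E F:Hom ?E F F"
  using lf_ob[OF F] lf_hom[OF F] unfolding functor_category_def
  by (auto intro!: nt_restrI simp: hs)
next
 let ?E = "functor_category B C"
 fix F G H th et assume "F:Ob ?E" "G:Ob ?E" "H:Ob ?E" and "th:Hom ?E F G" "et:Hom ?E G H"
 then have F: "LF B C F" and G: "LF B C G" and H: "LF B C H"
  and t: "th:nat_trans B C F G" and e: "et:nat_trans B C G H" by (auto simp: functor_category_def)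
 note s = lf_ob[OF F] lf_ob[OF G] lf_ob[OF H] lf_hom[OF F] lf_hom[OF G] lf_hom[OF H] nt_hom[OF t] nt_hom[OF e]
 have "(\<lambda>X\<in>Ob B. Comp C (omap F X) (omap G X) (omap H X) (et X) (th X)):nat_trans B C F H"
 proof (rule nt_restrI)
  fix X Y f assume X: "X:Ob B" "Y:Ob B" "f:Hom B X Y"
  have "Comp C (omap F X) (omap F Y) (omap H Y) (Comp C (omap F Y) (omap G Y) (omap H Y) (et Y) (th Y)) (mmap F X Y f)
   = Comp C (omap F X) (omap G X) (omap H Y) (Comp C (omap G X) (omap G Y) (omap H Y) (et Y) (mmap G X Y f)) (th X)"
   using X nt_nat[OF t X] by (simp add: s ca)
  then show "Comp C (omap F X) (omap F Y) (omap H Y) (Comp C (omap F Y) (omap G Y) (omap H Y) (et Y) (th Y)) (mmap F X Y f) =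
   Comp C (omap F X) (omap H X) (omap H Y) (mmap H X Y f) (Comp C (omap F X) (omap G X) (omap H X) (et X) (th X))"
   using X nt_nat[OF e X] by (simp add: s ca)
 qed (simp add: s hs)
 then show "Comp ?E F G H et th:Hom ?E F H" by (simp add: functor_category_def)
next
 let ?E = "functor_category B C"
 fix F G H K th et ze assume "F:Ob ?E" "G:Ob ?E" "H:Ob ?E" "K:Ob ?E" "th:Hom ?E F G" "et:Hom ?E G H" "ze:Hom ?E H K"
 then have F: "LF B C F" "LF B C G" "LF B C H" "LF B C K"
  and t: "th:nat_trans B C F G" "et:nat_trans B C G H" "ze:nat_trans B C H K" by (auto simp: functor_category_def)
 note s = F[THEN lf_ob] t[THEN nt_hom]
 show "Comp ?E F G K (Comp ?E G H K ze et) th = Comp ?E F H K ze (Comp ?E F G H et th)"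
  unfolding functor_category_def lincat.simps by (rule ext) (simp add: restrict_def s ca)
next
 let ?E = "functor_category B C"
 fix F G th assume "F:Ob ?E" "G:Ob ?E" "th:Hom ?E F G"
 then have F: "LF B C F" "LF B C G"
  and t: "th:nat_trans B C F G" by (auto simp: functor_category_def)
 note s = F[THEN lf_ob] t[THEN nt_hom] t[THEN nt_ext]
 show "Comp ?E F G G (Ident ?E G) th = th" "Comp ?E F F G th (Ident ?E F) = th"
  unfolding functor_category_def lincat.simps
  by (rule ext, simp add: restrict_def s hs)+
next
 let ?E = "functor_category B C"
 fix F G H th et c assume "F:Ob ?E" "G:Ob ?E" "H:Ob ?E" "th:Hom ?E F G" "et:Hom ?E G H"
 then have F: "LF B C F" "LF B C G" "LF B C H"
  and t: "th:nat_trans B C F G" "et:nat_trans B C G H" by (auto simp: functor_category_def)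
 note s = F[THEN lf_ob] t[THEN nt_hom]
 show "Comp ?E F G H (Hscale ?E G H c et) th = Hscale ?E F H c (Comp ?E F G H et th)"
  "Comp ?E F G H et (Hscale ?E F G c th) = Hscale ?E F H c (Comp ?E F G H et th)"
  unfolding functor_category_def lincat.simps
  by (rule ext, simp add: restrict_def s distrib)+
 fix et' assume "et':Hom ?E G H"
 then have t': "et':nat_trans B C G H" by (auto simp: functor_category_def)
 show "Comp ?E F G H (Hadd ?E G H et et') th = Hadd ?E F H (Comp ?E F G H et th) (Comp ?E F G H et' th)"
  unfolding functor_category_def lincat.simps
  by (rule ext) (simp add: restrict_def s distrib nt_hom[OF t'])
next
 let ?E = "functor_category B C"
 fix F G H th th' et assume "F:Ob ?E" "G:Ob ?E" "H:Ob ?E" "th:Hom ?E F G" "th':Hom ?E F G" "et:Hom ?E G H"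
 then have F: "LF B C F" "LF B C G" "LF B C H"
  and t: "th:nat_trans B C F G" "th':nat_trans B C F G" "et:nat_trans B C G H" by (auto simp: functor_category_def)
 note s = F[THEN lf_ob] t[THEN nt_hom]
 show "Comp ?E F G H et (Hadd ?E F G th th') = Hadd ?E F H (Comp ?E F G H et th) (Comp ?E F G H et th')"
  unfolding functor_category_def lincat.simps
  by (rule ext) (simp add: restrict_def s distrib)
qed

lemma functor_has_biproducts:
 assumes "has_biproducts C"
 shows "has_biproducts (functor_category B C)"
 unfolding has_biproducts_def
proof (intro ballI)
 let ?E = "functor_category B C"
 fix F G assume "F:Ob ?E" "G:Ob ?E"
 then have F: "LF B C F" and G: "LF B C G" by (auto simp: functor_category_def)
 have "ALL X. EX Z i1 i2 p1 p2. X:Ob B-->binary_biproduct C (omap F X) (omap G X) Z i1 i2 p1 p2"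
  using assms lf_ob[OF F] lf_ob[OF G] unfolding has_biproducts_def by blast
 then obtain Z i1 i2 p1 p2 where
  "!!X. X:Ob B ==> binary_biproduct C (omap F X) (omap G X) (Z X) (i1 X) (i2 X) (p1 X) (p2 X)" by metis
 note b = this[unfolded binary_biproduct_def]
 note s = lf_ob[OF F] lf_ob[OF G] lf_hom[OF F] lf_hom[OF G]
 have p: "Comp C V (Z X) (omap F X) (p1 X) (Comp C V (omap F X) (Z X) (i1 X) f) = f"
  "Comp C V (Z X) (omap G X) (p2 X) (Comp C V (omap F X) (Z X) (i1 X) f) = Hzero C V (omap G X)"
  if "V:Ob C" "X:Ob B" "f:Hom C V (omap F X)" for V X f
  using b[OF that(2)] that s ca[of V "omap F X" "Z X" "omap F X" f "i1 X" "p1 X"]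
   ca[of V "omap F X" "Z X" "omap G X" f "i1 X" "p2 X"] by (auto simp: hs)
 have p': "Comp C V (Z X) (omap F X) (p1 X) (Comp C V (omap G X) (Z X) (i2 X) f) = Hzero C V (omap F X)"
  "Comp C V (Z X) (omap G X) (p2 X) (Comp C V (omap G X) (Z X) (i2 X) f) = f"
  if "V:Ob C" "X:Ob B" "f:Hom C V (omap G X)" for V X f
  using b[OF that(2)] that s ca[of V "omap G X" "Z X" "omap F X" f "i2 X" "p1 X"]
   ca[of V "omap G X" "Z X" "omap G X" f "i2 X" "p2 X"] by (auto simp: hs)
 \<comment> \<open>The biproducts are chosen independently at every object. \<open>a\<close> and
   \<open>c\<close> are the two diagonal blocks of the sum functor on \<open>f\<close>, written
   through the chosen inclusions and projections; mixed composites vanish by orthogonality.\<close>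
 define a where "a X Y f = Comp C (Z X) (omap F Y) (Z Y) (i1 Y) (Comp C (Z X) (omap F X) (omap F Y) (mmap F X Y f) (p1 X))"
  for X Y f
 define c where "c X Y f = Comp C (Z X) (omap G Y) (Z Y) (i2 Y) (Comp C (Z X) (omap G X) (omap G Y) (mmap G X Y f) (p2 X))"
  for X Y f
 define H where "H = \<lparr>omap = Z, mmap = (%X Y f. Hadd C (Z X) (Z Y) (a X Y f) (c X Y f))\<rparr>"
 have ac: "a X Y f:Hom C (Z X) (Z Y)" "c X Y f:Hom C (Z X) (Z Y)"
  if "X:Ob B" "Y:Ob B" "f:Hom B X Y" for X Y f
  using that b[OF that(1)] b[OF that(2)] by (auto simp: a_def c_def s hs)
 have H: "LF B C H"
  unfolding linear_functor_def
 proof (intro conjI ballI allI)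
  fix X assume X: "X:Ob B"
  show "omap H X:Ob C" using b[OF X] by (simp add: H_def)
  show "mmap H X X (Ident B X) = Ident C (omap H X)"
   using b[OF X] X by (simp add: H_def a_def c_def lf_ident[OF F] lf_ident[OF G] hs)
 next
  fix X Y f assume X: "X:Ob B" and Y: "Y:Ob B" and f: "f:Hom B X Y"
  note bb = b[OF X] b[OF Y]
  show "mmap H X Y f:Hom C (omap H X) (omap H Y)" using ac[OF X Y f] bb by (simp add: H_def hs)
  show "mmap H X Y (Hscale B X Y r f) = Hscale C (omap H X) (omap H Y) r (mmap H X Y f)" for r
   using X Y f bb ac[OF X Y f]
   by (simp add: H_def hscale_add a_def c_def lf_scale[OF F] lf_scale[OF G] distrib s hs)
  fix g assume g: "g:Hom B X Y"
  have "a X Y (Hadd B X Y f g) = Hadd C (Z X) (Z Y) (a X Y f) (a X Y g)"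
   "c X Y (Hadd B X Y f g) = Hadd C (Z X) (Z Y) (c X Y f) (c X Y g)"
   using X Y f g bb by (simp_all add: a_def c_def lf_add[OF F] lf_add[OF G] distrib s hs)
  then show "mmap H X Y (Hadd B X Y f g) = Hadd C (omap H X) (omap H Y) (mmap H X Y f) (mmap H X Y g)"
   using ac[OF X Y f] ac[OF X Y g] bb by (simp add: H_def hadd_assoc hadd_lcomm hs)
 next
  fix X Y f W g assume X: "X:Ob B" and Y: "Y:Ob B" and f: "f:Hom B X Y" and W: "W:Ob B" and g: "g:Hom B Y W"
  note bb = b[OF X] b[OF Y] b[OF W]
  have 1: "Comp C (Z X) (Z Y) (Z W) (a Y W g) (a X Y f) = a X W (Comp B X Y W g f)"
   "Comp C (Z X) (Z Y) (Z W) (a Y W g) (c X Y f) = Hzero C (Z X) (Z W)"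
   "Comp C (Z X) (Z Y) (Z W) (c Y W g) (a X Y f) = Hzero C (Z X) (Z W)"
   "Comp C (Z X) (Z Y) (Z W) (c Y W g) (c X Y f) = c X W (Comp B X Y W g f)"
   using X Y W f g bb
   by (simp_all add: a_def c_def lf_comp[OF F] lf_comp[OF G] ca s hs p p')
  have "Comp B X Y W g f:Hom B X W\<or>True" by simp
  have "a X W (Comp B X Y W g f):Hom C (Z X) (Z W)" "c X W (Comp B X Y W g f):Hom C (Z X) (Z W)"
   unfolding 1[symmetric] using ac[OF X Y f] ac[OF Y W g] bb by (auto simp: hs)
  then show "mmap H X W (Comp B X Y W g f) = Comp C (omap H X) (omap H Y) (omap H W) (mmap H Y W g) (mmap H X Y f)"
   using ac[OF X Y f] ac[OF Y W g] bb by (simp add: H_def distrib hs 1)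
 qed
 have n1: "(\<lambda>X\<in>Ob B. i1 X):nat_trans B C F H"
 proof (rule nt_restrI)
  fix X Y f assume X: "X:Ob B" and Y: "Y:Ob B" and f: "f:Hom B X Y"
  show "Comp C (omap F X) (omap F Y) (omap H Y) (i1 Y) (mmap F X Y f) =
   Comp C (omap F X) (omap H X) (omap H Y) (mmap H X Y f) (i1 X)"
   using X Y f b[OF X] b[OF Y] ac[OF X Y f] by (simp add: H_def distrib a_def c_def ca s hs)
 qed (use b in "simp add: H_def")
 have n2: "(\<lambda>X\<in>Ob B. i2 X):nat_trans B C G H"
 proof (rule nt_restrI)
  fix X Y f assume X: "X:Ob B" and Y: "Y:Ob B" and f: "f:Hom B X Y"
  show "Comp C (omap G X) (omap G Y) (omap H Y) (i2 Y) (mmap G X Y f) =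
   Comp C (omap G X) (omap H X) (omap H Y) (mmap H X Y f) (i2 X)"
   using X Y f b[OF X] b[OF Y] ac[OF X Y f] by (simp add: H_def distrib a_def c_def ca s hs)
 qed (use b in "simp add: H_def")
 have n3: "(\<lambda>X\<in>Ob B. p1 X):nat_trans B C H F"
 proof (rule nt_restrI)
  fix X Y f assume X: "X:Ob B" and Y: "Y:Ob B" and f: "f:Hom B X Y"
  show "Comp C (omap H X) (omap H Y) (omap F Y) (p1 Y) (mmap H X Y f) =
   Comp C (omap H X) (omap F X) (omap F Y) (mmap F X Y f) (p1 X)"
   using X Y f b[OF X] b[OF Y] ac[OF X Y f] by (simp add: H_def distrib a_def c_def p p' s hs)
 qed (use b in "simp add: H_def")
 have n4: "(\<lambda>X\<in>Ob B. p2 X):nat_trans B C H G"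
 proof (rule nt_restrI)
  fix X Y f assume X: "X:Ob B" and Y: "Y:Ob B" and f: "f:Hom B X Y"
  show "Comp C (omap H X) (omap H Y) (omap G Y) (p2 Y) (mmap H X Y f) =
   Comp C (omap H X) (omap G X) (omap G Y) (mmap G X Y f) (p2 X)"
   using X Y f b[OF X] b[OF Y] ac[OF X Y f] by (simp add: H_def distrib a_def c_def p p' s hs)
 qed (use b in "simp add: H_def")
 have "binary_biproduct ?E F G H (\<lambda>X\<in>Ob B. i1 X) (\<lambda>X\<in>Ob B. i2 X) (\<lambda>X\<in>Ob B. p1 X) (\<lambda>X\<in>Ob B. p2 X)"
  unfolding binary_biproduct_def
  using F G H n1 n2 n3 n4 b by (simp add: functor_category_def H_def fun_eq_iff restrict_def)
 then show "EX Z i1 i2 p1 p2. binary_biproduct ?E F G Z i1 i2 p1 p2" by blast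
qed

lemma functor_splits_idempotents:
 assumes "splits_idempotents C"
 shows "splits_idempotents (functor_category B C)"
 unfolding splits_idempotents_def
proof (intro ballI impI)
 let ?E = "functor_category B C"
 fix F e assume "F:Ob ?E" "e:Hom ?E F F" and ee: "Comp ?E F F F e e = e"
 then have F: "LF B C F" and e: "e:nat_trans B C F F" by (auto simp: functor_category_def)
 note s = lf_ob[OF F] lf_hom[OF F] nt_hom[OF e]
 have ee: "Comp C (omap F X) (omap F X) (omap F X) (e X) (e X) = e X" if "X:Ob B" for X
  using fun_cong[OF ee, of X] that by (simp add: functor_category_def)
 have "EX Z p i. X:Ob B-->Z:Ob C & p:Hom C (omap F X) Z & i:Hom C Z (omap F X) &
   Comp C Z (omap F X) Z p i = Ident C Z & Comp C (omap F X) Z (omap F X) i p = e X" for X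
 proof (cases "X:Ob B")
  case True
  from assms[unfolded splits_idempotents_def, rule_format, OF s(1) s(3) ee, OF True True True]
  show ?thesis by blast
 qed simp
 then obtain Z p i where b: "!!X. X:Ob B ==> Z X:Ob C & p X:Hom C (omap F X) (Z X) &
   i X:Hom C (Z X) (omap F X) & Comp C (Z X) (omap F X) (Z X) (p X) (i X) = Ident C (Z X) &
   Comp C (omap F X) (Z X) (omap F X) (i X) (p X) = e X" by metis
 have pe: "Comp C (omap F X) (omap F X) (Z X) (p X) (e X) = p X" if X: "X:Ob B" for X
  using b[OF X] X s ca[of "omap F X" "Z X" "omap F X" "Z X" "p X" "i X" "p X"] by (auto simp: hs)
 have ei: "Comp C (Z X) (omap F X) (omap F X) (e X) (i X) = i X" if X: "X:Ob B" for X
  using b[OF X] X s ca[of "Z X" "omap F X" "Z X" "omap F X" "i X" "p X" "i X"] by (auto simp: hs)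
 \<comment> \<open>The summand acts on \<open>f\<close> by the compression of F f with the
   splittings at X and Y. Naturality of \<open>e\<close> is what makes \<open>p\<close> and
   \<open>i\<close> natural.\<close>
 define m where "m X Y f = Comp C (Z X) (omap F Y) (Z Y) (p Y) (Comp C (Z X) (omap F X) (omap F Y) (mmap F X Y f) (i X))" for X Y f
 define H where "H = \<lparr>omap = Z, mmap = m\<rparr>"
 have pm: "Comp C (omap F X) (Z X) (Z Y) (m X Y f) (p X) = Comp C (omap F X) (omap F Y) (Z Y) (p Y) (mmap F X Y f)"
  and im: "Comp C (Z X) (Z Y) (omap F Y) (i Y) (m X Y f) = Comp C (Z X) (omap F X) (omap F Y) (mmap F X Y f) (i X)"
  if X: "X:Ob B" and Y: "Y:Ob B" and f: "f:Hom B X Y" for X Y f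
 proof -
  note bb = b[OF X] b[OF Y]
  have "Comp C (omap F X) (Z X) (Z Y) (m X Y f) (p X) =
   Comp C (omap F X) (omap F Y) (Z Y) (p Y) (Comp C (omap F X) (omap F X) (omap F Y) (mmap F X Y f) (e X))"
   using bb X Y f by (simp add: m_def ca s hs)
  also have "\<dots> = Comp C (omap F X) (omap F Y) (Z Y) (Comp C (omap F Y) (omap F Y) (Z Y) (p Y) (e Y)) (mmap F X Y f)"
   unfolding nt_nat[OF e X Y f, symmetric] using bb X Y f by (simp add: ca s)
  finally show "Comp C (omap F X) (Z X) (Z Y) (m X Y f) (p X) = Comp C (omap F X) (omap F Y) (Z Y) (p Y) (mmap F X Y f)"
   by (simp add: pe Y)
  have "Comp C (Z X) (Z Y) (omap F Y) (i Y) (m X Y f) =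
   Comp C (Z X) (omap F Y) (omap F Y) (Comp C (omap F Y) (Z Y) (omap F Y) (i Y) (p Y)) (Comp C (Z X) (omap F X) (omap F Y) (mmap F X Y f) (i X))"
   using bb X Y f unfolding m_def by (intro ca[symmetric]) (auto simp: s hs)
  also have "\<dots> = Comp C (Z X) (omap F X) (omap F Y) (Comp C (omap F X) (omap F Y) (omap F Y) (e Y) (mmap F X Y f)) (i X)"
   using bb X Y f by (simp add: ca s)
  also have "\<dots> = Comp C (Z X) (omap F X) (omap F Y) (mmap F X Y f) (Comp C (Z X) (omap F X) (omap F X) (e X) (i X))"
   unfolding nt_nat[OF e X Y f] using bb X Y f by (simp add: ca s)
  finally show "Comp C (Z X) (Z Y) (omap F Y) (i Y) (m X Y f) = Comp C (Z X) (omap F X) (omap F Y) (mmap F X Y f) (i X)"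
   by (simp add: ei X)
 qed
 have mh: "m X Y f:Hom C (Z X) (Z Y)" if "X:Ob B" "Y:Ob B" "f:Hom B X Y" for X Y f
  using that b[OF that(1)] b[OF that(2)] by (auto simp: m_def s hs)
 have H: "LF B C H"
  unfolding linear_functor_def
 proof (intro conjI ballI allI)
  fix X assume X: "X:Ob B"
  show "omap H X:Ob C" using b[OF X] by (simp add: H_def)
  show "mmap H X X (Ident B X) = Ident C (omap H X)"
   using b[OF X] X s by (simp add: H_def m_def lf_ident[OF F] hs)
 next
  fix X Y f assume X: "X:Ob B" and Y: "Y:Ob B" and f: "f:Hom B X Y"
  note bb = b[OF X] b[OF Y]
  show "mmap H X Y f:Hom C (omap H X) (omap H Y)" using mh[OF X Y f] by (simp add: H_def)
  show "mmap H X Y (Hscale B X Y r f) = Hscale C (omap H X) (omap H Y) r (mmap H X Y f)" for r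
   using X Y f bb by (simp add: H_def m_def lf_scale[OF F] distrib s hs)
  fix g assume g: "g:Hom B X Y"
  show "mmap H X Y (Hadd B X Y f g) = Hadd C (omap H X) (omap H Y) (mmap H X Y f) (mmap H X Y g)"
   using X Y f g bb by (simp add: H_def m_def lf_add[OF F] distrib s hs)
 next
  fix X Y f W g assume X: "X:Ob B" and Y: "Y:Ob B" and f: "f:Hom B X Y" and W: "W:Ob B" and g: "g:Hom B Y W"
  note bb = b[OF X] b[OF Y] b[OF W]
  have "Comp C (Z X) (Z Y) (Z W) (m Y W g) (m X Y f) =
   Comp C (Z X) (omap F W) (Z W) (p W) (Comp C (Z X) (omap F Y) (omap F W) (mmap F Y W g) (Comp C (Z X) (Z Y) (omap F Y) (i Y) (m X Y f)))"
   using X Y W f g bb mh[OF X Y f] by (simp add: m_def[of Y W g] ca s hs)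
  also have "\<dots> = m X W (Comp B X Y W g f)"
   unfolding im[OF X Y f] using X Y W f g bb by (simp add: m_def lf_comp[OF F] ca s hs)
  finally show "mmap H X W (Comp B X Y W g f) = Comp C (omap H X) (omap H Y) (omap H W) (mmap H Y W g) (mmap H X Y f)"
   by (simp add: H_def)
 qed
 have n1: "(\<lambda>X\<in>Ob B. p X):nat_trans B C F H"
  by (rule nt_restrI) (use b pm in "simp_all add: H_def")
 have n2: "(\<lambda>X\<in>Ob B. i X):nat_trans B C H F"
  by (rule nt_restrI) (use b im in "simp_all add: H_def")
 show "EX Y:Ob ?E. EX p:Hom ?E F Y. EX s:Hom ?E Y F.
   Comp ?E Y F Y p s = Ident ?E Y & Comp ?E F Y F s p = e"
  using H n1 n2 b nt_ext[OF e]
  by (intro bexI[of _ H] bexI[of _ "\<lambda>X\<in>Ob B. p X"] bexI[of _ "\<lambda>X\<in>Ob B. i X"])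
   (simp_all add: functor_category_def H_def fun_eq_iff restrict_def)
qed

end

section \<open>Matrices and modules as linear categories\<close>

definition mat_category :: "(nat, 'k::field mat, 'k) lincat" where
 "mat_category = \<lparr>Ob = UNIV, Hom = (%n m. CM m n), Comp = (%_ _ _ g f. g * f),
   Ident = 1\<^sub>m, Hzero = (%n m. 0\<^sub>m m n), Hadd = (%_ _ f g. f + g), Hscale = (%_ _ c f. c \<cdot>\<^sub>m f)\<rparr>"

lemma smult_mat_zero: "A:CM n m ==> (0 :: 'k::field) \<cdot>\<^sub>m A = 0\<^sub>m n m"
 by auto

lemma kspace_mat: "kspace (CM n m) (+) (\<cdot>\<^sub>m) (0\<^sub>m n m :: 'k::field mat)"
 by unfold_locales (auto simp: algebra_simps)

interpretation Mat: linear_category mat_category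
proof (rule linear_category.intro)
 show "kspace (Hom mat_category X Y) (Hadd mat_category X Y) (Hscale mat_category X Y)
  (Hzero mat_category X Y :: 'k::field mat)" for X Y
  using kspace_mat[of Y X] by (simp add: mat_category_def)
qed (auto simp: mat_category_def add_mult_distrib_mat mult_add_distrib_mat mult_smult_assoc_mat
  mult_smult_distrib)

lemma vec_diff_zero: "u:CV k ==> v:CV k ==> u - v = 0\<^sub>v k\<longleftrightarrow>u = (v :: 'k::field vec)"
 by (auto simp: vec_eq_iff)

text \<open>The image of \<open>e\<close> is realized as the quotient of the space by the kernel of
  \<open>e\<close>. For the projection P and its section S one has P e = P and e S P = e, so P and e
  S split \<open>e\<close>.\<close>

lemma mat_splits_idempotents: "splits_idempotents (mat_category :: (nat, 'k::field mat, 'k) lincat)"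
 unfolding splits_idempotents_def
proof (intro ballI impI)
 fix n and e :: "'k mat"
 assume "e:Hom mat_category n n" "Comp mat_category n n n e e = e"
 then have e: "e:CM n n" "e * e = e" by (auto simp: mat_category_def)
 interpret V: kspace "CV n" "(+)" "(\<cdot>\<^sub>v)" "0\<^sub>v n :: 'k vec" by (rule kspace_vec)
 define W where "W = {x:CV n. e *v x = 0\<^sub>v n}"
 have "V.subsp W" using e unfolding V.subsp_def W_def
  by (auto simp: mult_add_distrib_mat_vec mult_mat_vec)
 then obtain m P S where P: "P:CM m n" "S:CM n m" "P * S = 1\<^sub>m m"
  and ker: "ALL x:CV n. P *v x = 0\<^sub>v m\<longleftrightarrow>x:W" using vec_quotient by blast
 have diff: "M *v (x - y) = 0\<^sub>v k\<longleftrightarrow>M *v x = M *v y" if "M:CM k n" "x:CV n" "y:CV n"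
  for M :: "'k mat" and k x y
 proof -
  have "M *v (x - y) = M *v x - M *v y" using that by (simp add: mult_minus_distrib_mat_vec)
  moreover have "M *v x:CV k" "M *v y:CV k" using that by auto
  ultimately show ?thesis using vec_diff_zero by metis
 qed
 have Pe: "P * e = P"
 proof (rule mat_eq_by_vecs)
  fix x :: "'k vec" assume x: "x:CV n"
  have "e *v (e *v x) = e *v x" using e x by (metis assoc_mult_mat_vec)
  then have "e *v x - x:W" using diff[OF e(1), of "e *v x" x] e x by (auto simp: W_def)
  then have "P *v (e *v x) = P *v x" using ker diff[OF P(1), of "e *v x" x] e x by (auto simp: W_def)
  then show "(P * e) *v x = P *v x" using P e x by simp
 qed (use P e in auto)
 have eSP: "e * S * P = e"
 proof (rule mat_eq_by_vecs)
  fix x :: "'k vec" assume x: "x:CV n"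
  have "(P * S) *v (P *v x) = P *v (S *v (P *v x))"
   using P x by (intro assoc_mult_mat_vec) auto
  then have "P *v (S *v (P *v x)) = P *v x" unfolding P(3) using P(1) x by simp
  then have "S *v (P *v x) - x:W" using ker diff[OF P(1), of "S *v (P *v x)" x] P x by auto
  then have "e *v (S *v (P *v x)) = e *v x" using diff[OF e(1), of "S *v (P *v x)" x] P x by (auto simp: W_def)
  moreover have "(e * S * P) *v x = (e * S) *v (P *v x)"
   using P e x by (intro assoc_mult_mat_vec) auto
  moreover have "(e * S) *v (P *v x) = e *v (S *v (P *v x))"
   using P e x by (intro assoc_mult_mat_vec) auto
  ultimately show "(e * S * P) *v x = e *v x" by (simp only:)
 qed (use P e in auto)
 have "P * (e * S) = 1\<^sub>m m" using P e Pe by (metis assoc_mult_mat)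
 then show "EX Y:Ob mat_category. EX p:Hom mat_category n Y. EX s:Hom mat_category Y n.
   Comp mat_category Y n Y p s = Ident mat_category Y & Comp mat_category n Y n s p = e"
  using P e eSP by (intro bexI[of _ m] bexI[of _ P] bexI[of _ "e * S"]) (auto simp: mat_category_def)
qed

lemma mat_has_biproducts: "has_biproducts (mat_category :: (nat, 'k::field mat, 'k) lincat)"
 unfolding has_biproducts_def
proof (intro ballI)
 fix n m :: nat
 define i1 i2 p1 p2 :: "'k mat"
  where "i1 = mat (n + m) n (%(i, j). if i = j then 1 else 0)"
   and "i2 = mat (n + m) m (%(i, j). if i = n + j then 1 else 0)"
   and "p1 = mat n (n + m) (%(i, j). if i = j then 1 else 0)"
   and "p2 = mat m (n + m) (%(i, j). if j = n + i then 1 else 0)"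
 note d = i1_def i2_def p1_def p2_def
 have "p1 * i1 = 1\<^sub>m n"
 proof (rule eq_matI)
  fix i j assume "i < dim_row (1\<^sub>m n :: 'k mat)" "j < dim_col (1\<^sub>m n :: 'k mat)"
  then have ij: "i < n" "j < n" by auto
  have "(p1 * i1) $$ (i, j) = (\<Sum>k<n + m. if k = i then (if i = j then 1 else 0) else 0)"
   using ij by (auto simp: d scalar_prod_def lessThan_atLeast0 simp del: sum.delta sum.delta' intro!: sum.cong)
  then show "(p1 * i1) $$ (i, j) = 1\<^sub>m n $$ (i, j)" using ij by (subst (asm) sum.delta) auto
 qed (auto simp: d)
 moreover have "p2 * i2 = 1\<^sub>m m"
 proof (rule eq_matI)
  fix i j assume "i < dim_row (1\<^sub>m m :: 'k mat)" "j < dim_col (1\<^sub>m m :: 'k mat)"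
  then have ij: "i < m" "j < m" by auto
  have "(p2 * i2) $$ (i, j) = (\<Sum>k<n + m. if k = n + i then (if i = j then 1 else 0) else 0)"
   using ij by (auto simp: d scalar_prod_def lessThan_atLeast0 simp del: sum.delta sum.delta' intro!: sum.cong)
  then show "(p2 * i2) $$ (i, j) = 1\<^sub>m m $$ (i, j)" using ij by (subst (asm) sum.delta) auto
 qed (auto simp: d)
 moreover have "p2 * i1 = 0\<^sub>m m n" by (auto simp: d scalar_prod_def intro!: sum.neutral)
 moreover have "p1 * i2 = 0\<^sub>m n m" by (auto simp: d scalar_prod_def intro!: sum.neutral)
 moreover have "i1 * p1 + i2 * p2 = 1\<^sub>m (n + m)"
 proof (rule eq_matI)
  fix i j assume "i < dim_row (1\<^sub>m (n + m) :: 'k mat)" "j < dim_col (1\<^sub>m (n + m) :: 'k mat)"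
  then have ij: "i < n + m" "j < n + m" by auto
  have "(i1 * p1) $$ (i, j) = (\<Sum>k<n. if k = i then (if i = j then 1 else 0) else 0)"
   using ij by (auto simp: d scalar_prod_def lessThan_atLeast0 simp del: sum.delta sum.delta' intro!: sum.cong)
  also have "\<dots> = (if i < n then (if i = j then 1 else 0) else 0)" by (subst sum.delta) auto
  finally have 1: "(i1 * p1) $$ (i, j) = (if i < n then (if i = j then 1 else 0) else 0)" .
  have "(i2 * p2) $$ (i, j) = (\<Sum>k<m. if k = i - n then (if i = j & n\<le>i then 1 else 0) else 0)"
   using ij by (auto simp: d scalar_prod_def lessThan_atLeast0 simp del: sum.delta sum.delta' intro!: sum.cong)
  also have "\<dots> = (if i - n < m then (if i = j & n\<le>i then 1 else 0) else 0)" by (subst sum.delta) auto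
  finally have 2: "(i2 * p2) $$ (i, j) = (if i - n < m then (if i = j & n\<le>i then 1 else 0) else 0)" .
  have "i2 * p2:CM (n + m) (n + m)" by (auto simp: d)
  then show "(i1 * p1 + i2 * p2) $$ (i, j) = 1\<^sub>m (n + m) $$ (i, j)"
   using 1 2 ij by (subst index_add_mat(1)) auto
 qed (auto simp: d)
 ultimately have "binary_biproduct mat_category n m (n + m) i1 i2 p1 p2"
  by (auto simp: binary_biproduct_def mat_category_def d)
 then show "EX Z i1 i2 p1 p2. binary_biproduct (mat_category :: (nat, 'k mat, 'k) lincat) n m Z i1 i2 p1 p2" by blast
qed

lemma module_linear_category: "linear_category (MC (R :: ('k::field, 'a) module))"
proof (rule linear_category.intro)
 fix X Y assume "X:Ob (MC R)" "Y:Ob (MC R)"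
 then obtain n rx m si where X: "X = (n, rx)" "Y = (m, si)" and r: "ALL a:carrier R. rx a:CM n n"
  "ALL a:carrier R. si a:CM m m"
  by (cases X; cases Y) (auto simp: module_category_def module_structure_def)
 interpret M: kspace "CM m n" "(+)" "(\<cdot>\<^sub>m)" "0\<^sub>m m n :: 'k mat" by (rule kspace_mat)
 have "M.subsp {f:CM m n. ALL a:carrier R. f * rx a = si a * f}"
  unfolding M.subsp_def
 proof (intro conjI ballI allI)
  have "0\<^sub>m m n * rx a = si a * 0\<^sub>m m n" if "a:carrier R" for a
   using r that left_mult_zero_mat[of "rx a" n n m] right_mult_zero_mat[of "si a" m m n] by simp
  then show "0\<^sub>m m n:{f:CM m n. ALL a:carrier R. f * rx a = si a * f}" by simp
  fix x assume x: "x:{f:CM m n. ALL a:carrier R. f * rx a = si a * f}"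
  have "(c \<cdot>\<^sub>m x) * rx a = si a * (c \<cdot>\<^sub>m x)" if "a:carrier R" for a c
   using r that x mult_smult_assoc_mat[of x m n "rx a" n c] mult_smult_distrib[of "si a" m m x n c] by simp
  then show "c \<cdot>\<^sub>m x:{f:CM m n. ALL a:carrier R. f * rx a = si a * f}" for c using x by simp
  fix y assume y: "y:{f:CM m n. ALL a:carrier R. f * rx a = si a * f}"
  have "(x + y) * rx a = si a * (x + y)" if "a:carrier R" for a
   using r that x y add_mult_distrib_mat[of x m n y "rx a" n] mult_add_distrib_mat[of "si a" m m x n y] by simp
  then show "x + y:{f:CM m n. ALL a:carrier R. f * rx a = si a * f}" using x y by simp
 qed auto
 from M.kspace_subsp[OF this] show "kspace (Hom (MC R) X Y) (Hadd (MC R) X Y)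
   (Hscale (MC R) X Y) (Hzero (MC R) X Y)"
  by (simp add: module_category_def X)
next
 fix X Y Z f g assume "X:Ob (MC R)" "Y:Ob (MC R)" "Z:Ob (MC R)"
  "f:Hom (MC R) X Y" "g:Hom (MC R) Y Z"
 then obtain n rx m si l ta where X: "X = (n, rx)" "Y = (m, si)" "Z = (l, ta)" and r: "ALL a:carrier R. rx a:CM n n"
  "ALL a:carrier R. si a:CM m m" "ALL a:carrier R. ta a:CM l l"
  and f: "f:CM m n" "ALL a:carrier R. f * rx a = si a * f"
  and g: "g:CM l m" "ALL a:carrier R. g * si a = ta a * g"
  by (cases X; cases Y; cases Z) (auto simp: module_category_def module_structure_def)
 have "g * f * rx a = ta a * (g * f)" if "a:carrier R" for a
  using that r f g assoc_mult_mat[of g l m f n "rx a" n] assoc_mult_mat[of g l m "si a" m f n]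
   assoc_mult_mat[of "ta a" l l g m f n] by simp
 then show "Comp (MC R) X Y Z g f:Hom (MC R) X Z"
  using f g by (auto simp: module_category_def X)
qed (auto simp: module_category_def module_structure_def add_mult_distrib_mat mult_add_distrib_mat
  mult_smult_assoc_mat mult_smult_distrib)

text \<open>A module is a linear functor on the algebra, regarded as a category with one object.\<close>

definition one_object_category :: "('k, 'a) module=>(unit, 'a, 'k) lincat" where
 "one_object_category R = \<lparr>Ob = UNIV, Hom = (%_ _. carrier R), Comp = (%_ _ _. monoid.mult R),
   Ident = (%_. one R), Hzero = (%_ _. zero R), Hadd = (%_ _. add R), Hscale = (%_ _. smult R)\<rparr>"

lemma module_as_functor:
 "MS R n rx \<longleftrightarrow>
  LF (one_object_category R) mat_category \<lparr>omap = (%_. n), mmap = (%_ _. rx)\<rparr>"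
 "LF (one_object_category R) mat_category F ==> MS R (omap F ()) (mmap F () ())"
 by (auto simp: linear_functor_def module_structure_def one_object_category_def mat_category_def)

text \<open>A transformation of functors on a single object is one intertwining matrix, so the
  biproduct of the functor category, evaluated at \<open>()\<close>, is a biproduct of
  modules.\<close>

lemma module_has_biproducts: "has_biproducts (MC (R :: ('k::field, 'a) module))"
 unfolding has_biproducts_def
proof (intro ballI)
 let ?E = "functor_category (one_object_category R) (mat_category :: (nat, 'k mat, 'k) lincat)"
 fix X Y assume "X:Ob (MC R)" "Y:Ob (MC R)"
 then obtain n rx m si where X: "X = (n, rx)" "Y = (m, si)" "MS R n rx" "MS R m si"
  by (cases X; cases Y) (auto simp: module_category_def)
 let ?F = "\<lparr>omap = (%_. n), mmap = (%_ _. rx)\<rparr>" and ?G = "\<lparr>omap = (%_. m), mmap = (%_ _. si)\<rparr>"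
 have "?F:Ob ?E" "?G:Ob ?E" using X module_as_functor(1) by (auto simp: functor_category_def)
 then obtain H i1 i2 p1 p2 where b: "binary_biproduct ?E ?F ?G H i1 i2 p1 p2"
  using Mat.functor_has_biproducts[OF mat_has_biproducts] unfolding has_biproducts_def by blast
 then have H: "MS R (omap H ()) (mmap H () ())"
  by (intro module_as_functor(2)) (auto simp: binary_biproduct_def functor_category_def)
 have "binary_biproduct (MC R) X Y (omap H (), mmap H () ()) (i1 ()) (i2 ()) (p1 ()) (p2 ())"
  using b H X unfolding binary_biproduct_def
  by (auto simp: module_category_def functor_category_def nat_trans_def mat_category_def
    one_object_category_def fun_eq_iff)
 then show "EX Z i1 i2 p1 p2. binary_biproduct (MC R) X Y Z i1 i2 p1 p2" by blast
qed

lemma module_splits_idempotents: "splits_idempotents (MC (R :: ('k::field, 'a) module))"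
 unfolding splits_idempotents_def
proof (intro ballI impI)
 let ?E = "functor_category (one_object_category R) (mat_category :: (nat, 'k mat, 'k) lincat)"
 fix X e assume "X:Ob (MC R)" and e: "e:Hom (MC R) X X"
  "Comp (MC R) X X X e e = e"
 then obtain n rx where X: "X = (n, rx)" "MS R n rx"
  by (cases X) (auto simp: module_category_def)
 let ?F = "\<lparr>omap = (%_. n), mmap = (%_ _. rx)\<rparr>"
 have F: "?F:Ob ?E" using X module_as_functor(1) by (auto simp: functor_category_def)
 have "(%_. e):Hom ?E ?F ?F" "Comp ?E ?F ?F ?F (%_. e) (%_. e) = (%_. e)"
  using e X by (auto simp: module_category_def functor_category_def nat_trans_def mat_category_def
    one_object_category_def)
 then obtain H p s where H: "H:Ob ?E" "p:Hom ?E ?F H" "s:Hom ?E H ?F"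
  "Comp ?E H ?F H p s = Ident ?E H" "Comp ?E ?F H ?F s p = (%_. e)"
  using Mat.functor_splits_idempotents[OF mat_splits_idempotents] F unfolding splits_idempotents_def by meson
 have "MS R (omap H ()) (mmap H () ())"
  using H by (intro module_as_functor(2)) (auto simp: functor_category_def)
 then show "EX Y:Ob (MC R). EX p:Hom (MC R) X Y. EX s:Hom (MC R) Y X.
   Comp (MC R) Y X Y p s = Ident (MC R) Y &
   Comp (MC R) X Y X s p = e"
  using H X
  by (intro bexI[of _ "(omap H (), mmap H () ())"] bexI[of _ "p ()"] bexI[of _ "s ()"])
   (auto simp: module_category_def functor_category_def nat_trans_def mat_category_def
    one_object_category_def fun_eq_iff)
qed

section \<open>The abelianization of a category with an additive generator\<close>

lemma smult_mat_vec:
 "A:CM n m ==> x:CV m ==> (c \<cdot>\<^sub>m A) *v x = c .*v (A *v (x :: 'k::field vec))"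
 by (rule eq_vecI) (auto simp: scalar_prod_def sum_distrib_left mult.assoc)

lemma image_eq_singleton: "a:A ==> (!!x. x:A ==> f x = c) ==> f ` A = {c}"
 by auto

lemma (in kspace) fin_over_trans:
 assumes "fin_over W V" "fin_over U W"
 shows "fin_over U V"
 using assms(1) by induction (use assms(2) fin_over.step in auto)

text \<open>T is an additive generator: the identity of every object factors through T. The
  bijection \<open>u\<close> reverses composition, so R is the opposite of the endomorphism ring of
  T, and the spaces Hom(T, Y), with endomorphisms acting by precomposition, become left
  R-modules.\<close>

locale morita = linear_category C for C :: "('o, 'm, 'k::field) lincat" +
 fixes T :: 'o and R :: "('k, 'a) module" and u :: "'m=>'a"
 assumes T: "T:Ob C"
  and u_bij: "bij_betw u (Hom C T T) (carrier R)"
  and u_add: "f:Hom C T T ==> g:Hom C T T ==> u (Hadd C T T f g) = u f\<oplus>\<^bsub>R\<^esub>u g"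
  and u_scale: "f:Hom C T T ==> u (Hscale C T T c f) = c\<odot>\<^bsub>R\<^esub>u f"
  and u_comp: "f:Hom C T T ==> g:Hom C T T ==> u (Comp C T T T f g) = u g\<otimes>\<^bsub>R\<^esub>u f"
  and u_ident: "u (Ident C T) = \<one>\<^bsub>R\<^esub>"
  and factors_T: "Y:Ob C ==> factors C {T} Y Y (Ident C Y)"
  and biproducts: "has_biproducts C"
  and zero_ob: "EX Z. zero_object C Z"
  and fin_end: "kspace.fin_over (Hom C T T) (Hadd C T T) (Hscale C T T) {Hzero C T T} (Hom C T T)"
begin

definition v :: "'a=>'m" where "v = inv_into (Hom C T T) u"

lemma v_hom: "a:carrier R ==> v a:Hom C T T"
 using bij_betw_apply[OF bij_betw_inv_into[OF u_bij]] by (simp add: v_def)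

lemma u_v: "a:carrier R ==> u (v a) = a"
 using bij_betw_inv_into_right[OF u_bij] by (simp add: v_def)

lemma v_u: "f:Hom C T T ==> v (u f) = f"
 using bij_betw_inv_into_left[OF u_bij] by (simp add: v_def)

lemma u_closed: "f:Hom C T T ==> u f:carrier R"
 using bij_betw_apply[OF u_bij] .

lemma v_add: "a:carrier R ==> b:carrier R ==> v (a\<oplus>\<^bsub>R\<^esub>b) = Hadd C T T (v a) (v b)"
 using v_u[of "Hadd C T T (v a) (v b)"] T by (simp add: u_add v_hom u_v hs)

lemma v_mult: "a:carrier R ==> b:carrier R ==> v (a\<otimes>\<^bsub>R\<^esub>b) = Comp C T T T (v b) (v a)"
 using v_u[of "Comp C T T T (v b) (v a)"] T by (simp add: u_comp v_hom u_v hs)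

lemma v_scale: "a:carrier R ==> v (c\<odot>\<^bsub>R\<^esub>a) = Hscale C T T c (v a)"
 using v_u[of "Hscale C T T c (v a)"] T by (simp add: u_scale v_hom u_v hs)

lemma v_one: "v \<one>\<^bsub>R\<^esub> = Ident C T"
 using v_u[of "Ident C T"] T by (simp add: u_ident hs)

text \<open>The laws of \<open>module_structure\<close> speak of zero only indirectly; the zero
  morphism is 0 times itself.\<close>

lemma u_zero_module: "MS R n rx ==> rx (u (Hzero C T T)) = 0\<^sub>m n n"
proof -
 assume m: "MS R n rx"
 have z: "Hzero C T T:Hom C T T" using T by (simp add: hs)
 have "u (Hzero C T T) = 0\<odot>\<^bsub>R\<^esub>u (Hzero C T T)"
  using u_scale[OF z, of 0] T by (simp add: hscale_zero)
 then have "rx (u (Hzero C T T)) = 0 \<cdot>\<^sub>m rx (u (Hzero C T T))"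
  using m u_closed[OF z] unfolding module_structure_def by metis
 moreover have "rx (u (Hzero C T T)):CM n n" using m u_closed[OF z] by (auto simp: module_structure_def)
 ultimately show ?thesis using smult_mat_zero by metis
qed

lemma spaceT: "Y:Ob C ==> kspace (Hom C T Y) (Hadd C T Y) (Hscale C T Y) (Hzero C T Y)"
 by (rule hom_space[OF T])

lemma post_subsp:
 assumes X: "X:Ob C" "Y:Ob C" "ax:Hom C X Y"
 shows "kspace.subsp (Hom C T Y) (Hadd C T Y) (Hscale C T Y) (Hzero C T Y) (Comp C T X Y ax ` Hom C T X)"
proof -
 interpret K: kspace "Hom C T Y" "Hadd C T Y" "Hscale C T Y" "Hzero C T Y" by (rule spaceT[OF X(2)])
 show ?thesis
  unfolding K.subsp_def
 proof (intro conjI ballI allI)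
  show "Comp C T X Y ax ` Hom C T X<=Hom C T Y" using X T by (auto simp: hs)
  have "Hzero C T Y = Comp C T X Y ax (Hzero C T X)" using X T by (simp add: hs)
  then show "Hzero C T Y:Comp C T X Y ax ` Hom C T X" using zero_hom[OF T X(1)] by blast
  fix x assume "x:Comp C T X Y ax ` Hom C T X"
  then obtain a where a: "a:Hom C T X" "x = Comp C T X Y ax a" by blast
  have "Hscale C T Y c x = Comp C T X Y ax (Hscale C T X c a)" for c
   using a X T by (simp add: distrib)
  then show "Hscale C T Y c x:Comp C T X Y ax ` Hom C T X" for c using a X T by (auto simp: hs)
  fix y assume "y:Comp C T X Y ax ` Hom C T X"
  then obtain b where b: "b:Hom C T X" "y = Comp C T X Y ax b" by blast
  have "Hadd C T Y x y = Comp C T X Y ax (Hadd C T X a b)"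
   using a b X T by (simp add: distrib)
  then show "Hadd C T Y x y:Comp C T X Y ax ` Hom C T X" using a b X T by (auto simp: hs)
 qed
qed

text \<open>A factorization of the identity of Y through T places Hom(T, Y) inside a finite sum of
  images of the endomorphism ring of T, which is finite dimensional.\<close>

lemma fin_hom:
 assumes Y: "Y:Ob C"
 shows "kspace.fin_over (Hom C T Y) (Hadd C T Y) (Hscale C T Y) {Hzero C T Y} (Hom C T Y)"
proof -
 interpret K: kspace "Hom C T Y" "Hadd C T Y" "Hscale C T Y" "Hzero C T Y" by (rule spaceT[OF Y])
 have "K.fin_over {Hzero C T Y} (Comp C T Y Y r ` Hom C T Y)" if "factors C {T} Y Y r" for r
  using that
 proof induction
  case zero
  have "Comp C T Y Y (Hzero C Y Y) ` Hom C T Y = {Hzero C T Y}"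
   by (rule image_eq_singleton[OF zero_hom[OF T Y]]) (use Y T in "simp add: hs")
  then show ?case using K.fin_over.base by simp
 next
  case (step r s f g)
  then have f: "f:Hom C Y T" and g: "g:Hom C T Y" and s: "s = T" by auto
  have r: "r:Hom C Y Y" using factors_hom[OF _ step.hyps(1) Y Y] T by simp
  have sub: "K.subsp (Comp C T Y Y r ` Hom C T Y)" by (rule post_subsp[OF Y Y r])
  have "K.fin_over {Hzero C T Y} (Comp C T T Y g ` Hom C T T)"
   by (rule fin_over_image[OF spaceT[OF T] spaceT[OF Y] _ _ _ fin_end])
    (use T Y g in "auto simp: hs distrib")
  from K.fin_over_trans[OF K.fin_over_sum[OF this sub] step.IH]
  have fin: "K.fin_over {Hzero C T Y} {Hadd C T Y w x |w x. w:Comp C T Y Y r ` Hom C T Y & x:Comp C T T Y g ` Hom C T T}" .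
  let ?r = "Hadd C Y Y r (Comp C Y s Y g f)"
  have rh: "?r:Hom C Y Y" using r f g s T Y by (simp add: hs)
  have "Comp C T Y Y ?r y = Hadd C T Y (Comp C T Y Y r y) (Comp C T T Y g (Comp C T Y T f y))"
   if "y:Hom C T Y" for y using that r f g s T Y by (simp add: hs distrib ca)
  then have "Comp C T Y Y ?r ` Hom C T Y <=
   {Hadd C T Y w x |w x. w:Comp C T Y Y r ` Hom C T Y & x:Comp C T T Y g ` Hom C T T}"
   using f T Y by (auto simp: hs intro!: exI imageI)
  from K.fin_over_subspace[OF fin post_subsp[OF Y Y rh] this] show ?case .
 qed
 from this[OF factors_T[OF Y]] have "K.fin_over {Hzero C T Y} (Comp C T Y Y (Ident C Y) ` Hom C T Y)" .
 moreover have "Comp C T Y Y (Ident C Y) ` Hom C T Y = Hom C T Y"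
  using Y T by (auto simp: hs image_iff)
 ultimately show ?thesis by simp
qed

definition equivariant :: "'o=>nat=>('a=>'k mat)=>('m=>'k vec)=>bool" where
 "equivariant Y n rx q\<longleftrightarrow>vlin (Hom C T Y) (Hadd C T Y) (Hscale C T Y) n q &
   (ALL y:Hom C T Y. ALL f:Hom C T T. q (Comp C T T Y y f) = rx (u f) *v q y)"

lemma
 assumes "equivariant Y n rx q"
 shows eqv_carrier: "y:Hom C T Y ==> q y:CV n"
  and eqv_add: "y:Hom C T Y ==> y':Hom C T Y ==> q (Hadd C T Y y y') = q y + q y'"
  and eqv_scale: "y:Hom C T Y ==> q (Hscale C T Y c y) = c .*v q y"
  and eqv_act: "y:Hom C T Y ==> f:Hom C T T ==> q (Comp C T T Y y f) = rx (u f) *v q y"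
  and eqv_vlin: "vlin (Hom C T Y) (Hadd C T Y) (Hscale C T Y) n q"
 using assms by (auto simp: equivariant_def vlin_def)

lemma eqv_zero: "equivariant Y n rx q ==> Y:Ob C ==> q (Hzero C T Y) = 0\<^sub>v n"
 using kspace.vlin_zero[OF spaceT eqv_vlin] .

text \<open>The module laws are tested on the vectors \<open>q y\<close>, where they turn into laws
  of composition in the category. As \<open>q\<close> is onto, this determines the matrices.\<close>

lemma module_structureI:
 assumes rx: "!!a. a:carrier R ==> rx a:CM n n" and Y: "Y:Ob C"
  and q: "vlin (Hom C T Y) (Hadd C T Y) (Hscale C T Y) n q" "q ` Hom C T Y = CV n"
  and act: "!!y a. y:Hom C T Y ==> a:carrier R ==> rx a *v q y = q (Comp C T T Y y (v a))"
 shows "MS R n rx"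
proof -
 have eqI: "M = N" if "M:CM n n" "N:CM n n" "!!y. y:Hom C T Y ==> M *v q y = N *v q y"
  for M N
 proof (rule mat_eq_by_vecs[OF that(1,2)])
  fix x :: "'k vec" assume "x:CV n"
  then have "x:q ` Hom C T Y" using q(2) by simp
  then show "M *v x = N *v x" using that(3) by blast
 qed
 have qc: "q y:CV n" if "y:Hom C T Y" for y using q(1) that by (auto simp: vlin_def)
 have qadd: "q (Hadd C T Y y y') = q y + q y'" if "y:Hom C T Y" "y':Hom C T Y" for y y'
  using q(1) that by (auto simp: vlin_def)
 have qs: "q (Hscale C T Y c y) = c .*v q y" if "y:Hom C T Y" for y c
  using q(1) that by (auto simp: vlin_def)
 have closed: "\<one>\<^bsub>R\<^esub>:carrier R" using u_closed[OF ident_hom[OF T]] by (simp add: u_ident)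
 have closed': "a\<oplus>\<^bsub>R\<^esub>b:carrier R" "a\<otimes>\<^bsub>R\<^esub>b:carrier R" "c\<odot>\<^bsub>R\<^esub>a:carrier R"
  if "a:carrier R" "b:carrier R" for a b c
  using that u_add[of "v a" "v b", symmetric] u_comp[of "v b" "v a", symmetric] u_scale[of "v a" c, symmetric] T
  by (simp_all add: u_v v_hom u_closed hs)
 have 1: "rx \<one>\<^bsub>R\<^esub> = 1\<^sub>m n"
  by (rule eqI) (use closed rx qc act Y T in "auto simp: v_one hs")
 have 2: "rx (a\<oplus>\<^bsub>R\<^esub>b) = rx a + rx b" if "a:carrier R" "b:carrier R" for a b
  by (rule eqI) (use that closed' rx qc act Y T in \<open>auto simp: v_add v_hom hs distrib qadd
    add_mult_distrib_mat_vec[of _ n n]\<close>)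
 have 3: "rx (c\<odot>\<^bsub>R\<^esub>a) = c \<cdot>\<^sub>m rx a" if a: "a:carrier R" for a c
 proof (rule eqI)
  fix y assume y: "y:Hom C T Y"
  have "(c \<cdot>\<^sub>m rx a) *v q y = c .*v (rx a *v q y)"
   using rx[OF a] qc[OF y] by (rule smult_mat_vec)
  then show "rx (c\<odot>\<^bsub>R\<^esub>a) *v q y = (c \<cdot>\<^sub>m rx a) *v q y"
   using a y closed'(3)[OF a a] act Y T by (simp add: v_scale v_hom hs distrib qs)
 qed (use a closed' rx in auto)
 have 4: "rx (a\<otimes>\<^bsub>R\<^esub>b) = rx a * rx b" if a: "a:carrier R" "b:carrier R" for a b
 proof (rule eqI)
  fix y assume y: "y:Hom C T Y"
  have "(rx a * rx b) *v q y = rx a *v (rx b *v q y)"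
   using rx[OF a(1)] rx[OF a(2)] qc[OF y] by simp
  then show "rx (a\<otimes>\<^bsub>R\<^esub>b) *v q y = (rx a * rx b) *v q y"
   using a y closed'(2)[OF a] act Y T by (simp add: v_mult v_hom hs ca)
 qed (use a closed' rx in "auto intro!: mult_carrier_mat")
 show ?thesis using 1 2 3 4 rx by (auto simp: module_structure_def)
qed

text \<open>The R-module is the cokernel of the map Hom(T, X) \<rightarrow> Hom(T, Y) induced by
  \<open>ax\<close>, with \<open>q\<close> as the projection.\<close>

definition presents :: "'o\<times>'m\<times>'o=>nat\<times>('a=>'k mat)=>('m=>'k vec)=>bool" where
 "presents = (%(X, ax, Y) (n, rx) q. MS R n rx & equivariant Y n rx q &
   q ` Hom C T Y = CV n &
   (ALL y:Hom C T Y. q y = 0\<^sub>v n\<longleftrightarrow>y:Comp C T X Y ax ` Hom C T X))"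

lemma presents_exists:
 assumes X: "X:Ob C" "Y:Ob C" "ax:Hom C X Y"
 shows "EX M q. presents (X, ax, Y) M q"
proof -
 let ?W = "Comp C T X Y ax ` Hom C T X"
 interpret K: kspace "Hom C T Y" "Hadd C T Y" "Hscale C T Y" "Hzero C T Y" by (rule spaceT[OF X(2)])
 obtain n q where q: "vlin (Hom C T Y) (Hadd C T Y) (Hscale C T Y) n q" "q ` Hom C T Y = CV n"
  "ALL y:Hom C T Y. q y = 0\<^sub>v n\<longleftrightarrow>y:?W"
  using K.coker_coordinates[OF fin_hom[OF X(2)] post_subsp[OF X]] by blast
 have "EX M:CM n n. ALL y:Hom C T Y. M *v q y = q (Comp C T T Y y f)" if f: "f:Hom C T T" for f
 proof (rule K.vlin_factor[OF q(1,2)])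
  show "vlin (Hom C T Y) (Hadd C T Y) (Hscale C T Y) n (%y. q (Comp C T T Y y f))"
   using q(1) X T f by (simp add: vlin_def hs distrib)
  fix y assume y: "y:Hom C T Y" "q y = 0\<^sub>v n"
  then obtain x where x: "x:Hom C T X" "y = Comp C T X Y ax x" using q(3) by blast
  have "Comp C T T Y y f = Comp C T X Y ax (Comp C T T X x f)" using x X T f by (simp add: ca)
  then have "Comp C T T Y y f:?W" using x X T f by (auto simp: hs)
  then show "q (Comp C T T Y y f) = 0\<^sub>v n" using q(3) y X T f by (simp add: hs)
 qed
 then obtain M where M: "!!f. f:Hom C T T ==> M f:CM n n"
  "!!f y. f:Hom C T T ==> y:Hom C T Y ==> M f *v q y = q (Comp C T T Y y f)" by metis
 have "MS R n (%a. M (v a))"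
  by (rule module_structureI[OF _ X(2) q(1,2)]) (use M v_hom in auto)
 then have "presents (X, ax, Y) (n, %a. M (v a)) q"
  using q M by (auto simp: presents_def equivariant_def v_u)
 then show ?thesis by blast
qed

definition MM :: "'o\<times>'m\<times>'o=>nat\<times>('a=>'k mat)" where
 "MM P = (SOME M. EX q. presents P M q)"

definition QQ :: "'o\<times>'m\<times>'o=>'m=>'k vec" where
 "QQ P = (SOME q. presents P (MM P) q)"

text \<open>A class of pairs (f, g) goes to the matrix that g induces on the cokernels. The
  description quantifies over the whole class, so no representative is chosen; the matrix is unique
  because the projections are onto.\<close>

definition cok :: "('o\<times>'m\<times>'o, ('m\<times>'m) set, ('k, 'a) fdmod, 'k mat) lfunctor" where
 "cok = \<lparr>omap = MM, mmap = (%P P' s. THE m. m:CM (fst (MM P')) (fst (MM P)) &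
   (ALL (f, g):s. ALL y:Hom C T (snd (snd P)).
    m *v QQ P y = QQ P' (Comp C T (snd (snd P)) (snd (snd P')) g y)))\<rparr>"

lemma presents_QQ:
 assumes "(X, ax, Y):Ob (abelianization C)"
 shows "presents (X, ax, Y) (MM (X, ax, Y)) (QQ (X, ax, Y))"
proof -
 have "EX q. presents (X, ax, Y) (MM (X, ax, Y)) q" unfolding MM_def
  by (rule someI_ex) (use assms presents_exists in "auto simp: abelianization_def")
 then show ?thesis unfolding QQ_def by (rule someI_ex)
qed

text \<open>T behaves like a projective generator. The factorization through \<open>ax\<close> is
  given after composing with maps out of T, and these factorizations are added up along a
  factorization of the identity of V through T.\<close>

lemma factor_through_kernel:
 assumes X: "X:Ob C" "Y:Ob C" "ax:Hom C X Y" and V: "V:Ob C" "k:Hom C V Y"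
  and k: "!!x. x:Hom C T V ==> Comp C T V Y k x:Comp C T X Y ax ` Hom C T X"
 shows "EX h:Hom C V X. k = Comp C V X Y ax h"
proof -
 have "EX h:Hom C V X. Comp C V V Y k r = Comp C V X Y ax h" if "factors C {T} V V r" for r
  using that
 proof induction
  case zero
  show ?case using X V by (intro bexI[of _ "Hzero C V X"]) (simp_all add: hs)
 next
  case (step r s f g)
  then obtain h where h: "h:Hom C V X" "Comp C V V Y k r = Comp C V X Y ax h" by blast
  have f: "f:Hom C V T" and g: "g:Hom C T V" and s: "s = T" using step by auto
  obtain x where x: "x:Hom C T X" "Comp C T V Y k g = Comp C T X Y ax x" using k[OF g] by blast
  have r: "r:Hom C V V" using factors_hom[OF _ step.hyps(1) V(1) V(1)] T by simp
  have "Comp C V V Y k (Hadd C V V r (Comp C V s V g f)) =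
   Hadd C V Y (Comp C V X Y ax h) (Comp C V T Y (Comp C T V Y k g) f)"
   using h r f g s T V X by (simp add: hs distrib ca)
  also have "\<dots> = Comp C V X Y ax (Hadd C V X h (Comp C V T X x f))"
   unfolding x(2) using h x f T V X by (simp add: hs distrib ca)
  finally show ?case using h x f T V X by (auto simp: hs)
 qed
 from this[OF factors_T[OF V(1)]] show ?thesis using V X by (simp add: hs)
qed

section \<open>The cokernel functor on hom spaces: well defined, faithful and full\<close>

context
 fixes X ax Y X' ax' Y'
 assumes P: "(X, ax, Y):Ob (abelianization C)" and P': "(X', ax', Y'):Ob (abelianization C)"
begin

abbreviation (input) "src \<equiv> (X, ax, Y)"
abbreviation (input) "tgt \<equiv> (X', ax', Y')"

lemma obs: "X:Ob C" "Y:Ob C" "ax:Hom C X Y" "X':Ob C" "Y':Ob C" "ax':Hom C X' Y'"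
 using P P' by (auto simp: abelianization_def)

lemma eqvs: "equivariant Y (fst (MM src)) (snd (MM src)) (QQ src)"
 "equivariant Y' (fst (MM tgt)) (snd (MM tgt)) (QQ tgt)"
 "MS R (fst (MM src)) (snd (MM src))" "MS R (fst (MM tgt)) (snd (MM tgt))"
 "QQ src ` Hom C T Y = CV (fst (MM src))" "QQ tgt ` Hom C T Y' = CV (fst (MM tgt))"
 using presents_QQ[OF P] presents_QQ[OF P'] by (auto simp: presents_def split: prod.splits)

lemma kernels:
 "y:Hom C T Y ==> QQ src y = 0\<^sub>v (fst (MM src))\<longleftrightarrow>y:Comp C T X Y ax ` Hom C T X"
 "y':Hom C T Y' ==> QQ tgt y' = 0\<^sub>v (fst (MM tgt))\<longleftrightarrow>y':Comp C T X' Y' ax' ` Hom C T X'"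
 using presents_QQ[OF P] presents_QQ[OF P'] by (auto simp: presents_def split: prod.splits)

lemma mat_eqI:
 assumes "m:CM k (fst (MM src))" "m':CM k (fst (MM src))"
  "!!y. y:Hom C T Y ==> m *v QQ src y = m' *v QQ src y"
 shows "m = m'"
proof (rule mat_eq_by_vecs[OF assms(1,2)])
 fix x :: "'k vec" assume "x:CV (fst (MM src))"
 then have "x:QQ src ` Hom C T Y" using eqvs by simp
 then show "m *v x = m' *v x" using assms(3) by blast
qed

lemma mmapI:
 assumes "s~={}" "m:CM (fst (MM tgt)) (fst (MM src))"
  and m: "!!f g y. (f, g):s ==> y:Hom C T Y ==> m *v QQ src y = QQ tgt (Comp C T Y Y' g y)"
 shows "mmap cok src tgt s = m"
proof -
 have "m' = m" if "m':CM (fst (MM tgt)) (fst (MM src))"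
  "ALL (f, g):s. ALL y:Hom C T Y. m' *v QQ src y = QQ tgt (Comp C T Y Y' g y)" for m'
 proof (rule mat_eqI[OF that(1) assms(2)])
  fix y assume "y:Hom C T Y"
  moreover obtain f g where "(f, g):s" using assms(1) by auto
  ultimately show "m' *v QQ src y = m *v QQ src y" using m that(2) by fastforce
 qed
 then show ?thesis unfolding cok_def using assms by (auto intro!: the_equality)
qed

lemma ab_pairs_iff: "(f, g):ab_pairs C src tgt\<longleftrightarrow>f:Hom C X X' & g:Hom C Y Y' &
  Comp C X Y Y' g ax = Comp C X X' Y' ax' f"
 by (simp add: ab_pairs_def)

lemma ab_class_iff: "(f', g'):ab_class C src tgt (f, g)\<longleftrightarrow>(f', g'):ab_pairs C src tgt &
  (EX h:Hom C Y X'. g' = Hadd C Y Y' g (Comp C Y X' Y' ax' h))"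
 by (simp add: ab_class_def)

lemma ab_class_self: "(f, g):ab_pairs C src tgt ==> (f, g):ab_class C src tgt (f, g)"
 unfolding ab_class_iff using obs
 by (auto simp: hs ab_pairs_iff intro!: bexI[of _ "Hzero C Y X'"])

text \<open>A homotopy changes g y by an element of the image of \<open>ax'\<close>, which the
  projection kills.\<close>

lemma ab_class_QQ:
 assumes "g:Hom C Y Y'" "(f', g'):ab_class C src tgt (f, g)" "y:Hom C T Y"
 shows "QQ tgt (Comp C T Y Y' g' y) = QQ tgt (Comp C T Y Y' g y)"
proof -
 obtain h where h: "h:Hom C Y X'" "g' = Hadd C Y Y' g (Comp C Y X' Y' ax' h)"
  using assms by (auto simp: ab_class_iff)
 have 0: "QQ tgt (Comp C T X' Y' ax' (Comp C T Y X' h y)) = 0\<^sub>v (fst (MM tgt))"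
  using h obs T assms(3) kernels(2)[of "Comp C T X' Y' ax' (Comp C T Y X' h y)"] by (auto simp: hs)
 have "Comp C T Y Y' g' y = Hadd C T Y' (Comp C T Y Y' g y) (Comp C T X' Y' ax' (Comp C T Y X' h y))"
  using h obs T assms by (simp add: hs distrib ca)
 then show ?thesis
  using h obs T assms eqvs(2) by (simp add: eqv_add[OF eqvs(2)] eqv_carrier[OF eqvs(2)] hs 0)
qed

lemma mmap_class:
 assumes fg: "(f, g):ab_pairs C src tgt"
 shows "mmap cok src tgt (ab_class C src tgt (f, g)):CM (fst (MM tgt)) (fst (MM src))"
  and "y:Hom C T Y ==> mmap cok src tgt (ab_class C src tgt (f, g)) *v QQ src y =
   QQ tgt (Comp C T Y Y' g y)"
proof -
 interpret K: kspace "Hom C T Y" "Hadd C T Y" "Hscale C T Y" "Hzero C T Y" by (rule spaceT[OF obs(2)])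
 have f: "f:Hom C X X'" and g: "g:Hom C Y Y'" and c: "Comp C X Y Y' g ax = Comp C X X' Y' ax' f"
  using fg by (auto simp: ab_pairs_iff)
 have "EX m:CM (fst (MM tgt)) (fst (MM src)). ALL y:Hom C T Y. m *v QQ src y = QQ tgt (Comp C T Y Y' g y)"
 proof (rule K.vlin_factor[OF eqv_vlin[OF eqvs(1)] eqvs(5)])
  show "vlin (Hom C T Y) (Hadd C T Y) (Hscale C T Y) (fst (MM tgt)) (%y. QQ tgt (Comp C T Y Y' g y))"
   using eqv_vlin[OF eqvs(2)] obs T g by (simp add: vlin_def hs distrib)
  fix y assume y: "y:Hom C T Y" "QQ src y = 0\<^sub>v (fst (MM src))"
  then obtain x where x: "x:Hom C T X" "y = Comp C T X Y ax x" using kernels(1) by blast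
  have "Comp C T Y Y' g y = Comp C T X Y' (Comp C X Y Y' g ax) x" using x obs T g by (simp add: ca)
  also have "\<dots> = Comp C T X' Y' ax' (Comp C T X X' f x)" unfolding c using x obs T f by (simp add: ca)
  finally show "QQ tgt (Comp C T Y Y' g y) = 0\<^sub>v (fst (MM tgt))"
   using kernels(2)[of "Comp C T Y Y' g y"] x y obs T g f by (auto simp: hs)
 qed
 then obtain m where m: "m:CM (fst (MM tgt)) (fst (MM src))"
  "ALL y:Hom C T Y. m *v QQ src y = QQ tgt (Comp C T Y Y' g y)" by blast
 have "mmap cok src tgt (ab_class C src tgt (f, g)) = m"
 proof (rule mmapI[OF _ m(1)])
  show "ab_class C src tgt (f, g)~={}" using ab_class_self[OF fg] by blast
  fix f1 g1 y assume y: "(f1, g1):ab_class C src tgt (f, g)" "y:Hom C T Y"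
  show "m *v QQ src y = QQ tgt (Comp C T Y Y' g1 y)"
   unfolding ab_class_QQ[OF g y] using m(2) y(2) by blast
 qed
 then show "mmap cok src tgt (ab_class C src tgt (f, g)):CM (fst (MM tgt)) (fst (MM src))"
  "y:Hom C T Y ==> mmap cok src tgt (ab_class C src tgt (f, g)) *v QQ src y =
   QQ tgt (Comp C T Y Y' g y)" using m by simp_all
qed

lemma mmap_hom:
 assumes s: "s:Hom (abelianization C) src tgt"
 shows "mmap cok src tgt s:Hom (MC R) (MM src) (MM tgt)"
  and "mmap cok src tgt s:CM (fst (MM tgt)) (fst (MM src))"
  and "s~={}" and "(f, g):s ==> (f, g):ab_pairs C src tgt"
  and "(f, g):s ==> y:Hom C T Y ==> mmap cok src tgt s *v QQ src y = QQ tgt (Comp C T Y Y' g y)"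
proof -
 obtain f0 g0 where fg0: "(f0, g0):ab_pairs C src tgt" and s: "s = ab_class C src tgt (f0, g0)"
  using s by (auto simp: abelianization_def)
 have g0: "g0:Hom C Y Y'" using fg0 by (auto simp: ab_pairs_iff)
 let ?m = "mmap cok src tgt s"
 show m: "?m:CM (fst (MM tgt)) (fst (MM src))" using mmap_class[OF fg0] s by simp
 show "s~={}" using ab_class_self[OF fg0] s by auto
 show "(f, g):s ==> (f, g):ab_pairs C src tgt" using s ab_class_iff by simp
 show "(f, g):s ==> y:Hom C T Y ==> ?m *v QQ src y = QQ tgt (Comp C T Y Y' g y)"
  unfolding s using mmap_class(2)[OF fg0, of y] ab_class_QQ[OF g0, of f g f0 y] by metis
 have "?m * snd (MM src) a = snd (MM tgt) a * ?m" if a: "a:carrier R" for a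
 proof (rule mat_eqI)
  have c: "snd (MM src) a:CM (fst (MM src)) (fst (MM src))"
   "snd (MM tgt) a:CM (fst (MM tgt)) (fst (MM tgt))"
   using eqvs(3,4) a by (auto simp: module_structure_def)
  show "?m * snd (MM src) a:CM (fst (MM tgt)) (fst (MM src))"
   "snd (MM tgt) a * ?m:CM (fst (MM tgt)) (fst (MM src))" using m c by auto
  fix y assume y: "y:Hom C T Y"
  note qc = eqv_carrier[OF eqvs(1) y]
  have "(?m * snd (MM src) a) *v QQ src y = ?m *v QQ src (Comp C T T Y y (v a))"
   using m c qc eqv_act[OF eqvs(1) y v_hom[OF a]] by (simp add: u_v a)
  also have "\<dots> = QQ tgt (Comp C T T Y' (Comp C T Y Y' g0 y) (v a))"
   using mmap_class(2)[OF fg0, of "Comp C T T Y y (v a)"] s y obs T g0 v_hom[OF a]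
   by (simp add: hs ca)
  also have "\<dots> = snd (MM tgt) a *v (?m *v QQ src y)"
   using eqv_act[OF eqvs(2) _ v_hom[OF a], of "Comp C T Y Y' g0 y"] mmap_class(2)[OF fg0 y] s y obs T g0
   by (simp add: u_v a hs)
  also have "\<dots> = (snd (MM tgt) a * ?m) *v QQ src y" using m c qc by simp
  finally show "(?m * snd (MM src) a) *v QQ src y = (snd (MM tgt) a * ?m) *v QQ src y" .
 qed
 then show "?m:Hom (MC R) (MM src) (MM tgt)"
  using m by (auto simp: module_category_def split: prod.splits)
qed

text \<open>If two second components induce the same matrix, their difference maps Hom(T, Y) into
  the image of \<open>ax'\<close>. By \<open>factor_through_kernel\<close> it factors through
  \<open>ax'\<close>, and the factor is the required homotopy.\<close>

lemma faithful: "inj_on (mmap cok src tgt) (Hom (abelianization C) src tgt)"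
proof (rule inj_onI)
 fix s s' assume s: "s:Hom (abelianization C) src tgt" and s': "s':Hom (abelianization C) src tgt"
  and eq: "mmap cok src tgt s = mmap cok src tgt s'"
 obtain f g where fg: "(f, g):ab_pairs C src tgt" and sf: "s = ab_class C src tgt (f, g)"
  using s by (auto simp: abelianization_def)
 obtain f' g' where fg': "(f', g'):ab_pairs C src tgt" and sf': "s' = ab_class C src tgt (f', g')"
  using s' by (auto simp: abelianization_def)
 interpret K: kspace "Hom C Y Y'" "Hadd C Y Y'" "Hscale C Y Y'" "Hzero C Y Y'"
  by (rule hom_space[OF obs(2,5)])
 have g: "g:Hom C Y Y'" "g':Hom C Y Y'" using fg fg' by (auto simp: ab_pairs_iff)
 define d where "d = Hadd C Y Y' g' (Hscale C Y Y' (- 1) g)"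
 have d: "d:Hom C Y Y'" using g obs by (simp add: d_def hs)
 have "EX h:Hom C Y X'. d = Comp C Y X' Y' ax' h"
 proof (rule factor_through_kernel[OF obs(4-6,2) d])
  fix y assume y: "y:Hom C T Y"
  note c = eqv_carrier[OF eqvs(2)]
  have e: "QQ tgt (Comp C T Y Y' g y) = QQ tgt (Comp C T Y Y' g' y)"
   using mmap_class(2)[OF fg y] mmap_class(2)[OF fg' y] eq sf sf' by simp
  have h: "Comp C T Y Y' g y:Hom C T Y'" "Comp C T Y Y' g' y:Hom C T Y'" using y g obs T by (auto simp: hs)
  have "Comp C T Y Y' d y = Hadd C T Y' (Comp C T Y Y' g' y) (Hscale C T Y' (- 1) (Comp C T Y Y' g y))"
   using y g obs T by (simp add: d_def hs distrib)
  then have "QQ tgt (Comp C T Y Y' d y) = 0\<^sub>v (fst (MM tgt))"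
   using kspace.vlin_diff[OF spaceT[OF obs(5)] eqv_vlin[OF eqvs(2)] h(2,1)] e by simp
  then show "Comp C T Y Y' d y:Comp C T X' Y' ax' ` Hom C T X'"
   using kernels(2)[of "Comp C T Y Y' d y"] d y obs T by (auto simp: hs)
 qed
 then obtain h where h: "h:Hom C Y X'" "d = Comp C Y X' Y' ax' h" by blast
 have g': "g' = Hadd C Y Y' g (Comp C Y X' Y' ax' h)"
  unfolding h(2)[symmetric] d_def using g K.add_neg[OF g(1)]
  by (simp add: K.add_lcomm K.closed K.add_zero)
 have gg: "g = Hadd C Y Y' g' (Comp C Y X' Y' ax' (Hscale C Y X' (- 1) h))"
 proof -
  have "Comp C Y X' Y' ax' (Hscale C Y X' (- 1) h) = Hscale C Y Y' (- 1) (Comp C Y X' Y' ax' h)"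
   using h obs by (simp add: distrib)
  then show ?thesis unfolding g' using K.add_neg2[of "Comp C Y X' Y' ax' h" g] g h obs by (simp add: hs)
 qed
 have shift: "Hadd C Y Y' (Hadd C Y Y' a (Comp C Y X' Y' ax' h1)) (Comp C Y X' Y' ax' h2) =
   Hadd C Y Y' a (Comp C Y X' Y' ax' (Hadd C Y X' h1 h2))" if "a:Hom C Y Y'" "h1:Hom C Y X'" "h2:Hom C Y X'"
  for a h1 h2 using that obs by (simp add: distrib hadd_assoc hs)
 \<comment> \<open>A class consists of all pairs whose second component differs from the given one
   by some \<open>ax'\<close> h; the first component only has to complete the square. Pairs with
   homotopic second components therefore have classes contained in each other.\<close>
 have incl: "ab_class C src tgt (f1, g1)<=ab_class C src tgt (f2, g2)"
  if "g2:Hom C Y Y'" "k:Hom C Y X'" "g1 = Hadd C Y Y' g2 (Comp C Y X' Y' ax' k)" for f1 g1 f2 g2 k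
 proof
  fix x assume "x:ab_class C src tgt (f1, g1)"
  then obtain a b h where x: "x = (a, b)" "(a, b):ab_pairs C src tgt" and h: "h:Hom C Y X'"
   "b = Hadd C Y Y' g1 (Comp C Y X' Y' ax' h)" by (cases x) (auto simp: ab_class_iff)
  have "b = Hadd C Y Y' g2 (Comp C Y X' Y' ax' (Hadd C Y X' k h))"
   unfolding h(2) that(3) by (rule shift[OF that(1,2) h(1)])
  then show "x:ab_class C src tgt (f2, g2)"
   unfolding x(1) ab_class_iff using x(2) add_hom[OF obs(2,4) that(2) h(1)] by blast
 qed
 have "ab_class C src tgt (f', g')<=ab_class C src tgt (f, g)" using incl[OF g(1) h(1) g'] .
 moreover have "ab_class C src tgt (f, g)<=ab_class C src tgt (f', g')"
  by (rule incl[OF g(2) _ gg]) (use h obs in "simp add: hs")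
 ultimately show "s = s'" using sf sf' by blast
qed

text \<open>The lift g is assembled along a factorization of the identity of Y: in a summand b a
  with b from T to Y, the map b is replaced by a preimage z of \<open>m\<close> applied to b. The
  first component f then exists because g carries the image of \<open>ax\<close> into the kernel of
  the second projection.\<close>

lemma full:
 assumes "m:Hom (MC R) (MM src) (MM tgt)"
 shows "m:mmap cok src tgt ` Hom (abelianization C) src tgt"
proof -
 have m: "m:CM (fst (MM tgt)) (fst (MM src))"
  and mr: "!!a. a:carrier R ==> m * snd (MM src) a = snd (MM tgt) a * m"
  using assms by (auto simp: module_category_def split: prod.splits)
 note c = eqv_carrier[OF eqvs(1)] eqv_carrier[OF eqvs(2)]
 have "EX g:Hom C Y Y'. ALL y:Hom C T Y. QQ tgt (Comp C T Y Y' g y) = m *v QQ src (Comp C T Y Y r y)"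
  if "factors C {T} Y Y r" for r
  using that
 proof induction
  case zero
  show ?case using obs T m
   by (intro bexI[of _ "Hzero C Y Y'"])
    (auto simp: hs eqv_zero[OF eqvs(1)] eqv_zero[OF eqvs(2)] intro!: eq_vecI)
 next
  case (step r s a b)
  then obtain g where g: "g:Hom C Y Y'" "ALL y:Hom C T Y. QQ tgt (Comp C T Y Y' g y) = m *v QQ src (Comp C T Y Y r y)"
   by blast
  have a: "a:Hom C Y T" and b: "b:Hom C T Y" and s: "s = T" using step by auto
  have r: "r:Hom C Y Y" using factors_hom[OF _ step.hyps(1) obs(2) obs(2)] T by simp
  have "m *v QQ src b:QQ tgt ` Hom C T Y'" using m c(1)[OF b] eqvs(6) by simp
  then obtain z where z: "z:Hom C T Y'" "QQ tgt z = m *v QQ src b" by auto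
  let ?g = "Hadd C Y Y' g (Comp C Y T Y' z a)"
  have "QQ tgt (Comp C T Y Y' ?g y) = m *v QQ src (Comp C T Y Y (Hadd C Y Y r (Comp C Y s Y b a)) y)"
   if y: "y:Hom C T Y" for y
  proof -
   \<comment> \<open>R-linearity of \<open>m\<close> transfers the action of the endomorphism
     \<open>e\<close> from z to b, which shows that z a imitates \<open>m\<close> on b a.\<close>
   define e where "e = Comp C T Y T a y"
   have e: "e:Hom C T T" using a y obs T by (simp add: e_def hs)
   have rx: "snd (MM src) (u e):CM (fst (MM src)) (fst (MM src))"
    "snd (MM tgt) (u e):CM (fst (MM tgt)) (fst (MM tgt))"
    using eqvs(3,4) u_closed[OF e] by (auto simp: module_structure_def)
   have "QQ tgt (Comp C T T Y' z e) = snd (MM tgt) (u e) *v (m *v QQ src b)"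
    using eqv_act[OF eqvs(2) z(1) e] z(2) by simp
   also have "\<dots> = (snd (MM tgt) (u e) * m) *v QQ src b" using m rx c(1)[OF b] by simp
   also have "\<dots> = m *v (snd (MM src) (u e) *v QQ src b)"
    unfolding mr[OF u_closed[OF e], symmetric] using m rx c(1)[OF b] by simp
   also have "\<dots> = m *v QQ src (Comp C T T Y b e)" using eqv_act[OF eqvs(1) b e] by simp
   finally have 1: "QQ tgt (Comp C T T Y' z e) = m *v QQ src (Comp C T T Y b e)" .
   have "Comp C T Y Y' ?g y = Hadd C T Y' (Comp C T Y Y' g y) (Comp C T T Y' z e)"
    using g z a y obs T by (simp add: e_def hs distrib ca)
   moreover have "Comp C T Y Y (Hadd C Y Y r (Comp C Y s Y b a)) y = Hadd C T Y (Comp C T Y Y r y) (Comp C T T Y b e)"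
    using r b a y s obs T by (simp add: e_def hs distrib ca)
   moreover have "QQ src (Comp C T Y Y r y):CV (fst (MM src))" "QQ src (Comp C T T Y b e):CV (fst (MM src))"
    using c(1) r y b e obs T by (auto simp: hs)
   ultimately show ?thesis
    using g(2) 1 g(1) z r b e y obs T m
    by (simp add: eqv_add[OF eqvs(1)] eqv_add[OF eqvs(2)] hs mult_add_distrib_mat_vec[OF m])
  qed
  then show ?case using g z a obs T by (intro bexI[of _ ?g]) (auto simp: hs)
 qed
 from this[OF factors_T[OF obs(2)]] obtain g where g: "g:Hom C Y Y'"
  "ALL y:Hom C T Y. QQ tgt (Comp C T Y Y' g y) = m *v QQ src (Comp C T Y Y (Ident C Y) y)" by blast
 then have g2: "QQ tgt (Comp C T Y Y' g y) = m *v QQ src y" if "y:Hom C T Y" for y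
  using that obs T by (simp add: hs)
 have "EX f:Hom C X X'. Comp C X Y Y' g ax = Comp C X X' Y' ax' f"
 proof (rule factor_through_kernel[OF obs(4-6,1)])
  show "Comp C X Y Y' g ax:Hom C X Y'" using g obs by (simp add: hs)
  fix x assume x: "x:Hom C T X"
  have "QQ src (Comp C T X Y ax x) = 0\<^sub>v (fst (MM src))" using kernels(1) x obs T by (simp add: hs)
  then have "QQ tgt (Comp C T X Y' (Comp C X Y Y' g ax) x) = 0\<^sub>v (fst (MM tgt))"
   using g2[of "Comp C T X Y ax x"] x g(1) obs T m by (auto simp: hs ca intro!: eq_vecI)
  then show "Comp C T X Y' (Comp C X Y Y' g ax) x:Comp C T X' Y' ax' ` Hom C T X'"
   using kernels(2)[of "Comp C T X Y' (Comp C X Y Y' g ax) x"] x g(1) obs T by (simp add: hs)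
 qed
 then obtain f where f: "f:Hom C X X'" "Comp C X Y Y' g ax = Comp C X X' Y' ax' f" by blast
 then have fg: "(f, g):ab_pairs C src tgt" using g by (simp add: ab_pairs_iff)
 have "mmap cok src tgt (ab_class C src tgt (f, g)) = m"
  by (rule mat_eqI) (use m mmap_class[OF fg] g2 in auto)
 then show ?thesis using fg by (auto simp: abelianization_def)
qed

end

section \<open>The cokernel functor: functoriality, density and projective objects\<close>

lemma coker_functor_linear: "LF (abelianization C) (MC R) cok"
 unfolding linear_functor_def
proof (intro conjI ballI allI)
 fix P assume "P:Ob (abelianization C)"
 moreover obtain X ax Y where PX: "P = (X, ax, Y)" by (cases P)
 ultimately have P: "(X, ax, Y):Ob (abelianization C)" by simp
 note o = obs[OF P P] and e = eqvs[OF P P]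
 show "omap cok P:Ob (MC R)"
  using e(3) by (auto simp: cok_def PX module_category_def split: prod.splits)
 have id: "(Ident C X, Ident C Y):ab_pairs C (X, ax, Y) (X, ax, Y)"
  using o by (simp add: ab_pairs_iff[OF P P] hs)
 have "mmap cok P P (ab_class C (X, ax, Y) (X, ax, Y) (Ident C X, Ident C Y)) = 1\<^sub>m (fst (MM P))"
  unfolding PX
 proof (rule mmapI[OF P P])
  show "ab_class C (X, ax, Y) (X, ax, Y) (Ident C X, Ident C Y)~={}" using ab_class_self[OF P P id] by blast
  fix f g y assume y: "(f, g):ab_class C (X, ax, Y) (X, ax, Y) (Ident C X, Ident C Y)" "y:Hom C T Y"
  show "1\<^sub>m (fst (MM (X, ax, Y))) *v QQ (X, ax, Y) y = QQ (X, ax, Y) (Comp C T Y Y g y)"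
   unfolding ab_class_QQ[OF P P ident_hom[OF o(2)] y] using y(2) o T eqv_carrier[OF e(1) y(2)]
   by (simp add: hs)
 qed simp
 then show "mmap cok P P (Ident (abelianization C) P) = Ident (MC R) (omap cok P)"
  by (simp add: PX abelianization_def module_category_def cok_def split: prod.splits)
next
 fix P P' s
 assume "P:Ob (abelianization C)" "P':Ob (abelianization C)" and "s:Hom (abelianization C) P P'"
 moreover obtain X ax Y where PX: "P = (X, ax, Y)" by (cases P)
 moreover obtain X' ax' Y' where PX': "P' = (X', ax', Y')" by (cases P')
 ultimately have P: "(X, ax, Y):Ob (abelianization C)" and P': "(X', ax', Y'):Ob (abelianization C)"
  and s: "s:Hom (abelianization C) (X, ax, Y) (X', ax', Y')" by auto
 note o = obs[OF P P'] and e = eqvs[OF P P'] and ms = mmap_hom[OF P P' s]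
 let ?Fi = "mmap cok"
 show "?Fi P P' s:Hom (MC R) (omap cok P) (omap cok P')"
  using ms(1) by (simp add: PX PX' cok_def)
 show "?Fi P P' (Hscale (abelianization C) P P' c s) =
   Hscale (MC R) (omap cok P) (omap cok P') c (?Fi P P' s)" for c
 proof -
  define S where "S = (\<Union>(f, g)\<in>s. ab_class C (X, ax, Y) (X', ax', Y') (Hscale C X X' c f, Hscale C Y Y' c g))"
  have pr: "(Hscale C X X' c f, Hscale C Y Y' c g):ab_pairs C (X, ax, Y) (X', ax', Y')" if "(f, g):s" for f g
   using ms(4)[OF that] o by (simp add: ab_pairs_iff[OF P P'] hs distrib)
  have "?Fi (X, ax, Y) (X', ax', Y') S = c \<cdot>\<^sub>m ?Fi (X, ax, Y) (X', ax', Y') s"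
  proof (rule mmapI[OF P P'])
   obtain f g where "(f, g):s" using ms(3) by auto
   then show "S~={}" using ab_class_self[OF P P' pr] by (auto simp: S_def)
   fix a b y assume "(a, b):S" and y: "y:Hom C T Y"
   then obtain f g where fg: "(f, g):s"
    and ab: "(a, b):ab_class C (X, ax, Y) (X', ax', Y') (Hscale C X X' c f, Hscale C Y Y' c g)"
    by (auto simp: S_def)
   have g: "g:Hom C Y Y'" using ms(4)[OF fg] by (simp add: ab_pairs_iff[OF P P'])
   have "QQ (X', ax', Y') (Comp C T Y Y' b y) = QQ (X', ax', Y') (Comp C T Y Y' (Hscale C Y Y' c g) y)"
    by (rule ab_class_QQ[OF P P' _ ab y]) (use g o in "simp add: hs")
   also have "\<dots> = c .*v QQ (X', ax', Y') (Comp C T Y Y' g y)"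
    using g y o T by (simp add: distrib eqv_scale[OF e(2)] hs)
   also have "\<dots> = (c \<cdot>\<^sub>m ?Fi (X, ax, Y) (X', ax', Y') s) *v QQ (X, ax, Y) y"
    using ms(5)[OF fg y] smult_mat_vec[OF ms(2) eqv_carrier[OF e(1) y]] by simp
   finally show "(c \<cdot>\<^sub>m ?Fi (X, ax, Y) (X', ax', Y') s) *v QQ (X, ax, Y) y = QQ (X', ax', Y') (Comp C T Y Y' b y)" ..
  qed (use ms(2) in simp)
  then show ?thesis
   by (simp add: PX PX' S_def abelianization_def module_category_def split: prod.splits)
 qed
 fix t assume "t:Hom (abelianization C) P P'"
 then have t: "t:Hom (abelianization C) (X, ax, Y) (X', ax', Y')" by (simp add: PX PX')
 note mt = mmap_hom[OF P P' t]
 define S where "S = (\<Union>(f', g')\<in>s. \<Union>(f, g)\<in>t. ab_class C (X, ax, Y) (X', ax', Y')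
     (Hadd C X X' f' f, Hadd C Y Y' g' g))"
 have pr: "(Hadd C X X' f' f, Hadd C Y Y' g' g):ab_pairs C (X, ax, Y) (X', ax', Y')"
  if "(f', g'):s" "(f, g):t" for f g f' g'
  using ms(4)[OF that(1)] mt(4)[OF that(2)] o by (simp add: ab_pairs_iff[OF P P'] hs distrib)
 have "?Fi (X, ax, Y) (X', ax', Y') S = ?Fi (X, ax, Y) (X', ax', Y') s + ?Fi (X, ax, Y) (X', ax', Y') t"
 proof (rule mmapI[OF P P'])
  obtain f' g' f g where a: "(f', g'):s" "(f, g):t" using ms(3) mt(3) by auto
  have "(Hadd C X X' f' f, Hadd C Y Y' g' g):S"
   unfolding S_def using a ab_class_self[OF P P' pr[OF a]] by force
  then show "S~={}" by blast
  fix a b y assume "(a, b):S" and y: "y:Hom C T Y"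
  then obtain f g f' g' where fg': "(f', g'):s" and fg: "(f, g):t"
   and ab: "(a, b):ab_class C (X, ax, Y) (X', ax', Y') (Hadd C X X' f' f, Hadd C Y Y' g' g)"
   by (auto simp: S_def)
  have g: "g:Hom C Y Y'" "g':Hom C Y Y'" using ms(4)[OF fg'] mt(4)[OF fg] by (auto simp: ab_pairs_iff[OF P P'])
  have "QQ (X', ax', Y') (Comp C T Y Y' b y) = QQ (X', ax', Y') (Comp C T Y Y' (Hadd C Y Y' g' g) y)"
   by (rule ab_class_QQ[OF P P' _ ab y]) (use g o in "simp add: hs")
  also have "\<dots> = QQ (X', ax', Y') (Comp C T Y Y' g' y) + QQ (X', ax', Y') (Comp C T Y Y' g y)"
   using g y o T by (simp add: distrib eqv_add[OF e(2)] hs)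
  also have "\<dots> = (?Fi (X, ax, Y) (X', ax', Y') s + ?Fi (X, ax, Y) (X', ax', Y') t) *v QQ (X, ax, Y) y"
   using ms(5)[OF fg' y] mt(5)[OF fg y] add_mult_distrib_mat_vec[OF ms(2) mt(2) eqv_carrier[OF e(1) y]] by simp
  finally show "(?Fi (X, ax, Y) (X', ax', Y') s + ?Fi (X, ax, Y) (X', ax', Y') t) *v QQ (X, ax, Y) y =
   QQ (X', ax', Y') (Comp C T Y Y' b y)" ..
 qed (use ms(2) mt(2) in simp)
 then show "?Fi P P' (Hadd (abelianization C) P P' s t) =
   Hadd (MC R) (omap cok P) (omap cok P') (?Fi P P' s) (?Fi P P' t)"
  by (simp add: PX PX' S_def abelianization_def module_category_def split: prod.splits)
next
 fix P P' s P'' t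
 assume "P:Ob (abelianization C)" "P':Ob (abelianization C)" "s:Hom (abelianization C) P P'"
  and "P'':Ob (abelianization C)" "t:Hom (abelianization C) P' P''"
 moreover obtain X ax Y where PX: "P = (X, ax, Y)" by (cases P)
 moreover obtain X' ax' Y' where PX': "P' = (X', ax', Y')" by (cases P')
 moreover obtain X'' ax'' Y'' where PX'': "P'' = (X'', ax'', Y'')" by (cases P'')
 ultimately have P: "(X, ax, Y):Ob (abelianization C)" and P': "(X', ax', Y'):Ob (abelianization C)"
  and P'': "(X'', ax'', Y''):Ob (abelianization C)"
  and s: "s:Hom (abelianization C) (X, ax, Y) (X', ax', Y')"
  and t: "t:Hom (abelianization C) (X', ax', Y') (X'', ax'', Y'')" by auto
 note o = obs[OF P P'] obs(4-6)[OF P' P''] and e = eqvs[OF P P'] and ms = mmap_hom[OF P P' s] and mt = mmap_hom[OF P' P'' t]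
 let ?Fi = "mmap cok"
 define S where "S = (\<Union>(f', g')\<in>t. \<Union>(f, g)\<in>s. ab_class C (X, ax, Y) (X'', ax'', Y'')
     (Comp C X X' X'' f' f, Comp C Y Y' Y'' g' g))"
 have pr: "(Comp C X X' X'' f' f, Comp C Y Y' Y'' g' g):ab_pairs C (X, ax, Y) (X'', ax'', Y'')"
  if "(f', g'):t" "(f, g):s" for f g f' g'
 proof -
  have a: "f:Hom C X X'" "g:Hom C Y Y'" "Comp C X Y Y' g ax = Comp C X X' Y' ax' f"
   "f':Hom C X' X''" "g':Hom C Y' Y''" "Comp C X' Y' Y'' g' ax' = Comp C X' X'' Y'' ax'' f'"
   using ms(4)[OF that(2)] mt(4)[OF that(1)] by (auto simp: ab_pairs_iff[OF P P'] ab_pairs_iff[OF P' P''])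
  have "Comp C X Y Y'' (Comp C Y Y' Y'' g' g) ax = Comp C X X' Y'' (Comp C X' Y' Y'' g' ax') f"
   using a(1-5) o by (simp add: ca)
  also have "\<dots> = Comp C X X'' Y'' ax'' (Comp C X X' X'' f' f)"
   unfolding a(6) using a(1-5) o by (simp add: ca)
  finally show ?thesis using a o by (simp add: ab_pairs_iff[OF P P''] hs)
 qed
 have "?Fi (X, ax, Y) (X'', ax'', Y'') S = ?Fi (X', ax', Y') (X'', ax'', Y'') t * ?Fi (X, ax, Y) (X', ax', Y') s"
 proof (rule mmapI[OF P P''])
  obtain f' g' f g where a: "(f', g'):t" "(f, g):s" using ms(3) mt(3) by auto
  have "(Comp C X X' X'' f' f, Comp C Y Y' Y'' g' g):S"
   unfolding S_def using a ab_class_self[OF P P'' pr[OF a]] by force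
  then show "S~={}" by blast
  fix a b y assume "(a, b):S" and y: "y:Hom C T Y"
  then obtain f g f' g' where fg': "(f', g'):t" and fg: "(f, g):s"
   and ab: "(a, b):ab_class C (X, ax, Y) (X'', ax'', Y'') (Comp C X X' X'' f' f, Comp C Y Y' Y'' g' g)"
   by (auto simp: S_def)
  have g: "g:Hom C Y Y'" "g':Hom C Y' Y''" using ms(4)[OF fg] mt(4)[OF fg']
   by (auto simp: ab_pairs_iff[OF P P'] ab_pairs_iff[OF P' P''])
  have gy: "Comp C T Y Y' g y:Hom C T Y'" using g y o T by (simp add: hs)
  have "QQ (X'', ax'', Y'') (Comp C T Y Y'' b y) = QQ (X'', ax'', Y'') (Comp C T Y Y'' (Comp C Y Y' Y'' g' g) y)"
   by (rule ab_class_QQ[OF P P'' _ ab y]) (use g o in "simp add: hs")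
  also have "\<dots> = QQ (X'', ax'', Y'') (Comp C T Y' Y'' g' (Comp C T Y Y' g y))"
   using g y o T by (simp add: ca)
  also have "\<dots> = ?Fi (X', ax', Y') (X'', ax'', Y'') t *v (?Fi (X, ax, Y) (X', ax', Y') s *v QQ (X, ax, Y) y)"
   unfolding ms(5)[OF fg y] mt(5)[OF fg' gy] ..
  also have "\<dots> = (?Fi (X', ax', Y') (X'', ax'', Y'') t * ?Fi (X, ax, Y) (X', ax', Y') s) *v QQ (X, ax, Y) y"
   by (rule assoc_mult_mat_vec[symmetric, OF mt(2) ms(2) eqv_carrier[OF e(1) y]])
  finally show "(?Fi (X', ax', Y') (X'', ax'', Y'') t * ?Fi (X, ax, Y) (X', ax', Y') s) *v QQ (X, ax, Y) y =
   QQ (X'', ax'', Y'') (Comp C T Y Y'' b y)" ..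
 qed (use ms(2) mt(2) in simp)
 then show "?Fi P P'' (Comp (abelianization C) P P' P'' t s) =
  Comp (MC R) (omap cok P) (omap cok P') (omap cok P'') (?Fi P' P'' t) (?Fi P P' s)"
  by (simp add: PX PX' PX'' S_def abelianization_def module_category_def split: prod.splits)
qed

text \<open>The module is exhausted by a chain of vectors, and each new vector w is reached by
  adding one copy of T to Y whose identity is sent to w.\<close>

lemma generated_by_T:
 assumes m: "MS R n rx" and fin: "kspace.fin_over (CV n) (+) (\<cdot>\<^sub>v) {0\<^sub>v n} U"
 shows "EX Y:Ob C. EX q. equivariant Y n rx q & U<=q ` Hom C T Y"
proof -
 interpret V: kspace "CV n" "(+)" "(\<cdot>\<^sub>v)" "0\<^sub>v n :: 'k vec" by (rule kspace_vec)
 have rx: "rx (u f):CM n n" if "f:Hom C T T" for f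
  using m u_closed[OF that] by (simp add: module_structure_def)
 from fin show ?thesis
 proof induction
  case base
  obtain Z where Z: "Z:Ob C" using zero_ob by (auto simp: zero_object_def)
  have "equivariant Z n rx (%_. 0\<^sub>v n)" using rx by (fastforce simp: equivariant_def vlin_def intro!: eq_vecI)
  moreover have "{0\<^sub>v n}<=(%_. 0\<^sub>v n :: 'k vec) ` Hom C T Z" using zero_hom[OF T Z] by auto
  ultimately show ?case using Z by blast
 next
  case (step U w)
  then obtain Y q where Y: "Y:Ob C" and q: "equivariant Y n rx q" and U: "U<=q ` Hom C T Y" by blast
  obtain Z i1 i2 p1 p2 where "binary_biproduct C T Y Z i1 i2 p1 p2"
   using biproducts T Y unfolding has_biproducts_def by blast
  note b = this[unfolded binary_biproduct_def]
  \<comment> \<open>The component in T acts on \<open>w\<close> as an element of R, the component in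
    Y is sent by \<open>q\<close>; the inclusion \<open>i1\<close> of the new copy of T goes to
    \<open>w\<close>.\<close>
  define q' where "q' y = rx (u (Comp C T Z T p1 y)) *v w + q (Comp C T Z Y p2 y)" for y
  have w: "w:CV n" by fact
  have py: "Comp C T Z T p1 y:Hom C T T" "Comp C T Z Y p2 y:Hom C T Y" if "y:Hom C T Z" for y
   using that b by (auto simp: hs)
  have ms: "rx (a\<oplus>\<^bsub>R\<^esub>b) = rx a + rx b" "rx (a\<otimes>\<^bsub>R\<^esub>b) = rx a * rx b"
   if "a:carrier R" "b:carrier R" for a b using m that by (auto simp: module_structure_def)
  have msc: "rx (c\<odot>\<^bsub>R\<^esub>a) = c \<cdot>\<^sub>m rx a" if "a:carrier R" for a c
   using m that by (auto simp: module_structure_def)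
  have q': "equivariant Z n rx q'"
   unfolding equivariant_def vlin_def
  proof (intro conjI ballI allI)
   fix y assume y: "y:Hom C T Z"
   note y' = py[OF y]
   show "q' y:CV n" using rx[OF y'(1)] w eqv_carrier[OF q y'(2)] by (simp add: q'_def)
   show "q' (Hscale C T Z c y) = c .*v q' y" for c
    using b y y' w rx[OF y'(1)] eqv_carrier[OF q y'(2)] T
    by (simp add: q'_def distrib eqv_scale[OF q] u_scale msc u_closed smult_mat_vec[of _ n n]
      smult_add_distrib_vec[of _ n])
   show "q' (Hadd C T Z y y2) = q' y + q' y2" if y2: "y2:Hom C T Z" for y2
   proof -
    note y2' = py[OF y2]
    have "q' (Hadd C T Z y y2) = (rx (u (Comp C T Z T p1 y)) *v w + rx (u (Comp C T Z T p1 y2)) *v w) +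
      (q (Comp C T Z Y p2 y) + q (Comp C T Z Y p2 y2))"
     using b y y' y2 y2' w rx[OF y'(1)] rx[OF y2'(1)] T
     by (simp add: q'_def distrib eqv_add[OF q] u_add ms u_closed add_mult_distrib_mat_vec[of _ n n])
    then show ?thesis
     using rx[OF y'(1)] rx[OF y2'(1)] w eqv_carrier[OF q y'(2)] eqv_carrier[OF q y2'(2)]
     by (auto simp: q'_def intro!: eq_vecI)
   qed
   fix f assume f: "f:Hom C T T"
   show "q' (Comp C T T Z y f) = rx (u f) *v q' y"
   proof -
    have "Comp C T Z T p1 (Comp C T T Z y f) = Comp C T T T (Comp C T Z T p1 y) f"
     "Comp C T Z Y p2 (Comp C T T Z y f) = Comp C T T Y (Comp C T Z Y p2 y) f"
     using b y f T by (simp_all add: ca)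
    then have "q' (Comp C T T Z y f) = (rx (u f) * rx (u (Comp C T Z T p1 y))) *v w + rx (u f) *v q (Comp C T Z Y p2 y)"
     using y' f by (simp add: q'_def u_comp ms u_closed eqv_act[OF q])
    then show ?thesis
     using rx[OF y'(1)] rx[OF f] w eqv_carrier[OF q y'(2)] by (simp add: q'_def mult_add_distrib_mat_vec[of _ n n])
   qed
  qed
  have "w = q' i1"
   using b T Y w m eqv_zero[OF q Y] by (simp add: q'_def u_ident module_structure_def)
  moreover have "q' (Comp C T Y Z i2 y) = q y" if "y:Hom C T Y" for y
  proof -
   have "Comp C T Z T p1 (Comp C T Y Z i2 y) = Hzero C T T" "Comp C T Z Y p2 (Comp C T Y Z i2 y) = y"
    using b T that ca[of T Y Z T y i2 p1] ca[of T Y Z Y y i2 p2] by (auto simp: hs)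
   moreover have "0\<^sub>m n n *v w = 0\<^sub>v n" using w by (auto intro!: eq_vecI)
   ultimately show ?thesis using u_zero_module[OF m] eqv_carrier[OF q that] w by (simp add: q'_def)
  qed
  ultimately have "V.adjoin U w<=q' ` Hom C T Z"
  proof -
   assume w': "w = q' i1" and qq: "!!y. y:Hom C T Y ==> q' (Comp C T Y Z i2 y) = q y"
   show ?thesis
   proof
    fix x assume "x:V.adjoin U w"
    then obtain y c where y: "y:Hom C T Y" "x = q y + c .*v w" using U by (auto simp: V.adjoin_def)
    have "x = q' (Hadd C T Z (Comp C T Y Z i2 y) (Hscale C T Z c i1))"
     using y b T by (simp add: eqv_add[OF q'] eqv_scale[OF q'] qq w'[symmetric] hs)
    then show "x:q' ` Hom C T Z" using y b T by (auto simp: hs)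
   qed
  qed
  then show ?case using b q' by blast
 qed
qed

text \<open>The submodule generated by finitely many elements of Hom(T, Y) is the image of a
  morphism: one copy of T for each element, mapped to Y by that element. The clause about W records
  minimality, which becomes equality once U is itself a submodule.\<close>

lemma covered_by_T:
 assumes Y: "Y:Ob C" and fin: "kspace.fin_over (Hom C T Y) (Hadd C T Y) (Hscale C T Y) {Hzero C T Y} U"
 shows "EX X:Ob C. EX ax:Hom C X Y. U<=Comp C T X Y ax ` Hom C T X &
  (ALL W. kspace.subsp (Hom C T Y) (Hadd C T Y) (Hscale C T Y) (Hzero C T Y) W-->U<=W -->
   (ALL w:W. ALL f:Hom C T T. Comp C T T Y w f:W)-->Comp C T X Y ax ` Hom C T X<=W)"
proof -
 interpret K: kspace "Hom C T Y" "Hadd C T Y" "Hscale C T Y" "Hzero C T Y" by (rule spaceT[OF Y])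
 from fin show ?thesis
 proof induction
  case base
  obtain Z where Z: "Z:Ob C" using zero_ob by (auto simp: zero_object_def)
  have "Comp C T Z Y (Hzero C Z Y) ` Hom C T Z = {Hzero C T Y}"
   by (rule image_eq_singleton[OF zero_hom[OF T Z]]) (use Z Y T in "simp add: hs")
  then show ?case using Z zero_hom[OF Z Y] by (intro bexI[of _ Z] bexI[of _ "Hzero C Z Y"]) simp_all
 next
  case (step U w)
  then obtain X ax where X: "X:Ob C" and ax: "ax:Hom C X Y" and U: "U<=Comp C T X Y ax ` Hom C T X"
   and W: "ALL W. K.subsp W-->U<=W-->(ALL w:W. ALL f:Hom C T T. Comp C T T Y w f:W) -->
    Comp C T X Y ax ` Hom C T X<=W"
   by (elim bexE conjE) (rule that)
  have Us: "K.subsp U" by (rule K.fin_over_subsp) fact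
  obtain Z i1 i2 p1 p2 where "binary_biproduct C T X Z i1 i2 p1 p2"
   using biproducts T X unfolding has_biproducts_def by blast
  note b = this[unfolded binary_biproduct_def]
  have w: "w:Hom C T Y" by fact
  define bt where "bt = Hadd C Z Y (Comp C Z T Y w p1) (Comp C Z X Y ax p2)"
  have bt: "bt:Hom C Z Y" using b w ax Y by (simp add: bt_def hs)
  have btx: "Comp C T Z Y bt x = Hadd C T Y (Comp C T T Y w (Comp C T Z T p1 x)) (Comp C T X Y ax (Comp C T Z X p2 x))"
   if "x:Hom C T Z" for x using that b w ax Y T by (simp add: bt_def hs distrib ca)
  have i1: "Comp C T Z Y bt i1 = w" using b w ax Y T by (simp add: btx hs)
  have i2: "Comp C T Z Y bt (Comp C T X Z i2 x) = Comp C T X Y ax x" if "x:Hom C T X" for x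
  proof -
   have "Comp C T Z T p1 (Comp C T X Z i2 x) = Hzero C T T" "Comp C T Z X p2 (Comp C T X Z i2 x) = x"
    using b T that ca[of T X Z T x i2 p1] ca[of T X Z X x i2 p2] by (auto simp: hs)
   then show ?thesis using b w ax Y T that by (simp add: btx hs)
  qed
  have "K.adjoin U w<=Comp C T Z Y bt ` Hom C T Z"
  proof (rule K.adjoin_subset)
   show "K.subsp (Comp C T Z Y bt ` Hom C T Z)" using post_subsp b bt Y by blast
   show "w:Comp C T Z Y bt ` Hom C T Z" using i1 b by (metis imageI)
   show "U<=Comp C T Z Y bt ` Hom C T Z"
   proof
    fix y assume "y:U"
    then obtain x where x: "x:Hom C T X" "y = Comp C T X Y ax x" using U by blast
    then have "y = Comp C T Z Y bt (Comp C T X Z i2 x)" using i2 by simp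
    moreover have "Comp C T X Z i2 x:Hom C T Z" using x b T by (simp add: hs)
    ultimately show "y:Comp C T Z Y bt ` Hom C T Z" by blast
   qed
  qed
  moreover have "Comp C T Z Y bt ` Hom C T Z<=W" if s: "K.subsp W" "K.adjoin U w<=W"
   and cl: "ALL w:W. ALL f:Hom C T T. Comp C T T Y w f:W" for W
  proof
   fix y assume "y:Comp C T Z Y bt ` Hom C T Z"
   then obtain x where x: "x:Hom C T Z" "y = Comp C T Z Y bt x" by blast
   have "U<=W" "w:W"
    using s(2) K.subset_adjoin[of U w] K.mem_adjoin[of U w] Us w by (auto simp: K.subsp_def)
   moreover have "Comp C T X Y ax ` Hom C T X<=W" using W s(1) \<open>U \<subseteq> W\<close> cl by simp
   moreover have "Comp C T Z T p1 x:Hom C T T" "Comp C T Z X p2 x:Hom C T X" using x b T by (auto simp: hs)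
   ultimately show "y:W" unfolding x(2) btx[OF x(1)] using s(1) cl unfolding K.subsp_def by blast
  qed
  ultimately show ?case using b bt by (intro bexI[of _ Z] bexI[of _ bt]) auto
 qed
qed

text \<open>N is a quotient of some Hom(T, Y). The kernel is stable under the endomorphisms of T and
  finite dimensional, hence the image of a morphism \<open>ax\<close>. N and the chosen cokernel of
  \<open>ax\<close> are then quotients by the same kernel, which gives mutually inverse
  matrices.\<close>

lemma coker_functor_dense:
 assumes "N:Ob (MC R)"
 shows "EX P:Ob (abelianization C). iso_objects (MC R) (omap cok P) N"
proof -
 obtain n rx where N: "N = (n, rx)" and m: "MS R n rx" using assms by (auto simp: module_category_def)
 obtain Y q where Y: "Y:Ob C" and q: "equivariant Y n rx q" and "CV n<=q ` Hom C T Y"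
  using generated_by_T[OF m fin_over_vec] by blast
 then have surj: "q ` Hom C T Y = CV n" using eqv_carrier[OF q] by blast
 interpret K: kspace "Hom C T Y" "Hadd C T Y" "Hscale C T Y" "Hzero C T Y" by (rule spaceT[OF Y])
 define W where "W = {y:Hom C T Y. q y = 0\<^sub>v n}"
 have W: "K.subsp W" unfolding K.subsp_def W_def
  by (auto simp: K.closed eqv_zero[OF q Y] eqv_add[OF q] eqv_scale[OF q])
 have Wc: "ALL w:W. ALL f:Hom C T T. Comp C T T Y w f:W"
 proof (intro ballI)
  fix w f assume w: "w:W" and f: "f:Hom C T T"
  have "rx (u f):CM n n" using m u_closed[OF f] by (simp add: module_structure_def)
  then have "rx (u f) *v 0\<^sub>v n = 0\<^sub>v n" by (auto intro!: eq_vecI)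
  then show "Comp C T T Y w f:W" using w f Y T by (simp add: W_def hs eqv_act[OF q])
 qed
 have "K.fin_over {Hzero C T Y} W" by (rule K.fin_over_subspace[OF fin_hom[OF Y] W]) (auto simp: W_def)
 from covered_by_T[OF Y this] obtain X ax where X: "X:Ob C" "ax:Hom C X Y"
  and 1: "W<=Comp C T X Y ax ` Hom C T X"
  and 2: "ALL W'. K.subsp W'-->W<=W'-->(ALL w:W'. ALL f:Hom C T T. Comp C T T Y w f:W') -->
   Comp C T X Y ax ` Hom C T X<=W'" by (elim bexE conjE) (rule that)
 have WX: "Comp C T X Y ax ` Hom C T X = W"
  using 1 2[THEN spec[of _ W], THEN mp, OF W, THEN mp, OF subset_refl, THEN mp, OF Wc] by (rule equalityI[rotated])
 define P where "P = (X, ax, Y)"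
 have P: "(X, ax, Y):Ob (abelianization C)" using X Y by (simp add: abelianization_def)
 obtain n' rx' where M: "MM P = (n', rx')" by (cases "MM P")
 note e = eqvs[OF P P, folded P_def, unfolded M fst_conv snd_conv] and ker = kernels(1)[OF P P, folded P_def, unfolded M fst_conv WX]
 have kk: "QQ P y = 0\<^sub>v n'\<longleftrightarrow>q y = 0\<^sub>v n" if "y:Hom C T Y" for y using ker[OF that] that by (simp add: W_def)
 obtain a where a: "a:CM n n'" "ALL y:Hom C T Y. a *v QQ P y = q y"
  using K.vlin_factor[OF eqv_vlin[OF e(1)] e(5) eqv_vlin[OF q]] kk by blast
 obtain b where b: "b:CM n' n" "ALL y:Hom C T Y. b *v q y = QQ P y"
  using K.vlin_factor[OF eqv_vlin[OF q] surj eqv_vlin[OF e(1)]] kk by blast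
 have eq1: "M1 = M2" if "M1:CM k n'" "M2:CM k n'"
  "!!y. y:Hom C T Y ==> M1 *v QQ P y = M2 *v QQ P y" for M1 M2 k
  by (rule mat_eq_by_vecs[OF that(1,2)]) (use that(3) e(5) in "metis imageE")
 have eq2: "M1 = M2" if "M1:CM k n" "M2:CM k n"
  "!!y. y:Hom C T Y ==> M1 *v q y = M2 *v q y" for M1 M2 k
  by (rule mat_eq_by_vecs[OF that(1,2)]) (use that(3) surj in "metis imageE")
 have qc: "QQ P y:CV n'" "q y:CV n" if "y:Hom C T Y" for y
  using eqv_carrier[OF e(1) that] eqv_carrier[OF q that] .
 have ba: "b * a = 1\<^sub>m n'"
  by (rule eq1) (use a b qc in "auto simp: assoc_mult_mat_vec[of b n' n a n']")
 have ab: "a * b = 1\<^sub>m n"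
  by (rule eq2) (use a b qc in "auto simp: assoc_mult_mat_vec[of a n n' b n]")
 have rc: "rx r:CM n n" "rx' r:CM n' n'" if "r:carrier R" for r
  using m e(3) that by (auto simp: module_structure_def)
 have act: "q (Comp C T T Y y (v r)) = rx r *v q y" "QQ P (Comp C T T Y y (v r)) = rx' r *v QQ P y"
  if "y:Hom C T Y" "r:carrier R" for y r
  using eqv_act[OF q that(1) v_hom[OF that(2)]] eqv_act[OF e(1) that(1) v_hom[OF that(2)]] u_v[OF that(2)] by auto
 have yv: "Comp C T T Y y (v r):Hom C T Y" if "y:Hom C T Y" "r:carrier R" for y r
  using that v_hom Y T by (simp add: hs)
 have "a * rx' r = rx r * a" if r: "r:carrier R" for r
 proof (rule eq1)
  fix y assume y: "y:Hom C T Y"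
  have "(a * rx' r) *v QQ P y = a *v QQ P (Comp C T T Y y (v r))" using a rc[OF r] qc[OF y] act[OF y r] by simp
  also have "\<dots> = q (Comp C T T Y y (v r))" using a(2) yv[OF y r] by blast
  also have "\<dots> = rx r *v q y" by (rule act(1)[OF y r])
  also have "\<dots> = (rx r * a) *v QQ P y"
   using a rc[OF r] qc[OF y] y assoc_mult_mat_vec[of "rx r" n n a n' "QQ P y"] by simp
  finally show "(a * rx' r) *v QQ P y = (rx r * a) *v QQ P y" .
 qed (use a rc[OF r] in auto)
 moreover have "b * rx r = rx' r * b" if r: "r:carrier R" for r
 proof (rule eq2)
  fix y assume y: "y:Hom C T Y"
  have "(b * rx r) *v q y = b *v q (Comp C T T Y y (v r))" using b rc[OF r] qc[OF y] act[OF y r] by simp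
  also have "\<dots> = QQ P (Comp C T T Y y (v r))" using b(2) yv[OF y r] by blast
  also have "\<dots> = rx' r *v QQ P y" by (rule act(2)[OF y r])
  also have "\<dots> = (rx' r * b) *v q y"
   using b rc[OF r] qc[OF y] y assoc_mult_mat_vec[of "rx' r" n' n' b n "q y"] by simp
  finally show "(b * rx r) *v q y = (rx' r * b) *v q y" .
 qed (use b rc[OF r] in auto)
 ultimately have "iso_objects (MC R) (MM P) N"
  using a(1) b(1) ab ba by (auto simp: iso_objects_def module_category_def M N)
 then show ?thesis using P unfolding P_def by (auto simp: cok_def)
qed

theorem coker_functor_equivalence:
 "equivalence_of_categories (abelianization C) (MC R) cok"
 unfolding equivalence_of_categories_def
proof (intro conjI ballI)
 fix P P' assume P: "P:Ob (abelianization C)" "P':Ob (abelianization C)"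
 obtain X ax Y X' ax' Y' where PX: "P = (X, ax, Y)" "P' = (X', ax', Y')" by (cases P; cases P')
 note P = P[unfolded PX]
 have "mmap cok P P' ` Hom (abelianization C) P P' = Hom (MC R) (MM P) (MM P')"
  using full[OF P] mmap_hom(1)[OF P] unfolding PX by blast
 then show "bij_betw (mmap cok P P') (Hom (abelianization C) P P')
   (Hom (MC R) (omap cok P) (omap cok P'))"
  using faithful[OF P] by (simp add: bij_betw_def PX cok_def)
qed (use coker_functor_linear coker_functor_dense in auto)

text \<open>The object 0 \<rightarrow> F goes to Hom(T, F) itself, as nothing is divided out. The
  left ideal generated by \<open>u ep\<close> consists of the endomorphisms ep f, and composing with
  \<open>p\<close> carries these bijectively onto Hom(T, F), with inverse given by
  \<open>s\<close>.\<close>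

lemma coker_functor_projective:
 assumes Z: "zero_object C Z" and F: "F:Ob C" and ep: "p:Hom C T F" "s:Hom C F T"
  and ps: "Comp C F T F p s = Ident C F" and sp: "Comp C T F T s p = ep"
 shows "iso_to_principal_left R (omap cok (Z, Hzero C Z F, F)) (u ep)"
proof -
 define P where "P = (Z, Hzero C Z F, F)"
 have ZO: "Z:Ob C" using Z by (simp add: zero_object_def)
 have P: "(Z, Hzero C Z F, F):Ob (abelianization C)" using ZO F by (simp add: abelianization_def hs)
 obtain n rx where M: "MM P = (n, rx)" by (cases "MM P")
 note e = eqvs[OF P P, folded P_def, unfolded M fst_conv snd_conv] and ker = kernels(1)[OF P P, folded P_def, unfolded M fst_conv]
 have "Comp C T Z F (Hzero C Z F) ` Hom C T Z = {Hzero C T F}"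
  by (rule image_eq_singleton[OF zero_hom[OF T ZO]]) (use ZO F T in "simp add: hs")
 note ker = ker[unfolded this]
 interpret K: kspace "Hom C T F" "Hadd C T F" "Hscale C T F" "Hzero C T F" by (rule spaceT[OF F])
 have inj: "y = y'" if "y:Hom C T F" "y':Hom C T F" "QQ P y = QQ P y'" for y y'
  using K.vlin_diff[OF eqv_vlin[OF e(1)] that(1,2)] that K.diff_zero_eq ker K.closed by simp
 have eph: "ep:Hom C T T" using ep F T unfolding sp[symmetric] by (simp add: hs)
 have pep: "Comp C T T F p (Comp C T T T ep f) = Comp C T T F p f" if f: "f:Hom C T T" for f
 proof -
  have "Comp C T T F p (Comp C T T T ep f) = Comp C T F F (Comp C F T F p s) (Comp C T T F p f)"
   unfolding sp[symmetric] using f ep F T by (simp add: ca hs)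
  then show ?thesis using f ep F T ps by (simp add: hs)
 qed
 have sep: "Comp C T T T ep f = Comp C T F T s (Comp C T T F p f)" if f: "f:Hom C T T" for f
  unfolding sp[symmetric] using f ep F T by (simp add: ca)
 have pl: "principal_left R (u ep) = (%f. u (Comp C T T T ep f)) ` Hom C T T"
 proof -
  have "a\<otimes>\<^bsub>R\<^esub>u ep = u (Comp C T T T ep (v a))" if "a:carrier R" for a
   using that eph by (simp add: u_comp v_hom u_v)
  moreover have "u (Comp C T T T ep f) = u f\<otimes>\<^bsub>R\<^esub>u ep" if "f:Hom C T T" for f
   using that eph by (simp add: u_comp)
  ultimately show ?thesis unfolding principal_left_def image_def using v_hom u_closed
   by (intro Collect_cong) blast
 qed
 define th where "th x = QQ P (Comp C T T F p (v x))" for x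
 have th: "th (u (Comp C T T T ep f)) = QQ P (Comp C T T F p f)" if f: "f:Hom C T T" for f
  using f eph T by (simp add: th_def v_u pep hs)
 have pf: "Comp C T T F p f:Hom C T F" if "f:Hom C T T" for f using that ep F T by (simp add: hs)
 have sub: "x:carrier R" if "x:principal_left R (u ep)" for x
  using that eph T u_closed by (auto simp: pl hs)
 have "inj_on th (principal_left R (u ep))"
 proof (rule inj_onI)
  fix x x' assume "x:principal_left R (u ep)" "x':principal_left R (u ep)" and eq: "th x = th x'"
  then obtain f f' where f: "f:Hom C T T" "x = u (Comp C T T T ep f)" "f':Hom C T T" "x' = u (Comp C T T T ep f')"
   by (auto simp: pl)
  then have "Comp C T T F p f = Comp C T T F p f'" using eq th inj pf by simp
  then show "x = x'" using f sep by simp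
 qed
 moreover have "th ` principal_left R (u ep) = CV n"
 proof (intro equalityI subsetI)
  fix w assume "w:th ` principal_left R (u ep)"
  then show "w:CV n" using th pf eqv_carrier[OF e(1)] by (auto simp: pl)
 next
  fix w :: "'k vec" assume "w:CV n"
  then obtain y where y: "y:Hom C T F" "w = QQ P y" using e(5) by blast
  define f where "f = Comp C T F T s y"
  have f: "f:Hom C T T" using y ep F T by (simp add: f_def hs)
  have "Comp C T T F p f = Comp C T F F (Comp C F T F p s) y"
   unfolding f_def using y ep F T by (simp add: ca)
  then have "w = th (u (Comp C T T T ep f))" using y F T th[OF f] by (simp add: ps hs)
  then show "w:th ` principal_left R (u ep)" using f by (auto simp: pl)
 qed
 moreover have "th (x\<oplus>\<^bsub>R\<^esub>y) = th x + th y" if "x:principal_left R (u ep)" "y:principal_left R (u ep)" for x y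
  using sub[OF that(1)] sub[OF that(2)] v_hom ep F T pf
  by (simp add: th_def v_add distrib eqv_add[OF e(1)])
 moreover have "th (a\<otimes>\<^bsub>R\<^esub>x) = rx a *v th x" if "a:carrier R" "x:principal_left R (u ep)" for a x
 proof -
  note x = sub[OF that(2)]
  have "Comp C T T F p (v (a\<otimes>\<^bsub>R\<^esub>x)) = Comp C T T F (Comp C T T F p (v x)) (v a)"
   using that x v_hom ep F T by (simp add: v_mult ca)
  then show ?thesis using eqv_act[OF e(1) pf[OF v_hom[OF x]] v_hom[OF that(1)]] u_v[OF that(1)]
   by (simp add: th_def)
 qed
 ultimately have "iso_to_principal_left R (MM P) (u ep)"
  unfolding iso_to_principal_left_def M by (auto simp: bij_betw_def)
 then show ?thesis by (simp add: cok_def P_def)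
qed

end

section \<open>Tensor functors and the Eilenberg--Watts correspondence\<close>

text \<open>Flattens a pair of indices (i, j) to t = i n + j, for the model of a tensor product over
  the field on column vectors of length d n.\<close>

lemma sum_div_mod:
 "(\<Sum>t<d * n. f (t div n) (t mod n)) = (\<Sum>i<d. \<Sum>j<n. (f i j :: 'a::comm_monoid_add))" for n :: nat
proof -
 have "(\<Sum>t = i * n..<i * n + n. f (t div n) (t mod n)) = (\<Sum>j<n. f i j)" for i
 proof -
  have "(\<Sum>t = 0 + i * n..<n + i * n. f (t div n) (t mod n)) = (\<Sum>j = 0..<n. f i j)"
   unfolding sum.shift_bounds_nat_ivl by (intro sum.cong) auto
  then show ?thesis by (simp add: add.commute lessThan_atLeast0)
 qed
 then show ?thesis unfolding sum.nat_group[symmetric] by simp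
qed

locale function_algebra = ring A for A :: "('k::field, 'x=>'k) module" (structure) +
 assumes carrier_subspace: "fsubspace (carrier A)"
  and carrier_fin: "EX S. finite S & carrier A<=spt S"
  and add_eq: "add A = (+)" and zero_eq: "zero A = 0" and smult_eq: "smult A = fscale"
  and scale_mult: "a:carrier A ==> b:carrier A ==> fscale c a\<otimes>b = fscale c (a\<otimes>b)"
  and mult_scale: "a:carrier A ==> b:carrier A ==> a\<otimes>fscale c b = fscale c (a\<otimes>b)"
begin

lemma carrier_add: "a:carrier A ==> b:carrier A ==> a + b:carrier A"
 using carrier_subspace by (simp add: fsubspace_iff)

lemma carrier_scale: "a:carrier A ==> fscale c a:carrier A"
 using carrier_subspace by (simp add: fsubspace_iff)

lemma carrier_zero: "0:carrier A"
 using carrier_subspace by (simp add: fsubspace_iff)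

lemma add_mult: "a:carrier A ==> b:carrier A ==> d:carrier A ==> (a + b)\<otimes>d = a\<otimes>d + b\<otimes>d"
 using l_distr by (simp add: add_eq)

lemma mult_add: "a:carrier A ==> b:carrier A ==> d:carrier A ==> d\<otimes>(a + b) = d\<otimes>a + d\<otimes>b"
 using r_distr by (simp add: add_eq)

end

locale fd_bimodule = function_algebra A for A :: "('k::field, 'x=>'k) module" (structure) +
 fixes B :: "('k, 'x=>'k, 'y) bimod"
 assumes b_subspace: "fsubspace (bC B)"
  and b_fin: "EX S. finite S & bC B<=spt S"
  and lact_closed: "a:carrier A ==> b:bC B ==> lact B a b:bC B"
  and ract_closed: "a:carrier A ==> b:bC B ==> ract B b a:bC B"
  and lact_add: "a:carrier A ==> b:bC B ==> b':bC B ==>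
   lact B a (b + b') = lact B a b + lact B a b'"
  and lact_scale: "a:carrier A ==> b:bC B ==> lact B a (fscale c b) = fscale c (lact B a b)"
  and add_lact: "a:carrier A ==> a':carrier A ==> b:bC B ==>
   lact B (a + a') b = lact B a b + lact B a' b"
  and scale_lact: "a:carrier A ==> b:bC B ==> lact B (fscale c a) b = fscale c (lact B a b)"
  and mult_lact: "a:carrier A ==> a':carrier A ==> b:bC B ==>
   lact B (a\<otimes>a') b = lact B a (lact B a' b)"
  and one_lact: "b:bC B ==> lact B \<one> b = b"
  and ract_add: "a:carrier A ==> b:bC B ==> b':bC B ==>
   ract B (b + b') a = ract B b a + ract B b' a"
  and ract_scale: "a:carrier A ==> b:bC B ==> ract B (fscale c b) a = fscale c (ract B b a)"
  and add_ract: "a:carrier A ==> a':carrier A ==> b:bC B ==>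
   ract B b (a + a') = ract B b a + ract B b a'"
  and scale_ract: "a:carrier A ==> b:bC B ==> ract B b (fscale c a) = fscale c (ract B b a)"
  and mult_ract: "a:carrier A ==> a':carrier A ==> b:bC B ==>
   ract B b (a\<otimes>a') = ract B (ract B b a) a'"
  and one_ract: "b:bC B ==> ract B b \<one> = b"
  and lact_ract: "a:carrier A ==> a':carrier A ==> b:bC B ==>
   lact B a (ract B b a') = ract B (lact B a b) a'"
begin

lemma b_add: "b:bC B ==> b':bC B ==> b + b':bC B"
 using b_subspace by (simp add: fsubspace_iff)

lemma b_scale: "b:bC B ==> fscale c b:bC B"
 using b_subspace by (simp add: fsubspace_iff)

lemma b_coordinates:
 "EX d q q'. vlin (bC B) (+) fscale d q & (ALL b:bC B. q' (q b) = b) &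
  (ALL x:CV d. q' x:bC B & q (q' x) = x)"
proof -
 interpret K: kspace "bC B" "(+)" fscale 0 by (rule kspace_fun[OF b_subspace])
 obtain S where "finite S" "bC B<=spt S" using b_fin by blast
 from K.coordinates[OF fin_over_fun[OF b_subspace this]] obtain d q
  where q: "vlin (bC B) (+) fscale d q" "bij_betw q (bC B) (CV d)" by blast
 show ?thesis
  using q(1) bij_betw_inv_into_left[OF q(2)] bij_betw_inv_into_right[OF q(2)]
   bij_betw_apply[OF bij_betw_inv_into[OF q(2)]]
  by (intro exI[of _ d] exI[of _ q] exI[of _ "inv_into (bC B) q"]) auto
qed

end

section \<open>Tensor products of bimodules with modules\<close>

lemma balD:
 assumes "balanced_map A B (n, rx) m ga"
 shows "b:bC B ==> x:CV n ==> ga b x:CV m"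
  and "b:bC B ==> b':bC B ==> x:CV n ==> ga (b + b') x = ga b x + ga b' x"
  and "b:bC B ==> x:CV n ==> x':CV n ==> ga b (x + x') = ga b x + ga b x'"
  and "b:bC B ==> x:CV n ==> ga (fscale c b) x = c .*v ga b x"
  and "b:bC B ==> x:CV n ==> ga b (c .*v x) = c .*v ga b x"
  and "b:bC B ==> x:CV n ==> a:carrier A ==> ga (ract B b a) x = ga b (rx a *v x)"
 using assms unfolding balanced_map_def prod.case by blast+

lemma balanced_mapI:
 assumes "!!b x. b:bC B ==> x:CV n ==> ga b x:CV m"
  and "!!b b' x. b:bC B ==> b':bC B ==> x:CV n ==> ga (b + b') x = ga b x + ga b' x"
  and "!!b x x'. b:bC B ==> x:CV n ==> x':CV n ==> ga b (x + x') = ga b x + ga b x'"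
  and "!!b x c. b:bC B ==> x:CV n ==> ga (fscale c b) x = c .*v ga b x"
  and "!!b x c. b:bC B ==> x:CV n ==> ga b (c .*v x) = c .*v ga b x"
  and "!!b x a. b:bC B ==> x:CV n ==> a:carrier A ==> ga (ract B b a) x = ga b (rx a *v x)"
 shows "balanced_map A B (n, rx) m ga"
 unfolding balanced_map_def prod.case using assms by blast

lemma balanced_map_mult:
 assumes ga: "balanced_map A B (n, rx) m ga" and M: "M:CM l m"
  and rx: "!!a. a:carrier A ==> rx a:CM n n"
 shows "balanced_map A B (n, rx) l (%b x. M *v ga b x)"
proof -
 note g = balD[OF ga]
 show ?thesis
  by (rule balanced_mapI)
   (use M g(1) rx in "auto simp: g(2-6) mult_add_distrib_mat_vec[OF M] mult_mat_vec[OF M]")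
qed

text \<open>The uniqueness half of the universal property, detached from any particular balanced
  map. Equalities of matrices out of a tensor product are checked by it on elementary
  tensors.\<close>

definition spans_tensor :: "('k::field, 'a, 'x) bimod=>nat=>nat=>(('x=>'k)=>'k vec=>'k vec)=>bool" where
 "spans_tensor B n m bt\<longleftrightarrow>(ALL l. ALL M:CM l m. ALL M':CM l m.
   (ALL b:bC B. ALL x:CV n. M *v bt b x = M' *v bt b x)-->M = M')"

lemma spans_tensorD:
 "spans_tensor B n m bt ==> M:CM l m ==> M':CM l m ==>
  (!!b x. b:bC B ==> x:CV n ==> M *v bt b x = M' *v bt b x) ==> M = M'"
 unfolding spans_tensor_def by blast

lemma is_tensor_product_iff:
 assumes "MS A n rx"
 shows "is_tensor_product A B (n, rx) (m, si) bt\<longleftrightarrow>balanced_map A B (n, rx) m bt &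
   (ALL a:carrier A. ALL b:bC B. ALL x:CV n. bt (lact B a b) x = si a *v bt b x) &
   spans_tensor B n m bt &
   (ALL l ga. balanced_map A B (n, rx) l ga -->
    (EX h:CM l m. ALL b:bC B. ALL x:CV n. h *v bt b x = ga b x))"
  (is "?L\<longleftrightarrow>?R")
proof
 assume L: ?L
 have r: "rx a:CM n n" if "a:carrier A" for a using assms that by (auto simp: module_structure_def)
 have b: "balanced_map A B (n, rx) m bt" using L by (simp add: is_tensor_product_def)
 have u: "EX! h. h:CM l m & (ALL b:bC B. ALL x:CV n. h *v bt b x = ga b x)"
  if "balanced_map A B (n, rx) l ga" for l ga
  using L that unfolding is_tensor_product_def prod.case by blast
 have "spans_tensor B n m bt"
  unfolding spans_tensor_def
 proof (intro allI ballI impI)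
  fix l M M' assume M: "M:CM l m" "M':CM l m"
   "ALL b:bC B. ALL x:CV n. M *v bt b x = M' *v bt b x"
  have "balanced_map A B (n, rx) l (%b x. M *v bt b x)" by (rule balanced_map_mult[OF b M(1)]) (rule r)
  from u[OF this] obtain N where
   N: "ALL h. h:CM l m & (ALL b:bC B. ALL x:CV n. h *v bt b x = M *v bt b x)-->h = N"
   by (elim ex1E conjE) (rule that)
  have "M = N" by (rule N[rule_format]) (use M(1) in simp)
  moreover have "M' = N" by (rule N[rule_format]) (use M in simp)
  ultimately show "M = M'" by simp
 qed
 then show ?R using L u unfolding is_tensor_product_def prod.case by blast
next
 assume R: ?R
 have "EX! h. h:CM l m & (ALL b:bC B. ALL x:CV n. h *v bt b x = ga b x)"
  if "balanced_map A B (n, rx) l ga" for l ga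
 proof -
  obtain h where h: "h:CM l m" "ALL b:bC B. ALL x:CV n. h *v bt b x = ga b x"
   using R \<open>balanced_map A B (n, rx) l ga\<close> by blast
  have sp: "spans_tensor B n m bt" using R by blast
  show ?thesis
  proof (rule ex1I[of _ h])
   show "h:CM l m & (ALL b:bC B. ALL x:CV n. h *v bt b x = ga b x)" using h by blast
   fix h' assume h': "h':CM l m & (ALL b:bC B. ALL x:CV n. h' *v bt b x = ga b x)"
   show "h' = h" by (rule spans_tensorD[OF sp, where l = l]) (use h h' in simp_all)
  qed
 qed
 then show ?L using R unfolding is_tensor_product_def prod.case by blast
qed

context fd_bimodule
begin

text \<open>Over the field, the tensor product of B with the module is a space of column vectors of
  length d n. It is divided by the common kernel of the linear maps that all balanced maps induce on
  it; the balancing relations lie in this kernel automatically, so no relations have to be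
  listed.\<close>

lemma universal_balanced_map:
 assumes X: "MS A n rx"
 shows "EX m bt. balanced_map A B (n, rx) m bt & spans_tensor B n m bt &
   (ALL l ga. balanced_map A B (n, rx) l ga -->
    (EX h:CM l m. ALL b:bC B. ALL x:CV n. h *v bt b x = ga b x))"
proof -
 have rx: "rx a:CM n n" if "a:carrier A" for a using X that by (auto simp: module_structure_def)
 obtain d q q' where q: "vlin (bC B) (+) fscale d q" and q'q: "!!b. b:bC B ==> q' (q b) = b"
  and qq': "!!x. x:CV d ==> q' x:bC B" "!!x. x:CV d ==> q (q' x) = x"
  using b_coordinates by blast
 have qB: "q b:CV d" "q (b + b') = q b + q b'" "q (fscale c b) = c .*v q b"
  if "b:bC B" "b':bC B" for b b' c using q that by (auto simp: vlin_def)
 have q'lin: "q' (x + y) = q' x + q' y" if "x:CV d" "y:CV d" for x y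
  using that qq' qB(2)[of "q' x" "q' y"] q'q[of "q' x + q' y"] b_add by simp
 have q'lin': "q' (c .*v x) = fscale c (q' x)" if "x:CV d" for x c
  using that qq' qB(3)[of "q' x" "q' x" c] q'q[of "fscale c (q' x)"] b_scale by simp
 define bas where "bas i = q' (unit_vec d i)" for i
 have bas: "bas i:bC B" "q (bas i) = unit_vec d i" for i using qq' by (auto simp: bas_def)
 \<comment> \<open>\<open>bt0\<close> is the elementary tensor over the field in coordinates, and
   \<open>h0\<close> below is the matrix of the linear map induced by \<open>ga\<close>, read off
   from the values on pairs of basis vectors.\<close>
 define bt0 where "bt0 b x = vec (d * n) (%t. q b $ (t div n) * x $ (t mod n))" for b x
 define h0 where "h0 l ga = mat l (d * n) (%(r, t). ga (bas (t div n)) (unit_vec n (t mod n)) $ r)"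
  for l and ga :: "('y=>'k)=>'k vec=>'k vec"
 have dm: "t div n < d" "t mod n < n" if "t < d * n" for t
  using that by (auto simp: less_mult_imp_div_less) (metis mod_less_divisor mult_0_right not_less_zero gr0I)
 have h0c: "h0 l ga:CM l (d * n)" for l ga by (simp add: h0_def)
 have bt0c: "bt0 b x:CV (d * n)" for b x by (simp add: bt0_def)
 have h0: "h0 l ga *v bt0 b x = ga b x" if ga: "balanced_map A B (n, rx) l ga" and b: "b:bC B"
  and x: "x:CV n" for l ga b x
 proof (rule eq_vecI)
  note g = balD[OF ga]
  fix r assume "r < dim_vec (ga b x)"
  then have r: "r < l" using g(1)[OF b x] by simp
  have ex: "ga b y $ r = (\<Sum>j<n. ga b (unit_vec n j) $ r * y $ j)" if b: "b:bC B" and y: "y:CV n" for b y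
  proof -
   have "vlin (CV n) (+) (\<cdot>\<^sub>v) l (ga b)" using g b by (simp add: vlin_def)
   from vlin_matrix[OF this] obtain M where M: "M:CM l n" "ALL x:CV n. M *v x = ga b x" ..
   have "(M *v y) $ r = (\<Sum>j<n. M $$ (r, j) * y $ j)"
    using M(1) y r by (auto simp: scalar_prod_def lessThan_atLeast0 intro!: sum.cong)
   then have "ga b y $ r = (\<Sum>j<n. M $$ (r, j) * y $ j)" using M(2) y by simp
   also have "\<dots> = (\<Sum>j<n. ga b (unit_vec n j) $ r * y $ j)"
   proof (rule sum.cong[OF refl])
    fix j assume "j:{..<n}"
    then show "M $$ (r, j) * y $ j = ga b (unit_vec n j) $ r * y $ j"
     using mult_mat_vec_unit[OF M(1) r, of j] M(2) by simp
   qed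
   finally show ?thesis .
  qed
  have ex': "ga b y $ r = (\<Sum>i<d. ga (bas i) y $ r * q b $ i)" if y: "y:CV n" for y
  proof -
   have "vlin (CV d) (+) (\<cdot>\<^sub>v) l (%w. ga (q' w) y)"
    using g qq' q'lin q'lin' y by (simp add: vlin_def)
   from vlin_matrix[OF this] obtain M where M: "M:CM l d" "ALL w:CV d. M *v w = ga (q' w) y" ..
   have "ga b y = M *v q b" using M(2) qB(1)[OF b b] q'q[OF b] by simp
   then have "ga b y $ r = (\<Sum>i<d. M $$ (r, i) * q b $ i)"
    using M(1) qB(1)[OF b b] r by (auto simp: scalar_prod_def lessThan_atLeast0 intro!: sum.cong)
   also have "\<dots> = (\<Sum>i<d. ga (bas i) y $ r * q b $ i)"
   proof (rule sum.cong[OF refl])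
    fix i assume "i:{..<d}"
    then show "M $$ (r, i) * q b $ i = ga (bas i) y $ r * q b $ i"
     using mult_mat_vec_unit[OF M(1) r, of i] M(2) by (simp add: bas_def)
   qed
   finally show ?thesis .
  qed
  have "(h0 l ga *v bt0 b x) $ r = (\<Sum>t<d * n. ga (bas (t div n)) (unit_vec n (t mod n)) $ r * (q b $ (t div n) * x $ (t mod n)))"
   using r by (auto simp: h0_def bt0_def scalar_prod_def lessThan_atLeast0 intro!: sum.cong)
  also have "\<dots> = (\<Sum>i<d. \<Sum>j<n. ga (bas i) (unit_vec n j) $ r * (q b $ i * x $ j))"
   by (rule sum_div_mod[where f = "%i j. ga (bas i) (unit_vec n j) $ r * (q b $ i * x $ j)"])
  also have "\<dots> = (\<Sum>i<d. ga (bas i) x $ r * q b $ i)"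
   unfolding ex[OF bas(1) x] sum_distrib_right by (intro sum.cong refl) (simp add: mult_ac)
  finally show "(h0 l ga *v bt0 b x) $ r = ga b x $ r" using ex'[OF x] by simp
 qed (use balD(1)[OF ga b x] in "auto simp: h0_def")
 interpret V: kspace "CV (d * n)" "(+)" "(\<cdot>\<^sub>v)" "0\<^sub>v (d * n) :: 'k vec" by (rule kspace_vec)
 define W where "W = {y:CV (d * n). ALL l ga. balanced_map A B (n, rx) l ga-->h0 l ga *v y = 0\<^sub>v l}"
 have z: "M *v 0\<^sub>v (d * n) = 0\<^sub>v l" if "M:CM l (d * n)" for M :: "'k mat" and l
  using that by (auto intro!: eq_vecI)
 have "V.subsp W"
  unfolding V.subsp_def W_def
  by (auto simp: z[OF h0c] mult_add_distrib_mat_vec[OF h0c] mult_mat_vec[OF h0c])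
 then obtain m P S where P: "P:CM m (d * n)" "S:CM (d * n) m" "P * S = 1\<^sub>m m"
  and ker: "ALL x:CV (d * n). P *v x = 0\<^sub>v m\<longleftrightarrow>x:W" using vec_quotient by blast
 define bt where "bt b x = P *v bt0 b x" for b x
 have PW: "P *v x = P *v y" if "x:CV (d * n)" "y:CV (d * n)"
  "!!l ga. balanced_map A B (n, rx) l ga ==> h0 l ga *v x = h0 l ga *v y" for x y
 proof -
  have "h0 l ga *v (x - y) = 0\<^sub>v l" if "balanced_map A B (n, rx) l ga" for l ga
  proof -
   have "h0 l ga *v y:CV l" by (rule mult_mat_vec_carrier[OF h0c]) fact
   then show ?thesis
    using \<open>balanced_map A B (n, rx) l ga \<Longrightarrow> h0 l ga *\<^sub>v x = h0 l ga *\<^sub>v y\<close> that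
     mult_minus_distrib_mat_vec[OF h0c \<open>x \<in> _\<close> \<open>y \<in> _\<close>, of l ga] by simp
  qed
  then have "x - y:W" using that by (simp add: W_def)
  then have "P *v (x - y) = 0\<^sub>v m" using ker that(1,2) by simp
  then have "P *v x - P *v y = 0\<^sub>v m"
   unfolding mult_minus_distrib_mat_vec[OF P(1) that(1,2)] .
  then show ?thesis 
   using vec_diff_zero[OF mult_mat_vec_carrier[OF P(1) that(1)] mult_mat_vec_carrier[OF P(1) that(2)]] by blast
 qed
 have bt: "balanced_map A B (n, rx) m bt"
 proof (rule balanced_mapI)
  fix b and x :: "'k vec" assume b: "b:bC B" and x: "x:CV n"
  show "bt b x:CV m" unfolding bt_def by (rule mult_mat_vec_carrier[OF P(1) bt0c])
  have "bt0 (fscale c b) x = c .*v bt0 b x" "bt0 b (c .*v x) = c .*v bt0 b x" for c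
   using b x qB(1,3)[OF b b] by (auto simp: bt0_def dm intro!: eq_vecI)
  then show "bt (fscale c b) x = c .*v bt b x" "bt b (c .*v x) = c .*v bt b x" for c
   unfolding bt_def by (simp_all add: mult_mat_vec[OF P(1) bt0c])
  show "bt (b + b') x = bt b x + bt b' x" if b': "b':bC B" for b'
  proof -
   have "bt0 (b + b') x = bt0 b x + bt0 b' x"
    using b x qB(1,2)[OF b b'] qB(1)[OF b' b'] by (auto simp: bt0_def dm distrib_right intro!: eq_vecI)
   then show ?thesis unfolding bt_def by (simp add: mult_add_distrib_mat_vec[OF P(1) bt0c bt0c])
  qed
  show "bt b (x + x') = bt b x + bt b x'" if x': "x':CV n" for x'
  proof -
   have "bt0 b (x + x') = bt0 b x + bt0 b x'"
    using b x x' by (auto simp: bt0_def dm distrib_left intro!: eq_vecI)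
   then show ?thesis unfolding bt_def by (simp add: mult_add_distrib_mat_vec[OF P(1) bt0c bt0c])
  qed
  show "bt (ract B b a) x = bt b (rx a *v x)" if a: "a:carrier A" for a
   unfolding bt_def
  proof (rule PW[OF bt0c bt0c])
   fix l ga assume g: "balanced_map A B (n, rx) l ga"
   show "h0 l ga *v bt0 (ract B b a) x = h0 l ga *v bt0 b (rx a *v x)"
    using h0[OF g ract_closed[OF a b] x] h0[OF g b mult_mat_vec_carrier[OF rx[OF a] x]]
     balD(6)[OF g b x a] by simp
  qed
 qed
 moreover have "spans_tensor B n m bt"
  unfolding spans_tensor_def
 proof (intro allI ballI impI)
  fix l and M M' :: "'k mat" assume M: "M:CM l m" "M':CM l m"
   and eq: "ALL b:bC B. ALL x:CV n. M *v bt b x = M' *v bt b x"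
  have "M * P = M' * P"
  proof (rule eq_matI)
   fix i t assume "i < dim_row (M' * P)" "t < dim_col (M' * P)"
   then have it: "i < l" "t < d * n" using M P by auto
   \<comment> \<open>Every unit vector is an elementary tensor of two basis vectors, so agreement on
     elementary tensors is agreement on a basis.\<close>
   have u: "unit_vec (d * n) t = bt0 (bas (t div n)) (unit_vec n (t mod n))"
   proof (rule eq_vecI)
    fix s assume "s < dim_vec (bt0 (bas (t div n)) (unit_vec n (t mod n)))"
    then have s: "s < d * n" by (simp add: bt0_def)
    have "s = t\<longleftrightarrow>s div n = t div n & s mod n = t mod n" by (metis div_mult_mod_eq)
    then show "unit_vec (d * n) t $ s = bt0 (bas (t div n)) (unit_vec n (t mod n)) $ s"
     using s it dm[OF s] dm[OF it(2)] by (auto simp: bt0_def bas(2) unit_vec_def)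
   qed (simp add: bt0_def)
   have "(M * P) *v unit_vec (d * n) t = (M' * P) *v unit_vec (d * n) t"
    using eq M P bas(1)[of "t div n"] bt0c unfolding u bt_def by simp
   then show "(M * P) $$ (i, t) = (M' * P) $$ (i, t)"
    using mult_mat_vec_unit[OF mult_carrier_mat[OF M(1) P(1)] it]
     mult_mat_vec_unit[OF mult_carrier_mat[OF M(2) P(1)] it] by simp
  qed (use M P in auto)
  then have "M * (P * S) = M' * (P * S)"
   unfolding assoc_mult_mat[OF M(1) P(1,2), symmetric] assoc_mult_mat[OF M(2) P(1,2), symmetric] by simp
  then show "M = M'" using M unfolding P(3) by simp
 qed
 moreover have "EX h:CM l m. ALL b:bC B. ALL x:CV n. h *v bt b x = ga b x"
  if g: "balanced_map A B (n, rx) l ga" for l ga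
 \<comment> \<open>\<open>S\<close> lifts the quotient back to column vectors of length d n. Which
   lift is taken does not affect the result, as \<open>h0 l ga\<close> vanishes on the kernel of
   \<open>P\<close>.\<close>
 proof (intro bexI[of _ "h0 l ga * S"] ballI)
  show "h0 l ga * S:CM l m" by (rule mult_carrier_mat[OF h0c P(2)])
  fix b and x :: "'k vec" assume b: "b:bC B" and x: "x:CV n"
  define y where "y = S *v bt b x"
  have bc: "bt b x:CV m" unfolding bt_def by (rule mult_mat_vec_carrier[OF P(1) bt0c])
  have y: "y:CV (d * n)" unfolding y_def by (rule mult_mat_vec_carrier[OF P(2) bc])
  have "P *v y = (P * S) *v bt b x" unfolding y_def by (rule assoc_mult_mat_vec[OF P(1,2) bc, symmetric])
  then have "P *v y = P *v bt0 b x" using bc unfolding P(3) by (simp add: bt_def)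
  then have "P *v (y - bt0 b x) = 0\<^sub>v m"
   using mult_minus_distrib_mat_vec[OF P(1) y bt0c] mult_mat_vec_carrier[OF P(1) bt0c] by simp
  then have "y - bt0 b x:W" using ker y bt0c by simp
  then have "h0 l ga *v (y - bt0 b x) = 0\<^sub>v l" using g by (simp add: W_def)
  then have "h0 l ga *v y - h0 l ga *v bt0 b x = 0\<^sub>v l"
   using mult_minus_distrib_mat_vec[OF h0c y bt0c] by simp
  then have "h0 l ga *v y = ga b x"
   using h0[OF g b x] vec_diff_zero[OF mult_mat_vec_carrier[OF h0c y] mult_mat_vec_carrier[OF h0c bt0c]] by metis
  then show "(h0 l ga * S) *v bt b x = ga b x"
   unfolding y_def using assoc_mult_mat_vec[OF h0c P(2) bc] by simp
 qed
 ultimately show ?thesis by blast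
qed

text \<open>An algebra element a acts by b \<otimes> x \<mapsto> a b \<otimes> x, which is balanced
  because the two actions on B commute. The module laws then hold on elementary tensors.\<close>

lemma tensor_product_exists:
 assumes X: "MS A n rx"
 shows "EX m si bt. MS A m si & is_tensor_product A B (n, rx) (m, si) bt"
proof -
 have rx: "rx a:CM n n" if "a:carrier A" for a using X that by (auto simp: module_structure_def)
 obtain m bt where bt: "balanced_map A B (n, rx) m bt" and sp: "spans_tensor B n m bt"
  and un: "!!l ga. balanced_map A B (n, rx) l ga ==>
    EX h:CM l m. ALL b:bC B. ALL x:CV n. h *v bt b x = ga b x"
  using universal_balanced_map[OF X] by blast
 note g = balD[OF bt]
 have "EX h:CM m m. ALL b:bC B. ALL x:CV n. h *v bt b x = bt (lact B a b) x"
  if a: "a:carrier A" for a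
  by (rule un, rule balanced_mapI)
   (use g a rx lact_closed ract_closed in "auto simp: lact_add lact_scale lact_ract")
 then obtain si where si: "!!a. a:carrier A ==> si a:CM m m"
  and s: "!!a b x. a:carrier A ==> b:bC B ==> x:CV n ==> si a *v bt b x = bt (lact B a b) x"
  by metis
 have "MS A m si"
  unfolding module_structure_def
 proof (intro conjI ballI allI)
  show "si \<one> = 1\<^sub>m m"
   by (rule spans_tensorD[OF sp si[OF one_closed] one_carrier_mat]) (use g s in "auto simp: one_lact")
  fix a assume a: "a:carrier A"
  show "si a:CM m m" by (rule si[OF a])
  show "si (c\<odot>a) = c \<cdot>\<^sub>m si a" for c
   by (rule spans_tensorD[OF sp, where l = m])
    (use si a g s lact_closed carrier_scale in "auto simp: smult_eq scale_lact smult_mat_vec[OF si]")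
  fix b assume b: "b:carrier A"
  show "si (a\<oplus>b) = si a + si b"
   by (rule spans_tensorD[OF sp, where l = m])
    (use si a b g s lact_closed carrier_add in "auto simp: add_eq add_lact add_mult_distrib_mat_vec[OF si si]")
  show "si (a\<otimes>b) = si a * si b"
   by (rule spans_tensorD[OF sp, where l = m])
    (use si a b g s lact_closed mult_carrier_mat[OF si[OF a] si[OF b]] in
     \<open>auto simp: mult_lact assoc_mult_mat_vec[OF si si]\<close>)
 qed
 moreover have "is_tensor_product A B (n, rx) (m, si) bt"
  unfolding is_tensor_product_iff[OF X] using bt sp un s by simp
 ultimately show ?thesis by blast
qed

end

text \<open>\<open>is_tensor_functor\<close> with its universal maps \<open>bt\<close> named, since
  natural transformations are going to be described in terms of these maps.\<close>

definition tens ::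
 "('k::field, 'a) module=>('k, 'a, 'x) bimod=>('k, 'a) endofunctor =>
  (('k, 'a) fdmod=>('x=>'k)=>'k vec=>'k vec)=>bool" where
 "tens A B F bt\<longleftrightarrow>LF (MC A) (MC A) F &
   (ALL X:Ob (MC A). is_tensor_product A B X (omap F X) (bt X)) &
   (ALL X:Ob (MC A). ALL Y:Ob (MC A). ALL f:Hom (MC A) X Y.
    ALL b:bC B. ALL x:CV (fst X). mmap F X Y f *v bt X b x = bt Y b (f *v x))"

lemma is_tensor_functor_iff: "is_tensor_functor A B F\<longleftrightarrow>(EX bt. tens A B F bt)"
 unfolding is_tensor_functor_def tens_def by blast

lemma tfs:
 assumes t: "tens A B F bt" and X: "MS A n rx"
 shows "MS A (fst (omap F (n, rx))) (snd (omap F (n, rx)))"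
  and "balanced_map A B (n, rx) (fst (omap F (n, rx))) (bt (n, rx))"
  and "a:carrier A ==> b:bC B ==> x:CV n ==>
   bt (n, rx) (lact B a b) x = snd (omap F (n, rx)) a *v bt (n, rx) b x"
  and "spans_tensor B n (fst (omap F (n, rx))) (bt (n, rx))"
  and "balanced_map A B (n, rx) l ga ==>
    EX h:CM l (fst (omap F (n, rx))). ALL b:bC B. ALL x:CV n. h *v bt (n, rx) b x = ga b x"
  and "b:bC B ==> x:CV n ==> bt (n, rx) b x:CV (fst (omap F (n, rx)))"
proof -
 have XO: "(n, rx):Ob (MC A)" using X by (simp add: module_category_def)
 obtain m si where F: "omap F (n, rx) = (m, si)" by (cases "omap F (n, rx)")
 have "omap F (n, rx):Ob (MC A)" using t XO by (auto simp: tens_def intro: lf_ob)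
 then show "MS A (fst (omap F (n, rx))) (snd (omap F (n, rx)))" by (simp add: F module_category_def)
 have "is_tensor_product A B (n, rx) (m, si) (bt (n, rx))" using t XO F unfolding tens_def by metis
 note i = this[unfolded is_tensor_product_iff[OF X]]
 then show "balanced_map A B (n, rx) (fst (omap F (n, rx))) (bt (n, rx))"
  "a:carrier A ==> b:bC B ==> x:CV n ==>
   bt (n, rx) (lact B a b) x = snd (omap F (n, rx)) a *v bt (n, rx) b x"
  "spans_tensor B n (fst (omap F (n, rx))) (bt (n, rx))"
  "balanced_map A B (n, rx) l ga ==>
    EX h:CM l (fst (omap F (n, rx))). ALL b:bC B. ALL x:CV n. h *v bt (n, rx) b x = ga b x"
  "b:bC B ==> x:CV n ==> bt (n, rx) b x:CV (fst (omap F (n, rx)))"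
  unfolding F fst_conv snd_conv using balD(1) by blast+
qed

lemma tens_map:
 assumes "tens A B F bt" "MS A n rx" "MS A m si"
  "f:Hom (MC A) (n, rx) (m, si)" "b:bC B" "x:CV n"
 shows "mmap F (n, rx) (m, si) f *v bt (n, rx) b x = bt (m, si) b (f *v x)"
 using assms unfolding tens_def by (auto simp: module_category_def)

lemma tens_mmap_carrier:
 assumes "tens A B F bt" "MS A n rx" "MS A m si"
  "f:Hom (MC A) (n, rx) (m, si)"
 shows "mmap F (n, rx) (m, si) f:CM (fst (omap F (m, si))) (fst (omap F (n, rx)))"
proof -
 have "mmap F (n, rx) (m, si) f:Hom (MC A) (omap F (n, rx)) (omap F (m, si))"
  using assms by (intro lf_hom[of "MC A" "MC A" F]) (auto simp: tens_def module_category_def)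
 then show ?thesis by (auto simp: module_category_def split: prod.splits)
qed

text \<open>After choosing a tensor product for every module, a homomorphism f acts by b \<otimes> x
  \<mapsto> b \<otimes> f x; functoriality and linearity are checked on elementary tensors.\<close>

lemma (in fd_bimodule) tensor_functor_exists: "EX F. is_tensor_functor A B F"
proof -
 let ?C = "MC A"
 have "EX M bt. X:Ob ?C-->M:Ob ?C & is_tensor_product A B X M bt" for X
 proof (cases "X:Ob ?C")
  case True
  then obtain n rx where X: "X = (n, rx)" "MS A n rx" by (auto simp: module_category_def)
  from tensor_product_exists[OF X(2)] show ?thesis unfolding X(1) by (auto simp: module_category_def)
 qed simp
 then obtain M bt where M: "!!X. X:Ob ?C ==> M X:Ob ?C" "!!X. X:Ob ?C ==> is_tensor_product A B X (M X) (bt X)"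
  by metis
 have P: "balanced_map A B X (fst (M X)) (bt X)" "spans_tensor B (fst X) (fst (M X)) (bt X)"
  "!!l ga. balanced_map A B X l ga ==>
    EX h:CM l (fst (M X)). ALL b:bC B. ALL x:CV (fst X). h *v bt X b x = ga b x"
  "!!a b x. a:carrier A ==> b:bC B ==> x:CV (fst X) ==>
    bt X (lact B a b) x = snd (M X) a *v bt X b x"
  "MS A (fst (M X)) (snd (M X))"
  "MS A (fst X) (snd X)"
  if XO: "X:Ob ?C" for X
 proof -
  obtain n rx m si where X: "X = (n, rx)" "MS A n rx" "M X = (m, si)" "MS A m si"
   using XO M(1)[OF XO] by (cases X; cases "M X") (auto simp: module_category_def)
  have "is_tensor_product A B (n, rx) (m, si) (bt X)" using M(2)[OF XO] X by simp
  note i = this[unfolded is_tensor_product_iff[OF X(2)]]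
  show "balanced_map A B X (fst (M X)) (bt X)" "spans_tensor B (fst X) (fst (M X)) (bt X)"
   "!!l ga. balanced_map A B X l ga ==>
    EX h:CM l (fst (M X)). ALL b:bC B. ALL x:CV (fst X). h *v bt X b x = ga b x"
   "!!a b x. a:carrier A ==> b:bC B ==> x:CV (fst X) ==>
    bt X (lact B a b) x = snd (M X) a *v bt X b x"
   "MS A (fst (M X)) (snd (M X))" "MS A (fst X) (snd X)"
   using i X(2,4) unfolding X(3) fst_conv snd_conv unfolding X(1) fst_conv snd_conv by blast+
 qed
 have Bc: "bt X b x:CV (fst (M X))" if "X:Ob ?C" "b:bC B" "x:CV (fst X)" for X b x
  using P(1)[OF that(1)] that(2,3) balD(1) by (metis prod.collapse)
 have act: "bt X (ract B b a) x = bt X b (snd X a *v x)" "bt X b (x + x') = bt X b x + bt X b x'"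
  "bt X b (c .*v x) = c .*v bt X b x" "bt X (fscale c b) x = c .*v bt X b x"
  if "X:Ob ?C" "b:bC B" "x:CV (fst X)" "x':CV (fst X)" "a:carrier A" for X b x a x' c
  using P(1)[OF that(1)] that(2-5) balD(3-6)[of A B "fst X" "snd X"] by (metis prod.collapse)+
 have add: "bt X (b + b') x = bt X b x + bt X b' x"
  if "X:Ob ?C" "b:bC B" "b':bC B" "x:CV (fst X)" for X b b' x
  using P(1)[OF that(1)] that(2-4) balD(2)[of A B "fst X" "snd X"] by (metis prod.collapse)
 have homD: "f:CM (fst Y) (fst X)" "a:carrier A ==> f * snd X a = snd Y a * f"
  if "f:Hom ?C X Y" for f X Y a using that by (cases X; cases Y; auto simp: module_category_def)+
 have homI: "f:Hom ?C X Y" if "f:CM (fst Y) (fst X)" "!!a. a:carrier A ==> f * snd X a = snd Y a * f"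
  for f X Y using that by (cases X; cases Y) (auto simp: module_category_def)
 have mats: "snd X a:CM (fst X) (fst X)" "snd (M X) a:CM (fst (M X)) (fst (M X))"
  if "X:Ob ?C" "a:carrier A" for X a using P(5,6)[OF that(1)] that(2) by (auto simp: module_structure_def)
 have "EX h:CM (fst (M Y)) (fst (M X)). ALL b:bC B. ALL x:CV (fst X). h *v bt X b x = bt Y b (f *v x)"
  if X: "X:Ob ?C" and Y: "Y:Ob ?C" and f: "f:Hom ?C X Y" for X Y f
 proof (rule P(3)[OF X])
  note fc = homD(1)[OF f]
  have fx: "f *v x:CV (fst Y)" if "x:CV (fst X)" for x by (rule mult_mat_vec_carrier[OF fc that])
  have "balanced_map A B (fst X, snd X) (fst (M Y)) (%b x. bt Y b (f *v x))"
  proof (rule balanced_mapI)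
   fix b and x :: "'k vec" assume b: "b:bC B" and x: "x:CV (fst X)"
   show "bt Y b (f *v x):CV (fst (M Y))" using Bc[OF Y b fx[OF x]] .
   show "bt Y (b + b') (f *v x) = bt Y b (f *v x) + bt Y b' (f *v x)" if "b':bC B" for b'
    by (rule add[OF Y b that fx[OF x]])
   show "bt Y b (f *v (x + x')) = bt Y b (f *v x) + bt Y b (f *v x')" if "x':CV (fst X)" for x'
    unfolding mult_add_distrib_mat_vec[OF fc x that] by (rule act(2)[OF Y b fx[OF x] fx[OF that] carrier_zero])
   show "bt Y (fscale c b) (f *v x) = c .*v bt Y b (f *v x)" for c
    by (rule act(4)[OF Y b fx[OF x] fx[OF x] carrier_zero])
   show "bt Y b (f *v (c .*v x)) = c .*v bt Y b (f *v x)" for c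
    unfolding mult_mat_vec[OF fc x] by (rule act(3)[OF Y b fx[OF x] fx[OF x] carrier_zero])
   show "bt Y (ract B b a) (f *v x) = bt Y b (f *v (snd X a *v x))" if a: "a:carrier A" for a
   proof -
    have "f *v (snd X a *v x) = (f * snd X a) *v x"
     by (rule assoc_mult_mat_vec[OF fc mats(1)[OF X a] x, symmetric])
    also have "\<dots> = snd Y a *v (f *v x)"
     unfolding homD(2)[OF f a] by (rule assoc_mult_mat_vec[OF mats(1)[OF Y a] fc x])
    finally show ?thesis using act(1)[OF Y b fx[OF x] fx[OF x] a] by simp
   qed
  qed
  then show "balanced_map A B X (fst (M Y)) (%b x. bt Y b (f *v x))" by simp
 qed
 then obtain mx where mx: "!!X Y f. X:Ob ?C ==> Y:Ob ?C ==> f:Hom ?C X Y ==> mx X Y f:CM (fst (M Y)) (fst (M X))"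
  and mxbt: "!!X Y f b x. X:Ob ?C ==> Y:Ob ?C ==> f:Hom ?C X Y ==> b:bC B ==> x:CV (fst X) ==>
   mx X Y f *v bt X b x = bt Y b (f *v x)" by metis
 define F where "F = \<lparr>omap = M, mmap = mx\<rparr>"
 note eqI = spans_tensorD[OF P(2)]
 interpret Cat: linear_category ?C by (rule module_linear_category)
 have Fl: "LF ?C ?C F"
  unfolding linear_functor_def
 proof (intro conjI ballI allI)
  fix X assume X: "X:Ob ?C"
  show "omap F X:Ob ?C" using M(1)[OF X] by (simp add: F_def)
  have id: "Ident ?C Y = 1\<^sub>m (fst Y)" for Y by (cases Y) (simp add: module_category_def)
  show "mmap F X X (Ident ?C X) = Ident ?C (omap F X)"
   unfolding F_def lfunctor.simps id
   by (rule eqI[OF X, where l = "fst (M X)"]) (use mx[OF X X] mxbt[OF X X] Cat.ident_hom[OF X] Bc[OF X] in "auto simp: id")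
 next
  fix X Y f assume X: "X:Ob ?C" and Y: "Y:Ob ?C" and f: "f:Hom ?C X Y"
  note fc = homD(1)[OF f] and m = mx[OF X Y f] and mb = mxbt[OF X Y f]
  have fx: "f *v x:CV (fst Y)" if "x:CV (fst X)" for x by (rule mult_mat_vec_carrier[OF fc that])
  have "mx X Y f:Hom ?C (M X) (M Y)"
  proof (rule homI[OF m])
   fix a assume a: "a:carrier A"
   show "mx X Y f * snd (M X) a = snd (M Y) a * mx X Y f"
   proof (rule eqI[OF X])
    show "mx X Y f * snd (M X) a:CM (fst (M Y)) (fst (M X))" "snd (M Y) a * mx X Y f:CM (fst (M Y)) (fst (M X))"
     using m mats(2)[OF X a] mats(2)[OF Y a] by auto
    fix b and x :: "'k vec" assume b: "b:bC B" and x: "x:CV (fst X)"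
    have "(mx X Y f * snd (M X) a) *v bt X b x = mx X Y f *v bt X (lact B a b) x"
     unfolding P(4)[OF X a b x] by (rule assoc_mult_mat_vec[OF m mats(2)[OF X a] Bc[OF X b x]])
    also have "\<dots> = snd (M Y) a *v (mx X Y f *v bt X b x)"
     using mb[OF lact_closed[OF a b] x] mb[OF b x] P(4)[OF Y a b fx[OF x]] by simp
    also have "\<dots> = (snd (M Y) a * mx X Y f) *v bt X b x"
     by (rule assoc_mult_mat_vec[OF mats(2)[OF Y a] m Bc[OF X b x], symmetric])
    finally show "(mx X Y f * snd (M X) a) *v bt X b x = (snd (M Y) a * mx X Y f) *v bt X b x" .
   qed
  qed
  then show "mmap F X Y f:Hom ?C (omap F X) (omap F Y)" by (simp add: F_def)
  have ops: "Hadd ?C X Y = (%f g. f + g)" "Hscale ?C X Y = (%c f. c \<cdot>\<^sub>m f)" "Comp ?C X Y Z = (%g f. g * f)" for X Y Z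
   by (auto simp: module_category_def)
  show "mmap F X Y (Hscale ?C X Y c f) = Hscale ?C (omap F X) (omap F Y) c (mmap F X Y f)" for c
   unfolding F_def lfunctor.simps ops
  proof (rule eqI[OF X])
   have cf: "c \<cdot>\<^sub>m f:Hom ?C X Y" using Cat.scale_hom[OF X Y f, of c] by (simp add: ops)
   show "mx X Y (c \<cdot>\<^sub>m f):CM (fst (M Y)) (fst (M X))" by (rule mx[OF X Y cf])
   show "c \<cdot>\<^sub>m mx X Y f:CM (fst (M Y)) (fst (M X))" using m by simp
   fix b and x :: "'k vec" assume b: "b:bC B" and x: "x:CV (fst X)"
   show "mx X Y (c \<cdot>\<^sub>m f) *v bt X b x = (c \<cdot>\<^sub>m mx X Y f) *v bt X b x"
    unfolding mxbt[OF X Y cf b x] smult_mat_vec[OF m Bc[OF X b x]] mb[OF b x] smult_mat_vec[OF fc x]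
    by (rule act(3)[OF Y b fx[OF x] fx[OF x] carrier_zero])
  qed
  show "mmap F X Y (Hadd ?C X Y f g) = Hadd ?C (omap F X) (omap F Y) (mmap F X Y f) (mmap F X Y g)"
   if g: "g:Hom ?C X Y" for g
   unfolding F_def lfunctor.simps ops
  proof (rule eqI[OF X])
   have fg: "f + g:Hom ?C X Y" using Cat.add_hom[OF X Y f g] by (simp add: ops)
   note gc = homD(1)[OF g] and m' = mx[OF X Y g]
   show "mx X Y (f + g):CM (fst (M Y)) (fst (M X))" by (rule mx[OF X Y fg])
   show "mx X Y f + mx X Y g:CM (fst (M Y)) (fst (M X))" using m m' by simp
   fix b and x :: "'k vec" assume b: "b:bC B" and x: "x:CV (fst X)"
   show "mx X Y (f + g) *v bt X b x = (mx X Y f + mx X Y g) *v bt X b x"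
    unfolding mxbt[OF X Y fg b x] add_mult_distrib_mat_vec[OF m m' Bc[OF X b x]] mb[OF b x] mxbt[OF X Y g b x]
     add_mult_distrib_mat_vec[OF fc gc x]
    by (rule act(2)[OF Y b fx[OF x] mult_mat_vec_carrier[OF gc x] carrier_zero])
  qed
  show "mmap F X Z (Comp ?C X Y Z g f) = Comp ?C (omap F X) (omap F Y) (omap F Z) (mmap F Y Z g) (mmap F X Y f)"
   if Z: "Z:Ob ?C" and g: "g:Hom ?C Y Z" for g Z
   unfolding F_def lfunctor.simps ops
  proof (rule eqI[OF X])
   have gf: "g * f:Hom ?C X Z" using Cat.comp_hom[OF X Y Z f g] by (simp add: ops)
   note gc = homD(1)[OF g] and m' = mx[OF Y Z g]
   show "mx X Z (g * f):CM (fst (M Z)) (fst (M X))" by (rule mx[OF X Z gf])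
   show "mx Y Z g * mx X Y f:CM (fst (M Z)) (fst (M X))" using m m' by simp
   fix b and x :: "'k vec" assume b: "b:bC B" and x: "x:CV (fst X)"
   show "mx X Z (g * f) *v bt X b x = (mx Y Z g * mx X Y f) *v bt X b x"
    unfolding mxbt[OF X Z gf b x] assoc_mult_mat_vec[OF m' m Bc[OF X b x]] mb[OF b x] mxbt[OF Y Z g b fx[OF x]]
     assoc_mult_mat_vec[OF gc fc x] ..
  qed
 qed
 have "tens A B F bt" unfolding tens_def using Fl M(2) mxbt by (simp add: F_def)
 then show ?thesis using is_tensor_functor_iff by blast
qed

text \<open>\<open>et\<close> is the transformation b \<otimes> x \<mapsto> \<open>fi\<close> b
  \<otimes> x. As a relation between transformations and maps of bimodules it serves both directions
  of the Eilenberg--Watts correspondence, and it constrains \<open>fi\<close> only on the carrier of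
  B.\<close>

definition EW ::
 "('k::field, 'a) module=>('k, 'a, 'x) bimod =>
  ('k, 'a) endofunctor=>(('k, 'a) fdmod=>('x=>'k)=>'k vec=>'k vec) =>
  ('k, 'a) endofunctor=>(('k, 'a) fdmod=>('y=>'k)=>'k vec=>'k vec) =>
  (('x=>'k)=>('y=>'k))=>(('k, 'a) fdmod=>'k mat)=>bool" where
 "EW A B F bt G bt' fi et\<longleftrightarrow>et:nat_trans (MC A) (MC A) F G &
   (ALL n rx. MS A n rx-->(ALL b:bC B. ALL x:CV n.
    et (n, rx) *v bt (n, rx) b x = bt' (n, rx) (fi b) x))"

lemma BHD:
 assumes "fi:BH A B B'"
 shows "x:bC B ==> fi x:bC B'"
  and "x:bC B ==> y:bC B ==> fi (x + y) = fi x + fi y"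
  and "x:bC B ==> fi (fscale c x) = fscale c (fi x)"
  and "x:bC B ==> a:carrier A ==> fi (lact B a x) = lact B' a (fi x)"
  and "x:bC B ==> a:carrier A ==> fi (ract B x a) = ract B' (fi x) a"
 using assms unfolding bimodule_homs_def by blast+

abbreviation EF :: "('k::field, 'a) module=>(('k, 'a) endofunctor, ('k, 'a) fdmod=>'k mat, 'k) lincat" where
 "EF A \<equiv> functor_category (MC A) (MC A)"

lemma EF_lin: "linear_category (EF A)"
 using linear_category.functor_linear_category[OF module_linear_category] .

lemma nt_carrier:
 assumes "et:nat_trans (MC A) (MC A) F G" "MS A n rx"
 shows "et (n, rx):CM (fst (omap G (n, rx))) (fst (omap F (n, rx)))"
  and "a:carrier A ==> et (n, rx) * snd (omap F (n, rx)) a = snd (omap G (n, rx)) a * et (n, rx)"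
 using nt_hom[OF assms(1), of "(n, rx)"] assms(2) by (auto simp: module_category_def split: prod.splits)

lemma fdmod_eqI:
 assumes "et:nat_trans (MC A) (MC A) F G"
  "th:nat_trans (MC A) (MC A) F' G'"
  "!!n rx. MS A n rx ==> et (n, rx) = th (n, rx)"
 shows "et = th"
 by (rule nt_eqI[OF assms(1,2)]) (use assms(3) in "auto simp: module_category_def")

lemma EW_unique:
 assumes F: "tens A B F bt" and e: "EW A B F bt G bt' fi et" "EW A B F bt G bt' fi' et'"
  and eq: "!!b. b:bC B ==> fi b = fi' b"
 shows "et = et'"
proof -
 note n = e[unfolded EW_def, THEN conjunct1] and f = e[unfolded EW_def, THEN conjunct2, rule_format]
 show ?thesis
 proof (rule fdmod_eqI[OF n])
  fix n rx assume X: "MS A n rx"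
  show "et (n, rx) = et' (n, rx)"
   by (rule spans_tensorD[OF tfs(4)[OF F X] nt_carrier(1)[OF n(1) X] nt_carrier(1)[OF n(2) X]])
    (use f[OF X] eq in simp)
 qed
qed

lemma EW_comp:
 assumes FGH: "LF (MC A) (MC A) F"
  "LF (MC A) (MC A) G"
  "LF (MC A) (MC A) H"
  and F: "tens A B F bt" and fi: "!!b. b:bC B ==> fi b:bC B'"
  and e: "EW A B F bt G bt' fi et" "EW A B' G bt' H bt'' gi th"
 shows "EW A B F bt H bt'' (%b. gi (fi b)) (Comp (EF A) F G H th et)"
proof -
 note n1 = e(1)[unfolded EW_def, THEN conjunct1] and f1 = e(1)[unfolded EW_def, THEN conjunct2, rule_format]
 note n2 = e(2)[unfolded EW_def, THEN conjunct1] and f2 = e(2)[unfolded EW_def, THEN conjunct2, rule_format]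
 have c: "Comp (EF A) F G H th et:nat_trans (MC A) (MC A) F H"
  using linear_category.comp_hom[OF EF_lin[of A], of F G H et th] FGH n1 n2
  by (simp add: functor_category_def)
 moreover have "Comp (EF A) F G H th et (n, rx) *v bt (n, rx) b x = bt'' (n, rx) (gi (fi b)) x"
  if X: "MS A n rx" and b: "b:bC B" and x: "x:CV n" for n rx b x
 proof -
  have "Comp (EF A) F G H th et (n, rx) = th (n, rx) * et (n, rx)"
   using X by (simp add: functor_category_def module_category_def)
  then show ?thesis
   using assoc_mult_mat_vec[OF nt_carrier(1)[OF n2 X] nt_carrier(1)[OF n1 X] tfs(6)[OF F X b x]]
    f1[OF X b x] f2[OF X fi[OF b] x] by simp
 qed
 ultimately show ?thesis unfolding EW_def by blast
qed

lemma EW_ident: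
 assumes F: "tens A B F bt"
 shows "EW A B F bt F bt (%b. b) (Ident (EF A) F)"
proof -
 have "LF (MC A) (MC A) F" using F by (simp add: tens_def)
 then have "Ident (EF A) F:nat_trans (MC A) (MC A) F F"
  using linear_category.ident_hom[OF EF_lin[of A], of F] by (simp add: functor_category_def)
 moreover have "Ident (EF A) F (n, rx) *v bt (n, rx) b x = bt (n, rx) b x"
  if X: "MS A n rx" and b: "b:bC B" and x: "x:CV n" for n rx b x
 proof -
  have "Ident (EF A) F (n, rx) = 1\<^sub>m (fst (omap F (n, rx)))"
   using X by (simp add: functor_category_def module_category_def split: prod.splits)
  then show ?thesis using tfs(6)[OF F X b x] by simp
 qed
 ultimately show ?thesis unfolding EW_def by blast
qed

lemma EW_add:
 assumes F: "tens A B F bt" and G: "tens A B' G bt'"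
  and fi: "!!b. b:bC B ==> fi b:bC B'" "!!b. b:bC B ==> gi b:bC B'"
  and e: "EW A B F bt G bt' fi et" "EW A B F bt G bt' gi th"
 shows "EW A B F bt G bt' (%b. fi b + gi b) (Hadd (EF A) F G et th)"
proof -
 note n1 = e(1)[unfolded EW_def, THEN conjunct1] and f1 = e(1)[unfolded EW_def, THEN conjunct2, rule_format]
 note n2 = e(2)[unfolded EW_def, THEN conjunct1] and f2 = e(2)[unfolded EW_def, THEN conjunct2, rule_format]
 have FG: "LF (MC A) (MC A) F" "LF (MC A) (MC A) G"
  using F G by (auto simp: tens_def)
 have c: "Hadd (EF A) F G et th:nat_trans (MC A) (MC A) F G"
  using linear_category.add_hom[OF EF_lin[of A], of F G et th] FG n1 n2
  by (simp add: functor_category_def)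
 moreover have "Hadd (EF A) F G et th (n, rx) *v bt (n, rx) b x = bt' (n, rx) (fi b + gi b) x"
  if X: "MS A n rx" and b: "b:bC B" and x: "x:CV n" for n rx b x
 proof -
  have "Hadd (EF A) F G et th (n, rx) = et (n, rx) + th (n, rx)"
   using X by (simp add: functor_category_def module_category_def split: prod.splits)
  then show ?thesis
   using add_mult_distrib_mat_vec[OF nt_carrier(1)[OF n1 X] nt_carrier(1)[OF n2 X] tfs(6)[OF F X b x]]
    f1[OF X b x] f2[OF X b x] balD(2)[OF tfs(2)[OF G X] fi(1)[OF b] fi(2)[OF b] x] by simp
 qed
 ultimately show ?thesis unfolding EW_def by blast
qed

lemma EW_scale:
 assumes F: "tens A B F bt" and G: "tens A B' G bt'"
  and fi: "!!b. b:bC B ==> fi b:bC B'"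
  and e: "EW A B F bt G bt' fi et"
 shows "EW A B F bt G bt' (%b. fscale c (fi b)) (Hscale (EF A) F G c et)"
proof -
 note n1 = e[unfolded EW_def, THEN conjunct1] and f1 = e[unfolded EW_def, THEN conjunct2, rule_format]
 have FG: "LF (MC A) (MC A) F" "LF (MC A) (MC A) G"
  using F G by (auto simp: tens_def)
 have c: "Hscale (EF A) F G c et:nat_trans (MC A) (MC A) F G"
  using linear_category.scale_hom[OF EF_lin[of A], of F G et c] FG n1
  by (simp add: functor_category_def)
 moreover have "Hscale (EF A) F G c et (n, rx) *v bt (n, rx) b x = bt' (n, rx) (fscale c (fi b)) x"
  if X: "MS A n rx" and b: "b:bC B" and x: "x:CV n" for n rx b x
 proof -
  have "Hscale (EF A) F G c et (n, rx) = c \<cdot>\<^sub>m et (n, rx)"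
   using X by (simp add: functor_category_def module_category_def split: prod.splits)
  then show ?thesis
   using smult_mat_vec[OF nt_carrier(1)[OF n1 X] tfs(6)[OF F X b x]]
    f1[OF X b x] balD(4)[OF tfs(2)[OF G X] fi[OF b] x] by simp
 qed
 ultimately show ?thesis unfolding EW_def by blast
qed

lemma EW_exists:
 fixes A :: "('k::field, 'x=>'k) module"
 assumes F: "tens A B F bt" and G: "tens A B' G bt'" and fi: "fi:BH A B B'"
  and B: "fd_bimodule A B"
 shows "EX et. EW A B F bt G bt' fi et"
proof -
 interpret fd_bimodule A B by fact
 note p = BHD[OF fi]
 have FG: "LF (MC A) (MC A) F" "LF (MC A) (MC A) G"
  using F G by (auto simp: tens_def)
 have "EX h. MS A (fst X) (snd X)-->h:CM (fst (omap G X)) (fst (omap F X)) &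
  (ALL b:bC B. ALL x:CV (fst X). h *v bt X b x = bt' X (fi b) x)" for X
 proof (cases X)
  case (Pair n rx)
  show ?thesis
  proof (cases "MS A n rx")
   case X: True
   have rx: "rx a:CM n n" if "a:carrier A" for a using X that by (auto simp: module_structure_def)
   note g = balD[OF tfs(2)[OF G X]]
   have "balanced_map A B (n, rx) (fst (omap G (n, rx))) (%b x. bt' (n, rx) (fi b) x)"
    by (rule balanced_mapI) (use g p in "simp_all")
   from tfs(5)[OF F X this] show ?thesis unfolding Pair by auto
  qed (simp add: Pair)
 qed
 then obtain h where hc: "!!n rx. MS A n rx ==> h (n, rx):CM (fst (omap G (n, rx))) (fst (omap F (n, rx)))"
  and hb: "!!n rx b x. MS A n rx ==> b:bC B ==> x:CV n ==>
   h (n, rx) *v bt (n, rx) b x = bt' (n, rx) (fi b) x" by (metis fst_conv snd_conv)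
 define et where "et = (\<lambda>X\<in>Ob (MC A). h X)"
 have "et:nat_trans (MC A) (MC A) F G"
  unfolding et_def
 proof (rule nt_restrI)
  fix X assume "X:Ob (MC A)"
  then obtain n rx where Xe: "X = (n, rx)" and X: "MS A n rx" by (auto simp: module_category_def)
  have "h (n, rx) * snd (omap F (n, rx)) a = snd (omap G (n, rx)) a * h (n, rx)" if a: "a:carrier A" for a
  proof (rule spans_tensorD[OF tfs(4)[OF F X], where l = "fst (omap G (n, rx))"])
   have m: "snd (omap F (n, rx)) a:CM (fst (omap F (n, rx))) (fst (omap F (n, rx)))"
    "snd (omap G (n, rx)) a:CM (fst (omap G (n, rx))) (fst (omap G (n, rx)))"
    using tfs(1)[OF F X] tfs(1)[OF G X] a by (auto simp: module_structure_def)
   show "h (n, rx) * snd (omap F (n, rx)) a:CM (fst (omap G (n, rx))) (fst (omap F (n, rx)))"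
    "snd (omap G (n, rx)) a * h (n, rx):CM (fst (omap G (n, rx))) (fst (omap F (n, rx)))"
    using m hc[OF X] by auto
   fix b and x :: "'k vec" assume b: "b:bC B" and x: "x:CV n"
   show "(h (n, rx) * snd (omap F (n, rx)) a) *v bt (n, rx) b x = (snd (omap G (n, rx)) a * h (n, rx)) *v bt (n, rx) b x"
    unfolding assoc_mult_mat_vec[OF hc[OF X] m(1) tfs(6)[OF F X b x]]
     assoc_mult_mat_vec[OF m(2) hc[OF X] tfs(6)[OF F X b x]]
     tfs(3)[OF F X a b x, symmetric] hb[OF X b x] hb[OF X lact_closed[OF a b] x] p(4)[OF b a]
    by (rule tfs(3)[OF G X a p(1)[OF b] x])
  qed
  then show "h X:Hom (MC A) (omap F X) (omap G X)"
   using hc[OF X] by (auto simp: Xe module_category_def split: prod.splits)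
 next
  fix X Y f assume "X:Ob (MC A)" "Y:Ob (MC A)"
   and f: "f:Hom (MC A) X Y"
  then obtain n rx m si where e: "X = (n, rx)" "Y = (m, si)" and X: "MS A n rx"
   and Y: "MS A m si" by (auto simp: module_category_def)
  note f = f[unfolded e]
  have fc: "f:CM m n" using f by (simp add: module_category_def)
  note mF = tens_mmap_carrier[OF F X Y f] and mG = tens_mmap_carrier[OF G X Y f]
  have "h (m, si) * mmap F (n, rx) (m, si) f = mmap G (n, rx) (m, si) f * h (n, rx)"
  proof (rule spans_tensorD[OF tfs(4)[OF F X]])
   show "h (m, si) * mmap F (n, rx) (m, si) f:CM (fst (omap G (m, si))) (fst (omap F (n, rx)))"
    "mmap G (n, rx) (m, si) f * h (n, rx):CM (fst (omap G (m, si))) (fst (omap F (n, rx)))"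
    using mF mG hc[OF X] hc[OF Y] by auto
   fix b and x :: "'k vec" assume b: "b:bC B" and x: "x:CV n"
   note fx = mult_mat_vec_carrier[OF fc x]
   show "(h (m, si) * mmap F (n, rx) (m, si) f) *v bt (n, rx) b x = (mmap G (n, rx) (m, si) f * h (n, rx)) *v bt (n, rx) b x"
    unfolding assoc_mult_mat_vec[OF hc[OF Y] mF tfs(6)[OF F X b x]]
     assoc_mult_mat_vec[OF mG hc[OF X] tfs(6)[OF F X b x]]
     tens_map[OF F X Y f b x] hb[OF X b x] hb[OF Y b fx] tens_map[OF G X Y f p(1)[OF b] x] ..
  qed
  then show "Comp (MC A) (omap F X) (omap F Y) (omap G Y) (h Y) (mmap F X Y f) =
   Comp (MC A) (omap F X) (omap G X) (omap G Y) (mmap G X Y f) (h X)"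
   by (simp add: module_category_def e)
 qed
 moreover have "et (n, rx) = h (n, rx)" if "MS A n rx" for n rx
  using that by (simp add: et_def module_category_def)
 ultimately show ?thesis unfolding EW_def using hb by (metis (no_types, lifting))
qed

text \<open>The algebra as a module over itself, in coordinates: \<open>e\<close> is the coordinate
  vector of 1 and \<open>c\<close> turns coordinates back into elements. The last clause is freeness
  on \<open>e\<close>.\<close>

lemma (in function_algebra) regular_module:
 "EX N ta c e. MS A N ta & e:CV N &
   (ALL x:CV N. c x:carrier A & ta (c x) *v e = x) &
   (ALL x:CV N. ALL y:CV N. c (x + y) = c x + c y) &
   (ALL x:CV N. ALL r. c (r .*v x) = fscale r (c x)) &
   (ALL a:carrier A. ALL x:CV N. c (ta a *v x) = a\<otimes>c x) & c e = \<one> &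
   (ALL n rx. MS A n rx-->(ALL x:CV n.
    EX f:Hom (MC A) (N, ta) (n, rx). f *v e = x))"
proof -
 interpret K: kspace "carrier A" "(+)" fscale 0 by (rule kspace_fun[OF carrier_subspace])
 obtain S where "finite S" "carrier A<=spt S" using carrier_fin by blast
 from K.coordinates[OF fin_over_fun[OF carrier_subspace this]] obtain N q
  where q: "vlin (carrier A) (+) fscale N q" "bij_betw q (carrier A) (CV N)" by blast
 define c where "c = inv_into (carrier A) q"
 have cq: "c (q a) = a" if "a:carrier A" for a using bij_betw_inv_into_left[OF q(2) that] by (simp add: c_def)
 have qc: "q (c x) = x" "c x:carrier A" if "x:CV N" for x
  using bij_betw_inv_into_right[OF q(2) that] bij_betw_apply[OF bij_betw_inv_into[OF q(2)] that] by (auto simp: c_def)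
 have qs: "q ` carrier A = CV N" using q(2) by (simp add: bij_betw_def)
 have ql: "q a:CV N" "q (fscale r a) = r .*v q a" if "a:carrier A" for a r
  using q(1) that by (auto simp: vlin_def)
 have qa: "q (a + b) = q a + q b" if "a:carrier A" "b:carrier A" for a b
  using q(1) that by (auto simp: vlin_def)
 have inj: "a = 0" if "a:carrier A" "q a = 0\<^sub>v N" for a
  using that cq[OF that(1)] cq[OF carrier_zero] K.vlin_zero[OF q(1)] by simp
 have "EX M:CM N N. ALL b:carrier A. M *v q b = q (a\<otimes>b)" if a: "a:carrier A" for a
 proof (rule K.vlin_factor[OF q(1) qs])
  show "vlin (carrier A) (+) fscale N (%b. q (a\<otimes>b))"
   using a ql qa carrier_add carrier_scale by (auto simp: vlin_def mult_add mult_scale)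
  fix b assume "b:carrier A" "q b = 0\<^sub>v N"
  then show "q (a\<otimes>b) = 0\<^sub>v N" using inj[of b] a r_null[OF a] K.vlin_zero[OF q(1)] by (simp add: zero_eq)
 qed
 then obtain ta where ta: "!!a. a:carrier A ==> ta a:CM N N"
  and taq: "!!a b. a:carrier A ==> b:carrier A ==> ta a *v q b = q (a\<otimes>b)" by metis
 have eqI: "M = M'" if "M:CM l N" "M':CM l N" "!!b. b:carrier A ==> M *v q b = M' *v q b"
  for M M' :: "'k mat" and l :: nat
 proof (rule mat_eq_by_vecs[OF that(1,2)])
  fix x :: "'k vec" assume "x:CV N"
  then show "M *v x = M' *v x" using that(3)[of "c x"] qc by simp
 qed
 have ms: "MS A N ta"
  unfolding module_structure_def
 proof (intro conjI ballI allI)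
  show "ta \<one> = 1\<^sub>m N"
   by (rule eqI[OF ta[OF one_closed] one_carrier_mat]) (use ql in "simp add: taq")
  fix a assume a: "a:carrier A"
  show "ta a:CM N N" by (rule ta[OF a])
  have ra: "r\<odot>a:carrier A" for r using carrier_scale[OF a] by (simp add: smult_eq)
  show "ta (r\<odot>a) = r \<cdot>\<^sub>m ta a" for r
   by (rule eqI[OF ta[OF ra] smult_carrier_mat[OF ta[OF a]]]) (use a ta carrier_scale ql in
    \<open>simp_all add: smult_eq taq smult_mat_vec[OF ta] scale_mult\<close>)
  fix b assume b: "b:carrier A"
  show "ta (a\<oplus>b) = ta a + ta b"
   by (rule eqI[OF ta[OF a_closed[OF a b]] add_carrier_mat[OF ta[OF b]]]) (use a b ta carrier_add ql in
    \<open>simp_all add: add_eq taq add_mult_distrib_mat_vec[OF ta ta] add_mult qa\<close>)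
  show "ta (a\<otimes>b) = ta a * ta b"
   by (rule eqI[OF ta[OF m_closed[OF a b]] mult_carrier_mat[OF ta[OF a] ta[OF b]]]) (use a b ta ql mult_carrier_mat[OF ta[OF a] ta[OF b]] in
    \<open>simp_all add: taq assoc_mult_mat_vec[OF ta ta] m_assoc\<close>)
 qed
 have 1: "ta (c x) *v q \<one> = x" if "x:CV N" for x using qc[OF that] by (simp add: taq)
 have 2: "c (x + y) = c x + c y" if "x:CV N" "y:CV N" for x y
  using cq[OF carrier_add[OF qc(2)[OF that(1)] qc(2)[OF that(2)]]] qc that qa[of "c x" "c y"] by simp
 have 3: "c (r .*v x) = fscale r (c x)" if "x:CV N" for x r
  using cq[OF carrier_scale[OF qc(2)[OF that]], of r] qc that ql(2)[of "c x" r] by simp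
 have 4: "c (ta a *v x) = a\<otimes>c x" if "a:carrier A" "x:CV N" for a x
  using taq[OF that(1) qc(2)[OF that(2)]] qc[OF that(2)] cq[of "a\<otimes>c x"] that(1) by simp
 have 5: "EX f:Hom (MC A) (N, ta) (n, rx). f *v q \<one> = x"
  if X: "MS A n rx" and x: "x:CV n" for n rx x
 proof -
  have rx: "rx a:CM n n" if "a:carrier A" for a using X that by (auto simp: module_structure_def)
  have rxm: "rx (a\<otimes>b) = rx a * rx b" "rx (a + b) = rx a + rx b" "rx (fscale r a) = r \<cdot>\<^sub>m rx a"
   if "a:carrier A" "b:carrier A" for a b r
   using X that unfolding module_structure_def by (auto simp: add_eq smult_eq)
  have z: "rx 0 *v x = 0\<^sub>v n"
  proof -
   have "rx (fscale 0 0) = 0 \<cdot>\<^sub>m rx 0" by (rule rxm(3)[OF carrier_zero carrier_zero])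
   moreover have "fscale 0 (0 :: 'x=>'k) = 0" by auto
   ultimately have "rx 0 = 0\<^sub>m n n" using smult_mat_zero[OF rx[OF carrier_zero]] by simp
   then show ?thesis using x by (auto intro!: eq_vecI)
  qed
  have "EX M:CM n N. ALL b:carrier A. M *v q b = rx b *v x"
  proof (rule K.vlin_factor[OF q(1) qs])
   show "vlin (carrier A) (+) fscale n (%b. rx b *v x)"
    using x rx by (auto simp: vlin_def rxm add_mult_distrib_mat_vec[OF rx rx] smult_mat_vec[OF rx]
     intro: mult_mat_vec_carrier)
   fix b assume "b:carrier A" "q b = 0\<^sub>v N"
   then show "rx b *v x = 0\<^sub>v n" using inj[of b] z by simp
  qed
  then obtain f where f: "f:CM n N" and fq: "!!b. b:carrier A ==> f *v q b = rx b *v x" by blast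
  have "f * ta a = rx a * f" if a: "a:carrier A" for a
  proof (rule eqI[OF mult_carrier_mat[OF f ta[OF a]] mult_carrier_mat[OF rx[OF a] f]])
   fix b assume b: "b:carrier A"
   show "(f * ta a) *v q b = (rx a * f) *v q b"
    unfolding assoc_mult_mat_vec[OF f ta[OF a] ql(1)[OF b]] assoc_mult_mat_vec[OF rx[OF a] f ql(1)[OF b]]
     taq[OF a b] fq[OF b] fq[OF m_closed[OF a b]] rxm(1)[OF a b] by (rule assoc_mult_mat_vec[OF rx[OF a] rx[OF b] x])
  qed
  moreover have "f *v q \<one> = x" using fq[OF one_closed] X x by (simp add: module_structure_def)
  ultimately show ?thesis using f by (auto simp: module_category_def)
 qed
 have "MS A N ta & q \<one>:CV N &
   (ALL x:CV N. c x:carrier A & ta (c x) *v q \<one> = x) &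
   (ALL x:CV N. ALL y:CV N. c (x + y) = c x + c y) &
   (ALL x:CV N. ALL r. c (r .*v x) = fscale r (c x)) &
   (ALL a:carrier A. ALL x:CV N. c (ta a *v x) = a\<otimes>c x) & c (q \<one>) = \<one> &
   (ALL n rx. MS A n rx-->(ALL x:CV n.
    EX f:Hom (MC A) (N, ta) (n, rx). f *v q \<one> = x))"
  by (intro conjI ballI allI impI ms ql(1) qc(2) 1 2 3 4 5 cq one_closed)
 then show ?thesis by (intro exI)
qed

text \<open>Tensoring B with the regular module gives B back: the map b \<otimes> x \<mapsto> b c(x)
  is inverse to b \<mapsto> b \<otimes> 1.\<close>

lemma (in fd_bimodule) eval_at_one:
 assumes G: "tens A B G bt" and La: "MS A N ta" and e: "e:CV N"
  and c: "!!x. x:CV N ==> c x:carrier A" "!!x. x:CV N ==> ta (c x) *v e = x"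
   "!!x y. x:CV N ==> y:CV N ==> c (x + y) = c x + c y"
   "!!x r. x:CV N ==> c (r .*v x) = fscale r (c x)"
   "!!a x. a:carrier A ==> x:CV N ==> c (ta a *v x) = a\<otimes>c x" "c e = \<one>"
 shows "bij_betw (%b. bt (N, ta) b e) (bC B) (CV (fst (omap G (N, ta))))"
proof -
 let ?m = "fst (omap G (N, ta))"
 obtain d q q' where q: "vlin (bC B) (+) fscale d q" and q'q: "!!b. b:bC B ==> q' (q b) = b"
  and qq': "!!x. x:CV d ==> q' x:bC B" "!!x. x:CV d ==> q (q' x) = x"
  using b_coordinates by blast
 have qB: "q b:CV d" "q (b + b') = q b + q b'" "q (fscale r b) = r .*v q b"
  if "b:bC B" "b':bC B" for b b' r using q that by (auto simp: vlin_def)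
 note g = balD[OF tfs(2)[OF G La]]
 have qact: "q (ract B b a):CV d" if "b:bC B" "a:carrier A" for a b
  using qB(1)[OF ract_closed[OF that(2,1)] that(1)] .
 have "balanced_map A B (N, ta) d (%b x. q (ract B b (c x)))"
 proof (rule balanced_mapI)
  fix b and x :: "'k vec" assume b: "b:bC B" and x: "x:CV N"
  note cx = c(1)[OF x] and r = ract_closed[OF c(1)[OF x] b]
  show "q (ract B b (c x)):CV d" by (rule qact[OF b cx])
  show "q (ract B (b + b') (c x)) = q (ract B b (c x)) + q (ract B b' (c x))" if "b':bC B" for b'
   unfolding ract_add[OF cx b that] by (rule qB(2)[OF r ract_closed[OF cx that]])
  show "q (ract B b (c (x + x'))) = q (ract B b (c x)) + q (ract B b (c x'))" if "x':CV N" for x'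
   unfolding c(3)[OF x that] add_ract[OF cx c(1)[OF that] b] by (rule qB(2)[OF r ract_closed[OF c(1)[OF that] b]])
  show "q (ract B (fscale k b) (c x)) = k .*v q (ract B b (c x))" for k
   unfolding ract_scale[OF cx b] by (rule qB(3)[OF r r])
  show "q (ract B b (c (k .*v x))) = k .*v q (ract B b (c x))" for k
   unfolding c(4)[OF x] scale_ract[OF cx b] by (rule qB(3)[OF r r])
  show "q (ract B (ract B b a) (c x)) = q (ract B b (c (ta a *v x)))" if a: "a:carrier A" for a
   unfolding c(5)[OF a x] mult_ract[OF a cx b] ..
 qed
 from tfs(5)[OF G La this] obtain h where h: "h:CM d ?m"
  and hb: "!!b x. b:bC B ==> x:CV N ==> h *v bt (N, ta) b x = q (ract B b (c x))" by blast
 have he: "h *v bt (N, ta) b e = q b" if "b:bC B" for b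
  using hb[OF that e] c(6) one_ract[OF that] by simp
 have q'l: "q' (x + y) = q' x + q' y" if "x:CV d" "y:CV d" for x y
  using that qq' qB(2)[of "q' x" "q' y"] q'q[of "q' x + q' y"] b_add by simp
 have q's: "q' (k .*v x) = fscale k (q' x)" if "x:CV d" for x k
  using that qq' qB(3)[of "q' x" "q' x" k] q'q[of "fscale k (q' x)"] b_scale by simp
 have "vlin (CV d) (+) (\<cdot>\<^sub>v) ?m (%w. bt (N, ta) (q' w) e)"
  using g qq' q'l q's e by (simp add: vlin_def)
 from vlin_matrix[OF this] obtain k where k: "k:CM ?m d"
  and kb: "ALL w:CV d. k *v w = bt (N, ta) (q' w) e" ..
 have kq: "k *v q b = bt (N, ta) b e" if "b:bC B" for b
  using kb qB(1)[OF that that] q'q[OF that] by simp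
 have bte: "bt (N, ta) b x = bt (N, ta) (ract B b (c x)) e" if "b:bC B" "x:CV N" for b x
  using g(6)[OF that(1) e c(1)[OF that(2)]] c(2)[OF that(2)] by simp
 have kh: "k * h = 1\<^sub>m ?m"
 proof (rule spans_tensorD[OF tfs(4)[OF G La], where l = ?m])
  fix b and x :: "'k vec" assume b: "b:bC B" and x: "x:CV N"
  note btc = tfs(6)[OF G La b x]
  have "(k * h) *v bt (N, ta) b x = k *v q (ract B b (c x))"
   unfolding assoc_mult_mat_vec[OF k h btc] hb[OF b x] ..
  also have "\<dots> = bt (N, ta) b x" unfolding kq[OF ract_closed[OF c(1)[OF x] b]] bte[OF b x] ..
  finally show "(k * h) *v bt (N, ta) b x = 1\<^sub>m ?m *v bt (N, ta) b x" using btc by simp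
 qed (use k h in auto)
 show ?thesis
 proof (rule bij_betwI[where g = "%w. q' (h *v w)"])
  show "(%b. bt (N, ta) b e):bC B \<rightarrow> CV ?m" using tfs(6)[OF G La _ e] by blast
  show "(%w. q' (h *v w)):CV ?m \<rightarrow> bC B" using qq'(1) mult_mat_vec_carrier[OF h] by blast
  show "q' (h *v bt (N, ta) b e) = b" if "b:bC B" for b using he q'q that by simp
  fix w :: "'k vec" assume w: "w:CV ?m"
  have hw: "h *v w:CV d" by (rule mult_mat_vec_carrier[OF h w])
  have "bt (N, ta) (q' (h *v w)) e = (k * h) *v w" using kb hw assoc_mult_mat_vec[OF k h w] by simp
  then show "bt (N, ta) (q' (h *v w)) e = w" using w by (simp add: kh)
 qed
qed

text \<open>Evaluation at the regular module defines \<open>fi\<close> by the requirement that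
  \<open>fi\<close> b \<otimes> 1 is the image of b \<otimes> 1. For a vector x of any module,
  naturality along the homomorphism that takes 1 to x carries this formula over to b \<otimes>
  x.\<close>

lemma EW_surj:
 assumes F: "tens A B F bt" and G: "tens A B' G bt'" and B: "fd_bimodule A B" and B': "fd_bimodule A B'"
  and et: "et:nat_trans (MC A) (MC A) F G"
 shows "EX fi:BH A B B'. EW A B F bt G bt' fi et"
proof -
 interpret B: fd_bimodule A B by fact
 interpret B': fd_bimodule A B' by fact
 obtain N ta c e where La: "MS A N ta" and e: "e:CV N" and
  c: "ALL x:CV N. c x:carrier A & ta (c x) *v e = x"
   "ALL x:CV N. ALL y:CV N. c (x + y) = c x + c y"
   "ALL x:CV N. ALL r. c (r .*v x) = fscale r (c x)"
   "ALL a:carrier A. ALL x:CV N. c (ta a *v x) = a\<otimes>\<^bsub>A\<^esub>c x" "c e = \<one>\<^bsub>A\<^esub>" and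
  free: "ALL n rx. MS A n rx-->(ALL x:CV n.
    EX f:Hom (MC A) (N, ta) (n, rx). f *v e = x)"
  using B.regular_module by (elim exE conjE) (rule that)
 have bij: "bij_betw (%b. bt' (N, ta) b e) (bC B') (CV (fst (omap G (N, ta))))"
  by (rule B'.eval_at_one[OF G La e, where c = c]) (use c in blast)+
 note nc = nt_carrier[OF et]
 define fi where "fi b = inv_into (bC B') (%b. bt' (N, ta) b e) (et (N, ta) *v bt (N, ta) b e)" for b
 have ete: "et (N, ta) *v bt (N, ta) b e:CV (fst (omap G (N, ta)))" if "b:bC B" for b
  by (rule mult_mat_vec_carrier[OF nc(1)[OF La] tfs(6)[OF F La that e]])
 have fic: "fi b:bC B'" and fie: "bt' (N, ta) (fi b) e = et (N, ta) *v bt (N, ta) b e" if "b:bC B" for b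
  using bij_betw_inv_into_right[OF bij ete[OF that]] bij_betw_apply[OF bij_betw_inv_into[OF bij] ete[OF that]]
  by (auto simp: fi_def)
 have main: "et (n, rx) *v bt (n, rx) b x = bt' (n, rx) (fi b) x"
  if X: "MS A n rx" and b: "b:bC B" and x: "x:CV n" for n rx b x
 proof -
  obtain f where f: "f:Hom (MC A) (N, ta) (n, rx)" and fe: "f *v e = x" using free X x by blast
  note mF = tens_mmap_carrier[OF F La X f] and mG = tens_mmap_carrier[OF G La X f]
  have nat: "et (n, rx) * mmap F (N, ta) (n, rx) f = mmap G (N, ta) (n, rx) f * et (N, ta)"
   using nt_nat[OF et, of "(N, ta)" "(n, rx)" f] f X La by (simp add: module_category_def)
  have "et (n, rx) *v bt (n, rx) b x = (et (n, rx) * mmap F (N, ta) (n, rx) f) *v bt (N, ta) b e"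
   unfolding assoc_mult_mat_vec[OF nc(1)[OF X] mF tfs(6)[OF F La b e]] tens_map[OF F La X f b e] fe ..
  also have "\<dots> = bt' (n, rx) (fi b) x"
   unfolding nat assoc_mult_mat_vec[OF mG nc(1)[OF La] tfs(6)[OF F La b e]] fie[OF b, symmetric]
    tens_map[OF G La X f fic[OF b] e] fe ..
  finally show ?thesis .
 qed
 have inj: "b = b'" if "b:bC B'" "b':bC B'" "bt' (N, ta) b e = bt' (N, ta) b' e" for b b'
  using bij that unfolding bij_betw_def inj_on_def by blast
 note gF = balD[OF tfs(2)[OF F La]] and gG = balD[OF tfs(2)[OF G La]]
 note etLa = nc(1)[OF La]
 have "fi:BH A B B'"
  unfolding bimodule_homs_def
 proof (intro CollectI ballI conjI allI)
  fix b assume b: "b:bC B"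
  note bc = tfs(6)[OF F La b e]
  show "fi b:bC B'" by (rule fic[OF b])
  show "fi (b + b') = fi b + fi b'" if b': "b':bC B" for b'
  proof (rule inj[OF fic[OF B.b_add[OF b b']] B'.b_add[OF fic[OF b] fic[OF b']]])
   show "bt' (N, ta) (fi (b + b')) e = bt' (N, ta) (fi b + fi b') e"
    unfolding gG(2)[OF fic[OF b] fic[OF b'] e] fie[OF b] fie[OF b'] fie[OF B.b_add[OF b b']] gF(2)[OF b b' e]
    by (rule mult_add_distrib_mat_vec[OF etLa bc tfs(6)[OF F La b' e]])
  qed
  show "fi (fscale r b) = fscale r (fi b)" for r
  proof (rule inj[OF fic[OF B.b_scale[OF b]] B'.b_scale[OF fic[OF b]]])
   show "bt' (N, ta) (fi (fscale r b)) e = bt' (N, ta) (fscale r (fi b)) e"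
    unfolding gG(4)[OF fic[OF b] e] fie[OF b] fie[OF B.b_scale[OF b]] gF(4)[OF b e]
    by (rule mult_mat_vec[OF etLa bc])
  qed
  fix a assume a: "a:carrier A"
  have m: "snd (omap F (N, ta)) a:CM (fst (omap F (N, ta))) (fst (omap F (N, ta)))"
   "snd (omap G (N, ta)) a:CM (fst (omap G (N, ta))) (fst (omap G (N, ta)))"
   using tfs(1)[OF F La] tfs(1)[OF G La] a by (auto simp: module_structure_def)
  show "fi (lact B a b) = lact B' a (fi b)"
  proof (rule inj[OF fic[OF B.lact_closed[OF a b]] B'.lact_closed[OF a fic[OF b]]])
   have "et (N, ta) *v (snd (omap F (N, ta)) a *v bt (N, ta) b e) =
    snd (omap G (N, ta)) a *v (et (N, ta) *v bt (N, ta) b e)"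
    unfolding assoc_mult_mat_vec[OF etLa m(1) bc, symmetric] assoc_mult_mat_vec[OF m(2) etLa bc, symmetric]
     nc(2)[OF La a] ..
   then show "bt' (N, ta) (fi (lact B a b)) e = bt' (N, ta) (lact B' a (fi b)) e"
    unfolding fie[OF B.lact_closed[OF a b]] tfs(3)[OF F La a b e] tfs(3)[OF G La a fic[OF b] e] fie[OF b] .
  qed
  \<comment> \<open>Since b a \<otimes> 1 = b \<otimes> a, right linearity is the formula
    \<open>main\<close> at the vector a of the regular module, that is, naturality along right
    multiplication by a.\<close>
  show "fi (ract B b a) = ract B' (fi b) a"
  proof (rule inj[OF fic[OF B.ract_closed[OF a b]] B'.ract_closed[OF a fic[OF b]]])
   have ae: "ta a *v e:CV N"
    using La a e by (auto simp: module_structure_def intro: mult_mat_vec_carrier)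
   show "bt' (N, ta) (fi (ract B b a)) e = bt' (N, ta) (ract B' (fi b) a) e"
    unfolding fie[OF B.ract_closed[OF a b]] gF(6)[OF b e a] gG(6)[OF fic[OF b] e a] by (rule main[OF La b ae])
  qed
 qed
 then show ?thesis using main et unfolding EW_def by blast
qed

section \<open>Path algebras\<close>

text \<open>The linear functional taking the value \<open>w p\<close> on the basis vector p.
  Elements are compared through all weights \<open>w\<close>, as in \<open>pair_eqI\<close>; this
  turns products into nested pairings and reduces associativity to a statement about single
  paths.\<close>

definition pair :: "('p=>'k::field)=>('p=>'k)=>'k" where
 "pair f w = (\<Sum>p | f p~=0. f p * w p)"

lemma pair_superset: "finite S ==> {p. f p~=0}<=S ==> pair f w = (\<Sum>p\<in>S. f p * w p)"
 unfolding pair_def by (rule sum.mono_neutral_left) auto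

lemma pair_cong: "(!!p. f p~=0 ==> w p = w' p) ==> pair f w = pair f w'"
 unfolding pair_def by (rule sum.cong) auto

lemma pair_add:
 assumes "finite {p. f p~=0}" "finite {p. g p~=0}"
 shows "pair (f + g) w = pair f w + pair g w"
proof -
 let ?S = "{p. f p~=0}\<union>{p. g p~=0}"
 have S: "finite ?S" using assms by simp
 have "pair (f + g) w = (\<Sum>p\<in>?S. (f + g) p * w p)" by (rule pair_superset[OF S]) auto
 also have "\<dots> = (\<Sum>p\<in>?S. f p * w p) + (\<Sum>p\<in>?S. g p * w p)"
  by (simp add: sum.distrib distrib_right)
 also have "\<dots> = pair f w + pair g w"
  using pair_superset[OF S, of f w] pair_superset[OF S, of g w] by simp
 finally show ?thesis .
qed

lemma pair_scale: "pair (fscale c f) w = c * pair f w"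
 by (cases "c = 0") (simp_all add: pair_def sum_distrib_left mult.assoc)

lemma pair_zero: "pair 0 w = 0" by (simp add: pair_def)

lemma pair_weight_sum: "pair f (%p. \<Sum>m\<in>V. w m p) = (\<Sum>m\<in>V. pair f (w m))"
 unfolding pair_def by (simp add: sum_distrib_left sum.swap[of _ V])

lemma pair_weight_mult: "pair f (%p. w p * c) = pair f w * c"
 unfolding pair_def by (simp add: sum_distrib_right mult.assoc)

lemma pair_weight_zero: "pair f (%p. 0) = 0" unfolding pair_def by simp

lemma pair_pvec: "pair (pvec p) w = w p"
proof -
 have "{r. pvec p r~=(0::'a)} = {p}" by (auto simp: pvec_def)
 then show ?thesis by (simp add: pair_def) (simp add: pvec_def)
qed

lemma pair_delta: "finite {p. f p~=0} ==> pair f (%p. if p = r then 1 else 0) = f r"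
 unfolding pair_def by (auto simp: if_distrib[of "%x. _ * x"] cong: if_cong)

lemma pair_eqI:
 assumes "finite {p. f p~=0}" "finite {p. g p~=0}" "!!w. pair f w = pair g w"
 shows "f = g"
 using assms(3)[of "%p. if p = _ then 1 else 0"] pair_delta[OF assms(1)] pair_delta[OF assms(2)] by (metis ext)

section \<open>The path algebra of a finite digraph\<close>

locale quiver = fin_digraph G for G :: "('v, 'e) pre_digraph"
begin

abbreviation "KG \<equiv> path_algebra G"
abbreviation kmult (infixl "**" 70) where "f ** g \<equiv> f\<otimes>\<^bsub>KG\<^esub>g"
abbreviation "oneK \<equiv> \<one>\<^bsub>KG\<^esub>"

lemma qpaths_iff: "(s, xs):qpaths G\<longleftrightarrow>awalk s xs (awlast s xs)"
 by (simp add: qpaths_def psrc_def ptgt_def)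

lemma qpath_ends: "p:qpaths G ==> psrc p:verts G & ptgt G p:verts G"
 unfolding qpaths_def by (auto intro: awalk_hd_in_verts awalk_last_in_verts)

lemma trivial_qpath: "v:verts G ==> (v, []):qpaths G"
 by (simp add: qpaths_iff awalk_Nil_iff)

lemma trivial_ends: "psrc (v, []) = v" "ptgt G (v, []) = v"
 by (simp_all add: psrc_def ptgt_def)

lemma pcomp_qpath:
 assumes "p:qpaths G" "q:qpaths G" "ptgt G q = psrc p"
 shows "pcomp p q:qpaths G" "psrc (pcomp p q) = psrc q" "ptgt G (pcomp p q) = ptgt G p"
proof -
 show "psrc (pcomp p q) = psrc q" by (simp add: pcomp_def psrc_def)
 have "awlast (fst q) (snd q @ snd p) = awlast (fst p) (snd p)"
  using assms(3) by (simp add: awlast_append ptgt_def psrc_def)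
 then show t: "ptgt G (pcomp p q) = ptgt G p" by (simp add: ptgt_def pcomp_def psrc_def)
 show "pcomp p q:qpaths G"
  using assms t unfolding qpaths_def by (auto simp: pcomp_def psrc_def ptgt_def)
qed

lemma pcomp_assoc: "pcomp (pcomp a b) c = pcomp a (pcomp b c)"
 by (simp add: pcomp_def psrc_def)

lemma pcomp_unit: "pcomp p (psrc p, []) = p" "ptgt G q = v ==> pcomp (v, []) q = q"
 by (simp_all add: pcomp_def psrc_def)

lemma carrier_KG: "f:carrier KG\<longleftrightarrow>finite {p. f p~=0} & {p. f p~=0}<=qpaths G"
 by (simp add: path_algebra_def)

lemma KG_simps: "zero KG = 0" "add KG = (+)" "smult KG = fscale"
 by (simp_all add: path_algebra_def)

text \<open>A decomposition of \<open>r\<close> is determined by the position at which its list of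
  arrows is cut.\<close>

lemma finite_decompositions:
 "finite {(p, q). p:qpaths G & q:qpaths G & ptgt G q = psrc p & pcomp p q = r}"
proof (rule finite_subset)
 let ?f = "%n. ((awlast (fst r) (take n (snd r)), drop n (snd r)), (fst r, take n (snd r)))"
 show "{(p, q). p:qpaths G & q:qpaths G & ptgt G q = psrc p & pcomp p q = r}<=?f ` {..length (snd r)}"
 proof clarify
  fix s t and xs ys :: "'e list" assume "ptgt G (t, ys) = psrc (s, xs)"
  then show "((s, xs), (t, ys)):(%n. ((awlast (fst (pcomp (s, xs) (t, ys))) (take n (snd (pcomp (s, xs) (t, ys)))), drop n (snd (pcomp (s, xs) (t, ys)))),
    (fst (pcomp (s, xs) (t, ys)), take n (snd (pcomp (s, xs) (t, ys)))))) ` {..length (snd (pcomp (s, xs) (t, ys)))}"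
   by (intro image_eqI[where x = "length ys"]) (auto simp: pcomp_def psrc_def ptgt_def)
 qed
qed simp

text \<open>With value 1 these are the structure constants of the algebra in the basis of
  paths.\<close>

definition joined :: "('v, 'e) qpath=>('v, 'e) qpath=>('v, 'e) qpath=>'k::field=>'k" where
 "joined p q r c = (if ptgt G q = psrc p & pcomp p q = r then c else 0)"

lemma mult_eval:
 assumes f: "f:carrier KG" and g: "g:carrier KG"
 shows "(f ** g) r = pair f (%p. pair g (%q. joined p q r (1 :: 'k::field)))"
proof -
 let ?D = "{(p, q). p:qpaths G & q:qpaths G & ptgt G q = psrc p & pcomp p q = r}"
 let ?P = "{p. f p~=0}\<times>{p. g p~=0}"
 have fin: "finite ?P" using f g by (simp add: carrier_KG)
 have "(f ** g) r = (\<Sum>(p, q)\<in>?D. f p * g q)" by (simp add: path_algebra_def)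
 also have "\<dots> = (\<Sum>(p, q)\<in>?D\<inter>?P. f p * g q)"
  by (rule sum.mono_neutral_right[OF finite_decompositions]) auto
 also have "\<dots> = (\<Sum>(p, q)\<in>?P. f p * (g q * joined p q r 1))"
  by (rule sum.mono_neutral_cong_left[OF fin]) (use f g in "auto simp: joined_def carrier_KG split: if_splits")
 also have "\<dots> = pair f (%p. pair g (%q. joined p q r 1))"
  by (simp add: pair_def sum.cartesian_product sum_distrib_left)
 finally show ?thesis .
qed

lemma mult_support:
 assumes f: "f:carrier KG" and g: "g:carrier KG"
 shows "{r. (f ** g) r~=(0 :: 'k::field)} <=
   (%(p, q). pcomp p q) ` {(p, q):{p. f p~=0}\<times>{p. g p~=0}. ptgt G q = psrc p}"
proof
 fix r assume "r:{r. (f ** g) r~=0}"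
 then have "pair f (%p. pair g (%q. joined p q r 1))~=0" using mult_eval[OF f g] by simp
 then obtain p where "f p~=0" "pair g (%q. joined p q r (1 :: 'k))~=0"
  unfolding pair_def[of f] by (metis (mono_tags, lifting) mem_Collect_eq mult_zero_right sum.not_neutral_contains_not_neutral)
 moreover from this obtain q where "g q~=0" "joined p q r (1 :: 'k)~=0"
  unfolding pair_def by (metis (mono_tags, lifting) mem_Collect_eq mult_zero_right sum.not_neutral_contains_not_neutral)
 ultimately show "r:(%(p, q). pcomp p q) ` {(p, q):{p. f p~=0}\<times>{p. g p~=0}. ptgt G q = psrc p}"
  by (force simp: joined_def split: if_splits)
qed

lemma mult_closed:
 assumes f: "f:carrier KG" and g: "g:carrier KG"
 shows "f ** g:carrier KG"
 unfolding carrier_KG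
proof
 have "finite ({p. f p~=0}\<times>{p. g p~=0})" using f g by (simp add: carrier_KG)
 then have "finite {(p, q):{p. f p~=0}\<times>{p. g p~=0}. ptgt G q = psrc p}"
  by (rule rev_finite_subset) auto
 then show "finite {p. (f ** g) p~=0}" by (rule finite_subset[OF mult_support[OF f g] finite_imageI])
 have "(%(p, q). pcomp p q) ` {(p, q):{p. f p~=0}\<times>{p. g p~=0}. ptgt G q = psrc p}<=qpaths G"
  using f g unfolding carrier_KG by (auto intro!: pcomp_qpath(1))
 then show "{p. (f ** g) p~=0}<=qpaths G" by (rule subset_trans[OF mult_support[OF f g]])
qed

text \<open>Summing over \<open>r\<close> collapses the structure constants to the value of the
  weight at the composite path.\<close>

lemma pair_mult:
 assumes f: "f:carrier KG" and g: "g:carrier KG"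
 shows "pair (f ** g) w = pair f (%p. pair g (%q. if ptgt G q = psrc p then w (pcomp p q) else (0 :: 'k::field)))"
proof -
 let ?K = "(%(p, q). pcomp p q) ` ({p. f p~=0}\<times>{p. g p~=0})"
 have K: "finite ?K" using f g by (simp add: carrier_KG)
 have sub: "{r. (f ** g) r~=0}<=?K" using mult_support[OF f g] by auto
 have "pair (f ** g) w = (\<Sum>r\<in>?K. pair f (%p. pair g (%q. joined p q r 1)) * w r)"
  unfolding pair_superset[OF K sub] mult_eval[OF f g] ..
 also have "\<dots> = pair f (%p. pair g (%q. \<Sum>r\<in>?K. joined p q r 1 * w r))"
  by (simp only: pair_weight_sum pair_weight_mult)
 also have "\<dots> = pair f (%p. pair g (%q. if ptgt G q = psrc p then w (pcomp p q) else 0))"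
 proof (intro pair_cong)
  fix p q assume pq: "f p~=0" "g q~=0"
  have "(\<Sum>r\<in>?K. joined p q r 1 * w r) = (\<Sum>r\<in>?K. if r = pcomp p q then (if ptgt G q = psrc p then w r else 0) else 0)"
   by (intro sum.cong) (auto simp: joined_def)
  also have "\<dots> = (if ptgt G q = psrc p then w (pcomp p q) else 0)"
   using pq by (subst sum.delta[OF K]) force
  finally show "(\<Sum>r\<in>?K. joined p q r 1 * w r) = (if ptgt G q = psrc p then w (pcomp p q) else 0)" .
 qed
 finally show ?thesis .
qed

lemma one_eval: "oneK r = (if snd r = [] & fst r:verts G then 1 else (0 :: 'k::field))"
proof -
 have "(\<Sum>v\<in>S. pvec (v, [])) r = (if snd r = [] & fst r:S then 1 else (0 :: 'k))" if "finite S" for S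
  using that by induction (auto simp: pvec_def prod_eq_iff)
 then show ?thesis using finite_verts by (simp add: path_algebra_def)
qed

lemma one_support: "{p. oneK p~=(0 :: 'k::field)} = (%v. (v, [])) ` verts G"
 by (auto simp: one_eval split: if_splits)

lemma one_KG: "oneK:carrier (KG :: ('k::field, _) module)"
 unfolding carrier_KG one_support using trivial_qpath by auto

lemma pair_one: "pair oneK w = (\<Sum>v\<in>verts G. w (v, []) :: 'k::field)"
proof -
 have "pair oneK w = (\<Sum>p\<in>(%v. (v, [])) ` verts G. oneK p * w p)"
  unfolding pair_def one_support ..
 also have "\<dots> = (\<Sum>v\<in>verts G. w (v, []))" by (subst sum.reindex) (auto simp: inj_on_def one_eval)
 finally show ?thesis .
qed

lemma fin_support: "f:carrier KG ==> finite {p. f p~=0}" by (simp add: carrier_KG)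

lemma support_qpath: "f:carrier KG ==> f p~=0 ==> p:qpaths G" by (auto simp: carrier_KG)

lemma KG_subspace: "fsubspace (carrier KG :: (('v, 'e) qpath=>'k::field) set)"
 unfolding fsubspace_iff
proof (intro conjI ballI allI)
 fix f g :: "('v, 'e) qpath=>'k" assume fg: "f:carrier KG" "g:carrier KG"
 have "{p. (f + g) p~=0}<={p. f p~=0}\<union>{p. g p~=0}" by auto
 moreover have "finite ({p. f p~=0}\<union>{p. g p~=0})" "{p. f p~=0}\<union>{p. g p~=0}<=qpaths G"
  using fg by (auto simp: carrier_KG)
 ultimately show "f + g:carrier KG" unfolding carrier_KG by (meson finite_subset subset_trans)
next
 fix c and f :: "('v, 'e) qpath=>'k" assume f: "f:carrier KG"
 have "{p. fscale c f p~=0}<={p. f p~=0}" by auto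
 then show "fscale c f:carrier KG" using f unfolding carrier_KG by (meson finite_subset subset_trans)
qed (simp add: carrier_KG)

lemma KG_closed:
 "f:carrier KG ==> g:carrier KG ==> f + g:carrier KG"
 "f:carrier KG ==> fscale (c :: 'k::field) f:carrier KG"
 "0:carrier (KG :: ('k, _) module)"
 using KG_subspace unfolding fsubspace_iff by blast+

lemma KG_eqI:
 "f:carrier KG ==> g:carrier KG ==> (!!w. pair f w = pair g (w :: _=>'k::field)) ==> f = g"
 using pair_eqI fin_support by blast

lemma ring_KG: "ring (KG :: ('k::field, ('v, 'e) qpath=>'k) module)"
proof (rule ringI)
 show "abelian_group (KG :: ('k, ('v, 'e) qpath=>'k) module)"
 proof (rule abelian_groupI)
  fix f :: "('v, 'e) qpath=>'k" assume f: "f:carrier KG"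
  have "fscale (- 1) f\<oplus>\<^bsub>KG\<^esub>f = \<zero>\<^bsub>KG\<^esub>" by (auto simp: KG_simps)
  then show "EX y:carrier KG. y\<oplus>\<^bsub>KG\<^esub>f = \<zero>\<^bsub>KG\<^esub>" using KG_closed(2)[OF f] by blast
 qed (simp_all add: KG_simps KG_closed add.assoc add.commute)
 show "monoid (KG :: ('k, ('v, 'e) qpath=>'k) module)"
 proof (rule monoidI)
  show "f ** g:carrier KG" if "f:carrier KG" "g:carrier KG"
   for f g :: "('v, 'e) qpath=>'k" using mult_closed[OF that] .
  show "oneK:carrier (KG :: ('k, ('v, 'e) qpath=>'k) module)" by (rule one_KG)
  fix f g h :: "('v, 'e) qpath=>'k" assume f: "f:carrier KG" and g: "g:carrier KG" and h: "h:carrier KG"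
  show "f ** g ** h = f ** (g ** h)"
  proof (rule KG_eqI)
   fix w :: "('v, 'e) qpath=>'k"
   have "pair (f ** g ** h) w = pair f (%p. pair g (%q. if ptgt G q = psrc p then
     pair h (%r. if ptgt G r = psrc (pcomp p q) then w (pcomp (pcomp p q) r) else 0) else 0))"
    by (simp only: pair_mult f g h mult_closed)
   also have "\<dots> = pair f (%p. pair g (%q. pair h (%r. if ptgt G r = psrc q then
     (if ptgt G (pcomp q r) = psrc p then w (pcomp p (pcomp q r)) else 0) else 0)))"
   proof (intro pair_cong)
    fix p q assume "f p~=0" "g q~=0"
    then have pq: "p:qpaths G" "q:qpaths G" using support_qpath[OF f] support_qpath[OF g] by blast+
    have "pair h (%r. if ptgt G r = psrc q then
     (if ptgt G (pcomp q r) = psrc p then w (pcomp p (pcomp q r)) else 0) else 0) =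
     pair h (%r. if ptgt G q = psrc p then if ptgt G r = psrc (pcomp p q) then w (pcomp (pcomp p q) r) else 0 else 0)"
    proof (intro pair_cong)
     fix r assume "h r~=0"
     then have "r:qpaths G" using support_qpath[OF h] by blast
     then show "(if ptgt G r = psrc q then
      (if ptgt G (pcomp q r) = psrc p then w (pcomp p (pcomp q r)) else 0) else 0) =
      (if ptgt G q = psrc p then if ptgt G r = psrc (pcomp p q) then w (pcomp (pcomp p q) r) else 0 else 0)"
      using pcomp_qpath[OF pq] pcomp_qpath[OF pq(2), of r] by (auto simp: pcomp_assoc)
    qed
    then show "(if ptgt G q = psrc p then pair h (%r. if ptgt G r = psrc (pcomp p q) then w (pcomp (pcomp p q) r) else 0) else 0) =
     pair h (%r. if ptgt G r = psrc q then
     (if ptgt G (pcomp q r) = psrc p then w (pcomp p (pcomp q r)) else 0) else 0)"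
     by (simp add: pair_weight_zero)
   qed
   also have "\<dots> = pair (f ** (g ** h)) w" by (simp only: pair_mult f g h mult_closed)
   finally show "pair (f ** g ** h) w = pair (f ** (g ** h)) w" .
  qed (use f g h mult_closed in blast)+
 next
  fix f :: "('v, 'e) qpath=>'k" assume f: "f:carrier KG"
  show "oneK ** f = f"
  proof (rule KG_eqI)
   fix w :: "('v, 'e) qpath=>'k"
   have "pair (oneK ** f) w = pair f (%q. \<Sum>v\<in>verts G. if v = ptgt G q then w (pcomp (v, []) q) else 0)"
    unfolding pair_mult[OF one_KG f] pair_one pair_weight_sum trivial_ends
    by (intro sum.cong refl pair_cong) auto
   also have "\<dots> = pair f w"
   proof (rule pair_cong)
    fix q assume "f q~=0"
    then have "ptgt G q:verts G" using qpath_ends support_qpath f by blast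
    then show "(\<Sum>v\<in>verts G. if v = ptgt G q then w (pcomp (v, []) q) else 0) = w q"
     by (simp add: pcomp_unit)
   qed
   finally show "pair (oneK ** f) w = pair f w" .
  qed (use f mult_closed one_KG in blast)+
  show "f ** oneK = f"
  proof (rule KG_eqI)
   fix w :: "('v, 'e) qpath=>'k"
   show "pair (f ** oneK) w = pair f w"
    unfolding pair_mult[OF f one_KG] pair_one trivial_ends
   proof (rule pair_cong)
    fix q assume "f q~=0"
    then have "psrc q:verts G" using qpath_ends support_qpath f by blast
    then show "(\<Sum>v\<in>verts G. if v = psrc q then w (pcomp q (v, [])) else 0) = w q"
     by (simp add: pcomp_unit)
   qed
  qed (use f mult_closed one_KG in blast)+
 qed
 fix f g h :: "('v, 'e) qpath=>'k" assume f: "f:carrier KG" and g: "g:carrier KG" and h: "h:carrier KG"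
 note c = f g h KG_closed mult_closed
 show "(f\<oplus>\<^bsub>KG\<^esub>g) ** h = f ** h\<oplus>\<^bsub>KG\<^esub>g ** h"
  unfolding KG_simps
  by (rule KG_eqI) (simp_all add: c pair_mult pair_add fin_support)
 show "h ** (f\<oplus>\<^bsub>KG\<^esub>g) = h ** f\<oplus>\<^bsub>KG\<^esub>h ** g"
  unfolding KG_simps
 proof (rule KG_eqI)
  fix w :: "('v, 'e) qpath=>'k"
  show "pair (h ** (f + g)) w = pair (h ** f + h ** g) w"
   by (simp add: c pair_mult pair_add fin_support) (simp add: pair_def sum.distrib distrib_left)
 qed (simp_all add: c)
qed

lemma KG_scale:
 assumes f: "f:carrier KG" and g: "g:carrier KG"
 shows "fscale c f ** g = fscale (c :: 'k::field) (f ** g)"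
  and "f ** fscale c g = fscale c (f ** g)"
proof -
 note cl = f g KG_closed mult_closed
 show "fscale c f ** g = fscale c (f ** g)"
  by (rule KG_eqI) (simp_all add: cl pair_mult pair_scale)
 show "f ** fscale c g = fscale c (f ** g)"
 proof (rule KG_eqI)
  fix w :: "('v, 'e) qpath=>'k"
  show "pair (f ** fscale c g) w = pair (fscale c (f ** g)) w"
   by (simp add: cl pair_mult pair_scale) (simp add: pair_def sum_distrib_left mult.left_commute)
 qed (simp_all add: cl)
qed

section \<open>Evaluation of path algebra elements on pairs of vertices\<close>

definition reach :: "'v=>'v=>bool" where
 "reach s t\<longleftrightarrow>(EX p:qpaths G. psrc p = s & ptgt G p = t)"

text \<open>Sends a path from s to t to the matrix unit at (t, s). The target comes first so that
  composition from right to left becomes matrix multiplication. The kernel turns out to be the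
  commutativity ideal.\<close>

definition ev :: "(('v, 'e) qpath=>'k::field)=>'v\<times>'v=>'k" where
 "ev f = (%(t, s). pair f (%p. if psrc p = s & ptgt G p = t then 1 else 0))"

lemma reach_verts: "reach s t ==> s:verts G & t:verts G"
 unfolding reach_def using qpath_ends by blast

lemma reach_refl: "v:verts G ==> reach v v"
 unfolding reach_def using trivial_qpath trivial_ends by blast

lemma reach_trans: "reach u v ==> reach v w ==> reach u w"
 unfolding reach_def using pcomp_qpath by metis

lemma ev_add: "f:carrier KG ==> g:carrier KG ==> ev (f + g) = ev f + ev g"
 by (auto simp: ev_def pair_add fin_support)

lemma ev_scale: "ev (fscale c f) = fscale c (ev f)"
 by (auto simp: ev_def pair_scale)

lemma ev_zero: "ev 0 = 0" by (auto simp: ev_def pair_zero)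

lemma ev_one: "ev oneK (t, s) = (if t = s & t:verts G then 1 else 0)"
proof -
 have "ev oneK (t, s) = (\<Sum>v\<in>verts G. if v = s then (if s = t then 1 else 0) else 0)"
  unfolding ev_def prod.case pair_one trivial_ends by (intro sum.cong) auto
 then show ?thesis by (auto split: if_splits)
qed

lemma ev_pvec: "ev (pvec p) (t, s) = (if psrc p = s & ptgt G p = t then 1 else 0)"
 by (simp add: ev_def pair_pvec)

lemma ev_support: "f:carrier KG ==> ev f (t, s)~=0 ==> reach s t"
proof (rule ccontr)
 assume f: "f:carrier KG" and e: "ev f (t, s)~=0" and n: "\<not> reach s t"
 have "ev f (t, s) = pair f (%p. 0)" unfolding ev_def prod.case
  by (rule pair_cong) (use n support_qpath[OF f] in "auto simp: reach_def")
 then show False using e by (simp add: pair_weight_zero)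
qed

lemma ev_mult:
 assumes f: "f:carrier KG" and g: "g:carrier KG"
 shows "ev (f ** g) (t, s) = (\<Sum>m\<in>verts G. ev f (t, m) * ev g (m, s))"
proof -
 have "ev (f ** g) (t, s) = pair f (%p. \<Sum>m\<in>verts G. (if psrc p = m & ptgt G p = t then 1 else 0) * ev g (m, s))"
  unfolding ev_def prod.case pair_mult[OF f g]
 proof (rule pair_cong)
  fix p assume "f p~=0"
  then have p: "p:qpaths G" using support_qpath f by blast
  have "pair g (%q. if ptgt G q = psrc p then if psrc (pcomp p q) = s & ptgt G (pcomp p q) = t then 1 else 0 else 0) =
   pair g (%q. (if psrc q = s & ptgt G q = psrc p then 1 else 0) * (if ptgt G p = t then 1 else 0))"
  proof (rule pair_cong)
   fix q assume "g q~=0"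
   then have "q:qpaths G" using support_qpath g by blast
   then show "(if ptgt G q = psrc p then if psrc (pcomp p q) = s & ptgt G (pcomp p q) = t then 1 else 0 else 0) =
    (if psrc q = s & ptgt G q = psrc p then 1 else 0) * (if ptgt G p = t then 1 else (0 :: 'a))"
    using pcomp_qpath[OF p, of q] by auto
  qed
  also have "\<dots> = (\<Sum>m\<in>verts G. if m = psrc p then (if ptgt G p = t then pair g (%q. if psrc q = s & ptgt G q = m then 1 else 0) else 0) else 0)"
   using qpath_ends[OF p] by (simp add: pair_weight_mult)
  also have "\<dots> = (\<Sum>m\<in>verts G. (if psrc p = m & ptgt G p = t then 1 else 0) * pair g (%q. if psrc q = s & ptgt G q = m then 1 else 0))"
   by (intro sum.cong) auto
  finally show "pair g (%q. if ptgt G q = psrc p then if psrc (pcomp p q) = s & ptgt G (pcomp p q) = t then 1 else 0 else 0) =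
   (\<Sum>m\<in>verts G. (if psrc p = m & ptgt G p = t then 1 else 0) * pair g (%q. if psrc q = s & ptgt G q = m then 1 else 0))" .
 qed
 also have "\<dots> = (\<Sum>m\<in>verts G. ev f (t, m) * ev g (m, s))"
  by (simp only: pair_weight_sum pair_weight_mult) (simp add: ev_def)
 finally show ?thesis .
qed

definition rep :: "'v=>'v=>('v, 'e) qpath" where
 "rep s t = (SOME p. p:qpaths G & psrc p = s & ptgt G p = t)"

lemma rep: "reach s t ==> rep s t:qpaths G & psrc (rep s t) = s & ptgt G (rep s t) = t"
 unfolding rep_def reach_def by (rule someI_ex) blast

lemma pvec_carrier: "p:qpaths G ==> pvec p:carrier KG"
 by (auto simp: carrier_KG pvec_def)

lemma ev_surj:
 fixes g :: "'v\<times>'v=>'k::field"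
 assumes g: "!!t s. g (t, s)~=0 ==> reach s t"
 shows "EX f:carrier KG. ev f = g"
proof -
 have "EX f:carrier KG. ev f = (%x. if x:S then g x else 0)" if "finite S" for S
  using that
 proof induction
  case empty show ?case using KG_closed(3) ev_zero[unfolded zero_fun_def]
   by (intro bexI[of _ 0]) (simp_all add: zero_fun_def)
 next
  case (insert x S)
  then obtain f where f: "f:carrier KG" "ev f = (%x. if x:S then g x else 0)" by blast
  obtain t s where x: "x = (t, s)" by (cases x)
  show ?case
  proof (cases "g x = 0")
   case True then show ?thesis using f by (intro bexI[of _ f]) auto
  next
   case False
   then have r: "reach s t" using g x by simp
   let ?h = "f + fscale (g x) (pvec (rep s t))"
   have h: "?h:carrier KG" using f rep[OF r] by (simp add: KG_closed pvec_carrier)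
   have "ev ?h = ev f + fscale (g x) (ev (pvec (rep s t)))"
    using f rep[OF r] by (simp add: ev_add KG_closed pvec_carrier ev_scale)
   also have "\<dots> = (%y. if y:insert x S then g y else 0)"
   proof
    fix y :: "'v\<times>'v" obtain b a where y: "y = (b, a)" by (cases y)
    show "(ev f + fscale (g x) (ev (pvec (rep s t)))) y = (if y:insert x S then g y else 0)"
     unfolding y using f(2) insert.hyps rep[OF r] x by (auto simp: ev_pvec)
   qed
   finally show ?thesis using h by blast
  qed
 qed
 from this[of "verts G\<times>verts G"] obtain f where f: "f:carrier KG"
  "ev f = (%x. if x:verts G\<times>verts G then g x else 0)" using finite_verts by blast
 have "ev f = g"
 proof
  fix x show "ev f x = g x" using f(2) g reach_verts by (cases x) auto
 qed
 then show ?thesis using f(1) by blast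
qed

lemma function_algebraI:
 assumes "finite (qpaths G)"
 shows "function_algebra (KG :: ('k::field, ('v, 'e) qpath=>'k) module)"
proof (intro function_algebra.intro function_algebra_axioms.intro)
 show "EX S. finite S & carrier KG<=(spt S :: (('v, 'e) qpath=>'k) set)"
  using assms by (intro exI[of _ "qpaths G"]) (auto simp: carrier_KG spt_def)
qed (simp_all add: ring_KG KG_subspace KG_simps KG_scale)

section \<open>The ideal of commutativity relations\<close>

abbreviation "CI \<equiv> commutativity_ideal G"

lemma kernel_ideal: "ideal {f:carrier KG. ev f = 0} (KG :: ('k::field, ('v, 'e) qpath=>'k) module)"
proof -
 interpret ring "KG :: ('k, ('v, 'e) qpath=>'k) module" by (rule ring_KG)
 have neg: "\<ominus>\<^bsub>KG\<^esub> f = fscale (- 1) f" if f: "f:carrier KG" for f :: "('v, 'e) qpath=>'k"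
 proof (rule minus_equality)
  show "fscale (- 1) f\<oplus>\<^bsub>KG\<^esub>f = \<zero>\<^bsub>KG\<^esub>" by (auto simp: KG_simps)
 qed (use f KG_closed(2)[OF f, of "- 1"] in simp_all)
 have ev0: "ev f (t, s) = 0" if "ev f = 0" for f :: "('v, 'e) qpath=>'k" and t s using that by simp
 show ?thesis
 proof (rule idealI[OF ring_KG])
  show "subgroup {f:carrier KG. ev f = 0} (add_monoid (KG :: ('k, ('v, 'e) qpath=>'k) module))"
  proof (rule subgroup.intro)
   fix f :: "('v, 'e) qpath=>'k" assume f: "f:{f:carrier KG. ev f = 0}"
   then have m: "f:carrier KG" "ev f = 0" by auto
   have "ev (fscale (- 1) f) = 0" unfolding ev_scale m(2) by auto
   then have "\<ominus>\<^bsub>KG\<^esub> f:{f:carrier KG. ev f = 0}"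
    unfolding neg[OF m(1)] using KG_closed(2)[OF m(1)] by blast
   then show "inv\<^bsub>add_monoid KG\<^esub> f:{f:carrier KG. ev f = 0}" by (simp add: a_inv_def)
  qed (auto simp: KG_simps KG_closed ev_add ev_zero)
  fix a x :: "('v, 'e) qpath=>'k" assume a: "a:{f:carrier KG. ev f = 0}" and x: "x:carrier KG"
  have "ev (x ** a) = 0" "ev (a ** x) = 0"
   using a x by (auto simp: fun_eq_iff ev_mult)
  then show "x ** a:{f:carrier KG. ev f = 0}" "a ** x:{f:carrier KG. ev f = 0}"
   using a x mult_closed by auto
 qed
qed

text \<open>Modulo the relations every path can be replaced by a chosen path with the same ends. The
  coefficient collected at a chosen path is an entry of \<open>ev f\<close>, so an element of the
  kernel equals the sum of its corrections.\<close>

lemma commutativity_ideal_eq: "CI = {f:carrier KG. ev f = (0 :: 'v\<times>'v=>'k::field)}"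
proof
 interpret ring "KG :: ('k, ('v, 'e) qpath=>'k) module" by (rule ring_KG)
 let ?D = "{pvec p - pvec q | p q. p:qpaths G & q:qpaths G & psrc p = psrc q & ptgt G p = ptgt G q} ::
  (('v, 'e) qpath=>'k) set"
 have D: "pvec p - pvec q = pvec p + fscale (- 1) (pvec q)" for p q :: "('v, 'e) qpath" by (auto simp: pvec_def)
 have "?D<={f:carrier KG. ev f = 0}"
 proof clarify
  fix p q assume p: "p:qpaths G" "q:qpaths G" "psrc p = psrc q" "ptgt G p = ptgt G q"
  have "ev (pvec p - pvec q) = ev (pvec p) + fscale (- 1 :: 'k) (ev (pvec q))"
   unfolding D by (simp only: ev_add KG_closed pvec_carrier p ev_scale)
  also have "\<dots> = 0"
  proof
   fix x show "(ev (pvec p) + fscale (- 1 :: 'k) (ev (pvec q))) x = 0 x" using p by (cases x) (simp add: ev_pvec)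
  qed
  finally have "ev (pvec p - pvec q) = (0 :: 'v\<times>'v=>'k)" .
  moreover have "(pvec p - pvec q :: _=>'k):carrier KG"
   unfolding D by (intro KG_closed pvec_carrier p)
  ultimately show "(pvec p - pvec q :: _=>'k):carrier KG & ev (pvec p - pvec q) = (0 :: 'v\<times>'v=>'k)" by simp
 qed
 then show "CI<={f:carrier KG. ev f = (0 :: 'v\<times>'v=>'k)}"
  unfolding commutativity_ideal_def by (rule genideal_minimal[OF kernel_ideal])
 have DC: "?D<=carrier KG" using \<open>?D \<subseteq> _\<close> by blast
 then interpret I: ideal "CI :: (('v, 'e) qpath=>'k) set" KG unfolding commutativity_ideal_def by (rule genideal_ideal)
 have gen: "(pvec p - pvec q :: _=>'k):CI" if "p:qpaths G" "q:qpaths G" "psrc p = psrc q" "ptgt G p = ptgt G q" for p q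
 proof -
  have "(pvec p - pvec q :: _=>'k):?D" using that by (intro CollectI exI[of _ p] exI[of _ q] conjI refl)
  then show ?thesis using genideal_self[OF DC] unfolding commutativity_ideal_def by (rule rev_subsetD)
 qed
 have sc: "fscale c x:CI" if x: "x:CI" for c :: 'k and x
 proof -
  have xc: "x:carrier KG" using x I.a_subset by blast
  have "fscale c x = fscale c oneK ** x" unfolding KG_scale(1)[OF one_KG xc] l_one[OF xc] ..
  then show ?thesis using I.I_l_closed[OF x KG_closed(2)[OF one_KG]] by simp
 qed
 have ad: "x + y:CI" if "x:CI" "y:CI" for x y :: "('v, 'e) qpath=>'k"
  using I.a_closed[OF that] by (simp add: KG_simps)
 have ze: "(0 :: ('v, 'e) qpath=>'k):CI" using I.zero_closed by (simp add: KG_simps)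
 show "{f:carrier KG. ev f = (0 :: 'v\<times>'v=>'k)}<=CI"
 proof clarify
  fix f :: "('v, 'e) qpath=>'k" assume f: "f:carrier KG" and e: "ev f = 0"
  define S where "S = {p. f p~=0}"
  have S: "finite S" "S<=qpaths G" using f by (auto simp: S_def carrier_KG)
  define pj where "pj p = rep (psrc p) (ptgt G p)" for p
  have pj: "pj p:qpaths G & psrc (pj p) = psrc p & ptgt G (pj p) = ptgt G p" if "p:qpaths G" for p
   unfolding pj_def by (rule rep) (use that in "auto simp: reach_def")
  have "(\<Sum>p\<in>S'. fscale (f p) (pvec p - pvec (pj p))):CI" if "finite S'" "S'<=qpaths G" for S'
   using that
  proof induction
   case empty show ?case unfolding sum.empty by (rule ze)
  next
   case (insert p F)
   have "fscale (f p) (pvec p - pvec (pj p)):CI"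
    by (rule sc, rule gen) (use pj[of p] insert.prems in auto)
   then show ?case unfolding sum.insert[OF insert.hyps] using ad insert by blast
  qed
  note mem = this[OF S]
  have "(\<Sum>p\<in>S. fscale (f p) (pvec p - pvec (pj p))) = f"
  proof
   fix r
   have "(\<Sum>p\<in>S. fscale (f p) (pvec p - pvec (pj p))) r = (\<Sum>p\<in>S. f p * pvec p r) - (\<Sum>p\<in>S. f p * pvec (pj p) r)"
    using S(1) by induction (auto simp: algebra_simps)
   also have "(\<Sum>p\<in>S. f p * pvec p r) = (\<Sum>p\<in>S. if p = r then f p else 0)"
    by (intro sum.cong) (auto simp: pvec_def)
   also have "\<dots> = f r" using S(1) by (simp add: S_def)
   \<comment> \<open>If \<open>r\<close> is one of the chosen paths, this is the sum of the
     coefficients of all paths parallel to \<open>r\<close>, which is an entry of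
     \<open>ev f\<close>; otherwise every term is zero.\<close>
   also have "(\<Sum>p\<in>S. f p * pvec (pj p) r) = 0"
   proof (cases "EX p0:qpaths G. pj p0 = r")
    case True
    then obtain p0 where p0: "p0:qpaths G" "pj p0 = r" by blast
    have eq: "pj p = r\<longleftrightarrow>psrc p = psrc p0 & ptgt G p = ptgt G p0" if "p:qpaths G" for p
     using pj[OF that] pj[OF p0(1)] p0(2) by (metis pj_def)
    have "(\<Sum>p\<in>S. f p * pvec (pj p) r) = ev f (ptgt G p0, psrc p0)"
     unfolding ev_def pair_def prod.case S_def[symmetric] using eq S(2)
     by (intro sum.cong) (auto simp: pvec_def)
    then show ?thesis by (simp add: e)
   next
    case False
    then have "r~=pj p" if "p:S" for p using that S(2) by blast
    then show ?thesis by (intro sum.neutral) (auto simp: pvec_def)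
   qed
   finally show "(\<Sum>p\<in>S. fscale (f p) (pvec p - pvec (pj p))) r = f r" by simp
  qed
  then show "f:CI" using mem by simp
 qed
qed

end

section \<open>Incidence algebras of finite posets\<close>

text \<open>The algebra is described through coordinates \<open>cf\<close> in the matrices supported
  on a finite order, target index first: the entry (t, s) can be nonzero only if
  \<open>le s t\<close>. The ring laws are pulled back from matrices, so the locale can be
  instantiated directly by an algebra of cosets.\<close>

locale incidence_algebra =
 fixes R :: "('k::field, 'a) module" (structure) and V :: "'v set" and le :: "'v=>'v=>bool"
  and cf :: "'a=>'v\<times>'v=>'k"
 assumes finite_V: "finite V" and le_V: "le s t ==> s:V & t:V"
  and le_refl: "v:V ==> le v v" and le_trans: "le r s ==> le s t ==> le r t"
  and le_antisym: "le s t ==> le t s ==> s = t"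
  and cf_bij: "bij_betw cf (carrier R) {g. ALL t s. g (t, s)~=0-->le s t}"
  and add_closed: "x:carrier R ==> y:carrier R ==> x\<oplus>y:carrier R"
  and cf_add: "x:carrier R ==> y:carrier R ==> cf (x\<oplus>y) p = cf x p + cf y p"
  and zero_closed: "\<zero>:carrier R" and cf_zero: "cf \<zero> p = 0"
  and one_closed: "\<one>:carrier R" and cf_one: "cf \<one> (t, s) = (if t = s & t:V then 1 else 0)"
  and mult_closed: "x:carrier R ==> y:carrier R ==> x\<otimes>y:carrier R"
  and cf_mult: "x:carrier R ==> y:carrier R ==> cf (x\<otimes>y) (t, s) = (\<Sum>m\<in>V. cf x (t, m) * cf y (m, s))"
  and smult_closed: "x:carrier R ==> c\<odot>x:carrier R"
  and cf_smult: "x:carrier R ==> cf (c\<odot>x) p = c * cf x p"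
begin

lemmas closed = add_closed zero_closed one_closed mult_closed smult_closed

lemma eqI: "x:carrier R ==> y:carrier R ==> (!!t s. cf x (t, s) = cf y (t, s)) ==> x = y"
 using cf_bij unfolding bij_betw_def inj_on_def by (metis ext surj_pair)

lemma cf_le: "x:carrier R ==> cf x (t, s)~=0 ==> le s t"
 using bij_betw_apply[OF cf_bij] by blast

definition el :: "('v\<times>'v=>'k)=>'a" where "el = inv_into (carrier R) cf"

lemma el:
 assumes "!!t s. g (t, s)~=0 ==> le s t"
 shows "el g:carrier R" "cf (el g) = g"
proof -
 have g: "g:{g. ALL t s. g (t, s)~=0-->le s t}" using assms by blast
 show "el g:carrier R" unfolding el_def by (rule bij_betw_apply[OF bij_betw_inv_into[OF cf_bij] g])
 show "cf (el g) = g" unfolding el_def by (rule bij_betw_inv_into_right[OF cf_bij g])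
qed

definition unit :: "'v=>'v=>'a" where "unit t s = el (%p. if p = (t, s) then 1 else 0)"

abbreviation "E v \<equiv> unit v v"

lemma unit: "le s t ==> unit t s:carrier R" "le s t ==> cf (unit t s) p = (if p = (t, s) then 1 else 0)"
proof -
 assume l: "le s t"
 have g: "le b a" if h: "(if (a, b) = (t, s) then 1 else (0 :: 'k))~=0" for a b
  using h l by (auto split: if_splits)
 show "unit t s:carrier R" unfolding unit_def by (rule el(1)[OF g])
 show "cf (unit t s) p = (if p = (t, s) then 1 else 0)"
  unfolding unit_def by (rule fun_cong[OF el(2)[OF g]])
qed

lemma E: "v:V ==> E v:carrier R" "v:V ==> cf (E v) p = (if p = (v, v) then 1 else 0)"
 using unit le_refl by blast+

lemma cf_unit_mult: "le s t ==> x:carrier R ==> cf (unit t s\<otimes>x) (b, a) = (if b = t then cf x (s, a) else 0)"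
proof -
 assume s: "le s t" "x:carrier R"
 have "cf (unit t s\<otimes>x) (b, a) = (\<Sum>m\<in>V. if m = s then (if b = t then cf x (s, a) else 0) else 0)"
  unfolding cf_mult[OF unit(1)[OF s(1)] s(2)] unit(2)[OF s(1)] by (intro sum.cong) auto
 then show ?thesis using finite_V le_V[OF s(1)] by simp
qed

lemma cf_mult_unit: "le s t ==> x:carrier R ==> cf (x\<otimes>unit t s) (b, a) = (if a = s then cf x (b, t) else 0)"
proof -
 assume s: "le s t" "x:carrier R"
 have "cf (x\<otimes>unit t s) (b, a) = (\<Sum>m\<in>V. if m = t then (if a = s then cf x (b, t) else 0) else 0)"
  unfolding cf_mult[OF s(2) unit(1)[OF s(1)]] unit(2)[OF s(1)] by (intro sum.cong) auto
 then show ?thesis using finite_V le_V[OF s(1)] by simp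
qed

lemma cf_corner: "w:V ==> v:V ==> x:carrier R ==>
  cf (E w\<otimes>x\<otimes>E v) (b, a) = (if b = w & a = v then cf x (w, v) else 0)"
 by (simp add: cf_mult_unit cf_unit_mult le_refl closed E)

lemma cf_mult_diag: "x:carrier R ==> y:carrier R ==> v:V ==> cf (x\<otimes>y) (v, v) = cf x (v, v) * cf y (v, v)"
proof -
 assume x: "x:carrier R" "y:carrier R" "v:V"
 have "cf (x\<otimes>y) (v, v) = (\<Sum>m\<in>V. if m = v then cf x (v, v) * cf y (v, v) else 0)"
  unfolding cf_mult[OF x(1,2)]
 proof (rule sum.cong[OF refl])
  fix m
  have "m = v" if "cf x (v, m)~=0" "cf y (m, v)~=0"
   using le_antisym[OF cf_le[OF x(1) that(1)] cf_le[OF x(2) that(2)]] .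
  then show "cf x (v, m) * cf y (m, v) = (if m = v then cf x (v, v) * cf y (v, v) else 0)" by auto
 qed
 then show ?thesis using finite_V x by simp
qed

lemma ring: "ring R"
proof (rule ringI)
 show "abelian_group R"
 proof (rule abelian_groupI)
  fix x assume x: "x:carrier R"
  have "(- 1)\<odot>x\<oplus>x = \<zero>" by (rule eqI) (use x in "simp_all add: closed cf_add cf_smult cf_zero")
  then show "EX y:carrier R. y\<oplus>x = \<zero>" using smult_closed[OF x] by blast
 qed (auto simp: closed intro!: eqI simp: cf_add cf_zero)
 show "monoid R"
 proof (rule monoidI)
  fix x y z assume x: "x:carrier R" "y:carrier R" "z:carrier R"
  show "x\<otimes>y\<otimes>z = x\<otimes>(y\<otimes>z)"
  proof (rule eqI)
   fix t s
   show "cf (x\<otimes>y\<otimes>z) (t, s) = cf (x\<otimes>(y\<otimes>z)) (t, s)"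
    using x by (simp add: closed cf_mult sum_distrib_left sum_distrib_right mult.assoc) (rule sum.swap)
  qed (use x in "simp_all add: closed")
 next
  fix x assume x: "x:carrier R"
  show "\<one>\<otimes>x = x"
  proof (rule eqI)
   fix t s
   have "cf (\<one>\<otimes>x) (t, s) = (\<Sum>m\<in>V. if m = t then cf x (t, s) else 0)"
    unfolding cf_mult[OF one_closed x] cf_one by (intro sum.cong) auto
   then show "cf (\<one>\<otimes>x) (t, s) = cf x (t, s)" using finite_V cf_le[OF x, of t s] le_V by auto
  qed (use x in "simp_all add: closed")
  show "x\<otimes>\<one> = x"
  proof (rule eqI)
   fix t s
   have "cf (x\<otimes>\<one>) (t, s) = (\<Sum>m\<in>V. if m = s then cf x (t, s) else 0)"
    unfolding cf_mult[OF x one_closed] cf_one by (intro sum.cong) auto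
   then show "cf (x\<otimes>\<one>) (t, s) = cf x (t, s)" using finite_V cf_le[OF x, of t s] le_V by auto
  qed (use x in "simp_all add: closed")
 qed (simp_all add: closed)
 fix x y z assume x: "x:carrier R" "y:carrier R" "z:carrier R"
 show "(x\<oplus>y)\<otimes>z = x\<otimes>z\<oplus>y\<otimes>z" "z\<otimes>(x\<oplus>y) = z\<otimes>x\<oplus>z\<otimes>y"
  by (rule eqI; use x in "simp add: closed cf_mult cf_add sum.distrib distrib_left distrib_right")+
qed

lemma cf_finsum:
 assumes "finite S" "f:S \<rightarrow> carrier R"
 shows "finsum R f S:carrier R & cf (finsum R f S) p = (\<Sum>s\<in>S. cf (f s) p)"
proof -
 interpret ring R by (rule ring)
 show ?thesis using assms
 proof induction
  case (insert s S)
  then have "f s:carrier R" "f:S \<rightarrow> carrier R" by auto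
  then show ?case using insert by (simp add: finsum_insert add_closed cf_add)
 qed (simp add: zero_closed cf_zero)
qed

lemma neg: "x:carrier R ==> \<ominus> x = (- 1)\<odot>x"
proof -
 assume x: "x:carrier R"
 interpret ring R by (rule ring)
 show ?thesis
  by (rule minus_equality) (use x in "auto intro!: eqI simp: incidence_algebra.closed[OF incidence_algebra_axioms] cf_add cf_smult cf_zero")
qed

lemma cf_minus: "x:carrier R ==> y:carrier R ==> x \<ominus> y:carrier R & cf (x \<ominus> y) p = cf x p - cf y p"
 by (simp add: a_minus_def neg closed cf_add cf_smult)

text \<open>Scalars act through multiples of 1, so left ideals are stable under them.\<close>

lemma smult_one: "x:carrier R ==> c\<odot>x = (c\<odot>\<one>)\<otimes>x"
proof -
 assume x: "x:carrier R"
 interpret ring R by (rule ring)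
 show ?thesis
 proof (rule eqI)
  fix t s
  have "cf (c\<odot>\<one>\<otimes>x) (t, s) = c * (\<Sum>m\<in>V. cf \<one> (t, m) * cf x (m, s))"
   using x smult_closed[OF one_closed] by (simp add: cf_mult cf_smult mult.assoc sum_distrib_left)
  also have "(\<Sum>m\<in>V. cf \<one> (t, m) * cf x (m, s)) = cf x (t, s)"
   unfolding cf_mult[OF one_closed x, symmetric] using x by simp
  finally show "cf (c\<odot>x) (t, s) = cf (c\<odot>\<one>\<otimes>x) (t, s)" using x by (simp add: cf_smult)
 qed (use x in "simp_all add: smult_closed")
qed

lemma fd_algebra: "fd_algebra R"
proof -
 interpret ring R by (rule ring)
 note cl = incidence_algebra.closed[OF incidence_algebra_axioms]
 have mod: "Module.module class_ring R"
 proof (rule Module.moduleI)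
  show "cring (class_ring :: 'k ring)" by (rule class_cring.cring_axioms)
  show "abelian_group R" by (rule abelian_group_axioms)
 qed (auto simp: cl intro!: eqI simp: cf_smult cf_add distrib_left distrib_right mult.assoc)
 interpret M: vectorspace class_ring R
  unfolding vectorspace_def using mod class_field.field_axioms by blast
 have "EX A. finite A & A<=carrier R & M.span A = carrier R"
 proof (intro exI conjI)
  let ?I = "{p:V\<times>V. le (snd p) (fst p)}"
  let ?u = "%p. unit (fst p) (snd p)"
  have fin: "finite ?I" using finite_V by simp
  show "finite (?u ` ?I)" using fin by simp
  show sub: "?u ` ?I<=carrier R" using unit(1) by auto
  have inj: "inj_on ?u ?I"
  proof (rule inj_onI)
   fix p q assume "p:?I" "q:?I" "?u p = ?u q"
   moreover from this have "cf (?u q) q = (1 :: 'k)" "cf (?u p) q = (if q = p then 1 else 0)"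
    using unit(2)[of "snd q" "fst q" q] unit(2)[of "snd p" "fst p" q] by auto
   ultimately show "p = q" by (auto split: if_splits)
  qed
  show "M.span (?u ` ?I) = carrier R"
  proof
   show "M.span (?u ` ?I)<=carrier R" using M.span_is_subset2 sub by blast
   show "carrier R<=M.span (?u ` ?I)"
   proof
    fix x assume x: "x:carrier R"
    define a where "a y = cf x (inv_into ?I ?u y)" for y
    have fc: "(%y. a y\<odot>y):?u ` ?I \<rightarrow> carrier R" using sub cl(5) by blast
    have "x = M.lincomb a (?u ` ?I)"
    proof (rule eqI[OF x])
     show "M.lincomb a (?u ` ?I):carrier R" unfolding M.lincomb_def using cf_finsum[OF _ fc] fin by blast
     fix t s
     have "cf (M.lincomb a (?u ` ?I)) (t, s) = (\<Sum>y\<in>?u ` ?I. cf (a y\<odot>y) (t, s))"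
      unfolding M.lincomb_def using cf_finsum[OF _ fc] fin by blast
     also have "\<dots> = (\<Sum>p\<in>?I. cf (a (?u p)\<odot>?u p) (t, s))" by (rule sum.reindex[OF inj, unfolded comp_def])
     also have "\<dots> = (\<Sum>p\<in>?I. if p = (t, s) then cf x (t, s) else 0)"
      by (intro sum.cong refl) (auto simp: a_def inv_into_f_f[OF inj] cf_smult unit)
     also have "\<dots> = cf x (t, s)" using fin cf_le[OF x, of t s] le_V by auto
     finally show "cf x (t, s) = cf (M.lincomb a (?u ` ?I)) (t, s)" ..
    qed
    then show "x:M.span (?u ` ?I)" unfolding M.span_def using fin
     by (intro CollectI exI[of _ a] exI[of _ "?u ` ?I"] conjI) simp_all
   qed
  qed
 qed
 then have "M.fin_dim" unfolding M.fin_dim_def .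
 moreover have "(c\<odot>x)\<otimes>y = c\<odot>(x\<otimes>y) & x\<otimes>(c\<odot>y) = c\<odot>(x\<otimes>y)"
  if "x:carrier R" "y:carrier R" for c x y
  using that by (auto intro!: eqI simp: cl cf_mult cf_smult sum_distrib_left mult.assoc mult.left_commute)
 ultimately show ?thesis unfolding fd_algebra_def using ring_axioms M.vectorspace_axioms by blast
qed

text \<open>The corner of R at \<open>E v\<close> has (v, v) as its only coordinate. Two nonzero
  orthogonal idempotents with sum \<open>E v\<close> would lie in this corner, and both coordinates
  would be 1 while their product is 0.\<close>

lemma primitive: "v:V ==> primitive_idempotent R (E v)"
proof -
 assume v: "v:V"
 interpret ring R by (rule ring)
 have "E v\<otimes>E v = E v" by (rule eqI) (use v in "auto simp: m_closed E cf_mult_unit le_refl")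
 moreover have "E v~=\<zero>" using E(2)[OF v, of "(v, v)"] cf_zero by auto
 moreover have False if f: "idempotent R f" "idempotent R g" "f~=\<zero>" "g~=\<zero>" "f\<otimes>g = \<zero>" "g\<otimes>f = \<zero>"
  "E v = f\<oplus>g" for f g
 proof -
  have fc: "f:carrier R" "g:carrier R" and ff: "f\<otimes>f = f" "g\<otimes>g = g" using f by (auto simp: idempotent_def)
  have "E v\<otimes>f\<otimes>E v = f" "E v\<otimes>g\<otimes>E v = g"
   using fc ff f by (simp_all add: l_distr r_distr)
  then have cff: "cf f (b, a) = (if b = v & a = v then cf f (v, v) else 0)"
   "cf g (b, a) = (if b = v & a = v then cf g (v, v) else 0)" for b a
   using cf_corner[OF v v fc(1), of b a] cf_corner[OF v v fc(2), of b a] by auto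
  have "cf f (v, v) * cf f (v, v) = cf f (v, v)" "cf g (v, v) * cf g (v, v) = cf g (v, v)"
   using cf_mult_diag[OF fc(1) fc(1) v] cf_mult_diag[OF fc(2) fc(2) v] ff by auto
  moreover have "cf f (v, v)~=0"
  proof
   assume z: "cf f (v, v) = 0"
   have "f = \<zero>" by (rule eqI[OF fc(1) zero_closed]) (subst cff(1), simp add: z cf_zero)
   then show False using f(3) by simp
  qed
  moreover have "cf g (v, v)~=0"
  proof
   assume z: "cf g (v, v) = 0"
   have "g = \<zero>" by (rule eqI[OF fc(2) zero_closed]) (subst cff(2), simp add: z cf_zero)
   then show False using f(4) by simp
  qed
  ultimately have "cf f (v, v) = 1" "cf g (v, v) = 1" by auto
  moreover have "cf f (v, v) * cf g (v, v) = 0" using cf_mult_diag[OF fc v] f(5) cf_zero by simp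
  ultimately show False by simp
 qed
 ultimately show ?thesis using E(1)[OF v] unfolding primitive_idempotent_def idempotent_def by blast
qed

text \<open>An isomorphism forces the corners between v and w to be nonzero in both directions, once
  by looking at the image of \<open>E v\<close> and once at a preimage of \<open>E w\<close>. This
  gives both inequalities, and antisymmetry applies.\<close>

lemma principal_left_iso_le:
 assumes v: "v:V" "w:V" and iso: "principal_left_iso R (E v) (E w)"
 shows "v = w"
proof -
 interpret ring R by (rule ring)
 obtain th where b: "bij_betw th (principal_left R (E v)) (principal_left R (E w))"
  and m: "!!a x. a:carrier R ==> x:principal_left R (E v) ==> th (a\<otimes>x) = a\<otimes>th x"
  using iso unfolding principal_left_iso_def by blast
 have EE: "E u\<otimes>E u = E u" if "u:V" for u using primitive[OF that] by (simp add: primitive_idempotent_def idempotent_def)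
 have E0: "E u~=\<zero>" if "u:V" for u using primitive[OF that] by (simp add: primitive_idempotent_def)
 have EP: "E u:principal_left R (E u)" if "u:V" for u
  unfolding principal_left_def using E(1)[OF that] EE[OF that] by force
 have PC: "x:carrier R" if "x:principal_left R (E u)" "u:V" for x u
  using that E(1) by (auto simp: principal_left_def)
 have zP: "\<zero>:principal_left R (E v)" unfolding principal_left_def using E(1)[OF v(1)] by (intro CollectI exI[of _ \<zero>]) simp
 have thE: "th (E v):principal_left R (E w)" using b EP[OF v(1)] by (rule bij_betw_apply)
 have th0: "th \<zero> = \<zero>"
  using m[OF zero_closed EP[OF v(1)]] E(1)[OF v(1)] PC[OF thE v(2)] by simp
 obtain a where a: "a:carrier R" "th (E v) = a\<otimes>E w" using thE by (auto simp: principal_left_def)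
 have "th (E v) = E v\<otimes>a\<otimes>E w" using m[OF E(1)[OF v(1)] EP[OF v(1)]] EE[OF v(1)] a E(1) v by (simp add: m_assoc)
 moreover have "th (E v)~=\<zero>"
  using b EP[OF v(1)] zP th0 E0[OF v(1)] unfolding bij_betw_def inj_on_def by metis
 moreover have "E v\<otimes>a\<otimes>E w = \<zero>" if "cf a (v, w) = 0"
  by (rule eqI) (use that cf_corner[OF v a(1)] a(1) E(1) v in "simp_all add: cf_zero")
 ultimately have "cf a (v, w)~=0" by metis
 then have 1: "le w v" using cf_le a by blast
 have "E w:th ` principal_left R (E v)" using b EP[OF v(2)] by (simp add: bij_betw_def)
 then obtain c where c: "c:carrier R" "E w = th (c\<otimes>E v)" by (auto simp: principal_left_def)
 have cP: "c\<otimes>E v:principal_left R (E v)" using c by (auto simp: principal_left_def)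
 have "E w = th (E w\<otimes>(c\<otimes>E v))" using m[OF E(1)[OF v(2)] cP] c(2) EE[OF v(2)] by simp
 then have "E w\<otimes>c\<otimes>E v~=\<zero>" using E0[OF v(2)] th0 c(1) E(1) v by (auto simp: m_assoc)
 moreover have "E w\<otimes>c\<otimes>E v = \<zero>" if "cf c (w, v) = 0"
  by (rule eqI) (use that cf_corner[OF v(2,1) c(1)] c(1) E(1) v in "simp_all add: cf_zero")
 ultimately have "cf c (w, v)~=0" by blast
 then have "le v w" using cf_le c by blast
 then show ?thesis using 1 le_antisym by blast
qed

text \<open>The reindexing \<open>h\<close> covers both the vertices themselves and the numbering
  that \<open>basic_fd_algebra\<close> asks for.\<close>

lemma basic_idempotents:
 assumes h: "bij_betw h I V"
 shows "basic_idempotents R I (%i. E (h i))"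
proof -
 interpret ring R by (rule ring)
 have I: "finite I" using bij_betw_finite[OF h] finite_V by simp
 have hV: "h i:V" if "i:I" for i using h that by (rule bij_betw_apply)
 have hne: "h i~=h j" if "i:I" "j:I" "i~=j" for i j
  using h that unfolding bij_betw_def inj_on_def by blast
 have "E (h i)\<otimes>E (h j) = \<zero>" if "i:I" "j:I" "i~=j" for i j
  by (rule eqI) (use hne[OF that] hV that in "auto simp: E cf_mult_unit le_refl cf_zero")
 moreover have "finsum R (%i. E (h i)) I = \<one>"
 proof (rule eqI)
  have fc: "(%i. E (h i)):I \<rightarrow> carrier R" using hV E(1) by auto
  show "finsum R (%i. E (h i)) I:carrier R" using cf_finsum[OF I fc] by blast
  fix t s
  have "cf (finsum R (%i. E (h i)) I) (t, s) = (\<Sum>i\<in>I. cf (E (h i)) (t, s))" using cf_finsum[OF I fc] by blast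
  also have "\<dots> = (\<Sum>v\<in>V. cf (E v) (t, s))" by (rule sum.reindex_bij_betw[OF h])
  also have "\<dots> = (\<Sum>v\<in>V. if v = t then (if t = s then 1 else 0) else 0)" by (intro sum.cong) (auto simp: E)
  also have "\<dots> = cf \<one> (t, s)" using finite_V by (auto simp: cf_one)
  finally show "cf (finsum R (%i. E (h i)) I) (t, s) = cf \<one> (t, s)" .
 qed simp
 ultimately show ?thesis
  unfolding basic_idempotents_def using I hV primitive principal_left_iso_le[OF hV hV] hne by (intro conjI ballI impI notI) metis+
qed

lemma basic_fd_algebra: "basic_fd_algebra R"
proof -
 obtain h where "bij_betw h {..<card V} V"
  using ex_bij_betw_nat_finite[OF finite_V] by (auto simp: lessThan_atLeast0)
 then show ?thesis unfolding basic_fd_algebra_def using fd_algebra basic_idempotents by blast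
qed

section \<open>The Jacobson radical and the quiver of an incidence algebra\<close>

lemma additive_subgroupI':
 assumes "L<=carrier R" "\<zero>:L" "!!x y. x:L ==> y:L ==> x\<oplus>y:L" "!!x. x:L ==> (- 1)\<odot>x:L"
 shows "additive_subgroup L R"
proof -
 interpret ring R by (rule ring)
 show ?thesis
 proof (intro additive_subgroup.intro subgroup.intro)
  show "inv\<^bsub>add_monoid R\<^esub> x:L" if "x:L" for x
   using neg[of x] assms(1,4) that unfolding a_inv_def by auto
 qed (use assms in auto)
qed

lemma left_idealD:
 assumes "left_ideal R L"
 shows "L<=carrier R" "x:L ==> y:L ==> x\<oplus>y:L" "\<zero>:L" "a:carrier R ==> x:L ==> a\<otimes>x:L"
proof -
 have L: "additive_subgroup L R" using assms by (simp add: left_ideal_def)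
 show "L<=carrier R" "\<zero>:L" using additive_subgroup.a_subset[OF L] additive_subgroup.zero_closed[OF L] .
 show "x:L ==> y:L ==> x\<oplus>y:L" by (rule additive_subgroup.a_closed[OF L])
 show "a:carrier R ==> x:L ==> a\<otimes>x:L" using assms by (simp add: left_ideal_def)
qed

lemma left_ideal_smult:
 assumes "left_ideal R L" "x:L"
 shows "c\<odot>x:L"
proof -
 have x: "x:carrier R" using left_idealD(1)[OF assms(1)] assms(2) by blast
 show ?thesis unfolding smult_one[OF x] by (rule left_idealD(4)[OF assms(1) smult_closed[OF one_closed] assms(2)])
qed

text \<open>Column s of \<open>x\<close> is the left multiple of \<open>E s\<close> by
  \<open>x\<close>, and \<open>x\<close> is the sum of its columns. The induction removes one column
  at a time.\<close>

lemma left_ideal_columns: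
 assumes L: "left_ideal R L" and S: "finite S" "S<=V" "!!s. s:S ==> E s:L"
  and x: "x:carrier R" "!!t s. cf x (t, s)~=0 ==> s:S"
 shows "x:L"
 using S x
proof (induction S arbitrary: x)
 case empty
 have "x = \<zero>" by (rule eqI) (use empty zero_closed cf_zero in auto)
 then show ?case using left_idealD(3)[OF L] by simp
next
 case (insert s S)
 interpret ring R by (rule ring)
 have s: "s:V" using insert by auto
 define y where "y = x \<ominus> x\<otimes>E s"
 have xE: "x\<otimes>E s:carrier R" using insert.prems E(1)[OF s] by auto
 have y: "y:carrier R" "cf y (t, r) = (if r = s then 0 else cf x (t, r))" for t r
  using cf_minus[OF insert.prems(3) xE] insert.prems cf_mult_unit[OF le_refl[OF s], of x] by (auto simp: y_def)
 have d: "cf x p = cf y p + cf (x\<otimes>E s) p" for p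
  using cf_minus[OF insert.prems(3) xE] by (simp add: y_def)
 have "y:L" by (rule insert.IH) (use insert.prems y in "auto split: if_splits")
 moreover have "x\<otimes>E s:L" by (rule left_idealD(4)[OF L]) (use insert.prems in auto)
 moreover have eq: "x = y\<oplus>x\<otimes>E s"
  by (rule eqI) (use y(1) xE insert.prems(3) d cf_add[OF y(1) xE] in simp_all)
 ultimately have "y\<oplus>x\<otimes>E s:L" by (intro left_idealD(2)[OF L])
 then show ?case by (simp only: eq[symmetric])
qed

definition off_diagonal :: "'a set" where
 "off_diagonal = {x:carrier R. ALL v:V. cf x (v, v) = 0}"

text \<open>The vanishing of one diagonal entry defines a left ideal of codimension one, hence a
  maximal one; this is the first inclusion. For the second, a maximal left ideal L that misses an
  off-diagonal element gives 1 = a + n with a in L and n off-diagonal, and strict triangularity of n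
  then puts every \<open>E i\<close> into L.\<close>

lemma jacobson_radical_eq: "jacobson_radical R = off_diagonal"
proof
 interpret ring R by (rule ring)
 note cl = incidence_algebra.closed[OF incidence_algebra_axioms]
 show "jacobson_radical R<=off_diagonal"
 proof
  fix x assume x: "x:jacobson_radical R"
  then have xc: "x:carrier R" by (simp add: jacobson_radical_def)
  have "cf x (v, v) = 0" if v: "v:V" for v
  proof -
   let ?L = "{x:carrier R. cf x (v, v) = 0}"
   have l: "left_ideal R ?L"
    unfolding left_ideal_def
    by (auto intro!: additive_subgroupI' simp: cl cf_add cf_zero cf_smult cf_mult_diag v)
   have "maximal_left_ideal R ?L"
    unfolding maximal_left_ideal_def
   proof (intro conjI allI impI l)
    show "?L~=carrier R" 
    proof
     assume "?L = carrier R"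
     then have "E v:?L" using E(1)[OF v] by simp
     then show False using E(2)[OF v] by simp
    qed
    fix L' assume L': "left_ideal R L' & ?L<=L'"
    then have sub: "L'<=carrier R" and ad: "!!x y. x:L' ==> y:L' ==> x\<oplus>y:L'"
     using left_idealD by auto
    show "L' = ?L\<or>L' = carrier R"
    proof (cases "L' = ?L")
     case False
     then obtain z where z: "z:L'" "cf z (v, v)~=0" "z:carrier R" using L' sub by blast
     have "y:L'" if y: "y:carrier R" for y
     proof -
      \<comment> \<open>Subtracting this multiple of \<open>z\<close> from \<open>y\<close> cancels
        the diagonal entry at v, so the difference lies in \<open>?L\<close>.\<close>
      let ?c = "cf y (v, v) / cf z (v, v)"
      have 1: "y\<oplus>(- ?c)\<odot>z:?L" using y z by (simp add: cl cf_add cf_smult)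
      have 2: "?c\<odot>z:L'" using left_ideal_smult L' z by blast
      have eq: "y = (y\<oplus>(- ?c)\<odot>z)\<oplus>?c\<odot>z"
       by (rule eqI) (use y z in "simp_all add: cl cf_add cf_smult")
      have "(y\<oplus>(- ?c)\<odot>z)\<oplus>?c\<odot>z:L'" by (rule ad[OF _ 2]) (use 1 L' in blast)
      then show ?thesis by (simp only: eq[symmetric])
     qed
     then show ?thesis using sub by blast
    qed simp
   qed
   then show ?thesis using x by (auto simp: jacobson_radical_def)
  qed
  then show "x:off_diagonal" using xc by (simp add: off_diagonal_def)
 qed
 show "off_diagonal<=jacobson_radical R"
 proof
  fix x assume x: "x:off_diagonal"
  then have xc: "x:carrier R" by (simp add: off_diagonal_def)
  have "x:L" if L: "maximal_left_ideal R L" for L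
  proof (rule ccontr)
   assume xL: "x~:L"
   have l: "left_ideal R L" and Lne: "L~=carrier R" using L by (auto simp: maximal_left_ideal_def)
   have sub: "L<=carrier R" and ad: "!!x y. x:L ==> y:L ==> x\<oplus>y:L" and ze: "\<zero>:L"
    and mu: "!!a x. a:carrier R ==> x:L ==> a\<otimes>x:L"
    using left_idealD[OF l] by auto
   have od: "off_diagonal<=carrier R" "\<zero>:off_diagonal"
    "!!x y. x:off_diagonal ==> y:off_diagonal ==> x\<oplus>y:off_diagonal"
    "!!x c. x:off_diagonal ==> c\<odot>x:off_diagonal"
    "!!a x. a:carrier R ==> x:off_diagonal ==> a\<otimes>x:off_diagonal"
    by (auto simp: off_diagonal_def cl cf_add cf_zero cf_smult cf_mult_diag)
   let ?M = "{a\<oplus>n | a n. a:L & n:off_diagonal}"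
   have LM: "L<=?M"
   proof
    fix a assume a: "a:L"
    then have "a = a\<oplus>\<zero>" using sub by auto
    then show "a:?M" using a od(2) by blast
   qed
   have "x = \<zero>\<oplus>x" using xc by simp
   then have xM: "x:?M" using ze x by blast
   have "left_ideal R ?M"
    unfolding left_ideal_def
   proof (intro conjI ballI additive_subgroupI')
    show "?M<=carrier R" using sub od by auto
    show "\<zero>:?M" using LM ze by blast
    fix y assume "y:?M"
    then obtain a n where y: "y = a\<oplus>n" "a:L" "n:off_diagonal" by blast
    have ac: "a:carrier R" "n:carrier R" using y sub od by auto
    have "(- 1)\<odot>y = (- 1)\<odot>a\<oplus>(- 1)\<odot>n"
     by (rule eqI) (use ac in "simp_all add: y cl cf_add cf_smult algebra_simps")
    then show "(- 1)\<odot>y:?M" using left_ideal_smult[OF l y(2)] od(4)[OF y(3)] by blast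
    show "b\<otimes>y:?M" if b: "b:carrier R" for b
    proof -
     have "b\<otimes>y = b\<otimes>a\<oplus>b\<otimes>n" using b ac by (simp add: y r_distr)
     then show ?thesis using mu[OF b y(2)] od(5)[OF b y(3)] by blast
    qed
    fix z assume "z:?M"
    then obtain a' n' where z: "z = a'\<oplus>n'" "a':L" "n':off_diagonal" by blast
    have zc: "a':carrier R" "n':carrier R" using z sub od by auto
    have "y\<oplus>z = (a\<oplus>a')\<oplus>(n\<oplus>n')" using ac zc by (simp add: y z a_ac)
    then show "y\<oplus>z:?M" using ad[OF y(2) z(2)] od(3)[OF y(3) z(3)] by blast
   qed
   then have "?M = carrier R" using L LM xM xL unfolding maximal_left_ideal_def by blast
   then obtain a n where an: "\<one> = a\<oplus>n" "a:L" "n:off_diagonal" using one_closed by blast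
   have ac: "a:carrier R" "n:carrier R" using an sub od by auto
   \<comment> \<open>Induction on the number of elements strictly below i. One has
     \<open>E i\<close> = \<open>E i\<close> a + \<open>E i\<close> n, and row i of n involves only
     columns strictly below i, whose idempotents are already in L.\<close>
   have EL: "E i:L" if "i:V" for i
    using that
   proof (induction "card {s. le s i & s~=i}" arbitrary: i rule: less_induct)
    case less
    note i = less.prems
    let ?S = "{s. le s i & s~=i}"
    have S: "finite ?S" "?S<=V" using finite_V le_V by (auto intro: rev_finite_subset)
    have "E s:L" if s: "s:?S" for s
    proof (rule less.hyps)
     have "{r. le r s & r~=s}\<subset>?S" using s le_trans le_antisym by blast
     then show "card {r. le r s & r~=s} < card ?S" using S(1) by (rule psubset_card_mono[rotated])
     show "s:V" using s S by blast
    qed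
    note ES = this
    have nn: "cf n (i, i) = 0" using an(3) i by (simp add: off_diagonal_def)
    have "E i\<otimes>n:L"
    proof (rule left_ideal_columns[OF l S ES])
     show "E i\<otimes>n:carrier R" using ac(2) E(1)[OF i] by simp
     fix t s assume "cf (E i\<otimes>n) (t, s)~=0"
     then have "cf n (i, s)~=0" unfolding cf_unit_mult[OF le_refl[OF i] ac(2)] by (simp split: if_splits)
     then show "s:?S" using cf_le[OF ac(2), of i s] nn by auto
    qed
    moreover have "E i\<otimes>a:L" using mu[OF E(1)[OF i] an(2)] .
    moreover have eq: "E i = E i\<otimes>a\<oplus>E i\<otimes>n"
     unfolding r_distr[OF ac E(1)[OF i], symmetric] an(1)[symmetric] using E(1)[OF i] by simp
    ultimately have "E i\<otimes>a\<oplus>E i\<otimes>n:L" by (intro ad)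
    then show ?case by (simp only: eq[symmetric])
   qed
   have "y:L" if "y:carrier R" for y
    by (rule left_ideal_columns[OF l finite_V subset_refl EL that]) (use cf_le[OF that] le_V in auto)
   then show False using Lne sub by blast
  qed
  then show "x:jacobson_radical R" using xc by (simp add: jacobson_radical_def)
 qed
qed

text \<open>A product of two off-diagonal elements can have a nonzero entry at (w, v) only if some m
  lies strictly between v and w, and then the matrix unit at (w, v) factors through m. Modulo the
  square of the radical, exactly the matrix units at covering pairs survive.\<close>

lemma quiver_of_incidence_algebra:
 assumes G: "fin_digraph G" "verts G = V"
  and arcs: "!!v w. v:V ==> w:V ==> EX a. {a:arcs G. tail G a = v & head G a = w} =
   (if le v w & v~=w & \<not> (EX m. le v m & le m w & m~=v & m~=w) then {a} else {})"
 shows "quiver_of_algebra R G E"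
proof -
 interpret ring R by (rule ring)
 note cl = incidence_algebra.closed[OF incidence_algebra_axioms]
 let ?J = "off_diagonal"
 let ?J2 = "ideal_prod R ?J ?J"
 have Jc: "?J<=carrier R" by (auto simp: off_diagonal_def)
 have J2c: "x:carrier R & (ALL v w. cf x (w, v)~=0-->(EX m. le v m & le m w & m~=v & m~=w))" if "x:?J2" for x
  using that
 proof induction
  case (prod i j)
  then have ij: "i:carrier R" "j:carrier R" using Jc by auto
  have "EX m. le v m & le m w & m~=v & m~=w" if "cf (i\<otimes>j) (w, v)~=0" for v w
  proof -
   from that obtain m where "m:V" "cf i (w, m) * cf j (m, v)~=0"
    unfolding cf_mult[OF ij] by (rule sum.not_neutral_contains_not_neutral)
   then have m: "m:V" "cf i (w, m)~=0" "cf j (m, v)~=0" by auto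
   then have "m~=w" "m~=v" using prod by (auto simp: off_diagonal_def)
   then show ?thesis using m cf_le ij by blast
  qed
  then show ?case using ij by simp
 next
  case (sum s1 s2)
  then show ?case by (auto simp: cf_add) (metis add.right_neutral)+
 qed
 have zJ: "\<zero>:?J" by (auto simp: off_diagonal_def cl cf_zero)
 have zJ2: "\<zero>:?J2" using ideal_prod.prod[OF zJ zJ, of R] by simp
 have "EX b. residue_basis R {E w\<otimes>x\<otimes>E v | x. x:?J} {E w\<otimes>x\<otimes>E v | x. x:?J2}
    {a:arcs G. tail G a = v & head G a = w} b" if v: "v:V" "w:V" for v w
 proof -
  let ?U = "{E w\<otimes>x\<otimes>E v | x. x:?J}" and ?W = "{E w\<otimes>x\<otimes>E v | x. x:?J2}"
  let ?S = "{a:arcs G. tail G a = v & head G a = w}"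
  have Ec: "E w\<otimes>x\<otimes>E v:carrier R" if "x:carrier R" for x using that E(1) v by auto
  have zW: "\<zero>:?W" using zJ2 E(1) v by (intro CollectI exI[of _ \<zero>]) simp
  show ?thesis
  proof (cases "le v w & v~=w & \<not> (EX m. le v m & le m w & m~=v & m~=w)")
   case True
   then obtain a where S: "?S = {a}" using arcs[OF v] by auto
   have un: "unit w v:carrier R" using unit True by blast
   have W0: "y = \<zero>" if yW: "y:?W" for y
   proof -
    obtain x where x: "x:?J2" "y = E w\<otimes>x\<otimes>E v" using yW by blast
    then have xc: "x:carrier R" "cf x (w, v) = 0" using J2c[OF x(1)] True by auto
    show ?thesis unfolding x(2) by (rule eqI) (use xc Ec cf_corner[OF v(2,1) xc(1)] in "auto simp: cl cf_zero")
   qed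
   have "residue_basis R ?U ?W {a} (%_. unit w v)"
    unfolding residue_basis_def
   proof (intro conjI ballI)
    have "unit w v = E w\<otimes>unit w v\<otimes>E v"
     by (rule eqI) (use un Ec cf_corner[OF v(2,1) un] True in "auto simp: unit")
    moreover have "unit w v:?J" using un unit(2)[of v w] True by (auto simp: off_diagonal_def)
    ultimately show "(%_. unit w v) ` {a}<=?U" by blast
    fix u assume "u:?U"
    then obtain x where x: "x:?J" "u = E w\<otimes>x\<otimes>E v" by blast
    then have xc: "x:carrier R" using Jc by auto
    have uc: "u:carrier R" using Ec xc x by simp
    have iff: "u \<ominus> finsum R (%s. c s\<odot>unit w v) {a}:?W\<longleftrightarrow>c a = cf x (w, v)" for c
    proof -
     have f: "finsum R (%s. c s\<odot>unit w v) {a} = c a\<odot>unit w v"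
      using un by (subst finsum_insert) (auto simp: cl)
     have cc: "c a\<odot>unit w v:carrier R" using un by (simp add: cl)
     have val: "cf (u \<ominus> c a\<odot>unit w v) (t, s) = (if t = w & s = v then cf x (w, v) - c a else 0)" for t s
      using cf_minus[OF uc cc] cf_corner[OF v(2,1) xc] un True by (auto simp: x cf_smult unit)
     show ?thesis unfolding f
     proof
      assume uW: "u \<ominus> c a\<odot>unit w v:?W"
      have "cf (u \<ominus> c a\<odot>unit w v) (w, v) = 0" unfolding W0[OF uW] by (rule cf_zero)
      then show "c a = cf x (w, v)" using val by simp
     next
      assume "c a = cf x (w, v)"
      then have "u \<ominus> c a\<odot>unit w v = \<zero>"
       by (intro eqI) (use val cf_minus[OF uc cc] in "auto simp: cl cf_zero")
      then show "u \<ominus> c a\<odot>unit w v:?W" using zW by simp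
     qed
    qed
    show "EX! c. c:{a} \<rightarrow>\<^sub>E UNIV & u \<ominus> finsum R (%s. c s\<odot>unit w v) {a}:?W"
    proof (rule ex1I[of _ "\<lambda>s\<in>{a}. cf x (w, v)"])
     show "(\<lambda>s\<in>{a}. cf x (w, v)):{a} \<rightarrow>\<^sub>E UNIV & u \<ominus> finsum R (%s. (\<lambda>s\<in>{a}. cf x (w, v)) s\<odot>unit w v) {a}:?W"
      unfolding iff by auto
     fix c assume c: "c:{a} \<rightarrow>\<^sub>E UNIV & u \<ominus> finsum R (%s. c s\<odot>unit w v) {a}:?W"
     then have "c a = cf x (w, v)" unfolding iff by blast
     then show "c = (\<lambda>s\<in>{a}. cf x (w, v))" using c by (auto simp: PiE_def extensional_def restrict_def fun_eq_iff)
    qed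
   qed
   then show ?thesis unfolding S by blast
  next
   case False
   then have S: "?S = {}" using arcs[OF v] unfolding if_not_P[OF False] by blast
   have UW: "u:?W" if uU: "u:?U" for u
   proof -
    obtain x where x: "x:?J" "u = E w\<otimes>x\<otimes>E v" using uU by blast
    then have xc: "x:carrier R" using Jc by auto
    show ?thesis
    proof (cases "cf x (w, v) = 0")
     case True
     have "u = \<zero>" unfolding x(2) by (rule eqI) (use Ec[OF xc] cf_corner[OF v(2,1) xc] True in "auto simp: cl cf_zero")
     then show ?thesis using zW by simp
    next
     case nz: False
     have "v~=w" using nz x(1) v by (auto simp: off_diagonal_def)
     then obtain m where m: "le v m" "le m w" "m~=v" "m~=w" using False cf_le[OF xc nz] by blast
     \<comment> \<open>\<open>?p\<close> has the same entry at (w, v) as \<open>x\<close>, and as a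
       product of two off-diagonal elements it lies in the square of the radical.\<close>
     let ?p = "(cf x (w, v)\<odot>unit w m)\<otimes>unit m v"
     have uc: "unit w m:carrier R" "unit m v:carrier R" "cf x (w, v)\<odot>unit w m:carrier R"
      using unit m by (auto simp: cl)
     have "cf x (w, v)\<odot>unit w m:?J" "unit m v:?J"
      using uc m by (auto simp: off_diagonal_def cf_smult unit)
     then have pJ: "?p:?J2" by (rule ideal_prod.prod)
     have "u = E w\<otimes>?p\<otimes>E v"
      unfolding x(2)
      by (rule eqI) (use Ec[OF xc] Ec[of ?p] cf_corner[OF v(2,1) xc] cf_corner[OF v(2,1), of ?p] uc m in
       \<open>auto simp: cl cf_mult_unit cf_smult unit\<close>)
     then show ?thesis using pJ by blast
    qed
   qed
   have "residue_basis R ?U ?W {} undefined"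
    unfolding residue_basis_def
   proof (intro conjI ballI)
    fix u assume u: "u:?U"
    then have uc: "u:carrier R" using Ec Jc by auto
    have "u \<ominus> \<zero> = u" by (rule eqI) (use cf_minus[OF uc zero_closed] uc in "auto simp: cf_zero")
    then show "EX! c. c:{} \<rightarrow>\<^sub>E UNIV & u \<ominus> finsum R (%s. c s\<odot>undefined s) {}:?W"
     using UW[OF u] by auto
   qed simp
   then show ?thesis unfolding S by blast
  qed
 qed
 moreover have "basic_idempotents R (verts G) E"
  unfolding G(2) using basic_idempotents[of id V] by simp
 ultimately show ?thesis
  unfolding quiver_of_algebra_def jacobson_radical_eq Let_def using G by simp
qed

end

section \<open>The path algebra modulo commutativity\<close>

context quiver
begin

text \<open>\<open>ev\<close> is constant on the cosets of its kernel, the commutativity ideal, so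
  any representative gives the same value.\<close>

definition coset_ev :: "(('v, 'e) qpath=>'k::field) set=>'v\<times>'v=>'k" where
 "coset_ev X = ev (SOME f. f:X)"

lemma CI_ideal: "ideal (CI :: (('v, 'e) qpath=>'k::field) set) KG"
 unfolding commutativity_ideal_eq by (rule kernel_ideal)

lemma coset_ev:
 fixes f :: "('v, 'e) qpath=>'k::field"
 assumes f: "f:carrier KG"
 shows "coset_ev (CI +>\<^bsub>KG\<^esub> f) = ev f"
proof -
 interpret I: ideal "CI :: (('v, 'e) qpath=>'k) set" KG by (rule CI_ideal)
 have "ev g = ev f" if gf: "g:CI +>\<^bsub>KG\<^esub> f" for g
 proof -
  obtain h where h: "h:CI" "g = h + f" using gf by (auto simp: a_r_coset_def r_coset_def KG_simps)
  have "h:carrier KG" "ev h = 0" using h(1) unfolding commutativity_ideal_eq by blast+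
  then show ?thesis unfolding h(2) using f by (simp only: ev_add add_0)
 qed
 moreover have "f:CI +>\<^bsub>KG\<^esub> f" by (rule I.a_rcos_self[OF f])
 ultimately show ?thesis unfolding coset_ev_def by (metis someI)
qed

lemma coset_eqI:
 fixes f g :: "('v, 'e) qpath=>'k::field"
 assumes f: "f:carrier KG" "g:carrier KG" "ev f = ev g"
 shows "CI +>\<^bsub>KG\<^esub> f = CI +>\<^bsub>KG\<^esub> g"
proof -
 interpret I: ideal "CI :: (('v, 'e) qpath=>'k) set" KG by (rule CI_ideal)
 have "ev (f + fscale (- 1) g) = 0"
  using f by (simp only: ev_add KG_closed ev_scale) auto
 then have "f + fscale (- 1) g:CI" unfolding commutativity_ideal_eq using f KG_closed by blast
 moreover have "f = (f + fscale (- 1) g)\<oplus>\<^bsub>KG\<^esub>g" by (auto simp: KG_simps)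
 ultimately have "f:CI +>\<^bsub>KG\<^esub> g" by (auto simp: a_r_coset_def r_coset_def)
 then show ?thesis using I.a_repr_independence[OF _ f(2) I.a_subgroup] by simp
qed

abbreviation "RG \<equiv> commutativity_algebra G"

lemma RG_ops:
 fixes f g :: "('v, 'e) qpath=>'k::field"
 assumes f: "f:carrier KG" and g: "g:carrier KG"
 shows "(CI +>\<^bsub>KG\<^esub> f)\<oplus>\<^bsub>RG\<^esub>(CI +>\<^bsub>KG\<^esub> g) = CI +>\<^bsub>KG\<^esub> (f + g)"
  and "(CI +>\<^bsub>KG\<^esub> f)\<otimes>\<^bsub>RG\<^esub>(CI +>\<^bsub>KG\<^esub> g) = CI +>\<^bsub>KG\<^esub> (f ** g)"
  and "c\<odot>\<^bsub>RG\<^esub>(CI +>\<^bsub>KG\<^esub> f) = CI +>\<^bsub>KG\<^esub> (fscale c f)"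
proof -
 interpret I: ideal "CI :: (('v, 'e) qpath=>'k) set" KG by (rule CI_ideal)
 show "(CI +>\<^bsub>KG\<^esub> f)\<oplus>\<^bsub>RG\<^esub>(CI +>\<^bsub>KG\<^esub> g) = CI +>\<^bsub>KG\<^esub> (f + g)"
  using I.a_rcos_sum[OF f g] by (simp add: commutativity_algebra_def quotient_algebra_def FactRing_def KG_simps)
 show "(CI +>\<^bsub>KG\<^esub> f)\<otimes>\<^bsub>RG\<^esub>(CI +>\<^bsub>KG\<^esub> g) = CI +>\<^bsub>KG\<^esub> (f ** g)"
  using I.rcoset_mult_add[OF f g] by (simp add: commutativity_algebra_def quotient_algebra_def FactRing_def)
 have eq: "CI +>\<^bsub>KG\<^esub> fscale c x = CI +>\<^bsub>KG\<^esub> fscale c f" if x: "x:CI +>\<^bsub>KG\<^esub> f" for x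
 proof -
  have xc: "x:carrier KG" using x I.a_r_coset_subset_G[OF I.a_subset f] by blast
  then have "ev x = ev f" using coset_ev[OF f] coset_ev[OF xc] I.a_repr_independence[OF x f I.a_subgroup] by simp
  then show ?thesis using xc f by (intro coset_eqI) (simp_all add: KG_closed ev_scale)
 qed
 have fin: "f:CI +>\<^bsub>KG\<^esub> f" by (rule I.a_rcos_self[OF f])
 show "c\<odot>\<^bsub>RG\<^esub>(CI +>\<^bsub>KG\<^esub> f) = CI +>\<^bsub>KG\<^esub> (fscale c f)"
 proof -
  have "(\<Union>x\<in>CI +>\<^bsub>KG\<^esub> f. CI +>\<^bsub>KG\<^esub> fscale c x) = CI +>\<^bsub>KG\<^esub> fscale c f"
   by (rule equalityI[OF UN_least UN_upper[OF fin]]) (rule equalityD1[OF eq])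
  then show ?thesis unfolding commutativity_algebra_def quotient_algebra_def module.simps KG_simps .
 qed
qed

lemma RG_consts:
 "carrier RG = (%f. CI +>\<^bsub>KG\<^esub> f) ` carrier (KG :: ('k::field, _) module)"
 "\<one>\<^bsub>RG\<^esub> = CI +>\<^bsub>KG\<^esub> (oneK :: _=>'k)" "\<zero>\<^bsub>RG\<^esub> = CI +>\<^bsub>KG\<^esub> (0 :: _=>'k)"
proof -
 interpret I: ideal "CI :: (('v, 'e) qpath=>'k) set" KG by (rule CI_ideal)
 show "carrier RG = (%f. CI +>\<^bsub>KG\<^esub> f) ` carrier (KG :: ('k::field, _) module)"
  by (auto simp: commutativity_algebra_def quotient_algebra_def FactRing_def A_RCOSETS_def RCOSETS_def a_r_coset_def)
 show "\<one>\<^bsub>RG\<^esub> = CI +>\<^bsub>KG\<^esub> (oneK :: _=>'k)"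
  by (simp add: commutativity_algebra_def quotient_algebra_def FactRing_def)
 have "CI +>\<^bsub>KG\<^esub> (0 :: _=>'k) = CI"
  using I.a_coset_join2[OF I.zero_closed I.a_subgroup I.additive_subgroup_axioms[THEN additive_subgroup.zero_closed]]
  by (simp add: KG_simps)
 then show "\<zero>\<^bsub>RG\<^esub> = CI +>\<^bsub>KG\<^esub> (0 :: _=>'k)"
  by (simp add: commutativity_algebra_def quotient_algebra_def FactRing_def)
qed

text \<open>The homomorphism theorem for \<open>ev\<close>: injectivity on cosets is the description
  of the ideal as a kernel, and the image consists of all matrices supported on
  reachability.\<close>

lemma incidence_RG:
 assumes anti: "!!s t. reach s t ==> reach t s ==> s = t"
 shows "incidence_algebra (RG :: ('k::field, (('v, 'e) qpath=>'k) set) module) (verts G) reach coset_ev"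
proof
 show "finite (verts G)" by simp
 show "reach s t ==> s:verts G & t:verts G" for s t by (rule reach_verts)
 show "bij_betw coset_ev (carrier RG) {g :: _=>'k. ALL t s. g (t, s)~=0-->reach s t}"
  unfolding bij_betw_def
 proof
  show "inj_on coset_ev (carrier (RG :: ('k, (('v, 'e) qpath=>'k) set) module))"
  proof (rule inj_onI)
   fix X Y assume "X:carrier (RG :: ('k, (('v, 'e) qpath=>'k) set) module)" "Y:carrier RG" and e: "coset_ev X = coset_ev Y"
   then obtain f g where f: "f:carrier KG" "X = CI +>\<^bsub>KG\<^esub> f" and g: "g:carrier KG" "Y = CI +>\<^bsub>KG\<^esub> g"
    unfolding RG_consts by blast
   then show "X = Y" using coset_eqI[OF f(1) g(1)] coset_ev[OF f(1)] coset_ev[OF g(1)] e by simp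
  qed
  show "coset_ev ` carrier RG = {g :: _=>'k. ALL t s. g (t, s)~=0-->reach s t}"
  proof (intro equalityI subsetI)
   fix g :: "'v\<times>'v=>'k" assume "g:coset_ev ` carrier RG"
   then show "g:{g :: _=>'k. ALL t s. g (t, s)~=0-->reach s t}"
    unfolding RG_consts using ev_support by (auto simp: coset_ev)
  next
   fix g :: "'v\<times>'v=>'k" assume "g:{g :: _=>'k. ALL t s. g (t, s)~=0-->reach s t}"
   then obtain f where "f:carrier KG" "ev f = g" using ev_surj[of g] by blast
   then show "g:coset_ev ` carrier RG" unfolding RG_consts using coset_ev by (metis imageI)
  qed
 qed
qed (auto simp: reach_refl anti RG_consts RG_ops coset_ev KG_closed mult_closed one_KG ev_add ev_zero ev_one ev_mult ev_scale
  intro: reach_trans)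

lemma vertex_idempotent_ev:
 "v:verts G ==> vertex_idempotent G v:carrier (RG :: ('k::field, (('v, 'e) qpath=>'k) set) module)"
 "v:verts G ==> coset_ev (vertex_idempotent G v) (t, s) = (if t = v & s = v then 1 else (0 :: 'k))"
proof -
 assume v: "v:verts G"
 have c: "(pvec (v, []) :: _=>'k):carrier KG" by (rule pvec_carrier[OF trivial_qpath[OF v]])
 show "vertex_idempotent G v:carrier (RG :: ('k, (('v, 'e) qpath=>'k) set) module)"
  unfolding vertex_idempotent_def RG_consts using c by blast
 show "coset_ev (vertex_idempotent G v) (t, s) = (if t = v & s = v then 1 else (0 :: 'k))"
  unfolding vertex_idempotent_def coset_ev[OF c] ev_pvec trivial_ends by auto
qed

end

section \<open>Tree quivers\<close>

text \<open>The property of trees from which the bimodule computations start: a path is determined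
  by its ends, so \<open>ev\<close> is injective and the path algebra becomes an algebra of
  matrices.\<close>

locale thin_quiver = quiver G for G :: "('v, 'e) pre_digraph" +
 assumes qpath_unique: "p:qpaths G ==> q:qpaths G ==> psrc p = psrc q ==> ptgt G p = ptgt G q ==> p = q"
begin

lemma finite_qpaths: "finite (qpaths G)"
proof (rule finite_imageD)
 show "inj_on (%p. (psrc p, ptgt G p)) (qpaths G)" using qpath_unique by (auto simp: inj_on_def)
 have "(%p. (psrc p, ptgt G p)) ` qpaths G<=verts G\<times>verts G" using qpath_ends by blast
 then show "finite ((%p. (psrc p, ptgt G p)) ` qpaths G)" by (rule finite_subset) simp
qed

lemma function_algebra_KG: "function_algebra (KG :: ('k::field, ('v, 'e) qpath=>'k) module)"
 by (rule function_algebraI[OF finite_qpaths])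

lemma rep_eq: "p:qpaths G ==> rep (psrc p) (ptgt G p) = p"
 using rep[of "psrc p" "ptgt G p"] qpath_unique unfolding reach_def by blast

lemma ev_apply: "f:carrier KG ==> p:qpaths G ==> ev f (ptgt G p, psrc p) = f p"
proof -
 assume f: "f:carrier KG" and p: "p:qpaths G"
 have "ev f (ptgt G p, psrc p) = pair f (%q. if q = p then 1 else 0)"
  unfolding ev_def prod.case using qpath_unique[OF support_qpath[OF f] p] by (intro pair_cong) auto
 then show ?thesis using pair_delta[OF fin_support[OF f]] by metis
qed

lemma ev_inj: "f:carrier KG ==> g:carrier KG ==> ev f = ev g ==> f = g"
proof
 fix p assume f: "f:carrier KG" "g:carrier KG" "ev f = ev g"
 show "f p = g p"
 proof (cases "p:qpaths G")
  case True then show ?thesis using ev_apply[OF f(1) True] ev_apply[OF f(2) True] f(3) by simp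
 next
  case False then show ?thesis using support_qpath[OF f(1)] support_qpath[OF f(2)] by metis
 qed
qed

end

lemma cas_double_forward:
 "pre_digraph.cas Q u p v ==> pre_digraph.cas (double_quiver Q) v r w ==>
  pre_digraph.cas (double_quiver Q) u (map (%e. (e, False)) p @ r) w"
 by (induction p arbitrary: u) (auto simp: pre_digraph.cas.simps double_quiver_def)

lemma cas_double_backward:
 "pre_digraph.cas Q u q v ==> pre_digraph.cas (double_quiver Q) u r w ==>
  pre_digraph.cas (double_quiver Q) v (rev (map (%e. (e, True)) q) @ r) w"
proof (induction q arbitrary: u r)
 case (Cons e q)
 have "pre_digraph.cas (double_quiver Q) v (rev (map (%e. (e, True)) q) @ (e, True) # r) w"
  by (rule Cons.IH[of "head Q e"]) (use Cons.prems in "auto simp: pre_digraph.cas.simps double_quiver_def")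
 then show ?case by simp
qed (auto simp: pre_digraph.cas.simps)

lemma cas_awalk_verts: "pre_digraph.cas Q u p v ==> pre_digraph.awalk_verts Q u p = u # map (head Q) p"
 by (induction p arbitrary: u) (auto simp: pre_digraph.cas.simps pre_digraph.awalk_verts.simps)

text \<open>In a minimal pair of distinct parallel walks, going along the first and back along the second
 is a cycle of the underlying graph.\<close>

lemma tree_quiver_walk_unique:
 assumes "tree_quiver Q" "pre_digraph.awalk Q u p v" "pre_digraph.awalk Q u q v"
 shows "p = q"
proof -
 interpret fin_digraph Q using assms(1) by (simp add: tree_quiver_def)
 have al: "awlast x (r @ [g]) = head Q g" for x r g by (simp add: awlast_append)
 show ?thesis using assms(2,3)
 proof (induction "length p + length q" arbitrary: u v p q rule: less_induct)
  case less
  show ?case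
  proof (rule ccontr)
   assume ne: "p~=q"
   \<comment> \<open>At a vertex where both walks are cut, the two prefixes coincide and the two
     suffixes coincide by minimality, unless one of these pairs is empty. So \<open>p\<close> and
     \<open>q\<close> meet only at their ends.\<close>
   have split: "p1 = [] & q1 = []\<or>p2 = [] & q2 = []"
    if h: "p = p1 @ p2" "q = q1 @ q2" "awlast u p1 = awlast u q1" for p1 p2 q1 q2
   proof (rule ccontr)
    assume n: "\<not> ?thesis"
    have w: "awalk u p1 (awlast u p1)" "awalk (awlast u p1) p2 v" "awalk u q1 (awlast u p1)" "awalk (awlast u p1) q2 v"
     using less.prems h by (auto simp: awalk_append_iff)
    have "p1 = q1" by (rule less.hyps[OF _ w(1) w(3)]) (use n h in auto)
    moreover have "p2 = q2" by (rule less.hyps[OF _ w(2) w(4)]) (use n h in auto)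
    ultimately show False using ne h by simp
   qed
   \<comment> \<open>A shorter closed walk is compared with the trivial walk at the same vertex,
     again by minimality.\<close>
   have closed: "r = []" if r: "awalk x r x" "length r < length p + length q" for x r
   proof -
    have "awalk x [] x" using r(1) by (simp add: awalk_Nil_iff awalk_hd_in_verts)
    then show ?thesis using less.hyps[of r "[]" x x] r by simp
   qed
   have dp: "distinct (map (head Q) p)"
   proof (rule ccontr)
    assume "\<not> ?thesis"
    then obtain xs ys zs y where "map (head Q) p = xs @ [y] @ ys @ [y] @ zs" using not_distinct_decomp by blast
    then obtain a e b f c where p: "p = a @ [e] @ b @ [f] @ c" "head Q e = y" "head Q f = y"
     by (auto simp: map_eq_append_conv map_eq_Cons_conv append_eq_map_conv Cons_eq_map_conv)
    have "awalk u ((a @ [e]) @ (b @ [f]) @ c) v" using less.prems(1) p by simp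
    then have "awalk y (b @ [f]) y"
     unfolding awalk_append_iff[of u "a @ [e]"] awalk_append_iff[of _ "b @ [f]"] al p by simp
    then show False using closed[of y "b @ [f]"] p by simp
   qed
   \<comment> \<open>The cycle runs backwards along \<open>q\<close>, so the vertices it visits
     there are the tails of the arrows of \<open>q\<close>.\<close>
   have dq: "distinct (map (tail Q) q)"
   proof (rule ccontr)
    assume "\<not> ?thesis"
    then obtain xs ys zs y where "map (tail Q) q = xs @ [y] @ ys @ [y] @ zs" using not_distinct_decomp by blast
    then obtain a e b f c where q: "q = a @ [e] @ b @ [f] @ c" "tail Q e = y" "tail Q f = y"
     by (auto simp: map_eq_append_conv map_eq_Cons_conv append_eq_map_conv Cons_eq_map_conv)
    have "awalk u (a @ (e # b) @ f # c) v" using less.prems(2) q by simp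
    then have "awalk (awlast u a) (e # b) (awlast (awlast u a) (e # b))" "awalk (awlast (awlast u a) (e # b)) (f # c) v"
     unfolding awalk_append_iff[of u a] awalk_append_iff[of _ "e # b"] by blast+
    then have "awalk y (e # b) y" using q by (metis awalk_Cons_iff)
    then show False using closed[of y "e # b"] q by simp
   qed
   have disj: False if ef: "e:set p" "f:set q" "head Q e = tail Q f" for e f
   proof -
    obtain a b c d where pq: "p = a @ e # b" "q = c @ f # d" using ef split_list by metis
    have "awlast u c = tail Q f" using less.prems(2) unfolding pq awalk_append_iff awalk_Cons_iff by simp
    then show False using split[of "a @ [e]" b c "f # d"] pq ef(3) al by simp
   qed
   have disje: False if e: "e:set p" "e:set q" for e
   proof -
    obtain a b c d where pq: "p = a @ e # b" "q = c @ e # d" using e split_list by metis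
    have "awlast u c = tail Q e" "awlast u a = tail Q e" using less.prems unfolding pq awalk_append_iff awalk_Cons_iff by simp_all
    then have "a = [] & c = []" using split[of a "e # b" c "e # d"] pq by simp
    moreover have "b = [] & d = []" using split[of "a @ [e]" b "c @ [e]" d] pq al by simp
    ultimately show False using ne pq by simp
   qed
   let ?D = "double_quiver Q"
   define c where "c = map (%e. (e, False)) p @ rev (map (%e. (e, True)) q)"
   have cq: "cas u p v" "cas u q v" "set p<=arcs Q" "set q<=arcs Q" "u:verts Q" using less.prems by (auto simp: awalk_def)
   have "pre_digraph.cas ?D u [] u" by (simp add: pre_digraph.cas.simps)
   from cas_double_forward[OF cq(1) cas_double_backward[OF cq(2) this]]
   have cc: "pre_digraph.cas ?D u c u" by (simp add: c_def)
   have "pre_digraph.awalk ?D u c u" using cc cq by (auto simp: pre_digraph.awalk_def c_def double_quiver_def)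
   moreover have "distinct (tl (pre_digraph.awalk_verts ?D u c))"
   proof -
    have "tl (pre_digraph.awalk_verts ?D u c) = map (head Q) p @ rev (map (tail Q) q)"
     unfolding cas_awalk_verts[OF cc] by (simp add: c_def double_quiver_def rev_map)
    then show ?thesis using dp dq disj by fastforce
   qed
   moreover have "c~=[]" using ne by (auto simp: c_def)
   ultimately have "pre_digraph.cycle ?D c" unfolding pre_digraph.cycle_def by blast
   moreover have "map fst c = p @ rev q" by (simp add: c_def rev_map comp_def)
   then have "distinct (map fst c)" using dp dq disje by (auto simp: distinct_map)
   ultimately show False using assms(1) unfolding tree_quiver_def by blast
  qed
 qed
qed

lemma tree_quiver_thin: "tree_quiver Q ==> thin_quiver Q"
proof -
 assume t: "tree_quiver Q"
 interpret quiver Q using t by (simp add: tree_quiver_def quiver_def)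
 show ?thesis
 proof
  fix p q assume "p:qpaths Q" "q:qpaths Q" "psrc p = psrc q" "ptgt Q p = ptgt Q q"
  then show "p = q" using tree_quiver_walk_unique[OF t, of "psrc p" "snd p" "ptgt Q p" "snd q"]
   by (auto simp: qpaths_def psrc_def prod_eq_iff)
 qed
qed

section \<open>Bimodules of functions on pairs of vertices\<close>

lemma BHI:
 assumes "!!x. x:bC B ==> fi x:bC B'"
  and "!!x y. x:bC B ==> y:bC B ==> fi (x + y) = fi x + fi y"
  and "!!x c. x:bC B ==> fi (fscale c x) = fscale c (fi x)"
  and "!!x a. x:bC B ==> a:carrier A ==> fi (lact B a x) = lact B' a (fi x)"
  and "!!x a. x:bC B ==> a:carrier A ==> fi (ract B x a) = ract B' (fi x) a"
 shows "fi:BH A B B'"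
 using assms unfolding bimodule_homs_def by blast

lemma BH_comp:
 assumes "fi:BH A B B'" "gi:BH A B' B''"
 shows "(%x. gi (fi x)):BH A B B''"
 by (rule BHI) (simp_all add: BHD[OF assms(1)] BHD[OF assms(2)])

text \<open>Bimodule laws are pulled back along an injective homomorphism: each law is verified
  after applying \<open>fi\<close>.\<close>

lemma fd_bimodule_transfer:
 fixes A :: "('k::field, 'x=>'k) module"
 assumes B': "fd_bimodule A B'" and s: "fsubspace (bC B)" "finite S" "bC B<=spt S"
  and l: "!!a b. a:carrier A ==> b:bC B ==> lact B a b:bC B & ract B b a:bC B"
  and fi: "fi:BH A B B'" "inj_on fi (bC B)"
 shows "fd_bimodule A B"
proof -
 interpret B': fd_bimodule A B' by fact
 have sc: "x + y:bC B" "fscale c x:bC B" if "x:bC B" "y:bC B" for x y c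
  using s(1) that unfolding fsubspace_iff by blast+
 note p = BHD[OF fi(1)]
 show ?thesis
  by unfold_locales
   (insert s l, blast, blast, blast, blast,
    (rule inj_onD[OF fi(2)], simp only: p l sc B'.lact_add B'.lact_scale B'.add_lact B'.scale_lact B'.mult_lact B'.one_lact
     B'.ract_add B'.ract_scale B'.add_ract B'.scale_ract B'.mult_ract B'.one_ract B'.lact_ract
     B'.carrier_add B'.carrier_scale B'.m_closed B'.one_closed,
    simp_all add: l sc B'.carrier_add B'.carrier_scale)+)
qed

text \<open>Delta functions are elementary tensors, and on a finite product they span all
  functions.\<close>

lemma fspan_outer:
 assumes S: "finite S" "finite S'"
 shows "fspan {(%(x, y). u x * w y) | u w. u:spt S & w:spt S'} =
  (spt (S\<times>S') :: ('x\<times>'y=>'k::field) set)" (is "fspan ?g = _")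
proof
 interpret vector_space "fscale :: 'k=>('x\<times>'y=>'k)=>'x\<times>'y=>'k"
  by unfold_locales (auto simp: algebra_simps fun_eq_iff)
 show "span ?g<=(spt (S\<times>S') :: ('x\<times>'y=>'k) set)"
  by (rule span_minimal[OF _ fsub_spt]) (auto simp: spt_def)
 show "(spt (S\<times>S') :: ('x\<times>'y=>'k) set)<=span ?g"
 proof
  fix f :: "'x\<times>'y=>'k" assume f: "f:spt (S\<times>S')"
  let ?d = "%p. (%(x, y). (if x = fst p then 1 else 0) * (if y = snd p then 1 else 0)) :: 'x\<times>'y=>'k"
  have "?d p:span ?g" if "p:S\<times>S'" for p
  proof (rule span_base)
   show "?d p:?g" using that
    by (intro CollectI exI[of _ "%x. if x = fst p then 1 else 0"] exI[of _ "%x. if x = snd p then 1 else 0"])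
     (auto simp: spt_def)
  qed
  then have "(\<Sum>p\<in>S\<times>S'. fscale (f p) (?d p)):span ?g" by (intro span_sum span_scale)
  moreover have "(\<Sum>p\<in>S\<times>S'. fscale (f p) (?d p)) = f"
  proof
   fix q
   have "(\<Sum>p\<in>F. fscale (f p) (?d p)) q = (\<Sum>p\<in>F. if p = q then f q else 0)" if "finite F" for F
    using that by induction (auto simp: prod_eq_iff split: prod.splits)
   then show "(\<Sum>p\<in>S\<times>S'. fscale (f p) (?d p)) q = f q" using f S by (cases q) (auto simp: spt_def)
  qed
  ultimately show "f:span ?g" by simp
 qed
qed

context thin_quiver
begin

lemma pair_filter:
 assumes "a:carrier KG"
 shows "(\<Sum>p | a p~=0 & P p. a p * g p) = pair a (%p. if P p then g p else (0 :: 'k::field))"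
proof -
 have "{p. a p~=0 & P p} = {p:{p. a p~=0}. P p}" by auto
 then show ?thesis unfolding pair_def by (simp only: sum.inter_filter[OF fin_support[OF assms]]) (rule sum.cong; simp)
qed

text \<open>Grouping the paths of \<open>a\<close> by their source turns the left action on N
  \<otimes> N' into multiplication by the matrix \<open>ev a\<close>; the right action is treated
  alike.\<close>

lemma NN_lact:
 assumes a: "a:carrier KG"
 shows "lact (NN G) a t (x, y) = (\<Sum>m\<in>verts G. ev a (x, m) * t (m, y) :: 'k::field)"
proof -
 have "lact (NN G) a t (x, y) = pair a (%p. if ptgt G p = x then t (psrc p, y) else 0)"
  by (simp add: NN_def outer_tensor_def N_lact_def pair_filter[OF a])
 also have "\<dots> = pair a (%p. \<Sum>m\<in>verts G. (if psrc p = m & ptgt G p = x then 1 else 0) * t (m, y))"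
 proof (rule pair_cong)
  fix p assume "a p~=0"
  then have "psrc p:verts G" using support_qpath[OF a] qpath_ends by blast
  have "(\<Sum>m\<in>verts G. (if psrc p = m & ptgt G p = x then 1 else 0) * t (m, y)) =
    (\<Sum>m\<in>verts G. if m = psrc p then (if ptgt G p = x then t (m, y) else 0) else 0)" by (intro sum.cong) auto
  then show "(if ptgt G p = x then t (psrc p, y) else 0) = (\<Sum>m\<in>verts G. (if psrc p = m & ptgt G p = x then 1 else 0) * t (m, y))"
   using \<open>psrc p \<in> verts G\<close> by simp
 qed
 also have "\<dots> = (\<Sum>m\<in>verts G. ev a (x, m) * t (m, y))"
  unfolding pair_weight_sum pair_weight_mult ev_def prod.case ..
 finally show ?thesis .
qed

lemma NN_ract:
 assumes a: "a:carrier KG"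
 shows "ract (NN G) t a (x, y) = (\<Sum>m\<in>verts G. t (x, m) * ev a (m, y) :: 'k::field)"
proof -
 have "ract (NN G) t a (x, y) = (\<Sum>p | a p~=0 & psrc p = y. a p * t (x, ptgt G p))"
  by (simp add: NN_def outer_tensor_def N'_ract_def mult.commute)
 also have "\<dots> = pair a (%p. if psrc p = y then t (x, ptgt G p) else 0)" by (rule pair_filter[OF a])
 also have "\<dots> = pair a (%p. \<Sum>m\<in>verts G. (if psrc p = y & ptgt G p = m then 1 else 0) * t (x, m))"
 proof (rule pair_cong)
  fix p assume "a p~=0"
  then have "ptgt G p:verts G" using support_qpath[OF a] qpath_ends by blast
  have "(\<Sum>m\<in>verts G. (if psrc p = y & ptgt G p = m then 1 else 0) * t (x, m)) =
    (\<Sum>m\<in>verts G. if m = ptgt G p then (if psrc p = y then t (x, m) else 0) else 0)" by (intro sum.cong) auto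
  then show "(if psrc p = y then t (x, ptgt G p) else 0) = (\<Sum>m\<in>verts G. (if psrc p = y & ptgt G p = m then 1 else 0) * t (x, m))"
   using \<open>ptgt G p \<in> verts G\<close> by simp
 qed
 also have "\<dots> = (\<Sum>m\<in>verts G. ev a (m, y) * t (x, m))"
  unfolding pair_weight_sum pair_weight_mult ev_def prod.case ..
 finally show ?thesis by (simp add: mult.commute)
qed

lemma NN_carrier: "bC (NN G) = (spt (verts G\<times>verts G) :: ('v\<times>'v=>'k::field) set)"
proof -
 have "N_space G = (spt (verts G) :: ('v=>'k) set)" by (auto simp: N_space_def spt_def)
 then show ?thesis using fspan_outer[of "verts G" "verts G"] by (simp add: NN_def outer_tensor_def)
qed

text \<open>Closed for the order on pairs generated by the two actions: a path acting on the left
  moves b forwards, one acting on the right moves a backwards. The functions supported on such a set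
  form a subbimodule of N \<otimes> N'.\<close>

definition upset :: "('v\<times>'v) set=>bool" where
 "upset U\<longleftrightarrow>U<=verts G\<times>verts G & (ALL b a b' a'. (b, a):U-->reach b b'-->reach a' a-->(b', a'):U)"

lemma upsetD: "upset U ==> (b, a):U ==> reach b b' ==> reach a' a ==> (b', a'):U"
 "upset U ==> (b, a):U ==> b:verts G & a:verts G"
 unfolding upset_def by blast+

lemma finite_upset: "upset U ==> finite U"
 unfolding upset_def by (rule finite_subset[of _ "verts G\<times>verts G"]) auto

text \<open>The direct sum over I of the bimodules of functions supported on \<open>up c\<close>.
  Single up-sets, the free bimodule and the generator are all equal to such a sum or embedded in
  one, so the bimodule laws are computed only in \<open>fam_fd\<close>.\<close>

definition fam :: "'i set=>('i=>('v\<times>'v) set)=>('k::field, ('v, 'e) qpath=>'k, 'i\<times>'v\<times>'v) bimod" where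
 "fam I up = \<lparr>bcarrier = spt (Sigma I up), lact = (%a f (c, x). lact (NN G) a (%y. f (c, y)) x),
   ract = (%f a (c, x). ract (NN G) (%y. f (c, y)) a x)\<rparr>"

lemma fam_lact: "a:carrier KG ==>
  lact (fam I up) a f (c, x, y) = (\<Sum>m\<in>verts G. ev a (x, m) * f (c, m, y) :: 'k::field)"
 by (simp add: fam_def NN_lact)

lemma fam_ract: "a:carrier KG ==>
  ract (fam I up) f a (c, x, y) = (\<Sum>m\<in>verts G. f (c, x, m) * ev a (m, y) :: 'k::field)"
 by (simp add: fam_def NN_ract)

lemma fam_fd:
 assumes I: "finite I" and up: "!!c. c:I ==> upset (up c)"
 shows "fd_bimodule KG (fam I up :: ('k::field, ('v, 'e) qpath=>'k, 'i\<times>'v\<times>'v) bimod)"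
proof (rule fd_bimodule.intro[OF function_algebra_KG], rule fd_bimodule_axioms.intro)
 let ?B = "fam I up :: ('k, ('v, 'e) qpath=>'k, 'i\<times>'v\<times>'v) bimod"
 note E = fam_lact fam_ract
 have sup: "f:bC ?B\<longleftrightarrow>(ALL c x y. f (c, x, y)~=0-->c:I & (x, y):up c)" for f
  by (auto simp: fam_def spt_def)
 have supV: "x:verts G" "y:verts G" if "f:bC ?B" "f (c, x, y)~=0" for f c x y
  using that up upsetD(2) unfolding sup by blast+
 show "fsubspace (bC ?B)" by (simp add: fam_def fsub_spt)
 show "EX S. finite S & bC ?B<=spt S"
  using I up finite_upset by (intro exI[of _ "Sigma I up"]) (auto simp: fam_def)
 fix a a' :: "('v, 'e) qpath=>'k" and b b' :: "'i\<times>'v\<times>'v=>'k" and k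
 assume a: "a:carrier KG" and b: "b:bC ?B"
 show "lact ?B a b:bC ?B"
  unfolding sup
 proof (intro allI impI)
  fix c x y assume "lact ?B a b (c, x, y)~=0"
  then obtain m where "ev a (x, m)~=0" "b (c, m, y)~=0"
   unfolding E(1)[OF a] by (metis (no_types, lifting) mult_not_zero sum.neutral)
  then have "c:I" "(m, y):up c" "reach m x" "reach y y" using b ev_support[OF a] supV[OF b] reach_refl unfolding sup by blast+
  then show "c:I & (x, y):up c" using upsetD(1)[OF up] by blast
 qed
 show "ract ?B b a:bC ?B"
  unfolding sup
 proof (intro allI impI)
  fix c x y assume "ract ?B b a (c, x, y)~=0"
  then obtain m where "ev a (m, y)~=0" "b (c, x, m)~=0"
   unfolding E(2)[OF a] by (metis (no_types, lifting) mult_not_zero sum.neutral)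
  then have "c:I" "(x, m):up c" "reach y m" "reach x x" using b ev_support[OF a] supV[OF b] reach_refl unfolding sup by blast+
  then show "c:I & (x, y):up c" using upsetD(1)[OF up] by blast
 qed
 show "lact ?B a (b + b') = lact ?B a b + lact ?B a b'" "ract ?B (b + b') a = ract ?B b a + ract ?B b' a"
  "lact ?B a (fscale k b) = fscale k (lact ?B a b)" "ract ?B (fscale k b) a = fscale k (ract ?B b a)"
  "lact ?B (fscale k a) b = fscale k (lact ?B a b)" "ract ?B b (fscale k a) = fscale k (ract ?B b a)"
  by (auto simp: fun_eq_iff E a KG_closed ev_scale algebra_simps sum.distrib sum_distrib_left)
 show "lact ?B (a + a') b = lact ?B a b + lact ?B a' b" "ract ?B b (a + a') = ract ?B b a + ract ?B b a'"
  "lact ?B (a ** a') b = lact ?B a (lact ?B a' b)" "ract ?B b (a ** a') = ract ?B (ract ?B b a) a'"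
  "lact ?B a (ract ?B b a') = ract ?B (lact ?B a b) a'" if a': "a':carrier KG"
 proof -
  show "lact ?B (a + a') b = lact ?B a b + lact ?B a' b" "ract ?B b (a + a') = ract ?B b a + ract ?B b a'"
   by (auto simp: fun_eq_iff E a a' KG_closed ev_add algebra_simps sum.distrib)
  show "lact ?B (a ** a') b = lact ?B a (lact ?B a' b)"
   by (auto simp: fun_eq_iff E a a' mult_closed ev_mult sum_distrib_left sum_distrib_right mult.assoc intro: sum.swap)
  show "ract ?B b (a ** a') = ract ?B (ract ?B b a) a'"
   by (auto simp: fun_eq_iff E a a' mult_closed ev_mult sum_distrib_left sum_distrib_right mult.assoc intro: sum.swap)
  show "lact ?B a (ract ?B b a') = ract ?B (lact ?B a b) a'"
   by (auto simp: fun_eq_iff E a a' sum_distrib_left sum_distrib_right mult.assoc intro: sum.swap)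
 qed
next
 let ?B = "fam I up :: ('k, ('v, 'e) qpath=>'k, 'i\<times>'v\<times>'v) bimod"
 fix b assume b: "b:bC ?B"
 have z: "b (c, x, y) = 0" if "x~:verts G\<or>y~:verts G" for c x y
 proof (rule ccontr)
  assume "b (c, x, y)~=0"
  then have "c:I" "(x, y):up c" using b by (auto simp: fam_def spt_def)
  then show False using upsetD(2)[OF up] that by blast
 qed
 show "lact ?B oneK b = b"
 proof (intro ext, clarify)
  fix c x y
  have "lact ?B oneK b (c, x, y) = (\<Sum>m\<in>verts G. if m = x then b (c, x, y) else 0)"
   unfolding fam_lact[OF one_KG] ev_one by (intro sum.cong) auto
  then show "lact ?B oneK b (c, x, y) = b (c, x, y)" using z by auto
 qed
 show "ract ?B b oneK = b"
 proof (intro ext, clarify)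
  fix c x y
  have "ract ?B b oneK (c, x, y) = (\<Sum>m\<in>verts G. if m = y then b (c, x, y) else 0)"
   unfolding fam_ract[OF one_KG] ev_one by (intro sum.cong) auto
  then show "ract ?B b oneK (c, x, y) = b (c, x, y)" using z by auto
 qed
qed

lemma NNs: "bC (NN_sub G M) = M" "lact (NN_sub G M) = lact (NN G)" "ract (NN_sub G M) = ract (NN G)"
 by (simp_all add: NN_sub_def)

lemma NN_sub_fd:
 assumes U: "upset U"
 shows "fd_bimodule KG (NN_sub G (spt U) :: ('k::field, ('v, 'e) qpath=>'k, 'v\<times>'v) bimod)"
proof (rule fd_bimodule_transfer[where fi = "%f p. f (snd p)" and S = U])
 let ?B = "fam {()} (%_. U) :: ('k, ('v, 'e) qpath=>'k, unit\<times>'v\<times>'v) bimod"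
 show B: "fd_bimodule KG ?B" by (rule fam_fd) (use U in auto)
 then interpret fd_bimodule KG ?B .
 show "(%f p. f (snd p)):BH KG (NN_sub G (spt U)) ?B"
  by (rule BHI) (auto simp: NNs fam_def spt_def)
 show "inj_on (%f p. f (snd p)) (bC (NN_sub G (spt U)))"
  by (auto simp: inj_on_def fun_eq_iff)
 fix a :: "('v, 'e) qpath=>'k" and b :: "'v\<times>'v=>'k" assume a: "a:carrier KG" and b: "b:bC (NN_sub G (spt U))"
 have "(%p. b (snd p)):bC ?B" using b by (auto simp: NNs fam_def spt_def)
 from lact_closed[OF a this] ract_closed[OF a this]
 show "lact (NN_sub G (spt U)) a b:bC (NN_sub G (spt U)) & ract (NN_sub G (spt U)) b a:bC (NN_sub G (spt U))"
  by (auto simp: NNs fam_def spt_def)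
qed (use finite_upset[OF U] in "auto simp: NNs fsub_spt")

end

section \<open>Subbimodules and their homomorphisms\<close>

definition delta :: "'x=>'x=>'k::field" where "delta x = (%y. if y = x then 1 else 0)"

lemma delta_spt: "(delta x :: 'x=>'k::field):spt S\<longleftrightarrow>x:S"
 by (auto simp: delta_def spt_def)

lemma sptD: "f:spt S ==> x~:S ==> f x = 0"
 unfolding spt_def by blast

lemma supportedI: "(!!x. x~:S ==> f x = 0) ==> f:spt S"
 unfolding spt_def by blast

lemma spt_le: "(spt U :: ('x=>'k::field) set)<=spt W\<longleftrightarrow>U<=W"
proof
 assume h: "(spt U :: ('x=>'k) set)<=spt W"
 show "U<=W"
 proof
  fix x assume "x:U"
  then have "(delta x :: 'x=>'k):spt U" by (simp only: delta_spt)
  from subsetD[OF h this] show "x:W" by (simp only: delta_spt)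
 qed
qed (auto simp: spt_def)

lemma supported_eq_iff: "(spt U :: ('x=>'k::field) set) = spt W\<longleftrightarrow>U = W"
 unfolding set_eq_subset spt_le ..

lemma bimodule_homs_inverse:
 assumes B: "fd_bimodule A B" and fi: "fi:BH A B B'" "inj_on fi (bC B)"
  and B': "fd_bimodule A B'" and g: "!!y. y:bC B' ==> g y:bC B" "!!y. y:bC B' ==> fi (g y) = y"
 shows "g:BH A B' B"
proof -
 interpret B: fd_bimodule A B by fact
 interpret B': fd_bimodule A B' by fact
 have sc: "fscale c x:bC B" if "x:bC B" for c x using B.b_subspace that unfolding fsubspace_iff by blast
 have sc': "fscale c x:bC B'" if "x:bC B'" for c x using B'.b_subspace that unfolding fsubspace_iff by blast
 show ?thesis
  by (rule BHI; (rule inj_onD[OF fi(2)])?)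
   (simp_all add: BHD[OF fi(1)] g B.b_add B'.b_add sc sc' B.lact_closed B'.lact_closed B.ract_closed B'.ract_closed)
qed

context thin_quiver
begin

lemma NN_sub_full: "NN_sub G (spt (verts G\<times>verts G)) = (NN G :: ('k::field, _, _) bimod)"
 by (simp add: NN_sub_def NN_carrier[symmetric])

lemma upset_Int: "upset U ==> upset W ==> upset (U\<inter>W)" and upset_Un: "upset U ==> upset W ==> upset (U\<union>W)"
 and upset_empty: "upset {}"
 unfolding upset_def by blast+

text \<open>The path from b to b' on the left and the one from a' to a on the right annihilate every
  coordinate except (b, a), which they carry to (b', a').\<close>

lemma NN_move:
 assumes "reach b b'" "reach a' a"
 shows "ract (NN G) (lact (NN G) (pvec (rep b b')) f) (pvec (rep a' a)) = fscale (f (b, a)) (delta (b', a') :: _=>'k::field)"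
proof (rule ext, clarify)
 fix x y
 have c: "(pvec (rep b b') :: _=>'k):carrier KG" "(pvec (rep a' a) :: _=>'k):carrier KG"
  using rep assms pvec_carrier by blast+
 have V: "a:verts G" "b:verts G" using assms reach_verts by blast+
 note r = rep[OF assms(1)] rep[OF assms(2)]
 let ?t = "lact (NN G) (pvec (rep b b')) f"
 have 1: "?t (x, y) = (if x = b' then f (b, y) else 0)" for x y
 proof -
  have "?t (x, y) = (\<Sum>m\<in>verts G. if m = b then (if x = b' then f (b, y) else 0) else 0)"
   unfolding NN_lact[OF c(1)] by (intro sum.cong) (use r in "auto simp: ev_pvec")
  then show ?thesis using V by simp
 qed
 have "ract (NN G) ?t (pvec (rep a' a)) (x, y) = (\<Sum>m\<in>verts G. if m = a then (if y = a' then ?t (x, a) else 0) else 0)"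
  unfolding NN_ract[OF c(2)] by (intro sum.cong) (use r in "auto simp: ev_pvec")
 also have "\<dots> = fscale (f (b, a)) (delta (b', a')) (x, y)" using V by (simp add: 1 delta_def)
 finally show "ract (NN G) ?t (pvec (rep a' a)) (x, y) = f (b, a) * delta (b', a') (x, y)" .
qed

lemma NN_hom_move:
 assumes M: "upset M" and fi: "fi:BH KG (NN_sub G (spt M)) (NN_sub G K)"
  and f: "f:spt M" and r: "reach b b'" "reach a' a"
 shows "fi (fscale (f (b, a)) (delta (b', a'))) = fscale (fi f (b, a)) (delta (b', a') :: _=>'k::field)"
proof -
 interpret fd_bimodule KG "NN_sub G (spt M) :: ('k, ('v, 'e) qpath=>'k, 'v\<times>'v) bimod" by (rule NN_sub_fd[OF M])
 have c: "(pvec (rep b b') :: _=>'k):carrier KG" "(pvec (rep a' a) :: _=>'k):carrier KG"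
  using rep r pvec_carrier by blast+
 have fM: "f:bC (NN_sub G (spt M))" using f by (simp add: NNs)
 show ?thesis
  using BHD(5)[OF fi lact_closed[OF c(1) fM] c(2)] BHD(4)[OF fi fM c(1)]
  by (simp add: NNs NN_move[OF r])
qed

text \<open>Multiplying by trivial paths on both sides isolates one coordinate, and a homomorphism
  commutes with this.\<close>

lemma NN_hom_diagonal:
 assumes M: "upset M" and fi: "fi:BH KG (NN_sub G (spt M)) (NN_sub G (spt K))"
  and K: "K<=verts G\<times>verts G" and f: "f:spt M"
 shows "fi f y = fi (delta y) y * (f y :: 'k::field)"
proof -
 obtain b a where y: "y = (b, a)" by (cases y)
 have fif: "fi f:spt K" using BHD(1)[OF fi] f by (simp add: NNs)
 show ?thesis
 proof (cases "b:verts G & a:verts G")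
  case False
  then have "y~:K" "y~:M" using K upsetD(2)[OF M] by (auto simp: y)
  then have "fi f y = 0" "f y = 0" using sptD[OF fif] sptD[OF f] by blast+
  then show ?thesis by simp
 next
  case True
  then have r: "reach b b" "reach a a" using reach_refl by blast+
  note m = NN_hom_move[OF M fi f r, folded y]
  show ?thesis
  proof (cases "y:M")
   case True
   then have "delta y:bC (NN_sub G (spt M))" by (simp add: NNs delta_spt)
   then have "fi (fscale (f y) (delta y)) = fscale (f y) (fi (delta y))" by (rule BHD(3)[OF fi])
   then have "f y * fi (delta y) y = fi f y * delta y y" using fun_cong[OF m, of y] by simp
   then show ?thesis by (simp add: delta_def mult.commute)
  next
   case False
   then have fy: "f y = 0" by (rule sptD[OF f])
   have "fscale (f y) (delta y) = fscale 0 f" by (simp add: fy)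
   moreover have "fi (fscale 0 f) = fscale 0 (fi f)" by (rule BHD(3)[OF fi]) (use f in "simp add: NNs")
   ultimately have "0 = fi f y * delta y y" using fun_cong[OF m, of y] by simp
   then show ?thesis by (simp add: delta_def fy)
  qed
 qed
qed

text \<open>Connectedness as a poset, phrased through up-sets because complementary up-sets are what
  splits a bimodule into direct summands.\<close>

definition conn :: "('v\<times>'v) set=>bool" where
 "conn U\<longleftrightarrow>U~={} & (ALL W<=U. upset W-->upset (U - W)-->W = {}\<or>W = U)"

text \<open>The diagonal entries of a homomorphism agree along every step of the order. The
  positions where they take a given value and the remaining positions are therefore both up-sets,
  and connectedness leaves a single value. If it is nonzero, the images of delta functions show that
  M lies in the support of the target.\<close>

lemma NN_hom_scalar:
 assumes M: "upset M" "conn M" and fi: "fi:BH KG (NN_sub G (spt M)) (NN_sub G (spt K))"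
  and K: "K<=verts G\<times>verts G"
 shows "EX c. (ALL f:spt M. fi f = fscale c f) & (c~=(0 :: 'k::field)-->M<=K)"
proof -
 let ?c = "%x. fi (delta x) x"
 obtain x0 where x0: "x0:M" using M(2) by (auto simp: conn_def)
 have step: "?c (b', a') = ?c (b, a)" if ba: "(b, a):M" "reach b b'" "reach a' a" for b a b' a'
 proof -
  have d: "delta (b, a):spt M" using ba(1) by (simp add: delta_spt)
  from fun_cong[OF NN_hom_move[OF M(1) fi d ba(2,3)], of "(b', a')"]
  show ?thesis by (simp add: delta_def)
 qed
 let ?W = "{x:M. ?c x = ?c x0}"
 have up: "upset {x:M. P (?c x)}" for P
  unfolding upset_def
 proof (intro conjI allI impI)
  show "{x:M. P (?c x)}<=verts G\<times>verts G" using M(1) unfolding upset_def by blast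
  fix b a b' a' assume h: "(b, a):{x:M. P (?c x)}" "reach b b'" "reach a' a"
  then have ba: "(b, a):M" by simp
  show "(b', a'):{x:M. P (?c x)}" using h(1) upsetD(1)[OF M(1) ba h(2,3)] step[OF ba h(2,3)] by simp
 qed
 have "M - ?W = {x:M. ?c x~=?c x0}" by blast
 then have "upset (M - ?W)" using up[of "%c. c~=?c x0"] by simp
 moreover have "?W<=M" by blast
 ultimately have "?W = {}\<or>?W = M" using M(2) up[of "%c. c = ?c x0"] unfolding conn_def by blast
 then have "?W = M" using x0 by blast
 then have c: "?c x = ?c x0" if "x:M" for x using that by blast
 have sc: "fi f = fscale (?c x0) f" if f: "f:spt M" for f
 proof
  fix y
  show "fi f y = ?c x0 * f y"
   using NN_hom_diagonal[OF M(1) fi K f, of y] c[of y] sptD[OF f, of y] by (cases "y:M") simp_all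
 qed
 have "M<=K" if nz: "?c x0~=0"
 proof
  fix x assume x: "x:M"
  then have d: "delta x:spt M" by (simp add: delta_spt)
  have "fi (delta x):spt K" using BHD(1)[OF fi] d by (simp add: NNs)
  moreover have "fi (delta x) x~=0" using nz c[OF x] by simp
  ultimately show "x:K" by (metis sptD)
 qed
 then show ?thesis using sc by blast
qed

lemma NN_inclusion: "U<=W ==> (%f. fscale c f):BH KG (NN_sub G (spt U :: ('v\<times>'v=>'k::field) set)) (NN_sub G (spt W))"
 by (rule BHI)
  (auto simp: NNs spt_def algebra_simps fun_eq_iff NN_lact NN_ract sum_distrib_left)

section \<open>The bimodules $X_{ij}$\<close>

text \<open>The up-set generated by (i, j) when both are vertices; it will be the support of
  \<open>X_bimod\<close> inside N \<otimes> N'.\<close>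

definition rect :: "'v=>'v=>('v\<times>'v) set" where "rect i j = {(b, a). reach i b & reach a j}"

lemma rect_upset: "upset (rect i j)"
 unfolding upset_def rect_def using reach_verts reach_trans by blast

text \<open>Whichever of two complementary up-sets contains the least element (i, j) contains
  everything.\<close>

lemma rect_conn: "i:verts G ==> j:verts G ==> conn (rect i j)"
proof -
 assume v: "i:verts G" "j:verts G"
 have c: "(i, j):rect i j" using v reach_refl by (simp add: rect_def)
 have all: "W = rect i j" if "W<=rect i j" "upset W" "(i, j):W" for W
  using that upsetD(1)[OF that(2,3)] by (auto simp: rect_def)
 show ?thesis
  unfolding conn_def
 proof (intro conjI allI impI)
  fix W assume W: "W<=rect i j" "upset W" "upset (rect i j - W)"
  show "W = {}\<or>W = rect i j"
  proof (cases "(i, j):W")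
   case True then show ?thesis using all W by blast
  next
   case False then have "rect i j - W = rect i j" using all[OF _ W(3)] c by blast
   then show ?thesis using W by blast
  qed
 qed (use c in blast)
qed

lemma carrier_spt: "carrier KG = (spt (qpaths G) :: (('v, 'e) qpath=>'k::field) set)"
proof (rule Set.set_eqI)
 fix f :: "('v, 'e) qpath=>'k"
 have "f:spt (qpaths G)\<longleftrightarrow>{p. f p~=0}<=qpaths G" unfolding spt_def by blast
 then show "f:carrier KG\<longleftrightarrow>f:spt (qpaths G)"
  unfolding carrier_KG using finite_subset[OF _ finite_qpaths] by blast
qed

lemma KG_zero: "f:carrier KG ==> p~:qpaths G ==> f p = 0"
 using support_qpath by blast

lemma ev_eq: "g:carrier KG ==> ev g (m, s) = (if reach s m then g (rep s m) else (0 :: 'k::field))"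
 using ev_apply[of g "rep s m"] rep[of s m] ev_support[of g m s] by auto

lemma ev_pvec_mult:
 assumes "p:qpaths G" "g:carrier KG"
 shows "ev (pvec p ** g) (t, s) = (if t = ptgt G p then ev g (psrc p, s) else (0 :: 'k::field))"
proof -
 have "ev (pvec p ** g) (t, s) = (\<Sum>m\<in>verts G. if m = psrc p then (if t = ptgt G p then ev g (psrc p, s) else 0) else 0)"
  unfolding ev_mult[OF pvec_carrier[OF assms(1)] assms(2)] by (intro sum.cong) (auto simp: ev_pvec)
 then show ?thesis using qpath_ends[OF assms(1)] by simp
qed

lemma ev_mult_pvec:
 assumes "p:qpaths G" "g:carrier KG"
 shows "ev (g ** pvec p) (t, s) = (if s = psrc p then ev g (t, ptgt G p) else (0 :: 'k::field))"
proof -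
 have "ev (g ** pvec p) (t, s) = (\<Sum>m\<in>verts G. if m = ptgt G p then (if s = psrc p then ev g (t, ptgt G p) else 0) else 0)"
  unfolding ev_mult[OF assms(2) pvec_carrier[OF assms(1)]] by (intro sum.cong) (auto simp: ev_pvec)
 then show ?thesis using qpath_ends[OF assms(1)] by simp
qed

lemma principal_supported:
 assumes i: "i:verts G"
 shows "principal_left KG (pvec (i, [])) = (spt {p:qpaths G. psrc p = i} :: (('v, 'e) qpath=>'k::field) set)"
  and "principal_right KG (pvec (i, [])) = (spt {p:qpaths G. ptgt G p = i} :: (('v, 'e) qpath=>'k::field) set)"
proof -
 note t = trivial_qpath[OF i]
 have c: "(pvec (i, []) :: _=>'k):carrier KG" by (rule pvec_carrier[OF t])
 have l: "(a ** pvec (i, [])) p = (if psrc p = i then a p else 0)" "(pvec (i, []) ** a) p = (if ptgt G p = i then a p else 0)"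
  if a: "a:carrier KG" for p and a :: "('v, 'e) qpath=>'k"
 proof -
  have "(a ** pvec (i, [])) p = (if psrc p = i then a p else 0) & (pvec (i, []) ** a) p = (if ptgt G p = i then a p else 0)"
  proof (cases "p:qpaths G")
   case True
   show ?thesis
    unfolding ev_apply[OF mult_closed[OF a c] True, symmetric] ev_apply[OF mult_closed[OF c a] True, symmetric]
     ev_mult_pvec[OF t a] ev_pvec_mult[OF t a] trivial_ends
    using ev_apply[OF a True] by auto
  next
   case False
   then show ?thesis by (simp add: KG_zero[OF a] KG_zero[OF mult_closed[OF a c]] KG_zero[OF mult_closed[OF c a]])
  qed
  then show "(a ** pvec (i, [])) p = (if psrc p = i then a p else 0)"
   "(pvec (i, []) ** a) p = (if ptgt G p = i then a p else 0)" by blast+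
 qed
 have e: "a = a ** pvec (i, [])" if "a:spt {p:qpaths G. psrc p = i}" for a :: "('v, 'e) qpath=>'k"
  using that l(1)[of a] unfolding carrier_spt by (auto simp: spt_def fun_eq_iff)
 have e': "a = pvec (i, []) ** a" if "a:spt {p:qpaths G. ptgt G p = i}" for a :: "('v, 'e) qpath=>'k"
  using that l(2)[of a] unfolding carrier_spt by (auto simp: spt_def fun_eq_iff)
 have sub: "a:carrier KG" if "a:spt {p:qpaths G. P p}" for P and a :: "('v, 'e) qpath=>'k"
  using that unfolding carrier_spt by (auto simp: spt_def)
 show "principal_left KG (pvec (i, [])) = (spt {p:qpaths G. psrc p = i} :: (('v, 'e) qpath=>'k::field) set)"
 proof
  show "principal_left KG (pvec (i, []))<=(spt {p:qpaths G. psrc p = i} :: (('v, 'e) qpath=>'k::field) set)"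
   using support_qpath by (auto simp: principal_left_def spt_def l split: if_splits)
  show "spt {p:qpaths G. psrc p = i}<=principal_left KG (pvec (i, []) :: _=>'k)"
  proof
   fix a :: "('v, 'e) qpath=>'k" assume a: "a:spt {p:qpaths G. psrc p = i}"
   show "a:principal_left KG (pvec (i, []))"
    unfolding principal_left_def by (rule CollectI, rule exI[of _ a]) (use e[OF a] sub[OF a] in simp)
  qed
 qed
 show "principal_right KG (pvec (i, [])) = (spt {p:qpaths G. ptgt G p = i} :: (('v, 'e) qpath=>'k::field) set)"
 proof
  show "principal_right KG (pvec (i, []))<=(spt {p:qpaths G. ptgt G p = i} :: (('v, 'e) qpath=>'k::field) set)"
   using support_qpath by (auto simp: principal_right_def spt_def l split: if_splits)
  show "spt {p:qpaths G. ptgt G p = i}<=principal_right KG (pvec (i, []) :: _=>'k)"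
  proof
   fix a :: "('v, 'e) qpath=>'k" assume a: "a:spt {p:qpaths G. ptgt G p = i}"
   show "a:principal_right KG (pvec (i, []))"
    unfolding principal_right_def by (rule CollectI, rule exI[of _ a]) (use e'[OF a] sub[OF a] in simp)
  qed
 qed
qed

lemma free_carrier: "bC (free_bimod KG) = (spt (qpaths G\<times>qpaths G) :: (_=>'k::field) set)"
 using fspan_outer[OF finite_qpaths finite_qpaths]
 by (simp add: free_bimod_def outer_tensor_def carrier_spt)

lemma X_carrier: "i:verts G ==> j:verts G ==> bC (X_bimod G i j) =
  (spt ({p:qpaths G. psrc p = i}\<times>{q:qpaths G. ptgt G q = j}) :: (_=>'k::field) set)"
 using fspan_outer[of "{p:qpaths G. psrc p = i}" "{q:qpaths G. ptgt G q = j}"] finite_qpaths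
 by (simp add: X_bimod_def outer_tensor_def Let_def principal_supported)

lemma X_actions: "lact (X_bimod G i j) = lact (free_bimod KG)" "ract (X_bimod G i j) = ract (free_bimod KG)"
 by (simp_all add: X_bimod_def free_bimod_def outer_tensor_def Let_def)

lemma free_lact:
 assumes a: "a:carrier KG" and t: "t:spt (qpaths G\<times>qpaths G)"
 shows "lact (free_bimod KG) a t (p, q) = (if p:qpaths G then \<Sum>m\<in>verts G. ev a (ptgt G p, m) *
  (if reach (psrc p) m then t (rep (psrc p) m, q) else 0) else (0 :: 'k::field))"
proof -
 have tc: "(%p. t (p, q)):carrier KG" unfolding carrier_spt by (rule supportedI) (use sptD[OF t] in blast)
 have e: "lact (free_bimod KG) a t (p, q) = (a ** (%p. t (p, q))) p" by (simp add: free_bimod_def outer_tensor_def)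
 show ?thesis
 proof (cases "p:qpaths G")
  case True
  show ?thesis unfolding e ev_apply[OF mult_closed[OF a tc] True, symmetric] ev_mult[OF a tc] ev_eq[OF tc] using True by simp
 qed (use support_qpath[OF mult_closed[OF a tc], of p] e in auto)
qed

lemma free_ract:
 assumes a: "a:carrier KG" and t: "t:spt (qpaths G\<times>qpaths G)"
 shows "ract (free_bimod KG) t a (p, q) = (if q:qpaths G then \<Sum>m\<in>verts G.
  (if reach m (ptgt G q) then t (p, rep m (ptgt G q)) else 0) * ev a (m, psrc q) else (0 :: 'k::field))"
proof -
 have tc: "(%q. t (p, q)):carrier KG" unfolding carrier_spt by (rule supportedI) (use sptD[OF t] in blast)
 have e: "ract (free_bimod KG) t a (p, q) = ((%q. t (p, q)) ** a) q" by (simp add: free_bimod_def outer_tensor_def)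
 show ?thesis
 proof (cases "q:qpaths G")
  case True
  show ?thesis unfolding e ev_apply[OF mult_closed[OF tc a] True, symmetric] ev_mult[OF tc a] ev_eq[OF tc] using True by simp
 qed (use support_qpath[OF mult_closed[OF tc a], of q] e in auto)
qed

text \<open>In a thin quiver, p \<otimes> q with p starting at i and q ending at j is determined by
  the target of p and the source of q. This is the projection of the free bimodule to its summand at
  (i, j), viewed inside N \<otimes> N'; \<open>to_free\<close> is the inclusion of that
  summand.\<close>

definition from_free :: "'v=>'v=>(('v, 'e) qpath\<times>('v, 'e) qpath=>'k::field)=>'v\<times>'v=>'k" where
 "from_free i j t = (%(b, a). if (b, a):rect i j then t (rep i b, rep a j) else 0)"

definition to_free :: "'v=>'v=>('v\<times>'v=>'k::field)=>('v, 'e) qpath\<times>('v, 'e) qpath=>'k" where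
 "to_free i j f = (%(p, q). if p:qpaths G & q:qpaths G & psrc p = i & ptgt G q = j then f (ptgt G p, psrc q) else 0)"

lemma from_free_hom:
 assumes B: "bC B<=spt (qpaths G\<times>qpaths G)" "lact B = lact (free_bimod KG)" "ract B = ract (free_bimod KG)"
 shows "from_free i j:BH KG B (NN_sub G (spt (rect i j) :: (_=>'k::field) set))"
proof (rule BHI)
 fix t and a :: "('v, 'e) qpath=>'k" assume t0: "t:bC B" and a: "a:carrier KG"
 then have t: "t:spt (qpaths G\<times>qpaths G)" using B by blast
 show "from_free i j (lact B a t) = lact (NN_sub G (spt (rect i j))) a (from_free i j t)"
 proof (rule ext, clarify)
  fix b c
  show "from_free i j (lact B a t) (b, c) = lact (NN_sub G (spt (rect i j))) a (from_free i j t) (b, c)"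
  proof (cases "(b, c):rect i j")
   case True
   then have r: "reach i b" "reach c j" by (auto simp: rect_def)
   show ?thesis using True rep[OF r(1)] r(2)
    by (auto simp: from_free_def B free_lact[OF a t] NNs NN_lact[OF a] rect_def intro: sum.cong)
  next
   case False
   have "ev a (b, m) * from_free i j t (m, c) = 0" for m
    using False ev_support[OF a, of b m] reach_trans by (auto simp: from_free_def rect_def)
   then have "lact (NN_sub G (spt (rect i j))) a (from_free i j t) (b, c) = 0"
    unfolding NNs NN_lact[OF a] by (intro sum.neutral) blast
   then show ?thesis using False by (simp add: from_free_def)
  qed
 qed
 show "from_free i j (ract B t a) = ract (NN_sub G (spt (rect i j))) (from_free i j t) a"
 proof (rule ext, clarify)
  fix b c
  show "from_free i j (ract B t a) (b, c) = ract (NN_sub G (spt (rect i j))) (from_free i j t) a (b, c)"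
  proof (cases "(b, c):rect i j")
   case True
   then have r: "reach i b" "reach c j" by (auto simp: rect_def)
   show ?thesis using True rep[OF r(2)] r(1)
    by (auto simp: from_free_def B free_ract[OF a t] NNs NN_ract[OF a] rect_def intro: sum.cong)
  next
   case False
   have "from_free i j t (b, m) * ev a (m, c) = 0" for m
    using False ev_support[OF a, of m c] reach_trans by (auto simp: from_free_def rect_def)
   then have "ract (NN_sub G (spt (rect i j))) (from_free i j t) a (b, c) = 0"
    unfolding NNs NN_ract[OF a] by (intro sum.neutral) blast
   then show ?thesis using False by (simp add: from_free_def)
  qed
 qed
qed (auto simp: from_free_def NNs spt_def)

lemma to_free_supported: "f:spt (rect i j) ==>
  (to_free i j f :: _=>'k::field):spt ({p:qpaths G. psrc p = i}\<times>{q:qpaths G. ptgt G q = j})"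
 by (auto simp: to_free_def spt_def split: if_splits)

lemma to_free_hom:
 assumes B: "spt ({p:qpaths G. psrc p = i}\<times>{q:qpaths G. ptgt G q = j})<=bC B"
  "lact B = lact (free_bimod KG)" "ract B = ract (free_bimod KG)"
 shows "to_free i j:BH KG (NN_sub G (spt (rect i j) :: (_=>'k::field) set)) B"
proof (rule BHI)
 fix f and a :: "('v, 'e) qpath=>'k" assume f: "(f :: 'v\<times>'v=>'k):bC (NN_sub G (spt (rect i j)))" and a: "a:carrier KG"
 then have f: "f:spt (rect i j)" by (simp add: NNs)
 have t: "to_free i j f:spt (qpaths G\<times>qpaths G)" using to_free_supported[OF f] by (auto simp: spt_def)
 have z: "f (b, c) = 0" if "\<not> reach i b\<or>\<not> reach c j" for b c using f that by (auto simp: spt_def rect_def)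
 show "to_free i j (lact (NN_sub G (spt (rect i j))) a f) = lact B a (to_free i j f)"
 proof (rule ext, clarify)
  fix p1 q1 :: 'v and p2 q2 :: "'e list"
  define p q where "p = (p1, p2)" and "q = (q1, q2)"
  have "to_free i j (lact (NN_sub G (spt (rect i j))) a f) (p, q) = lact B a (to_free i j f) (p, q)"
   unfolding B free_lact[OF a t] unfolding to_free_def prod.case NNs NN_lact[OF a]
   using rep[of "psrc p"] z by (auto intro!: sum.cong)
  then show "to_free i j (lact (NN_sub G (spt (rect i j))) a f) ((p1, p2), q1, q2) = lact B a (to_free i j f) ((p1, p2), q1, q2)"
   by (simp add: p_def q_def)
 qed
 show "to_free i j (ract (NN_sub G (spt (rect i j))) f a) = ract B (to_free i j f) a"
 proof (rule ext, clarify)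
  fix p1 q1 :: 'v and p2 q2 :: "'e list"
  define p q where "p = (p1, p2)" and "q = (q1, q2)"
  have "to_free i j (ract (NN_sub G (spt (rect i j))) f a) (p, q) = ract B (to_free i j f) a (p, q)"
   unfolding B free_ract[OF a t] unfolding to_free_def prod.case NNs NN_ract[OF a]
   using rep[of _ "ptgt G q"] z by (auto intro!: sum.cong)
  then show "to_free i j (ract (NN_sub G (spt (rect i j))) f a) ((p1, p2), q1, q2) = ract B (to_free i j f) a ((p1, p2), q1, q2)"
   by (simp add: p_def q_def)
 qed
qed (use B(1) to_free_supported in "auto simp: to_free_def NNs")

lemma from_to_free: "f:spt (rect i j) ==> from_free i j (to_free i j f) = (f :: _=>'k::field)"
 using rep by (auto simp: from_free_def to_free_def rect_def spt_def fun_eq_iff)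

lemma to_from_free:
 "t (p, q)~=0-->p:qpaths G & q:qpaths G ==> to_free i j (from_free i j t) (p, q) =
   (if psrc p = i & ptgt G q = j then t (p, q) else (0 :: 'k::field))"
 using rep_eq[of p] rep_eq[of q] unfolding to_free_def from_free_def prod.case rect_def reach_def by auto

text \<open>\<open>from_free\<close> identifies the bimodule with functions on a connected up-set,
  so every homomorphism to N \<otimes> N' is a multiple of it, and nonzero multiples share their
  image.\<close>

lemma X_images_eq:
 assumes v: "i:verts G" "j:verts G"
 shows "X_images G i j = {spt (rect i j) :: (_=>'k::field) set}"
proof -
 let ?X = "X_bimod G i j :: ('k, _, _) bimod"
 note XC = X_carrier[OF v, where 'k = 'k]
 have to: "to_free i j:BH KG (NN_sub G (spt (rect i j))) ?X"
  by (rule to_free_hom) (simp_all add: XC X_actions)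
 have frm: "from_free i j:BH KG ?X (NN_sub G (spt (rect i j)))"
  by (rule from_free_hom) (auto simp: XC X_actions spt_def)
 have tf: "to_free i j (from_free i j t) = t" if "t:bC ?X" for t
 proof (rule ext, rule prod.induct)
  fix p q
  have "t (p, q)~=0-->p:qpaths G & q:qpaths G & psrc p = i & ptgt G q = j" 
   using sptD[OF that[unfolded XC], of "(p, q)"] by blast
  then show "to_free i j (from_free i j t) (p, q) = t (p, q)" using to_from_free[of t p q i j] by auto
 qed
 have im: "from_free i j ` bC ?X = spt (rect i j)"
 proof (intro equalityI subsetI)
  show "x:spt (rect i j)" if "x:from_free i j ` bC ?X" for x
   using that BHD(1)[OF frm] by (auto simp: NNs)
  show "x:from_free i j ` bC ?X" if "x:spt (rect i j)" for x
   using that BHD(1)[OF to, of x] from_to_free[OF that] by (metis NNs(1) imageI)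
 qed
 show ?thesis
 proof (intro equalityI subsetI)
  fix M :: "('v\<times>'v=>'k) set" assume "M:X_images G i j"
  then obtain fi :: "_=>'v\<times>'v=>'k" and x where M: "M = fi ` bC ?X" and fi: "fi:BH KG ?X (NN G)" and x: "x:bC ?X" "fi x~=0"
   unfolding X_images_def by blast
  obtain c where c: "!!f. f:spt (rect i j) ==> fi (to_free i j f) = fscale c f"
   using NN_hom_scalar[OF rect_upset rect_conn[OF v] _ subset_refl] BH_comp[OF to fi] unfolding NN_sub_full by blast
  have p: "fi t = fscale c (from_free i j t)" if "t:bC ?X" for t
   using c[of "from_free i j t"] BHD(1)[OF frm that] tf[OF that] by (simp add: NNs)
  have c0: "c~=0" using x p[OF x(1)] by (auto simp: fun_eq_iff)
  have "M = fscale c ` from_free i j ` bC ?X" unfolding M image_image using p by simp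
  also have "\<dots> = spt (rect i j)" unfolding im
  proof (intro equalityI subsetI)
   show "y:spt (rect i j)" if "y:fscale c ` spt (rect i j)" for y using that by (auto simp: spt_def)
   fix y :: "'v\<times>'v=>'k" assume y: "y:spt (rect i j)"
   show "y:fscale c ` spt (rect i j)"
    by (rule image_eqI[of _ _ "fscale (1 / c) y"]) (use y c0 in "auto simp: spt_def")
  qed
  finally show "M:{spt (rect i j)}" by simp
 next
  fix M :: "('v\<times>'v=>'k) set" assume M: "M:{spt (rect i j)}"
  have h: "from_free i j:BH KG ?X (NN G)"
   using BH_comp[OF frm NN_inclusion[of "rect i j" "verts G\<times>verts G" 1]] rect_upset[of i j]
   unfolding NN_sub_full upset_def by simp
  have d: "delta (i, j):spt (rect i j)" using v reach_refl by (simp add: delta_spt rect_def)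
  then obtain x where x: "x:bC ?X" "from_free i j x = (delta (i, j) :: _=>'k)" using im by (metis imageE)
  then have "from_free i j x~=(0 :: _=>'k)" by (auto simp: delta_def fun_eq_iff)
  then show "M:X_images G i j" unfolding X_images_def using M im h x(1) by blast
 qed
qed

end

section \<open>Ideals of the path algebra\<close>

context thin_quiver
begin

lemma KG_idealI:
 fixes I :: "(('v, 'e) qpath=>'k::field) set"
 assumes I: "I<=carrier KG" "0:I" "!!f g. f:I ==> g:I ==> f + g:I" "!!c f. f:I ==> fscale c f:I"
  and m: "!!a f. a:carrier KG ==> f:I ==> a ** f:I & f ** a:I"
 shows "ideal I KG"
proof -
 interpret ring "KG :: ('k, ('v, 'e) qpath=>'k) module" by (rule ring_KG)
 have neg: "\<ominus>\<^bsub>KG\<^esub> f = fscale (- 1) f" if f: "f:carrier KG" for f :: "('v, 'e) qpath=>'k"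
 proof (rule minus_equality)
  show "fscale (- 1) f\<oplus>\<^bsub>KG\<^esub>f = \<zero>\<^bsub>KG\<^esub>" by (auto simp: KG_simps)
 qed (use f KG_closed(2)[OF f, of "- 1"] in simp_all)
 show ?thesis
 proof (rule idealI[OF ring_KG])
  show "subgroup I (add_monoid (KG :: ('k, ('v, 'e) qpath=>'k) module))"
  proof (rule subgroup.intro)
   fix f assume f: "f:I"
   then have "f:carrier KG" using I(1) by blast
   then have "\<ominus>\<^bsub>KG\<^esub> f:I" using neg[of f] I(4)[OF f, of "- 1"] by simp
   then show "inv\<^bsub>add_monoid KG\<^esub> f:I" by (simp add: a_inv_def)
  qed (use I in "auto simp: KG_simps")
 qed (use m in blast)+
qed

lemma KG_idealD:
 fixes I :: "(('v, 'e) qpath=>'k::field) set"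
 assumes I: "ideal I KG"
 shows "I<=carrier KG" "0:I" "f:I ==> g:I ==> f + g:I" "f:I ==> fscale c f:I"
  "a:carrier KG ==> f:I ==> a ** f:I" "a:carrier KG ==> f:I ==> f ** a:I"
proof -
 interpret ideal I "KG :: ('k, ('v, 'e) qpath=>'k) module" by fact
 show "I<=carrier KG" using a_subset .
 show "0:I" using additive_subgroup.zero_closed[OF additive_subgroup_axioms] by (simp add: KG_simps)
 show "f:I ==> g:I ==> f + g:I" using additive_subgroup.a_closed[OF additive_subgroup_axioms, of f g] by (simp add: KG_simps)
 show l: "a:carrier KG ==> f:I ==> a ** f:I" for a f using I_l_closed[of f a] by simp
 show "a:carrier KG ==> f:I ==> f ** a:I" using I_r_closed[of f a] by simp
 show "fscale c f:I" if f: "f:I"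
 proof -
  have fc: "f:carrier KG" using f a_subset by blast
  have "fscale c oneK ** f = fscale c f" using KG_scale(1)[OF one_KG fc, of c] fc by simp
  then show ?thesis using l[OF KG_closed(2)[OF one_KG] f, of c] by simp
 qed
qed

text \<open>The support of the regular bimodule inside N \<otimes> N'.\<close>

definition diag :: "('v\<times>'v) set" where "diag = {(b, a). reach a b}"

lemma diag_upset: "upset diag"
 unfolding upset_def diag_def using reach_verts reach_trans by blast

definition idl :: "('v\<times>'v) set=>(('v, 'e) qpath=>'k::field) set" where
 "idl U = {f:carrier KG. ev f:spt U}"

definition ev_inv :: "('v\<times>'v=>'k::field)=>('v, 'e) qpath=>'k" where
 "ev_inv f = (%p. if p:qpaths G then f (ptgt G p, psrc p) else 0)"

lemma ev_inv:
 fixes f :: "'v\<times>'v=>'k::field"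
 assumes f: "f:spt U" "U<=diag"
 shows "ev_inv f:idl U" "ev (ev_inv f) = f"
proof -
 have c: "ev_inv f:carrier KG" unfolding carrier_spt by (rule supportedI) (simp add: ev_inv_def)
 show e: "ev (ev_inv f) = f"
 proof (rule ext, rule prod.induct)
  fix t s
  have "f (t, s) = 0" if "\<not> reach s t" using sptD[OF f(1), of "(t, s)"] that f(2) by (auto simp: diag_def)
  then show "ev (ev_inv f) (t, s) = f (t, s)" 
   unfolding ev_eq[OF c] unfolding ev_inv_def using rep[of s t] by auto
 qed
 show "ev_inv f:idl U" unfolding idl_def using c e f(1) by simp
qed

lemma ev_supported: "f:carrier KG ==> (ev f :: _=>'k::field):spt diag"
 unfolding spt_def diag_def using ev_support by blast

lemma idl_diag: "idl diag = (carrier KG :: (_=>'k::field) set)"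
 unfolding idl_def using ev_supported by blast

lemma NN_sub_ev:
 assumes "a:carrier KG" "f:carrier KG"
 shows "lact (NN_sub G M) a (ev f) = (ev (a ** f) :: _=>'k::field)" "ract (NN_sub G M) (ev f) a = ev (f ** a)"
 using assms by (auto simp: fun_eq_iff NNs NN_lact NN_ract ev_mult)

lemma idl_ideal:
 assumes U: "upset U"
 shows "ideal (idl U :: (_=>'k::field) set) KG"
proof (rule KG_idealI)
 interpret fd_bimodule KG "NN_sub G (spt U) :: ('k, ('v, 'e) qpath=>'k, 'v\<times>'v) bimod" by (rule NN_sub_fd[OF U])
 note s = fsub_spt[of U, where 'k = 'k, unfolded fsubspace_iff]
 show "(0 :: _=>'k):idl U" using s KG_closed(3) unfolding idl_def ev_zero[symmetric] by simp
 fix f a :: "('v, 'e) qpath=>'k" assume f: "f:idl U"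
 then have fc: "f:carrier KG" "ev f:spt U" by (auto simp: idl_def)
 show "f + g:idl U" if "g:idl U" for g using that fc s by (auto simp: idl_def KG_closed ev_add)
 show "fscale c f:idl U" for c using fc s by (auto simp: idl_def KG_closed ev_scale)
 assume a: "a:carrier KG"
 have "ev f:bC (NN_sub G (spt U))" using fc by (simp add: NNs)
 from lact_closed[OF a this] ract_closed[OF a this]
 show "a ** f:idl U & f ** a:idl U"
  unfolding NN_sub_ev[OF a fc(1)] using mult_closed a fc by (auto simp: idl_def NNs)
qed (auto simp: idl_def)

text \<open>Multiplication by paths on both sides moves a nonzero entry of \<open>ev f\<close> along
  the order and isolates it. The positions occupied by elements of I thus form an up-set, and I
  contains the path at each of these positions.\<close>

lemma ideal_eq_idl:
 fixes I :: "(('v, 'e) qpath=>'k::field) set"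
 assumes I: "ideal I KG"
 shows "EX U. upset U & U<=diag & I = idl U"
proof -
 define U where "U = {x. EX f:I. ev f x~=0}"
 note d = KG_idealD[OF I]
 have sub: "f:carrier KG" if "f:I" for f using that d(1) by blast
 have Ud: "U<=diag" unfolding U_def diag_def using ev_support sub by blast
 have cut: "EX g:I. ALL t s. ev g (t, s) = (if t = b' & s = a' then ev f (b, a) else 0)"
  if f: "f:I" and r: "reach b b'" "reach a' a" for f b a b' a'
 proof -
  note r1 = rep[OF r(1)] and r2 = rep[OF r(2)]
  have c: "(pvec (rep b b') :: _=>'k):carrier KG" "(pvec (rep a' a) :: _=>'k):carrier KG" using r1 r2 pvec_carrier by blast+
  have "ev ((pvec (rep b b') ** f) ** pvec (rep a' a)) (t, s) = (if t = b' & s = a' then ev f (b, a) else 0)" for t s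
   using ev_mult_pvec[of "rep a' a" "pvec (rep b b') ** f" t s] ev_pvec_mult[of "rep b b'" f] r1 r2 sub[OF f] mult_closed[OF c(1) sub[OF f]]
   by simp
  then show ?thesis using d(6)[OF c(2) d(5)[OF c(1) f]] by blast
 qed
 have U: "upset U"
  unfolding upset_def
 proof (intro conjI allI impI)
  show "U<=verts G\<times>verts G" using Ud diag_upset unfolding upset_def by blast
  fix b a b' a' assume h: "(b, a):U" "reach b b'" "reach a' a"
  from h(1) obtain f where f: "f:I" "ev f (b, a)~=0" unfolding U_def by blast
  obtain g where "g:I" "ev g (b', a') = ev f (b, a)" using cut[OF f(1) h(2,3)] by auto
  then show "(b', a'):U" unfolding U_def using f(2) by (intro CollectI bexI[of _ g]) simp_all
 qed
 have pI: "pvec p:I" if p: "p:qpaths G" "(ptgt G p, psrc p):U" for p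
 proof -
  obtain f where f: "f:I" "ev f (ptgt G p, psrc p)~=0" using p(2) unfolding U_def by blast
  have "reach (ptgt G p) (ptgt G p)" "reach (psrc p) (psrc p)" using qpath_ends[OF p(1)] reach_refl by blast+
  from cut[OF f(1) this] obtain g where g: "g:I" "!!t s. ev g (t, s) = (if t = ptgt G p & s = psrc p then ev f (ptgt G p, psrc p) else 0)" by blast
  have "fscale (1 / ev f (ptgt G p, psrc p)) g = pvec p"
   by (rule ev_inj[OF KG_closed(2)[OF sub[OF g(1)]] pvec_carrier[OF p(1)]], unfold ev_scale)
    (use f(2) in "auto simp: fun_eq_iff g(2) ev_pvec")
  then show ?thesis using d(4)[OF g(1), of "1 / ev f (ptgt G p, psrc p)"] by simp
 qed
 have "f:I" if f: "f:idl U" for f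
 proof -
  have fc: "f:carrier KG" "ev f:spt U" using f by (auto simp: idl_def)
  have "(\<Sum>p\<in>S. fscale (f p) (pvec p)):I" if "finite S" "S<={p. f p~=0}" for S
   using that
  proof induction
   case empty show ?case unfolding sum.empty by (rule d(2))
  next
   case (insert p S)
   have p: "p:qpaths G" "f p~=0" using insert.prems support_qpath[OF fc(1)] by auto
   then have "ev f (ptgt G p, psrc p)~=0" using ev_apply[OF fc(1)] by simp
   then have "(ptgt G p, psrc p):U" using sptD[OF fc(2)] by blast
   then show ?case unfolding sum.insert[OF insert.hyps] using d(3)[OF d(4)[OF pI[OF p(1)]]] insert by blast
  qed
  note m = this[OF fin_support[OF fc(1)] subset_refl]
  have "(\<Sum>p | f p~=0. fscale (f p) (pvec p)) = f"
  proof
   fix r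
   have "(\<Sum>p\<in>S. fscale (f p) (pvec p)) r = (\<Sum>p\<in>S. if p = r then f r else 0)" if "finite S" for S
    using that by induction (auto simp: pvec_def)
   then show "(\<Sum>p | f p~=0. fscale (f p) (pvec p)) r = f r" using fin_support[OF fc(1)] by simp
  qed
  then show ?thesis using m by simp
 qed
 moreover have "I<=idl U" unfolding idl_def spt_def U_def using sub by blast
 ultimately show ?thesis using U Ud by blast
qed

lemma idl_subset: "U<=diag ==> (idl U :: (_=>'k::field) set)<=idl W\<longleftrightarrow>U<=W"
proof
 assume U: "U<=diag" and h: "(idl U :: (_=>'k) set)<=idl W"
 show "U<=W"
 proof
  fix x assume x: "x:U"
  have "(delta x :: _=>'k):spt U" using x by (simp add: delta_spt)
  from ev_inv[OF this U] have "(delta x :: _=>'k):spt W" using h by (auto simp: idl_def)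
  then show "x:W" by (simp add: delta_spt)
 qed
qed (auto simp: idl_def spt_def)

lemma idl_empty: "idl {} = {0 :: _=>'k::field}"
proof -
 have "f = 0" if "f:carrier KG" "ev f:spt {}" for f :: "_=>'k"
  by (rule ev_inj[OF that(1) KG_closed(3)], unfold ev_zero, rule ext) (use sptD[OF that(2)] in simp)
 moreover have "(0 :: _=>'k):idl {}" using KG_idealD(2)[OF idl_ideal[OF upset_empty]] .
 ultimately show ?thesis unfolding idl_def by blast
qed

lemma idl_trivial: "U<=diag ==> idl U = {0 :: _=>'k::field}\<longleftrightarrow>U = {}"
 using idl_subset[of U "{}", where 'k = 'k] idl_empty[where 'k = 'k] by auto

lemma subbimodule_ideal_iff:
 fixes I :: "(('v, 'e) qpath=>'k::field) set"
 assumes I: "ideal I KG"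
 shows "subbimodule KG (ideal_bimod KG I) W\<longleftrightarrow>ideal W KG & W<=I"
proof
 assume "subbimodule KG (ideal_bimod KG I) W"
 then have W: "fsubspace W" "W<=I" "!!a u. a:carrier KG ==> u:W ==> a ** u:W & u ** a:W"
  by (auto simp: subbimodule_def ideal_bimod_def)
 show "ideal W KG & W<=I"
  using W KG_idealD(1)[OF I] unfolding fsubspace_iff by (intro conjI KG_idealI) blast+
next
 assume W: "ideal W KG & W<=I"
 then show "subbimodule KG (ideal_bimod KG I) W"
  using KG_idealD[of W] unfolding subbimodule_def ideal_bimod_def fsubspace_iff by auto
qed

lemma idl_Un:
 assumes U: "U<=diag" "W<=diag" "upset U" "upset W"
 shows "{u + w | u w. u:idl U & w:idl W} = (idl (U\<union>W) :: (_=>'k::field) set)"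
proof (intro equalityI subsetI)
 fix f :: "_=>'k" assume "f:{u + w | u w. u:idl U & w:idl W}"
 then obtain u w where f: "f = u + w" "u:idl U" "w:idl W" by blast
 have "idl U<=(idl (U\<union>W) :: (_=>'k) set)" "idl W<=(idl (U\<union>W) :: (_=>'k) set)" using U idl_subset by blast+
 then show "f:idl (U\<union>W)" using f KG_idealD(3)[OF idl_ideal[OF upset_Un[OF U(3,4)]]] by blast
next
 fix f :: "_=>'k" assume f: "f:idl (U\<union>W)"
 let ?u = "%x. if x:U then ev f x else 0" and ?w = "%x. if x:U then 0 else ev f x"
 have s: "?u:spt U" "?w:spt W" using f by (auto simp: spt_def idl_def)
 note e = ev_inv[OF s(1) U(1)] ev_inv[OF s(2) U(2)]
 have c: "ev_inv ?u:carrier KG" "ev_inv ?w:carrier KG" "f:carrier KG" using e f by (auto simp: idl_def)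
 have "f = ev_inv ?u + ev_inv ?w"
  by (rule ev_inj[OF c(3) KG_closed(1)[OF c(1,2)]]) (simp only: ev_add[OF c(1,2)] e, auto)
 then show "f:{u + w | u w. u:idl U & w:idl W}" using e by blast
qed

text \<open>Subbimodules of the ideal are ideals, hence given by up-sets inside U. A direct
  decomposition into two nonzero parts is a partition of U into two nonempty up-sets.\<close>

lemma indecomposable_idl:
 assumes U: "upset U" "U<=diag"
 shows "indecomposable_bimodule KG (ideal_bimod KG (idl U :: (_=>'k::field) set))\<longleftrightarrow>conn U"
proof -
 let ?I = "%U. idl U :: (('v, 'e) qpath=>'k) set"
 let ?S = "%U' W'. subbimodule KG (ideal_bimod KG (?I U)) U' & subbimodule KG (ideal_bimod KG (?I U)) W' & U'~={0} & W'~={0} &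
  U'\<inter>W' = {0} & {u + w | u w. u:U' & w:W'} = ?I U"
 have I: "indecomposable_bimodule KG (ideal_bimod KG (?I U))\<longleftrightarrow>U~={} & \<not> (EX U' W'. ?S U' W')"
  unfolding indecomposable_bimodule_def using idl_trivial[OF U(2), where 'k = 'k] by (simp add: ideal_bimod_def)
 have a: "EX W<=U. upset W & upset (U - W) & W~={} & W~=U" if S: "?S U' W'" for U' W'
 proof -
  from S have "ideal U' KG" "ideal W' KG" "U'<=?I U" "W'<=?I U" unfolding subbimodule_ideal_iff[OF idl_ideal[OF U(1)]] by blast+
  then obtain A B where A: "upset A" "A<=diag" "U' = ?I A" and B: "upset B" "B<=diag" "W' = ?I B"
   using ideal_eq_idl by meson
  have AB: "?I A<=?I U" "?I B<=?I U" "?I (A\<union>B) = ?I U" "A~={}" "B~={}"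
   using S idl_Un[OF A(2) B(2) A(1) B(1), where 'k = 'k] idl_empty[where 'k = 'k] unfolding subbimodule_ideal_iff[OF idl_ideal[OF U(1)]] A(3) B(3) by auto
  have ABU: "A\<union>B = U" using AB(3) idl_subset[of "A\<union>B" U, where 'k = 'k] idl_subset[of U "A\<union>B", where 'k = 'k] A B U by blast
  have "?I (A\<inter>B)<=?I {}" using S unfolding A(3) B(3) idl_empty by (auto simp: idl_def spt_def)
  then have "A\<inter>B = {}" using idl_subset[of "A\<inter>B" "{}", where 'k = 'k] A(2) by blast
  then have "U - A = B" using ABU by blast
  then show ?thesis using A B AB ABU by (intro exI[of _ A]) auto
 qed
 have b: "EX U' W'. ?S U' W'" if W: "W<=U" "upset W" "upset (U - W)" "W~={}" "W~=U" for W
 proof (rule exI[of _ "?I W"], rule exI[of _ "?I (U - W)"])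
  have d: "W<=diag" "U - W<=diag" "U - W~={}" "W\<union>(U - W) = U" using W U by blast+
  have "?I W\<inter>?I (U - W)<=?I {}" by (auto simp: idl_def spt_def)
  moreover have "0:?I W" "0:?I (U - W)" using KG_idealD(2)[OF idl_ideal] W by blast+
  ultimately have "?I W\<inter>?I (U - W) = {0}" unfolding idl_empty by blast
  then show "?S (?I W) (?I (U - W))"
   unfolding subbimodule_ideal_iff[OF idl_ideal[OF U(1)]]
   using idl_Un[OF d(1,2) W(2,3), where 'k = 'k] idl_trivial[OF d(1), where 'k = 'k] idl_trivial[OF d(2), where 'k = 'k] d(3,4) W(4)
    idl_ideal[OF W(2)] idl_ideal[OF W(3)] idl_subset[OF d(1), of U, where 'k = 'k] idl_subset[OF d(2), of U, where 'k = 'k] W(1) by simp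
 qed
 show ?thesis
 proof
  assume i: "indecomposable_bimodule KG (ideal_bimod KG (?I U))"
  have "W = {}\<or>W = U" if W: "W<=U" "upset W" "upset (U - W)" for W
  proof (rule ccontr)
   assume "\<not> ?thesis"
   then have "W~={}" "W~=U" by auto
   from b[OF W this] show False using i unfolding I by (elim conjE notE)
  qed
  then show "conn U" using i unfolding I conn_def by simp
 next
  assume c: "conn U"
  have "\<not> (EX U' W'. ?S U' W')"
  proof (rule notI, elim exE)
   fix U' W' assume "?S U' W'"
   from a[OF this] c show False unfolding conn_def by auto
  qed
  then show "indecomposable_bimodule KG (ideal_bimod KG (?I U))" unfolding I using c unfolding conn_def by simp
 qed
qed

lemma ev_hom: "ev:BH KG (ideal_bimod KG (idl U :: (_=>'k::field) set)) (NN_sub G (spt U))"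
proof (rule BHI; unfold ideal_bimod_def bimod.simps)
 fix f g a :: "('v, 'e) qpath=>'k" and c assume f: "f:idl U"
 then have fc: "f:carrier KG" by (simp add: idl_def)
 show "ev f:bC (NN_sub G (spt U))" using f by (simp add: NNs idl_def)
 show "ev (fscale c f) = fscale c (ev f)" by (rule ev_scale)
 show "ev (f + g) = ev f + ev g" if "g:idl U" using that by (intro ev_add fc) (simp add: idl_def)
 show "ev (a ** f) = lact (NN_sub G (spt U)) a (ev f)" "ev (f ** a) = ract (NN_sub G (spt U)) (ev f) a"
  if "a:carrier KG" unfolding NN_sub_ev[OF that fc] by (rule refl)+
qed

lemma ev_inj_on: "inj_on ev (idl U :: (_=>'k::field) set)"
 unfolding inj_on_def idl_def using ev_inj by blast

lemma idl_fd:
 assumes U: "upset U"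
 shows "fd_bimodule KG (ideal_bimod KG (idl U :: (_=>'k::field) set))"
proof (rule fd_bimodule_transfer[OF NN_sub_fd[OF U] _ finite_qpaths _ _ ev_hom])
 have i: "ideal (idl U :: (_=>'k) set) KG" by (rule idl_ideal[OF U])
 note d = KG_idealD[OF i]
 show "fsubspace (bC (ideal_bimod KG (idl U :: (_=>'k) set)))" unfolding fsubspace_iff ideal_bimod_def using d by simp
 show "bC (ideal_bimod KG (idl U :: (_=>'k) set))<=spt (qpaths G)"
  using d(1) by (simp add: ideal_bimod_def carrier_spt)
 show "inj_on ev (bC (ideal_bimod KG (idl U :: (_=>'k) set)))" using ev_inj_on by (simp add: ideal_bimod_def)
qed (use KG_idealD(5,6)[OF idl_ideal[OF U]] in "auto simp: ideal_bimod_def")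

lemma ev_inv_hom:
 assumes U: "upset U" "U<=diag"
 shows "ev_inv:BH KG (NN_sub G (spt U :: (_=>'k::field) set)) (ideal_bimod KG (idl U))"
proof (rule bimodule_homs_inverse[OF idl_fd[OF U(1)] ev_hom _ NN_sub_fd[OF U(1)]])
 show "inj_on ev (bC (ideal_bimod KG (idl U :: (_=>'k) set)))" using ev_inj_on by (simp add: ideal_bimod_def)
qed (use ev_inv[OF _ U(2)] in "auto simp: ideal_bimod_def NNs")

text \<open>As both C and U - C are up-sets, neither action leads from one to the other, so cutting
  a function off outside C commutes with the actions.\<close>

lemma restriction_hom:
 assumes C: "C<=U" "upset C" "upset (U - C)"
 shows "(%f x. if x:C then f x else 0) :
  BH KG (NN_sub G (spt U :: (_=>'k::field) set)) (NN_sub G (spt C))"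
proof (rule BHI)
 fix f and a :: "('v, 'e) qpath=>'k" assume f0: "(f :: 'v\<times>'v=>'k):bC (NN_sub G (spt U))" and a: "a:carrier KG"
 then have f: "f:spt U" by (simp add: NNs)
 have V: "x:verts G & y:verts G" if "f (x, y)~=0" for x y
  using that sptD[OF f] C(1) upsetD(2)[OF C(2)] upsetD(2)[OF C(3)] by blast
 have l: "(if (x, y):C then ev a (x, m) * f (m, y) else 0) = ev a (x, m) * (if (m, y):C then f (m, y) else 0)" for x y m
 proof (cases "ev a (x, m) = 0\<or>f (m, y) = 0")
  case False
  then have "reach m x" "reach y y" "(m, y):U" using ev_support[OF a] sptD[OF f] V reach_refl by blast+
  then have "(x, y):C\<longleftrightarrow>(m, y):C" using upsetD(1)[OF C(2), of m y x y] upsetD(1)[OF C(3), of m y x y] by blast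
  then show ?thesis by simp
 qed auto
 have r: "(if (x, y):C then f (x, m) * ev a (m, y) else 0) = (if (x, m):C then f (x, m) else 0) * ev a (m, y)" for x y m
 proof (cases "ev a (m, y) = 0\<or>f (x, m) = 0")
  case False
  then have "reach y m" "reach x x" "(x, m):U" using ev_support[OF a] sptD[OF f] V reach_refl by blast+
  then have "(x, y):C\<longleftrightarrow>(x, m):C" using upsetD(1)[OF C(2), of x m x y] upsetD(1)[OF C(3), of x m x y] by blast
  then show ?thesis by simp
 qed auto
 show "(%x. if x:C then lact (NN_sub G (spt U)) a f x else 0) = lact (NN_sub G (spt C)) a (%x. if x:C then f x else 0)"
 proof (rule ext, rule prod.induct)
  fix x y
  show "(if (x, y):C then lact (NN_sub G (spt U)) a f (x, y) else 0) = lact (NN_sub G (spt C)) a (%x. if x:C then f x else 0) (x, y)"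
   unfolding NNs NN_lact[OF a] l[symmetric] by simp
 qed
 show "(%x. if x:C then ract (NN_sub G (spt U)) f a x else 0) = ract (NN_sub G (spt C)) (%x. if x:C then f x else 0) a"
 proof (rule ext, rule prod.induct)
  fix x y
  show "(if (x, y):C then ract (NN_sub G (spt U)) f a (x, y) else 0) = ract (NN_sub G (spt C)) (%x. if x:C then f x else 0) a (x, y)"
   unfolding NNs NN_ract[OF a] r[symmetric] by simp
 qed
qed (auto simp: NNs spt_def)

text \<open>Split until every piece is connected. It is carried along that the complement of each
  piece in U is an up-set, which \<open>restriction_hom\<close> relies on.\<close>

lemma conn_decomposition:
 assumes "upset U"
 shows "EX \<C>. finite \<C> & \<Union>\<C> = U & (ALL C:\<C>. upset C & upset (U - C) & conn C) & (ALL C:\<C>. ALL C':\<C>. C~=C'-->C\<inter>C' = {})"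
 using assms
proof (induction "card U" arbitrary: U rule: less_induct)
 case less
 show ?case
 proof (cases "U = {}\<or>conn U")
  case True
  then show ?thesis
  proof
   assume "U = {}" then show ?thesis by (intro exI[of _ "{}"]) simp
  next
   assume "conn U" then show ?thesis using less.prems upset_empty by (intro exI[of _ "{U}"]) simp
  qed
 next
  case False
  then obtain W where W: "W<=U" "upset W" "upset (U - W)" "W~={}" "W~=U" unfolding conn_def by blast
  have fin: "finite U" by (rule finite_upset[OF less.prems])
  have c: "card W < card U" "card (U - W) < card U" by (rule psubset_card_mono[OF fin]; use W in blast)+
  from less.hyps[OF c(1) W(2)] obtain \<A> where
   A: "finite \<A>" "\<Union>\<A> = W" "ALL C:\<A>. upset C & upset (W - C) & conn C" "ALL C:\<A>. ALL C':\<A>. C~=C'-->C\<inter>C' = {}"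
   by (elim exE conjE) (rule that)
  from less.hyps[OF c(2) W(3)] obtain \<B> where
   B: "finite \<B>" "\<Union>\<B> = U - W" "ALL C:\<B>. upset C & upset (U - W - C) & conn C" "ALL C:\<B>. ALL C':\<B>. C~=C'-->C\<inter>C' = {}"
   by (elim exE conjE) (rule that)
  show ?thesis
  proof (intro exI[of _ "\<A>\<union>\<B>"] conjI ballI impI)
   show "finite (\<A>\<union>\<B>)" "\<Union>(\<A>\<union>\<B>) = U" using A B W by auto
   fix C assume C: "C:\<A>\<union>\<B>"
   show "upset C" "conn C" using C A(3) B(3) by blast+
   show "upset (U - C)" using C
   proof
    assume c: "C:\<A>"
    have "U - C = (W - C)\<union>(U - W)" using c A(2) W(1) by blast
    then show ?thesis using c A(3) upset_Un W(3) by metis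
   next
    assume c: "C:\<B>"
    have "U - C = (U - W - C)\<union>W" using c B(2) W(1) by blast
    then show ?thesis using c B(3) upset_Un W(2) by metis
   qed
   fix C' assume "C':\<A>\<union>\<B>" "C~=C'"
   then show "C\<inter>C' = {}" using C A(2,4) B(2,4) by blast
  qed
 qed
qed

end

section \<open>The poset of subbimodules\<close>

lemma sum_delta:
 assumes "finite S" "f:spt S"
 shows "(\<Sum>x\<in>S. fscale (f x) (delta x)) = (f :: 'x=>'k::field)"
proof
 fix y
 have "(\<Sum>x\<in>F. fscale (f x) (delta x)) y = (\<Sum>x\<in>F. if x = y then f y else 0)" if "finite F" for F
  using that by induction (auto simp: delta_def)
 then show "(\<Sum>x\<in>S. fscale (f x) (delta x)) y = f y" using assms sptD[OF assms(2), of y] by simp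
qed

text \<open>The dummy argument fixes the type of the base field, which sets of pairs of vertices do
  not mention.\<close>

locale thin_quiver_over = thin_quiver G for G :: "('v, 'e) pre_digraph" + fixes K :: "'k::field itself"
begin

abbreviation spn :: "('v\<times>'v) set=>('v\<times>'v=>'k) set" where "spn U \<equiv> spt U"

abbreviation KA :: "('k, ('v, 'e) qpath=>'k) module" where "KA \<equiv> path_algebra G"

lemma A_image_eq: "A_image G = spn diag"
proof
 interpret vector_space "fscale :: 'k=>('v\<times>'v=>'k)=>'v\<times>'v=>'k"
  by unfold_locales (auto simp: algebra_simps fun_eq_iff)
 have e: "(\<Union>i\<in>verts G. \<Union>(X_images G i i)) = (\<Union>i\<in>verts G. spn (rect i i))"
  by (intro SUP_cong refl) (simp add: X_images_eq)
 show "A_image G<=spn diag"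
  unfolding A_image_def e
 proof (intro span_minimal fsub_spt UN_least)
  show "spn (rect i i)<=spn diag" for i
   unfolding spt_le rect_def diag_def using reach_trans by blast
 qed
 show "spn diag<=A_image G"
 proof
  fix f assume f: "f:spn diag"
  have "delta x:(\<Union>i\<in>verts G. spn (rect i i))" if "x:diag" for x
  proof -
   obtain b a where x: "x = (b, a)" by (cases x)
   have "reach a b" using that by (simp add: x diag_def)
   then have "a:verts G" "x:rect a a" using reach_verts reach_refl by (auto simp: x rect_def)
   then show ?thesis using delta_spt[of x "rect a a", where 'k = 'k] by blast
  qed
  then have "(\<Sum>x\<in>diag. fscale (f x) (delta x)):span (\<Union>i\<in>verts G. spn (rect i i))"
   by (intro span_sum span_scale span_base)
  then show "f:A_image G"
   unfolding A_image_def e sum_delta[OF finite_upset[OF diag_upset] f] .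
 qed
qed

text \<open>Compared with \<open>ev\<close>, the homomorphism rescales each coordinate in
  \<open>diag\<close> by a nonzero factor. The factors may vary with the coordinate; the image of an
  ideal is still the full space on its support.\<close>

lemma regular_hom_image:
 assumes gi: "gi:BH KA (ideal_bimod KA (carrier KA)) (NN_sub G (spn diag))"
  and inj: "inj_on gi (carrier KA)" and U: "upset U" "U<=diag"
 shows "gi ` idl U = spn U"
proof -
 define c where "c x = gi (ev_inv (delta x)) x" for x
 have h: "(%f. gi (ev_inv f)):BH KA (NN_sub G (spn diag)) (NN_sub G (spn diag))"
  by (rule BH_comp[OF ev_inv_hom[OF diag_upset subset_refl]]) (use gi in "simp add: idl_diag")
 have dV: "diag<=verts G\<times>verts G" using diag_upset by (simp add: upset_def)
 have v: "gi g y = c y * ev g y" if g: "g:carrier KA" for g y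
 proof -
  have s: "ev g:spn diag" by (rule ev_supported[OF g])
  have "ev_inv (ev g) = g" using ev_inj ev_inv[OF s subset_refl] g unfolding idl_diag by blast
  then show ?thesis using NN_hom_diagonal[OF diag_upset h dV s, of y] by (simp add: c_def)
 qed
 have c: "c x~=0" if x: "x:diag" for x
 proof
  assume z: "c x = 0"
  have d: "delta x:spn diag" using x by (simp add: delta_spt)
  note e = ev_inv[OF d subset_refl, unfolded idl_diag]
  have "gi (ev_inv (delta x)) y = gi 0 y" for y
   unfolding v[OF e(1)] v[OF KG_closed(3)] e(2) ev_zero using z by (simp add: delta_def)
  then have "ev_inv (delta x) = (0 :: _=>'k)" by (intro inj_onD[OF inj _ e(1) KG_closed(3)] ext)
  then have "delta x x = (0 :: 'k)" using fun_cong[OF e(2), of x] ev_zero[where 'a = 'k] by simp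
  then show False by (simp add: delta_def)
 qed
 show ?thesis
 proof (intro equalityI subsetI)
  fix y assume "y:gi ` idl U"
  then obtain g where g: "g:carrier KA" "ev g:spn U" "y = gi g" by (auto simp: idl_def)
  show "y:spn U" by (rule supportedI) (simp add: g(3) v[OF g(1)] sptD[OF g(2)])
 next
  fix y assume y: "y:spn U"
  let ?f = "%x. y x / c x"
  have f: "?f:spn U" using y by (auto simp: spt_def)
  note e = ev_inv[OF f U(2)]
  have "gi (ev_inv ?f) = y"
  proof
   fix x
   show "gi (ev_inv ?f) x = y x"
    using v[of "ev_inv ?f" x] e c[of x] U(2) sptD[OF y, of x] by (cases "x:U") (auto simp: idl_def)
  qed
  then show "y:gi ` idl U" using e(1) by (metis imageI)
 qed
qed

lemma ideal_images_eq: "ideal_images G = {spn U | U. upset U & U<=diag & conn U}"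
proof (intro equalityI subsetI)
 fix M assume "M:(ideal_images G :: ('v\<times>'v=>'k) set set)"
 then obtain gi I where M: "M = gi ` I" and gi: "gi:BH KA (ideal_bimod KA (carrier KA)) (NN_sub G (spn diag))"
  and b: "bij_betw gi (carrier KA) (spn diag)" and I: "ideal I KA" "indecomposable_bimodule KA (ideal_bimod KA I)"
  unfolding ideal_images_def Let_def A_image_eq by blast
 obtain U where U: "upset U" "U<=diag" "I = idl U" using ideal_eq_idl[OF I(1)] by blast
 have "conn U" using I(2) indecomposable_idl[OF U(1,2)] unfolding U(3) by blast
 moreover have "M = spn U" unfolding M U(3) by (rule regular_hom_image[OF gi bij_betw_imp_inj_on[OF b] U(1,2)])
 ultimately show "M:{spn U | U. upset U & U<=diag & conn U}" using U by blast
next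
 fix M assume "M:{spn U | U. upset U & U<=diag & conn U}"
 then obtain U where U: "upset U" "U<=diag" "conn U" "M = spn U" by blast
 have h: "ev:BH KA (ideal_bimod KA (carrier KA)) (NN_sub G (spn diag))"
  using ev_hom[of diag] unfolding idl_diag .
 have i: "inj_on ev (carrier KA)" using ev_inj_on[of diag] unfolding idl_diag .
 have im: "ev ` carrier KA = spn diag" using regular_hom_image[OF h i diag_upset subset_refl] unfolding idl_diag .
 have "bij_betw ev (carrier KA) (spn diag)" using i im by (simp add: bij_betw_def)
 moreover have "ev ` idl U = M" unfolding U(4) by (rule regular_hom_image[OF h i U(1,2)])
 moreover have "indecomposable_bimodule KA (ideal_bimod KA (idl U))" using indecomposable_idl[OF U(1,2)] U(3) by blast
 ultimately show "M:ideal_images G"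
  unfolding ideal_images_def Let_def A_image_eq using h idl_ideal[OF U(1)] by blast
qed

text \<open>Supports standing for the elements of \<open>T_set\<close>. Inclusion of supports is
  inclusion of subbimodules, so the poset can be studied without the field.\<close>

definition TU :: "('v\<times>'v) set set" where
 "TU = {U. (EX i:verts G. EX j:verts G. U = rect i j)\<or>(upset U & U<=diag & conn U)}"

lemma TU_upset: "U:TU ==> upset U" and TU_conn: "U:TU ==> conn U"
 unfolding TU_def using rect_upset rect_conn by blast+

lemma finite_TU: "finite TU"
proof (rule finite_subset)
 show "TU<=Pow (verts G\<times>verts G)" using TU_upset unfolding upset_def by blast
qed simp

lemma T_set_eq: "T_set G = spn ` TU"
proof -
 have "(\<Union>i\<in>verts G. \<Union>j\<in>verts G. X_images G i j) = (\<Union>i\<in>verts G. \<Union>j\<in>verts G. {spn (rect i j)})"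
  by (intro SUP_cong refl) (simp add: X_images_eq)
 then show ?thesis unfolding T_set_def ideal_images_eq TU_def by auto
qed

text \<open>An isomorphism is a nonzero scalar, so the two supports coincide. Hence the isomorphism
  classes in \<open>T_set\<close> are singletons.\<close>

lemma NN_iso_eq:
 assumes U: "upset U" "conn U" "upset W" and iso: "bimodule_iso KA (NN_sub G (spn U)) (NN_sub G (spn W))"
 shows "U = W"
proof -
 obtain fi where fi: "fi:BH KA (NN_sub G (spn U)) (NN_sub G (spn W))" "bij_betw fi (spn U) (spn W)"
  using iso unfolding bimodule_iso_def NNs by blast
 have W: "W<=verts G\<times>verts G" using U(3) by (simp add: upset_def)
 obtain c where c: "!!f. f:spn U ==> fi f = fscale c f" "c~=0-->U<=W"
  using NN_hom_scalar[OF U(1,2) fi(1) W] by blast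
 obtain x where x: "x:U" using U(2) by (auto simp: conn_def)
 then have d: "delta x:spn U" by (simp only: delta_spt)
 have d: "delta x:spn U" "fscale 0 (delta x):spn U" by (rule d) (simp add: spt_def)
 have "c~=0"
 proof
  assume z: "c = 0"
  have "fi (delta x) = fi (fscale 0 (delta x))" unfolding c(1)[OF d(1)] c(1)[OF d(2)] by (simp add: z)
  then have "delta x = (fscale 0 (delta x) :: _=>'k)" using fi(2) d unfolding bij_betw_def inj_on_def by blast
  from fun_cong[OF this, of x] show False by (simp add: delta_def)
 qed
 moreover have "W<=U"
 proof
  fix y assume y: "y:W"
  then have "delta y:fi ` spn U" using fi(2) unfolding bij_betw_def by (simp add: delta_spt)
  then obtain f where f: "f:spn U" "delta y = fi f" by blast
  have "delta y y = c * f y" unfolding f(2) c(1)[OF f(1)] ..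
  then have "f y~=0" by (auto simp: delta_def)
  then show "y:U" using sptD[OF f(1)] by blast
 qed
 ultimately show ?thesis using c(2) by blast
qed

lemma T_iso_eq: "T_iso G = Id_on (spn ` TU)"
proof (intro equalityI subsetI)
 fix z assume "z:(T_iso G :: ('v\<times>'v=>'k) set rel)"
 then obtain U W where "U:TU" "W:TU" "z = (spn U, spn W)" "bimodule_iso KA (NN_sub G (spn U)) (NN_sub G (spn W))"
  unfolding T_iso_def T_set_eq by blast
 then show "z:Id_on (spn ` TU)" using NN_iso_eq TU_upset TU_conn by blast
next
 fix z assume "z:Id_on (spn ` TU)"
 then obtain M where M: "z = (M, M)" "M:spn ` TU" by blast
 have "(%f. f):BH KA (NN_sub G M) (NN_sub G M)" by (rule BHI) auto
 moreover have "bij_betw (%f. f) (bC (NN_sub G M)) (bC (NN_sub G M))" by (simp add: bij_betw_def)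
 ultimately have "bimodule_iso KA (NN_sub G M) (NN_sub G M)" unfolding bimodule_iso_def by blast
 then show "z:T_iso G" unfolding T_iso_def T_set_eq using M by blast
qed

section \<open>The Hasse quiver of the poset\<close>

abbreviation QQ :: "(('k, 'v) iso_class, ('k, 'v) iso_class\<times>('k, 'v) iso_class) pre_digraph" where "QQ \<equiv> Q2 G"

definition cl :: "('v\<times>'v) set=>('k, 'v) iso_class" where "cl U = {spn U}"

lemma cl_eq: "cl U = cl W\<longleftrightarrow>U = W"
 by (simp add: cl_def supported_eq_iff)

lemma Q2_verts: "verts QQ = cl ` TU"
 unfolding Q2_def T_iso_eq T_set_eq cl_def by (auto simp: quotient_def)

lemma Q2_ends: "tail QQ = fst" "head QQ = snd"
 by (simp_all add: Q2_def)

definition cover :: "('v\<times>'v) set=>('v\<times>'v) set=>bool" where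
 "cover U W\<longleftrightarrow>U:TU & W:TU & W\<subset>U & \<not> (EX L:TU. W\<subset>L & L\<subset>U)"

lemma Q2_arcs: "arcs QQ = {(cl U, cl W) | U W. cover U W}"
proof -
 have s: "spn U\<subset>spn W\<longleftrightarrow>U\<subset>W" for U W
  unfolding psubset_eq spt_le supported_eq_iff ..
 have c: "covers_in (spn ` TU) (spn U) (spn W)\<longleftrightarrow>cover U W" if "U:TU" "W:TU" for U W
  unfolding covers_in_def cover_def s ball_simps bex_simps using that by (simp add: s)
 have "arcs QQ = {(c, d). c:cl ` TU & d:cl ` TU & (EX M:c. EX K:d. covers_in (spn ` TU) M K)}"
  using Q2_verts by (simp add: Q2_def T_set_eq)
 also have "\<dots> = {(cl U, cl W) | U W. U:TU & W:TU & covers_in (spn ` TU) (spn U) (spn W)}"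
  unfolding cl_def by auto
 also have "\<dots> = {(cl U, cl W) | U W. cover U W}" using c unfolding cover_def by blast
 finally show ?thesis .
qed

lemma Q2_quiver: "quiver QQ"
proof (intro quiver.intro fin_digraph.intro wf_digraph.intro fin_digraph_axioms.intro)
 show fv: "finite (verts QQ)" unfolding Q2_verts using finite_TU by simp
 have sub: "arcs QQ<=verts QQ\<times>verts QQ" unfolding Q2_arcs Q2_verts cover_def by blast
 show "finite (arcs QQ)" by (rule finite_subset[OF sub]) (use fv in simp)
 show "a:arcs QQ ==> tail QQ a:verts QQ" "a:arcs QQ ==> head QQ a:verts QQ" for a
  using sub unfolding Q2_ends by auto
qed

sublocale QQ: quiver QQ by (rule Q2_quiver)

text \<open>Every arrow shrinks the up-set. Conversely an inclusion is refined by intermediate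
  elements until each step is a cover; the induction is on the number of elements in the
  interval.\<close>

lemma Q2_reach_iff: "QQ.reach c d\<longleftrightarrow>(EX U:TU. EX W:TU. c = cl U & d = cl W & W<=U)"
proof
 assume "QQ.reach c d"
 then obtain xs where "QQ.awalk c xs d"
  unfolding QQ.reach_def by (auto simp: qpaths_def psrc_def ptgt_def)
 then show "EX U:TU. EX W:TU. c = cl U & d = cl W & W<=U"
 proof (induction xs arbitrary: c)
  case Nil
  then show ?case by (auto simp: QQ.awalk_Nil_iff Q2_verts)
 next
  case (Cons a xs)
  then have a: "a:arcs QQ" "c = fst a" "QQ.awalk (snd a) xs d" by (auto simp: QQ.awalk_Cons_iff Q2_ends)
  from Cons.IH[OF a(3)] obtain U W where U: "U:TU" "W:TU" "snd a = cl U" "d = cl W" "W<=U" by blast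
  from a(1) obtain U1 U2 where "a = (cl U1, cl U2)" "cover U1 U2" unfolding Q2_arcs by blast
  then show ?case using a(2) U unfolding cover_def by (auto simp: cl_eq)
 qed
next
 assume "EX U:TU. EX W:TU. c = cl U & d = cl W & W<=U"
 then obtain U W where UW: "U:TU" "W:TU" "c = cl U" "d = cl W" "W<=U" by blast
 have "QQ.reach (cl U) (cl W)" using UW(1,2,5)
 proof (induction "card {L:TU. W<=L & L<=U}" arbitrary: U W rule: less_induct)
  case less
  show ?case
  proof (cases "U = W")
   case True
   then show ?thesis using QQ.reach_refl less.prems by (simp add: Q2_verts)
  next
   case ne: False
   show ?thesis
   proof (cases "cover U W")
    case True
    then have a: "(cl U, cl W):arcs QQ" unfolding Q2_arcs by blast
    have "QQ.awalk (cl U) [(cl U, cl W)] (cl W)"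
     using a QQ.head_in_verts[OF a] by (simp add: QQ.awalk_Cons_iff QQ.awalk_Nil_iff Q2_ends)
    then show ?thesis unfolding QQ.reach_def
     by (intro bexI[of _ "(cl U, [(cl U, cl W)])"]) (auto simp: qpaths_def psrc_def ptgt_def Q2_ends)
   next
    case False
    then obtain L where L: "L:TU" "W\<subset>L" "L\<subset>U" using less.prems ne unfolding cover_def by blast
    have fin: "finite {L:TU. W<=L & L<=U}" using finite_TU by simp
    have c: "card {M:TU. L<=M & M<=U} < card {L:TU. W<=L & L<=U}"
     "card {M:TU. W<=M & M<=L} < card {L:TU. W<=L & L<=U}"
     by (rule psubset_card_mono[OF fin]; use L less.prems in blast)+
    have "QQ.reach (cl U) (cl L)" by (rule less.hyps[OF c(1) less.prems(1) L(1)]) (use L in blast)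
    moreover have "QQ.reach (cl L) (cl W)" by (rule less.hyps[OF c(2) L(1) less.prems(2)]) (use L in blast)
    ultimately show ?thesis by (rule QQ.reach_trans)
   qed
  qed
 qed
 then show "QQ.reach c d" using UW by simp
qed

lemma Q2_reach_cl: "U:TU ==> W:TU ==> QQ.reach (cl U) (cl W)\<longleftrightarrow>W<=U"
 unfolding Q2_reach_iff cl_eq by blast

lemma Q2_incidence:
 "incidence_algebra (commutativity_algebra QQ :: ('k, (('k, 'v) iso_class\<times>(('k, 'v) iso_class\<times>('k, 'v) iso_class) list=>'k) set) module)
   (verts QQ) QQ.reach QQ.coset_ev"
proof (rule QQ.incidence_RG)
 fix s t assume h: "QQ.reach s t" "QQ.reach t s"
 obtain U W where U: "U:TU" "W:TU" "s = cl U" "t = cl W" using h(1) unfolding Q2_reach_iff by blast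
 have "W<=U" "U<=W"
  using h unfolding U(3,4) Q2_reach_cl[OF U(1,2)] Q2_reach_cl[OF U(2,1)] .
 then show "s = t" using U by simp
qed

lemma Q2_cover_iff:
 assumes "U:TU" "W:TU"
 shows "cover U W\<longleftrightarrow>QQ.reach (cl U) (cl W) & cl U~=cl W &
  \<not> (EX m. QQ.reach (cl U) m & QQ.reach m (cl W) & m~=cl U & m~=cl W)"
proof -
 have "(EX m. QQ.reach (cl U) m & QQ.reach m (cl W) & m~=cl U & m~=cl W)\<longleftrightarrow>(EX L:TU. W\<subset>L & L\<subset>U)"
 proof
  assume "EX m. QQ.reach (cl U) m & QQ.reach m (cl W) & m~=cl U & m~=cl W"
  then obtain m where m: "QQ.reach (cl U) m" "QQ.reach m (cl W)" "m~=cl U" "m~=cl W" by blast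
  obtain L where L: "L:TU" "m = cl L" using m(1) unfolding Q2_reach_iff by blast
  then show "EX L:TU. W\<subset>L & L\<subset>U" using m assms Q2_reach_cl by (intro bexI[of _ L]) (auto simp: psubset_eq)
 next
  assume "EX L:TU. W\<subset>L & L\<subset>U"
  then obtain L where L: "L:TU" "W\<subset>L" "L\<subset>U" by blast
  then show "EX m. QQ.reach (cl U) m & QQ.reach m (cl W) & m~=cl U & m~=cl W"
   using assms by (intro exI[of _ "cl L"]) (auto simp: Q2_reach_cl cl_eq psubset_eq)
 qed
 then show ?thesis unfolding cover_def Q2_reach_cl[OF assms] cl_eq using assms by blast
qed

lemma Q2_arcs_between:
 assumes "v:verts QQ" "w:verts QQ"
 shows "EX a. {a:arcs QQ. tail QQ a = v & head QQ a = w} =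
   (if QQ.reach v w & v~=w & \<not> (EX m. QQ.reach v m & QQ.reach m w & m~=v & m~=w) then {a} else {})"
proof -
 obtain U W where U: "U:TU" "W:TU" "v = cl U" "w = cl W" using assms unfolding Q2_verts by blast
 have "{a:arcs QQ. tail QQ a = v & head QQ a = w} = (if cover U W then {(v, w)} else {})"
  unfolding Q2_arcs Q2_ends U(3,4) by (auto simp: cl_eq)
 then show ?thesis unfolding Q2_cover_iff[OF U(1,2)] U(3,4) by blast
qed

end

section \<open>Factorizations of identity transformations\<close>

text \<open>At the regular module the map b \<mapsto> b \<otimes> 1 is injective, and
  \<open>et\<close> determines \<open>fi\<close> b \<otimes> 1.\<close>

lemma EW_inj:
 fixes A :: "('k::field, 'x=>'k) module"
 assumes B': "fd_bimodule A B'" and G: "tens A B' G bt'"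
  and e: "EW A B F bt G bt' fi et" "EW A B F bt G bt' gi et"
  and b: "b:bC B" "fi b:bC B'" "gi b:bC B'"
 shows "fi b = gi b"
proof -
 interpret fd_bimodule A B' by fact
 obtain N ta c e' where La: "MS A N ta" and e': "e':CV N" and
  c: "ALL x:CV N. c x:carrier A & ta (c x) *v e' = x"
   "ALL x:CV N. ALL y:CV N. c (x + y) = c x + c y"
   "ALL x:CV N. ALL r. c (r .*v x) = fscale r (c x)"
   "ALL a:carrier A. ALL x:CV N. c (ta a *v x) = a\<otimes>\<^bsub>A\<^esub>c x" "c e' = \<one>\<^bsub>A\<^esub>"
  using regular_module by (elim exE conjE) (rule that)
 have "bij_betw (%b. bt' (N, ta) b e') (bC B') (CV (fst (omap G (N, ta))))"
  by (rule eval_at_one[OF G La e', where c = c]) (use c in simp_all)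
 moreover have "bt' (N, ta) (fi b) e' = bt' (N, ta) (gi b) e'"
  using e La b(1) e' unfolding EW_def by metis
 ultimately show ?thesis using b(2,3) unfolding bij_betw_def inj_on_def by blast
qed

lemma EW_cong:
 assumes "EW A B F bt G bt' fi et" "!!b. b:bC B ==> fi b = gi b"
 shows "EW A B F bt G bt' gi et"
 using assms unfolding EW_def by simp

lemma tens_linear: "tens A B F bt ==> F:Ob (EF A)"
 by (simp add: tens_def functor_category_def)

lemma EW_hom: "EW A B F bt G bt' fi et ==> et:Hom (EF A) F G"
 by (simp add: EW_def functor_category_def)

text \<open>Bimodule maps from B to B' and back induce an endomorphism of F that passes through G.
  Factorizations of functors are produced from bimodules in this way.\<close>

lemma factors_summand:
 fixes A :: "('k::field, 'x=>'k) module"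
 assumes F: "tens A B F bt" "fd_bimodule A B" and G: "tens A B' G bt'" "fd_bimodule A B'"
  and fi: "fi:BH A B B'" "gi:BH A B' B" and S: "G:S" "S<=Ob (EF A)"
 shows "EX et. EW A B F bt F bt (%b. gi (fi b)) et & factors (EF A) S F F et"
proof -
 obtain et where e: "EW A B F bt G bt' fi et" using EW_exists[OF F(1) G(1) fi(1) F(2)] by blast
 obtain th where t: "EW A B' G bt' F bt gi th" using EW_exists[OF G(1) F(1) fi(2) G(2)] by blast
 note l = tens_linear[OF F(1)] tens_linear[OF G(1)]
 have lf: "LF (MC A) (MC A) F" "LF (MC A) (MC A) G"
  using l by (simp_all add: functor_category_def)
 note h = EW_hom[OF e] EW_hom[OF t]
 show ?thesis
  using EW_comp[OF lf(1,2,1) F(1) BHD(1)[OF fi(1)] e t]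
   linear_category.factors_single[OF EF_lin S(2) l(1) l(1) S(1) h] by blast
qed

lemma factors_sum:
 fixes A :: "('k::field, 'x=>'k) module"
 assumes F: "tens A B F bt" "fd_bimodule A B" and S: "S<=Ob (EF A)" and L: "finite L"
  and ch: "!!l. l:L ==> EX et. EW A B F bt F bt (ch l) et & factors (EF A) S F F et"
   "!!l b. l:L ==> b:bC B ==> ch l b:bC B"
 shows "EX et. EW A B F bt F bt (%b. \<Sum>l\<in>L. ch l b) et & factors (EF A) S F F et"
 using L ch
proof induction
 case empty
 interpret linear_category "EF A" by (rule EF_lin)
 note l = tens_linear[OF F(1)]
 have "EW A B F bt F bt (%b. fscale 0 b) (Hscale (EF A) F F 0 (Ident (EF A) F))"
  by (rule EW_scale[OF F(1) F(1) _ EW_ident[OF F(1)]])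
 then have "EW A B F bt F bt (%b. \<Sum>l\<in>{}. ch l b) (Hzero (EF A) F F)"
  unfolding hscale_0[OF l l ident_hom[OF l]] by (rule EW_cong) auto
 then show ?case by (intro exI[of _ "Hzero (EF A) F F"] conjI factors.zero)
next
 case (insert l L)
 interpret B: fd_bimodule A B by (rule F(2))
 note o = tens_linear[OF F(1)]
 have zB: "0:bC B" using B.b_subspace unfolding fsubspace_iff by blast
 have sB: "(\<Sum>l\<in>L. ch l b):bC B" if "b:bC B" for b
  using insert.hyps(1) insert.prems(2) that zB by induction (auto intro: B.b_add)
 obtain et where e: "EW A B F bt F bt (%b. \<Sum>l\<in>L. ch l b) et" "factors (EF A) S F F et"
  using insert.IH insert.prems by blast
 obtain th where t: "EW A B F bt F bt (ch l) th" "factors (EF A) S F F th"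
  using insert.prems(1)[of l] by blast
 have "EW A B F bt F bt (%b. ch l b + (\<Sum>l\<in>L. ch l b)) (Hadd (EF A) F F th et)"
  by (rule EW_add[OF F(1) F(1) insert.prems(2)[OF insertI1] sB t(1) e(1)])
 moreover have "factors (EF A) S F F (Hadd (EF A) F F th et)"
  by (rule linear_category.factors_add[OF EF_lin S o o t(2) e(2)])
 ultimately show ?case unfolding sum.insert[OF insert.hyps] by blast
qed

text \<open>The maps \<open>ch l\<close> decompose the identity of B; the transformation they induce
  together must be the identity of F, because a bimodule map induces only one
  transformation.\<close>

lemma factors_ident:
 fixes A :: "('k::field, 'x=>'k) module"
 assumes F: "tens A B F bt" "fd_bimodule A B" and S: "S<=Ob (EF A)" and L: "finite L"
  and ch: "!!l. l:L ==> EX et. EW A B F bt F bt (ch l) et & factors (EF A) S F F et"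
   "!!l b. l:L ==> b:bC B ==> ch l b:bC B"
  and s: "!!b. b:bC B ==> (\<Sum>l\<in>L. ch l b) = b"
 shows "factors (EF A) S F F (Ident (EF A) F)"
proof -
 obtain et where e: "EW A B F bt F bt (%b. \<Sum>l\<in>L. ch l b) et" "factors (EF A) S F F et"
  using factors_sum[OF F S L, of ch, OF ch] by blast
 have "et = Ident (EF A) F"
  by (rule EW_unique[OF F(1) e(1) EW_ident[OF F(1)]]) (rule s)
 then show ?thesis using e(2) by simp
qed

lemma bimodule_hom_sum:
 assumes B: "fd_bimodule A B" and fi: "fi:BH A B B'" and L: "finite L" "!!l. l:L ==> x l:bC B"
 shows "fi (\<Sum>l\<in>L. x l) = (\<Sum>l\<in>L. fi (x l)) & (\<Sum>l\<in>L. x l):bC B"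
proof -
 interpret fd_bimodule A B by fact
 have z: "0:bC B" using b_subspace unfolding fsubspace_iff by blast
 have fi0: "fi 0 = 0" using BHD(3)[OF fi z, of 0] by (auto simp: fun_eq_iff zero_fun_def)
 show ?thesis using L z fi0 by (induction rule: finite_induct) (auto simp: BHD(2)[OF fi] b_add)
qed

section \<open>The additive category of 1-morphisms\<close>

lemma factors_full: "factors C S X Y r ==> factors (C\<lparr>Ob := O'\<rparr>) S X Y r"
proof (induction rule: factors.induct)
 case zero show ?case using factors.zero[of "C\<lparr>Ob := O'\<rparr>"] by simp
next
 case (step r s f g) then show ?case using factors.step[of "C\<lparr>Ob := O'\<rparr>" S X Y r s f g] by simp
qed

definition GenF :: "('k::field, 'x=>'k) module=>('k, 'x=>'k) endofunctor set" where
 "GenF A = {F. is_tensor_functor A (free_bimod A) F} \<union>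
   {F. EX I. ideal I A & is_tensor_functor A (ideal_bimod A I) F}"

lemma generating_functors_linear: "GenF A<=Ob (EF A)"
 unfolding GenF_def is_tensor_functor_iff by (intro Un_least subsetI) (auto intro: tens_linear)

lemma EF_additive: "has_biproducts (EF A)" "splits_idempotents (EF A)"
 using linear_category.functor_has_biproducts[OF module_linear_category module_has_biproducts]
  linear_category.functor_splits_idempotents[OF module_linear_category module_splits_idempotents] by blast+

lemma D_category_eq: "D_category A = EF A\<lparr>Ob := Ob (D_category A)\<rparr>"
 by (simp add: D_category_def Let_def)

lemma D_category_simps: "Hom (D_category A) = Hom (EF A)" "Comp (D_category A) = Comp (EF A)"
 "Ident (D_category A) = Ident (EF A)" "Hzero (D_category A) = Hzero (EF A)"
 "Hadd (D_category A) = Hadd (EF A)" "Hscale (D_category A) = Hscale (EF A)"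
 by (simp_all add: D_category_def Let_def)

text \<open>Being a 1-morphism becomes a condition on the identity transformation alone, which can
  be checked on bimodules.\<close>

lemma D_category_Ob: "F:Ob (D_category A)\<longleftrightarrow>F:Ob (EF A) &
  factors (EF A) (GenF A) F F (Ident (EF A) F)"
 unfolding linear_category.additive_closure_iff[OF EF_lin generating_functors_linear EF_additive, symmetric]
 by (simp add: D_category_def Let_def GenF_def)

lemma D_category_linear: "linear_category (D_category A)"
 by (subst D_category_eq, rule linear_category.full_subcategory[OF EF_lin]) (use D_category_Ob in blast)

text \<open>The identity of a biproduct is a sum of two composites, one through each summand, so it
  inherits factorizations from the identities of the summands.\<close>

lemma D_category_biproducts: "has_biproducts (D_category A)"
 unfolding has_biproducts_def
proof (intro ballI)
 interpret linear_category "EF A" by (rule EF_lin)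
 note S = generating_functors_linear[of A]
 let ?E = "EF A"
 fix X Y assume "X:Ob (D_category A)" "Y:Ob (D_category A)"
 then have X: "X:Ob ?E" "factors ?E (GenF A) X X (Ident ?E X)"
  and Y: "Y:Ob ?E" "factors ?E (GenF A) Y Y (Ident ?E Y)" unfolding D_category_Ob by blast+
 obtain Z i1 i2 p1 p2 where b: "binary_biproduct ?E X Y Z i1 i2 p1 p2"
  using EF_additive(1) X Y unfolding has_biproducts_def by blast
 then have Z: "Z:Ob ?E" and h: "i1:Hom ?E X Z" "i2:Hom ?E Y Z" "p1:Hom ?E Z X" "p2:Hom ?E Z Y"
  and s: "Hadd ?E Z Z (Comp ?E Z X Z i1 p1) (Comp ?E Z Y Z i2 p2) = Ident ?E Z" unfolding binary_biproduct_def by blast+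
 have "factors ?E (GenF A) Z Z (Comp ?E Z X Z i1 p1)" "factors ?E (GenF A) Z Z (Comp ?E Z Y Z i2 p2)"
  using factors_sandwich[OF S Z X(1) X(1) Z X(2) h(3,1)] factors_sandwich[OF S Z Y(1) Y(1) Z Y(2) h(4,2)]
  by (simp_all add: ident_left[OF Z X(1) h(3)] ident_left[OF Z Y(1) h(4)])
 from factors_add[OF S Z Z this] have "Z:Ob (D_category A)" unfolding s D_category_Ob using Z by blast
 then have "binary_biproduct (D_category A) X Y Z i1 i2 p1 p2"
  using b X Y unfolding binary_biproduct_def D_category_simps D_category_Ob by simp
 then show "EX Z i1 i2 p1 p2. binary_biproduct (D_category A) X Y Z i1 i2 p1 p2" by blast
qed

lemma D_category_zero: "X:Ob (EF A) ==> EX Z. zero_object (D_category A) Z"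
proof -
 assume "X:Ob (EF A)"
 then obtain Z where Z: "zero_object (EF A) Z"
  using linear_category.zero_object_exists[OF EF_lin EF_additive(2)] by blast
 then have z: "Z:Ob (EF A)" "Ident (EF A) Z = Hzero (EF A) Z Z" by (simp_all add: zero_object_def)
 have "factors (EF A) (GenF A) Z Z (Ident (EF A) Z)" unfolding z(2) by (rule factors.zero)
 then have "zero_object (D_category A) Z" unfolding zero_object_def D_category_simps D_category_Ob using z by simp
 then show ?thesis by blast
qed

section \<open>A generator\<close>

context thin_quiver_over
begin

definition up :: "('k, 'v) iso_class=>('v\<times>'v) set" where "up c = (THE U. cl U = c)"

lemma up_cl: "up (cl U) = U"
 unfolding up_def by (simp add: cl_eq)

lemma up: "c:verts QQ ==> up c:TU & cl (up c) = c"
 unfolding Q2_verts using up_cl by auto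

lemma reach_up: "QQ.reach c d\<longleftrightarrow>c:verts QQ & d:verts QQ & up d<=up c"
 unfolding Q2_reach_iff Q2_verts by (auto simp: up_cl cl_eq)

lemma up_upset: "c:verts QQ ==> upset (up c)" and up_conn: "c:verts QQ ==> conn (up c)"
 using up TU_upset TU_conn by blast+

text \<open>The direct sum of all bimodules in the poset, one for each vertex of the Hasse quiver;
  its tensor functor is the additive generator.\<close>

abbreviation BB :: "('k, ('v, 'e) qpath=>'k, ('k, 'v) iso_class\<times>'v\<times>'v) bimod" where "BB \<equiv> fam (verts QQ) up"

lemma BB_fd: "fd_bimodule KA BB"
 by (rule fam_fd) (simp_all add: up_upset)

lemma BB_carrier: "f:bC BB\<longleftrightarrow>(ALL c x. f (c, x)~=0-->c:verts QQ & x:up c)"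
 by (auto simp: fam_def spt_def)

lemma BB_D: "f:bC BB ==> f (c, x)~=0 ==> c:verts QQ & x:up c"
 unfolding BB_carrier by blast

abbreviation NU :: "('v\<times>'v) set=>('k, ('v, 'e) qpath=>'k, 'v\<times>'v) bimod" where "NU U \<equiv> NN_sub G (spn U)"

definition inj :: "('k, 'v) iso_class=>('v\<times>'v=>'k)=>('k, 'v) iso_class\<times>'v\<times>'v=>'k" where
 "inj c f = (%(d, x). if d = c then f x else 0)"

definition proj :: "('k, 'v) iso_class=>(('k, 'v) iso_class\<times>'v\<times>'v=>'k)=>'v\<times>'v=>'k" where
 "proj c h = (%x. h (c, x))"

lemma proj_inj: "proj c (inj c f) = f"
 by (simp add: proj_def inj_def)

lemma inj_hom: "c:verts QQ ==> inj c:BH KA (NU (up c)) BB"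
 by (rule BHI)
  (auto simp: inj_def NNs BB_carrier spt_def fam_lact fam_ract NN_lact NN_ract fun_eq_iff split: if_splits)

lemma proj_hom: "proj c:BH KA BB (NU (up c))"
 by (rule BHI)
  (auto simp: proj_def NNs BB_carrier spt_def fam_lact fam_ract NN_lact NN_ract fun_eq_iff)

lemma sum_inj_proj: "h:bC BB ==> (\<Sum>c\<in>verts QQ. inj c (proj c h)) = h"
proof (rule ext, rule prod.induct)
 fix d x assume h: "h:bC BB"
 have "(\<Sum>c\<in>F. inj c (proj c h)) (d, x) = (\<Sum>c\<in>F. if c = d then h (d, x) else 0)" if "finite F" for F
  using that by induction (auto simp: inj_def proj_def)
 then show "(\<Sum>c\<in>verts QQ. inj c (proj c h)) (d, x) = h (d, x)" using BB_D[OF h, of d x] by auto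
qed

text \<open>Endomorphisms of \<open>BB\<close> as matrices: the entry (t, s) is the scalar by which
  the summand t is mapped to the summand s. It can be nonzero only if \<open>up t\<close> is
  contained in \<open>up s\<close>, that is, if a path leads from s to t.\<close>

definition mats :: "(('k, 'v) iso_class\<times>('k, 'v) iso_class=>'k) set" where
 "mats = spt {(t, s). QQ.reach s t}"

definition mat_map where "mat_map g h = (%(s, x). \<Sum>t\<in>verts QQ. g (t, s) * h (t, x) :: 'k)"

lemma mat_map_hom:
 assumes g: "g:mats"
 shows "mat_map g:BH KA BB BB"
proof (rule BHI)
 fix h assume h: "h:bC BB"
 show "mat_map g h:bC BB"
  unfolding BB_carrier
 proof (intro allI impI)
  fix s x assume "mat_map g h (s, x)~=0"
  then obtain t where "g (t, s)~=0" "h (t, x)~=0"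
   unfolding mat_map_def prod.case by (metis (no_types, lifting) mult_not_zero sum.neutral)
  then have "QQ.reach s t" "x:up t" using sptD[OF g[unfolded mats_def], of "(t, s)"] BB_D[OF h] by auto
  then show "s:verts QQ & x:up s" unfolding reach_up by blast
 qed
 fix a :: "('v, 'e) qpath=>'k" assume a: "a:carrier KA"
 show "mat_map g (lact BB a h) = lact BB a (mat_map g h)"
  by (rule ext) (auto simp: mat_map_def fam_lact[OF a] sum_distrib_left mult.left_commute intro: sum.swap)
 show "mat_map g (ract BB h a) = ract BB (mat_map g h) a"
  by (rule ext) (auto simp: mat_map_def fam_ract[OF a] sum_distrib_left sum_distrib_right mult.assoc intro: sum.swap)
qed (auto simp: mat_map_def fun_eq_iff distrib_left sum.distrib sum_distrib_left mult.left_commute)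

text \<open>Between the summands t and s an endomorphism restricts to a homomorphism from functions
  on a connected up-set, which is a multiple of the inclusion; these multiples are the matrix
  entries.\<close>

lemma hom_mat_map:
 assumes fi: "fi:BH KA BB BB"
 shows "EX g:mats. ALL h:bC BB. fi h = mat_map g h"
proof -
 define P where "P t s c\<longleftrightarrow>(ALL f:spn (up t). proj s (fi (inj t f)) = fscale c f) & (c~=0-->up t<=up s)" for t s c
 have "EX c. P t s c" if ts: "t:verts QQ" "s:verts QQ" for t s
  unfolding P_def
  by (rule NN_hom_scalar[OF up_upset[OF ts(1)] up_conn[OF ts(1)] BH_comp[OF BH_comp[OF inj_hom[OF ts(1)] fi] proj_hom]])
   (use up_upset[OF ts(2)] in "simp add: upset_def")
 then have P: "P t s (SOME c. P t s c)" if "t:verts QQ" "s:verts QQ" for t s using that someI_ex by metis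
 define g where "g = (%(t, s). if t:verts QQ & s:verts QQ then SOME c. P t s c else 0)"
 have P1: "up t<=up s" if "t:verts QQ" "s:verts QQ" "(SOME c. P t s c)~=0" for t s
  using P[OF that(1,2)] that(3) unfolding P_def[of t s "SOME c. P t s c"] by blast
 have "g:mats"
  unfolding mats_def
 proof (rule supportedI)
  fix z assume z: "z~:{(t, s). QQ.reach s t}"
  obtain t s where ts: "z = (t, s)" by (cases z)
  show "g z = 0" using z P1[of t s] by (auto simp: ts g_def reach_up)
 qed
 moreover have "fi h = mat_map g h" if h: "h:bC BB" for h
 proof (rule ext, rule prod.induct)
  fix s x
  have ph: "proj t h:spn (up t)" for t using BHD(1)[OF proj_hom h] by (simp add: NNs)
  have ih: "inj t (proj t h):bC BB" if "t:verts QQ" for t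
   using BHD(1)[OF inj_hom[OF that]] ph by (simp add: NNs)
  show "fi h (s, x) = mat_map g h (s, x)"
  proof (cases "s:verts QQ")
   case True
   have e: "(\<Sum>t\<in>F. y t) (s, x) = (\<Sum>t\<in>F. y t (s, x))" if "finite F" for F and y :: "_=>('k, 'v) iso_class\<times>'v\<times>'v=>'k"
    using that by induction auto
   have "fi h = (\<Sum>t\<in>verts QQ. fi (inj t (proj t h)))"
    using bimodule_hom_sum[OF BB_fd fi, of "verts QQ" "%t. inj t (proj t h)"] ih sum_inj_proj[OF h] by simp
   then have "fi h (s, x) = (\<Sum>t\<in>verts QQ. proj s (fi (inj t (proj t h))) x)" by (simp add: e proj_def)
   also have "\<dots> = (\<Sum>t\<in>verts QQ. g (t, s) * h (t, x))"
   proof (rule sum.cong[OF refl])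
    fix t assume t: "t:verts QQ"
    have "proj s (fi (inj t (proj t h))) = fscale (SOME c. P t s c) (proj t h)" using P[OF t True] ph unfolding P_def by blast
    then show "proj s (fi (inj t (proj t h))) x = g (t, s) * h (t, x)" using t True by (simp add: g_def proj_def)
   qed
   finally show ?thesis by (simp add: mat_map_def)
  next
   case False
   then show ?thesis using BB_D[OF BHD(1)[OF fi h], of s x] by (auto simp: mat_map_def g_def)
  qed
 qed
 ultimately show ?thesis by blast
qed

lemma mat_map_inj:
 assumes g: "g:mats" "g':mats" and e: "!!h. h:bC BB ==> mat_map g h = mat_map g' h"
 shows "g = g'"
proof (rule ext, rule prod.induct)
 fix t s
 show "g (t, s) = g' (t, s)"
 proof (cases "t:verts QQ")
  case True
  obtain x where x: "x:up t" using up_conn[OF True] by (auto simp: conn_def)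
  have "inj t (delta x):bC BB"
   by (rule BHD(1)[OF inj_hom[OF True]]) (simp add: NNs delta_spt x)
  from fun_cong[OF e[OF this], of "(s, x)"] show ?thesis
   using True by (simp add: mat_map_def inj_def delta_def if_distrib[of "%x. _ * x"] cong: if_cong)
 next
  case False
  then have "(t, s)~:{(t, s). QQ.reach s t}" unfolding reach_up by blast
  then show ?thesis using sptD[of g] sptD[of g'] g unfolding mats_def by metis
 qed
qed

text \<open>The components \<open>from_free\<close> over all pairs (i, j) embed the free bimodule
  into a direct sum of rectangles, from which it inherits the laws.\<close>

lemma free_fd: "fd_bimodule KA (free_bimod KA)"
proof (rule fd_bimodule_transfer[where fi = "%t (c, x). if c:verts G\<times>verts G then from_free (fst c) (snd c) t x else 0"])
 let ?B = "fam (verts G\<times>verts G) (%c. rect (fst c) (snd c)) :: ('k, ('v, 'e) qpath=>'k, ('v\<times>'v)\<times>'v\<times>'v) bimod"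
 let ?fi = "%t (c, x). if c:verts G\<times>verts G then from_free (fst c) (snd c) t x else 0"
 show "fd_bimodule KA ?B" by (rule fam_fd) (simp_all add: rect_upset)
 show "fsubspace (bC (free_bimod KA))" unfolding free_carrier by (rule fsub_spt)
 show "finite (qpaths G\<times>qpaths G)" using finite_qpaths by simp
 show "bC (free_bimod KA)<=spt (qpaths G\<times>qpaths G)" unfolding free_carrier ..
 have h: "from_free i j:BH KA (free_bimod KA) (NU (rect i j))" for i j
  by (rule from_free_hom) (simp_all add: free_carrier)
 show "?fi:BH KA (free_bimod KA) ?B"
 proof (rule BHI; unfold free_carrier)
  fix t t' and a :: "('v, 'e) qpath=>'k" and c
  assume t: "(t :: _=>'k):spt (qpaths G\<times>qpaths G)"
  then have tB: "t:bC (free_bimod KA)" unfolding free_carrier .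
  note d = BHD[OF h]
  show "?fi t:bC ?B" by (auto simp: fam_def spt_def from_free_def split: if_splits)
  show "?fi (t + t') = ?fi t + ?fi t'" "?fi (fscale c t) = fscale c (?fi t)" by (auto simp: fun_eq_iff from_free_def)
  assume a: "a:carrier KA"
  show "?fi (lact (free_bimod KA) a t) = lact ?B a (?fi t)"
   by (rule ext) (auto simp: d(4)[OF tB a] NNs fam_lact[OF a] NN_lact[OF a])
  show "?fi (ract (free_bimod KA) t a) = ract ?B (?fi t) a"
   by (rule ext) (auto simp: d(5)[OF tB a] NNs fam_ract[OF a] NN_ract[OF a])
 qed
 show "inj_on ?fi (bC (free_bimod KA))"
  unfolding free_carrier
 proof (rule inj_onI, rule ext, rule prod.induct)
  fix t t' p q assume t: "(t :: _=>'k):spt (qpaths G\<times>qpaths G)" "t':spt (qpaths G\<times>qpaths G)" and e: "?fi t = ?fi t'"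
  show "t (p, q) = t' (p, q)"
  proof (cases "p:qpaths G & q:qpaths G")
   case True
   then have pq: "psrc p:verts G" "ptgt G q:verts G" using qpath_ends by blast+
   have "from_free (psrc p) (ptgt G q) t = from_free (psrc p) (ptgt G q) t'"
    using fun_cong[OF e, of "((psrc p, ptgt G q), _)"] pq by (auto simp: fun_eq_iff)
   then show ?thesis using to_from_free[of t p q "psrc p" "ptgt G q"] to_from_free[of t' p q "psrc p" "ptgt G q"] True by simp
  next
   case False
   then show ?thesis using sptD[OF t(1), of "(p, q)"] sptD[OF t(2), of "(p, q)"] by auto
  qed
 qed
 fix a :: "('v, 'e) qpath=>'k" and t assume a: "a:carrier KA" and "t:bC (free_bimod KA)"
 then have t: "t:spt (qpaths G\<times>qpaths G)" unfolding free_carrier by blast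
 have "lact (free_bimod KA) a t (p, q) = 0 & ract (free_bimod KA) t a (p, q) = 0" if "(p, q)~:qpaths G\<times>qpaths G" for p q
  unfolding free_lact[OF a t] free_ract[OF a t] using that sptD[OF t] by (auto intro!: sum.neutral)
 then show "lact (free_bimod KA) a t:bC (free_bimod KA) & ract (free_bimod KA) t a:bC (free_bimod KA)"
  unfolding free_carrier spt_def by auto
qed

end

lemma summand_cong:
 assumes "EX et. EW A B F bt F bt ch et & factors C S F F et" "!!b. b:bC B ==> ch b = ch' b"
 shows "EX et. EW A B F bt F bt ch' et & factors C S F F et"
 using assms EW_cong by blast

text \<open>The matrix units and the vertex idempotents agree at the vertices only, so the passage
  from one to the other needs this congruence.\<close>

lemma quiver_of_algebra_cong:
 assumes e: "quiver_of_algebra R G e" and eq: "!!v. v:verts G ==> e v = e' v" and R: "ring R"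
 shows "quiver_of_algebra R G e'"
proof -
 interpret ring R by (rule R)
 have b: "basic_idempotents R (verts G) e" using e by (simp add: quiver_of_algebra_def)
 then have c: "e':verts G \<rightarrow> carrier R"
  using eq by (auto simp: basic_idempotents_def primitive_idempotent_def idempotent_def)
 have "finsum R e (verts G) = finsum R e' (verts G)" by (rule finsum_cong'[OF refl c]) (simp add: eq)
 then have "basic_idempotents R (verts G) e'" using b unfolding basic_idempotents_def by (simp add: eq)
 then show ?thesis using e unfolding quiver_of_algebra_def Let_def by (simp add: eq)
qed

section \<open>Endomorphisms of the generator and the equivalence with modules\<close>

context thin_quiver_over
begin

abbreviation RQ :: "('k, (('k, 'v) iso_class\<times>(('k, 'v) iso_class\<times>('k, 'v) iso_class) list=>'k) set) module"
 where "RQ \<equiv> commutativity_algebra QQ"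

interpretation QI: incidence_algebra RQ "verts QQ" QQ.reach QQ.coset_ev
 by (rule Q2_incidence)

abbreviation "EE \<equiv> EF KA"

definition TT :: "('k, ('v, 'e) qpath=>'k) endofunctor" where "TT = (SOME F. is_tensor_functor KA BB F)"

definition btT where "btT = (SOME bt. tens KA BB TT bt)"

lemma TT: "tens KA BB TT btT"
proof -
 have "is_tensor_functor KA BB TT" unfolding TT_def by (rule someI_ex[OF fd_bimodule.tensor_functor_exists[OF BB_fd]])
 then show ?thesis unfolding btT_def is_tensor_functor_iff by (rule someI_ex)
qed

lemma TT_linear: "LF (MC KA) (MC KA) TT"
 using TT by (simp add: tens_def)

definition nt where "nt g = (SOME et. EW KA BB TT btT TT btT (mat_map g) et)"

lemma nt: "g:mats ==> EW KA BB TT btT TT btT (mat_map g) (nt g)"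
 unfolding nt_def by (rule someI_ex[OF EW_exists[OF TT TT mat_map_hom BB_fd]])

lemma nt_eq:
 "EW KA BB TT btT TT btT fi et ==> g:mats ==> (!!h. h:bC BB ==> fi h = mat_map g h) ==> et = nt g"
 by (rule EW_unique[OF TT _ nt])

lemma mat_map_closed: "g:mats ==> h:bC BB ==> mat_map g h:bC BB"
 by (rule BHD(1)[OF mat_map_hom])

text \<open>Eilenberg--Watts combined with the matrix description: a transformation comes from an
  endomorphism of \<open>BB\<close>, hence from a matrix, and both passages are injective.\<close>

lemma nt_bij: "bij_betw nt mats (Hom EE TT TT)"
 unfolding bij_betw_def
proof
 show "inj_on nt mats"
 proof (rule inj_onI)
  fix g g' assume g: "g:mats" "g':mats" and e: "nt g = nt g'"
  show "g = g'"
  proof (rule mat_map_inj[OF g])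
   fix h assume h: "h:bC BB"
   have "EW KA BB TT btT TT btT (mat_map g') (nt g)" unfolding e by (rule nt[OF g(2)])
   from EW_inj[where fi = "mat_map g" and gi = "mat_map g'", OF BB_fd TT nt[OF g(1)] this h
     mat_map_closed[OF g(1) h] mat_map_closed[OF g(2) h]]
   show "mat_map g h = mat_map g' h" .
  qed
 qed
 show "nt ` mats = Hom EE TT TT"
 proof (intro equalityI subsetI)
  show "et:Hom EE TT TT" if "et:nt ` mats" for et using that EW_hom[OF nt] by (elim imageE) simp
  fix et assume "et:Hom EE TT TT"
  then have "et:nat_trans (MC KA) (MC KA) TT TT" by (simp add: functor_category_def)
  from EW_surj[OF TT TT BB_fd BB_fd this] obtain fi where
   fi: "fi:BH KA BB BB" "EW KA BB TT btT TT btT fi et" by blast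
  obtain g where g: "g:mats" "ALL h:bC BB. fi h = mat_map g h" using hom_mat_map[OF fi(1)] by blast
  then have "et = nt g" using nt_eq[OF fi(2) g(1)] by blast
  then show "et:nt ` mats" using g(1) by blast
 qed
qed

lemma mats_closed: "g:mats ==> g':mats ==> g + g':mats" "g:mats ==> fscale c g:mats"
 using fsub_spt[of "{(t, s). QQ.reach s t}", where 'k = 'k] unfolding fsubspace_iff mats_def by blast+

lemma mats_reach: "g:mats ==> g (t, s)~=0 ==> QQ.reach s t"
 unfolding mats_def spt_def by blast

definition mat_mult :: "_=>_=>('k, 'v) iso_class\<times>('k, 'v) iso_class=>'k" where
 "mat_mult g g' = (%(t, s). \<Sum>m\<in>verts QQ. g (t, m) * g' (m, s))"

definition mat_one :: "('k, 'v) iso_class\<times>('k, 'v) iso_class=>'k" where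
 "mat_one = (%(t, s). if t = s & t:verts QQ then 1 else 0)"

lemma mat_mult_mats: "g:mats ==> g':mats ==> mat_mult g g':mats"
proof -
 assume g: "g:mats" "g':mats"
 have "QQ.reach s t" if nz: "mat_mult g g' (t, s)~=0" for t s
 proof -
  obtain m where "g (t, m)~=0" "g' (m, s)~=0"
   using nz unfolding mat_mult_def prod.case by (metis (no_types, lifting) mult_not_zero sum.neutral)
  then show ?thesis using mats_reach[OF g(1)] mats_reach[OF g(2)] QQ.reach_trans by blast
 qed
 then show ?thesis unfolding mats_def spt_def by blast
qed

lemma mat_one_mats: "mat_one:mats"
 using QQ.reach_refl by (auto simp: mats_def spt_def mat_one_def split: if_splits)

lemma delta_mats: "c:verts QQ ==> delta (c, c):mats"
 unfolding mats_def delta_spt using QQ.reach_refl by simp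

lemma nt_add: "g:mats ==> g':mats ==> Hadd EE TT TT (nt g) (nt g') = nt (g + g')"
 by (rule nt_eq[OF EW_add[OF TT TT mat_map_closed mat_map_closed nt nt]])
  (auto simp: mats_closed mat_map_def fun_eq_iff distrib_right sum.distrib)

lemma nt_scale: "g:mats ==> Hscale EE TT TT c (nt g) = nt (fscale c g)"
 by (rule nt_eq[OF EW_scale[OF TT TT mat_map_closed nt]])
  (auto simp: mats_closed mat_map_def fun_eq_iff sum_distrib_left mult.assoc)

text \<open>\<open>mat_map\<close> sums over the target index of the matrix, so composition reverses
  the matrix product. This is the reversal that the locale \<open>morita\<close> expects.\<close>

lemma nt_comp: "g:mats ==> g':mats ==> Comp EE TT TT TT (nt g) (nt g') = nt (mat_mult g' g)"
proof (rule nt_eq[OF EW_comp[OF TT_linear TT_linear TT_linear TT mat_map_closed nt nt]])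
 fix h
 show "mat_map g (mat_map g' h) = mat_map (mat_mult g' g) h"
  by (auto simp: mat_map_def mat_mult_def fun_eq_iff sum_distrib_left sum_distrib_right mult_ac intro: sum.swap)
qed (simp_all add: mat_mult_mats)

lemma nt_ident: "Ident EE TT = nt mat_one"
proof (rule nt_eq[OF EW_ident[OF TT] mat_one_mats], rule ext, rule prod.induct)
 fix h s x assume h: "h:bC BB"
 have "mat_map mat_one h (s, x) = (\<Sum>t\<in>verts QQ. if t = s then h (s, x) else 0)"
  unfolding mat_map_def prod.case by (intro sum.cong) (auto simp: mat_one_def)
 then show "h (s, x) = mat_map mat_one h (s, x)" using BB_D[OF h, of s x] by auto
qed

lemma el: "g:mats ==> QI.el g:carrier RQ" "g:mats ==> QQ.coset_ev (QI.el g) = g"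
 by (rule QI.el, rule mats_reach, assumption+)+

lemma el_eqI: "g:mats ==> x:carrier RQ ==> (!!t s. QQ.coset_ev x (t, s) = g (t, s)) ==> QI.el g = x"
 by (rule QI.eqI) (simp_all add: el)

definition eltT where "eltT et = QI.el (inv_into mats nt et)"

lemma eltT_nt: "g:mats ==> eltT (nt g) = QI.el g"
 unfolding eltT_def using bij_betw_imp_inj_on[OF nt_bij] by (simp add: inv_into_f_f)

lemma hom_nt: "f:Hom EE TT TT ==> EX g:mats. f = nt g"
 using nt_bij unfolding bij_betw_def by blast

lemma TU_cl: "U:TU ==> cl U:verts QQ"
 unfolding Q2_verts by blast

text \<open>The identity of \<open>BB\<close> is the sum of the projections to its summands. A
  summand on a rectangle passes through the free bimodule, any other one through the ideal with the
  same support.\<close>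

lemma TT_Ob: "TT:Ob (D_category KA)"
 unfolding D_category_Ob
proof
 show "TT:Ob EE" by (rule tens_linear[OF TT])
 note S = generating_functors_linear[of KA]
 show "factors EE (GenF KA) TT TT (Ident EE TT)"
 proof (rule factors_ident[OF TT BB_fd S, of "verts QQ" "%c h. inj c (proj c h)"])
  fix c assume c: "c:verts QQ"
  have ph: "proj c h:spn (up c)" if "h:bC BB" for h using BHD(1)[OF proj_hom that] by (simp add: NNs)
  show "EX et. EW KA BB TT btT TT btT (%h. inj c (proj c h)) et & factors EE (GenF KA) TT TT et"
  proof (cases "EX i:verts G. EX j:verts G. up c = rect i j")
   case True
   then obtain i j where ij: "up c = rect i j" by blast
   obtain F ga where F: "tens KA (free_bimod KA) F ga"
    using fd_bimodule.tensor_functor_exists[OF free_fd] unfolding is_tensor_functor_iff by blast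
   then have FS: "F:GenF KA" unfolding GenF_def is_tensor_functor_iff by blast
   have h1: "(%h. to_free i j (proj c h)):BH KA BB (free_bimod KA)"
    by (rule BH_comp[OF proj_hom], unfold ij, rule to_free_hom) (auto simp: free_carrier spt_def)
   have h2: "(%t. inj c (from_free i j t)):BH KA (free_bimod KA) BB"
    by (rule BH_comp[OF from_free_hom inj_hom[OF c, unfolded ij]]) (simp_all add: free_carrier)
   show ?thesis
    by (rule summand_cong[OF factors_summand[OF TT BB_fd F free_fd h1 h2 FS S]])
     (use ph in "simp add: ij from_to_free")
  next
   case False
   then have U: "upset (up c)" "up c<=diag" using up[OF c] unfolding TU_def by blast+
   obtain F ga where F: "tens KA (ideal_bimod KA (idl (up c))) F ga"
    using fd_bimodule.tensor_functor_exists[OF idl_fd[OF U(1)]] unfolding is_tensor_functor_iff by blast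
   then have FS: "F:GenF KA"
    unfolding GenF_def is_tensor_functor_iff using idl_ideal[OF U(1)] by blast
   show ?thesis
    by (rule summand_cong[OF factors_summand[OF TT BB_fd F idl_fd[OF U(1)]
       BH_comp[OF proj_hom ev_inv_hom[OF U]] BH_comp[OF ev_hom inj_hom[OF c]] FS S]])
     (simp only: ev_inv(2)[OF ph U(2)])
  qed
  show "inj c (proj c h):bC BB" if "h:bC BB" for h
   using BHD(1)[OF inj_hom[OF c]] ph[OF that] by (simp add: NNs)
 qed (simp_all add: sum_inj_proj)
qed

lemma TT_S: "TT:{TT}" "{TT}<=Ob EE"
 using tens_linear[OF TT] by simp_all

text \<open>The free bimodule is the direct sum of its parts at the pairs (i, j), and each part
  occurs as a summand of \<open>BB\<close> on a rectangle.\<close>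

lemma free_factors:
 assumes F: "tens KA (free_bimod KA) F ga"
 shows "factors EE {TT} F F (Ident EE F)"
proof (rule factors_ident[OF F free_fd TT_S(2), of "verts G\<times>verts G" "%(i, j) t. to_free i j (from_free i j t)"])
 fix l assume l: "l:verts G\<times>verts G"
 obtain i j where ij: "l = (i, j)" by (cases l)
 define c where "c = cl (rect i j)"
 have "rect i j:TU" using l by (auto simp: TU_def ij)
 then have c: "c:verts QQ" "up c = rect i j" by (simp_all add: c_def TU_cl up_cl)
 have h1: "(%t. inj c (from_free i j t)):BH KA (free_bimod KA) BB"
  by (rule BH_comp[OF from_free_hom inj_hom[OF c(1), unfolded c(2)]]) (simp_all add: free_carrier)
 have t: "to_free i j:BH KA (NU (rect i j)) (free_bimod KA)"
  by (rule to_free_hom) (auto simp: free_carrier spt_def)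
 have h2: "(%h. to_free i j (proj c h)):BH KA BB (free_bimod KA)"
  by (rule BH_comp[OF proj_hom[of c, unfolded c(2)] t])
 show "EX et. EW KA (free_bimod KA) F ga F ga ((%(i, j) t. to_free i j (from_free i j t)) l) et & factors EE {TT} F F et"
  unfolding ij prod.case
  by (rule summand_cong[OF factors_summand[OF F free_fd TT BB_fd h1 h2 TT_S]]) (simp add: proj_inj)
 show "(%(i, j) t. to_free i j (from_free i j t)) l b:bC (free_bimod KA)" for b :: "_=>'k"
  unfolding ij prod.case free_carrier by (auto simp: to_free_def spt_def)
next
 fix b :: "('v, 'e) qpath\<times>('v, 'e) qpath=>'k" assume b: "b:bC (free_bimod KA)"
 show "(\<Sum>l\<in>verts G\<times>verts G. (%(i, j) t. to_free i j (from_free i j t)) l b) = b"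
 proof (rule ext, rule prod.induct)
  fix p q
  have s: "b (p, q)~=0-->p:qpaths G & q:qpaths G"
   using sptD[OF b[unfolded free_carrier], of "(p, q)"] by blast
  have "(\<Sum>l\<in>L. (%(i, j) t. to_free i j (from_free i j t)) l b) (p, q) = (\<Sum>l\<in>L. if l = (psrc p, ptgt G q) then b (p, q) else 0)"
   if "finite L" for L
   using that by induction (auto simp: to_from_free[of b p q, OF s] split: if_splits)
  moreover have "b (p, q)~=0 ==> psrc p:verts G & ptgt G q:verts G" using s qpath_ends by blast
  ultimately show "(\<Sum>l\<in>verts G\<times>verts G. (%(i, j) t. to_free i j (from_free i j t)) l b) (p, q) = b (p, q)" by auto
 qed
qed simp

text \<open>The ideal is cut along the connected components of its support, each of which belongs to
  the poset and so occurs as a summand of \<open>BB\<close>.\<close>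

lemma ideal_factors:
 assumes U: "upset U" "U<=diag" and F: "tens KA (ideal_bimod KA (idl U)) F ga"
 shows "factors EE {TT} F F (Ident EE F)"
proof -
 obtain \<C> where C: "finite \<C>" "\<Union>\<C> = U" "ALL C:\<C>. upset C & upset (U - C) & conn C"
  "ALL C:\<C>. ALL C':\<C>. C~=C'-->C\<inter>C' = {}"
  using conn_decomposition[OF U(1)] by (elim exE conjE) (rule that)
 let ?r = "%C (f :: 'v\<times>'v=>'k) x. if x:C then f x else 0"
 let ?ch = "%C f. ev_inv (?r C (ev f))"
 note id = idl_fd[OF U(1)]
 have s: "ev f:spn U" if "f:bC (ideal_bimod KA (idl U))" for f using that by (simp add: ideal_bimod_def idl_def)
 show ?thesis
 proof (rule factors_ident[OF F id TT_S(2) C(1), of ?ch])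
  fix C assume Ci: "C:\<C>"
  note D = bspec[OF C(3) Ci]
  have CU: "C<=U" using C(2) Ci by blast
  define c where "c = cl C"
  have "C:TU" using D CU U(2) by (auto simp: TU_def)
  then have c: "c:verts QQ" "up c = C" by (simp_all add: c_def TU_cl up_cl)
  have h1: "(%f. inj c (?r C (ev f))):BH KA (ideal_bimod KA (idl U)) BB"
   using BH_comp[OF BH_comp[OF ev_hom restriction_hom[OF CU]] inj_hom[OF c(1), unfolded c(2)]] D by blast
  \<comment> \<open>The factor 1 stands for the inclusion of functions on C into functions on U, in
    the form supplied by \<open>NN_inclusion\<close>.\<close>
  have h2: "(%h. ev_inv (fscale 1 (proj c h))):BH KA BB (ideal_bimod KA (idl U))"
   using BH_comp[OF BH_comp[OF proj_hom[of c, unfolded c(2)] NN_inclusion[OF CU, of 1]] ev_inv_hom[OF U]] .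
  show "EX et. EW KA (ideal_bimod KA (idl U)) F ga F ga (?ch C) et & factors EE {TT} F F et"
   by (rule summand_cong[OF factors_summand[OF F id TT BB_fd h1 h2 TT_S]]) (simp add: proj_inj)
  fix f assume f: "f:bC (ideal_bimod KA (idl U))"
  have "?r C (ev f):spn U" using s[OF f] by (auto simp: spt_def)
  then show "?ch C f:bC (ideal_bimod KA (idl U))" using ev_inv(1)[OF _ U(2)] by (simp add: ideal_bimod_def)
 next
  fix f assume f: "f:bC (ideal_bimod KA (idl U))"
  have fc: "f:carrier KA" using f by (simp add: ideal_bimod_def idl_def)
  show "(\<Sum>C\<in>\<C>. ?ch C f) = f"
  proof
   fix p
   show "(\<Sum>C\<in>\<C>. ?ch C f) p = f p"
   proof (cases "p:qpaths G & f p~=0")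
    case True
    have e: "ev f (ptgt G p, psrc p) = f p" using ev_apply[OF fc] True by blast
    then have "(ptgt G p, psrc p):U" using sptD[OF s[OF f]] True by metis
    then obtain C0 where C0: "C0:\<C>" "(ptgt G p, psrc p):C0" using C(2) by blast
    have un: "(ptgt G p, psrc p):C\<longleftrightarrow>C = C0" if "C:\<C>" for C using C(4) that C0 by blast
    have "(\<Sum>C\<in>D. ?ch C f) p = (\<Sum>C\<in>D. if C = C0 then f p else 0)" if "finite D" "D<=\<C>" for D
     using that by induction (use True e un in "auto simp: ev_inv_def")
    from this[OF C(1) subset_refl] show ?thesis using C0(1) C(1) by simp
   next
    case False
    then have fp: "f p = 0" using KG_zero[OF fc] by blast
    have "(\<Sum>C\<in>D. ?ch C f) p = 0" if "finite D" for D
     using that by induction (use fp ev_apply[OF fc, of p] in "auto simp: ev_inv_def")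
    then show ?thesis using C(1) fp by simp
   qed
  qed
 qed
qed

text \<open>The identity of Y factors through the generating functors and theirs factor through
  \<open>TT\<close>; an arbitrary ideal enters through its up-set.\<close>

lemma D_factors_TT: "Y:Ob (D_category KA) ==> factors (D_category KA) {TT} Y Y (Ident (D_category KA) Y)"
proof -
 assume "Y:Ob (D_category KA)"
 then have Y: "Y:Ob EE" "factors EE (GenF KA) Y Y (Ident EE Y)" unfolding D_category_Ob by blast+
 have "factors EE {TT} s s (Ident EE s)" if s: "s:GenF KA" for s
 proof (cases "is_tensor_functor KA (free_bimod KA) s")
  case True then show ?thesis unfolding is_tensor_functor_iff using free_factors by blast
 next
  case False
  then obtain I where I: "ideal I KA" "is_tensor_functor KA (ideal_bimod KA I) s"
   using s unfolding GenF_def by blast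
  obtain U where U: "upset U" "U<=diag" "I = idl U" using ideal_eq_idl[OF I(1)] by blast
  then show ?thesis using I(2) ideal_factors unfolding is_tensor_functor_iff by blast
 qed
 from linear_category.factors_trans[OF EF_lin generating_functors_linear TT_S(2) Y(2) Y(1) Y(1) this]
 have "factors EE {TT} Y Y (Ident EE Y)" .
 from factors_full[OF this, of "Ob (D_category KA)"] show ?thesis unfolding D_category_eq[symmetric] D_category_simps .
qed

lemma D_morita: "morita (D_category KA) TT RQ eltT"
proof (rule morita.intro[OF D_category_linear], rule morita_axioms.intro; (unfold D_category_simps)?)
 show "TT:Ob (D_category KA)" by (rule TT_Ob)
 have m: "mats = {g. ALL t s. g (t, s)~=0-->QQ.reach s t}" by (auto simp: mats_def spt_def)
 have "bij_betw QI.el mats (carrier RQ)" unfolding m QI.el_def by (rule bij_betw_inv_into[OF QI.cf_bij])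
 from bij_betw_trans[OF bij_betw_inv_into[OF nt_bij] this]
 show "bij_betw eltT (Hom EE TT TT) (carrier RQ)" by (simp add: eltT_def[abs_def] comp_def)
 show "eltT (Hadd EE TT TT f g) = eltT f\<oplus>\<^bsub>RQ\<^esub>eltT g" if f: "f:Hom EE TT TT" "g:Hom EE TT TT" for f g
 proof -
  obtain a b where a: "a:mats" "f = nt a" and b: "b:mats" "g = nt b" using hom_nt f by meson
  show ?thesis unfolding a b nt_add[OF a(1) b(1)] eltT_nt[OF mats_closed(1)[OF a(1) b(1)]] eltT_nt[OF a(1)] eltT_nt[OF b(1)]
   by (rule el_eqI) (simp_all add: mats_closed a b QI.add_closed QI.cf_add el)
 qed
 show "eltT (Hscale EE TT TT c f) = c\<odot>\<^bsub>RQ\<^esub>eltT f" if f: "f:Hom EE TT TT" for f c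
 proof -
  obtain a where a: "a:mats" "f = nt a" using hom_nt f by meson
  show ?thesis unfolding a nt_scale[OF a(1)] eltT_nt[OF mats_closed(2)[OF a(1)]] eltT_nt[OF a(1)]
   by (rule el_eqI) (simp_all add: mats_closed a QI.smult_closed QI.cf_smult el)
 qed
 show "eltT (Comp EE TT TT TT f g) = eltT g\<otimes>\<^bsub>RQ\<^esub>eltT f" if f: "f:Hom EE TT TT" "g:Hom EE TT TT" for f g
 proof -
  obtain a b where a: "a:mats" "f = nt a" and b: "b:mats" "g = nt b" using hom_nt f by meson
  show ?thesis unfolding a b nt_comp[OF a(1) b(1)] eltT_nt[OF mat_mult_mats[OF b(1) a(1)]] eltT_nt[OF a(1)] eltT_nt[OF b(1)]
   by (rule el_eqI[OF mat_mult_mats[OF b(1) a(1)]]) (simp_all add: a b QI.mult_closed QI.cf_mult el mat_mult_def)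
 qed
 show "eltT (Ident EE TT) = \<one>\<^bsub>RQ\<^esub>"
  unfolding nt_ident eltT_nt[OF mat_one_mats]
  by (rule el_eqI[OF mat_one_mats]) (simp_all add: QI.one_closed QI.cf_one mat_one_def)
 show "factors (D_category KA) {TT} Y Y (Ident EE Y)" if "Y:Ob (D_category KA)" for Y
  using D_factors_TT[OF that] unfolding D_category_simps .
 show "has_biproducts (D_category KA)" by (rule D_category_biproducts)
 show "EX Z. zero_object (D_category KA) Z" by (rule D_category_zero[OF tens_linear[OF TT]])
 have sub: "fsubspace mats" unfolding mats_def by (rule fsub_spt)
 have fin: "finite (verts QQ\<times>verts QQ)" by simp
 have "mats<=spt (verts QQ\<times>verts QQ)" unfolding mats_def spt_le reach_up by blast
 from fin_over_image[OF kspace_fun[OF sub] linear_category.hom_space[OF EF_lin tens_linear[OF TT] tens_linear[OF TT]]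
   _ _ _ fin_over_fun[OF sub fin this], of nt]
 have "kspace.fin_over (Hom EE TT TT) (Hadd EE TT TT) (Hscale EE TT TT) {Hzero EE TT TT} (nt ` mats)"
  using bij_betw_apply[OF nt_bij] nt_add nt_scale by simp
 then show "kspace.fin_over (Hom EE TT TT) (Hadd EE TT TT) (Hscale EE TT TT) {Hzero EE TT TT} (Hom EE TT TT)"
  using nt_bij by (simp add: bij_betw_def)
qed

theorem principal_2_representation:
 "quiver_of_algebra RQ QQ (vertex_idempotent QQ) &
  (EX Fi. underlying_algebra (D_category KA) RQ Fi &
   (ALL c:verts QQ. ALL M:c. ALL F:Ob (D_category KA). ALL Z.
     is_tensor_functor KA (NN_sub G M) F & zero_object (D_category KA) Z -->
     iso_to_principal_left RQ (omap Fi (Z, Hzero (D_category KA) Z F, F)) (vertex_idempotent QQ c)))"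
proof (intro conjI exI ballI allI impI)
 interpret M: morita "D_category KA" TT RQ eltT by (rule D_morita)
 have E: "QI.unit v v = vertex_idempotent QQ v" if v: "v:verts QQ" for v
  by (rule QI.eqI[OF QI.E(1)[OF v] QQ.vertex_idempotent_ev(1)[OF v]])
   (auto simp: QI.E(2)[OF v] QQ.vertex_idempotent_ev(2)[OF v])
 have "quiver_of_algebra RQ QQ (%v. QI.unit v v)"
  by (rule QI.quiver_of_incidence_algebra[OF QQ.fin_digraph_axioms refl Q2_arcs_between])
 from quiver_of_algebra_cong[OF this E QI.ring]
 show "quiver_of_algebra RQ QQ (vertex_idempotent QQ)" .
 show "underlying_algebra (D_category KA) RQ M.cok"
  unfolding underlying_algebra_def using QI.basic_fd_algebra M.coker_functor_equivalence by blast
 fix c M F Z assume c: "c:verts QQ" and "M:c" and FO: "F:Ob (D_category KA)"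
  and F: "is_tensor_functor KA (NN_sub G M) F & zero_object (D_category KA) Z"
 have "M = spn (up c)" using up[OF c] \<open>M \<in> c\<close> unfolding cl_def by blast
 then obtain ga where F: "tens KA (NU (up c)) F ga" and Z: "zero_object (D_category KA) Z"
  using F unfolding is_tensor_functor_iff by blast
 have Fl: "LF (MC KA) (MC KA) F" using F by (simp add: tens_def)
 \<comment> \<open>F belongs to the summand of \<open>BB\<close> at c, so it splits off
   \<open>TT\<close> by the transformations induced by projection and inclusion. The resulting
   idempotent of \<open>TT\<close> is the matrix unit at (c, c), which corresponds to the vertex
   idempotent.\<close>
 obtain p where p: "EW KA BB TT btT F ga (proj c) p"
  using EW_exists[OF TT F proj_hom BB_fd] by blast
 obtain s where s: "EW KA (NU (up c)) F ga TT btT (inj c) s"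
  using EW_exists[OF F TT inj_hom[OF c] NN_sub_fd[OF up_upset[OF c]]] by blast
 have ps: "Comp EE F TT F p s = Ident EE F"
  by (rule EW_unique[OF F EW_comp[OF Fl TT_linear Fl F BHD(1)[OF inj_hom[OF c]] s p]
     EW_ident[OF F]]) (simp_all add: proj_inj)
 have sp: "Comp EE TT F TT s p = nt (delta (c, c))"
 proof (rule nt_eq[OF EW_comp[OF TT_linear Fl TT_linear TT BHD(1)[OF proj_hom] p s] delta_mats[OF c]],
   assumption, rule ext, rule prod.induct)
  fix h d and x :: "'v\<times>'v"
  have "mat_map (delta (c, c)) h (d, x) = (\<Sum>t\<in>verts QQ. if t = c then (if d = c then h (c, x) else 0) else 0)"
   unfolding mat_map_def prod.case by (intro sum.cong) (auto simp: delta_def)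
  then show "inj c (proj c h) (d, x) = mat_map (delta (c, c)) h (d, x)" using c by (simp add: inj_def proj_def)
 qed
 have "QI.el (delta (c, c)) = vertex_idempotent QQ c"
  by (rule el_eqI[OF delta_mats[OF c] QQ.vertex_idempotent_ev(1)[OF c]])
   (auto simp: QQ.vertex_idempotent_ev(2)[OF c] delta_def)
 then have "eltT (nt (delta (c, c))) = vertex_idempotent QQ c" by (simp add: eltT_nt[OF delta_mats[OF c]])
 then show "iso_to_principal_left RQ (omap M.cok (Z, Hzero (D_category KA) Z F, F)) (vertex_idempotent QQ c)"
  using M.coker_functor_projective[OF Z FO, of p s] EW_hom[OF p] EW_hom[OF s] ps sp
  unfolding D_category_simps by simp
qed

end

theorem mainTheorem7:
  fixes Q :: "('v, 'e) pre_digraph"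
    and A :: "('k::alg_closed_field, ('v, 'e) qpath \<Rightarrow> 'k) module"
    and G :: "(('k, 'v) iso_class, ('k, 'v) iso_class \<times> ('k, 'v) iso_class) pre_digraph"
  assumes "tree_quiver Q"
    and "A = path_algebra Q"
    and "G = Q2 Q"
    and "R = commutativity_algebra G"
  shows "quiver_of_algebra R G (vertex_idempotent G) \<and>
         (\<exists>\<Phi>. underlying_algebra (D_category A) R \<Phi> \<and>
           (\<forall>c\<in>verts G. \<forall>M\<in>c. \<forall>F\<in>Ob (D_category A). \<forall>Z.
              is_tensor_functor A (NN_sub Q M) F \<and> zero_object (D_category A) Z \<longrightarrow>
              iso_to_principal_left R
                (omap \<Phi> (Z, Hzero (D_category A) Z F, F)) (vertex_idempotent G c)))"
proof -
  interpret thin_quiver_over Q "TYPE('k)"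
    using tree_quiver_thin[OF assms(1)] by (simp add: thin_quiver_over_def)
  show ?thesis unfolding assms(2-4) by (rule principal_2_representation)
qed

end
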